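(* Let $d,k\in\mathbb{N}$, let $G\subset\mathbb{R}^d$ be a bounded domain, and let $\tau>0$, $\sigma>0$. Let $\mathbf{F}\colon\mathbb{R}^{k\times d}\to\mathcal{S}_{\ge 0}(\mathbb{R}^{k\times d})$ and the mollifier $\rho\colon\mathbb{R}^d\to\mathbb{R}$ be weakly differentiable with first-order weak derivatives essentially bounded by a number $c>0$. Let $\tilde{\mathbf{H}}^0\in L^\infty\big(G,\mathcal{S}_{\ge\alpha}(\mathbb{R}^{k\times d})\big)$ for some $\alpha>0$, let $\tilde{\mathbf{u}}^0\in\mathcal{V}$ and let $T>0$. Then the unique weak solution $(\mathbf{u},\mathbf{H})^T$ on $[0,T]$ of $$\partial_t\mathbf{u}+\mathcal{A}(\mathbf{H})\mathbf{u}=0\ \text{ in } L^2(0,T;\mathcal{V}'),$$ $$\tau\partial_t\mathbf{H}+\mathbf{H}-\mathcal{F}_\sigma(\mathbf{u})=0\ \text{ in } L^2\big(0,T;L^\infty(G,\mathcal{S}(\mathbb{R}^{k\times d}))\big),$$ $$\mathbf{u}(0,\cdot)=\tilde{\mathbf{u}}^0\ \text{ in }\mathcal{H},\qquad \mathbf{H}(0,\cdot)=\tilde{\mathbf{H}}^0\ \text{ in } L^\infty(G,\mathcal{S}(\mathbb{R}^{k\times d}))$$ satisfying $\mathbf{H}(t,\cdot)\in L^\infty(G,\mathcal{S}_{\ge\kappa}(\mathbb{R}^{k\times d}))$ for a.e. $t\in[0,T]$ with $\kappa:=\alpha\exp(-T/\tau)$ is also a strong solution.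
   Context: $\mathbb{R}^{k\times d}$ carries the Frobenius scalar product $\mathbf{D}:\hat{\mathbf{D}}=\sum_{i,j}D_{ij}\hat D_{ij}$. A fourth-order tensor $\mathbf{H}=(H_{ijIJ})\in\mathbb{R}^{(k\times d)\times(k\times d)}$ ($i,I=1,\dots,k$; $j,J=1,\dots,d$) acts on $\mathbf{D}\in\mathbb{R}^{k\times d}$ by $(\mathbf{H}\mathbf{D})_{ij}=\sum_{I=1}^k\sum_{J=1}^d H_{ijIJ}D_{IJ}$; the space of tensors carries the Frobenius norm. $\mathcal{S}(\mathbb{R}^{k\times d})$ is the space of symmetric tensors ($H_{ijIJ}=H_{IJij}$), and for $\kappa\ge 0$, $\mathcal{S}_{\ge\kappa}(\mathbb{R}^{k\times d})$ is the set of $\mathbf{H}\in\mathcal{S}(\mathbb{R}^{k\times d})$ with smallest eigenvalue $\ge\kappa$, i.e. $(\mathbf{H}\mathbf{D}):\mathbf{D}\ge\kappa\,\mathbf{D}:\mathbf{D}$ for all $\mathbf{D}$. $L^\infty(G,\mathcal{S}_{\ge\kappa}(\mathbb{R}^{k\times d}))$ is the set of $\mathbf{H}\in L^\infty(G,\mathcal{S}(\mathbb{R}^{k\times d}))$ with $\mathbf{H}(\mathbf{x})\in\mathcal{S}_{\ge\kappa}(\mathbb{R}^{k\times d})$ for a.e. $\mathbf{x}\in G$. $\mathcal{H}:=\{\mathbf{u}\in L^2(G,\mathbb{R}^k)\mid\int_G\mathbf{u}\,\mathrm{d}\mathbf{x}=\mathbf{0}\}$, $\mathcal{V}:=H^1(G,\mathbb{R}^k)\cap\mathcal{H}$,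 and $\mathcal{V}'$ is the dual of $\mathcal{V}$ in the Gelfand triple $(\mathcal{V},\mathcal{H},\mathcal{V}')$. For $\mathbf{H}\in L^\infty(G,\mathcal{S}_{\ge\kappa}(\mathbb{R}^{k\times d}))$ with $\kappa>0$, the operator $\mathcal{A}(\mathbf{H})\colon\mathcal{V}\to\mathcal{V}'$ is given by $\langle\mathcal{A}(\mathbf{H})\mathbf{u},\mathbf{v}\rangle_{\mathcal{V}';\mathcal{V}}=\int_G(\mathbf{H}\nabla\mathbf{u}):(\nabla\mathbf{v})\,\mathrm{d}\mathbf{x}$, with $\nabla\mathbf{u}=(\partial_{x_j}u_i)_{ij}$ the Jacobian. The mollifier satisfies $\rho\in W^{1,\infty}(\mathbb{R}^d,\mathbb{R})$, $\rho\ge 0$ a.e., $\int_{\mathbb{R}^d}\rho\,\mathrm{d}\mathbf{x}=1$. For $\mathbf{u}\in L^2(G,\mathbb{R}^k)$, $\nabla_\sigma\mathbf{u}:=\nabla(\mathbf{u}\ast\rho_\sigma)$, where $\rho_\sigma(\mathbf{x}):=\sigma^{-d}\rho(\mathbf{x}/\sigma)$ and $(\mathbf{u}\ast\rho_\sigma)(\mathbf{x}):=\int_G\rho_\sigma(\mathbf{x}-\mathbf{y})\mathbf{u}(\mathbf{y})\,\mathrm{d}\mathbf{y}$, $\mathbf{x}\in G$. $\mathcal{F}_\sigma(\mathbf{u}):=\mathbf{F}(\nabla_\sigma\mathbf{u})$. $\mathbf{F}$ is identified with its Lipschitz continuous representative. Weak solution on $[0,T]$: a pair $(\mathbf{u},\mathbf{H})^T$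 for which there is a number $\kappa>0$ with $\mathbf{H}\in\mathcal{S}_{\ge\kappa}(\mathbb{R}^{k\times d})$ a.e. in $(0,T)\times G$, with $$\mathbf{u}\in H^1(0,T;\mathcal{V}')\cap L^2(0,T;\mathcal{V}),\qquad \mathbf{H}\in W^{1,\infty}\big(0,T;L^\infty(G,\mathcal{S}(\mathbb{R}^{k\times d}))\big),$$ fulfilling the two differential equations and the initial conditions, the initial value of $\mathbf{u}$ being understood via the embedding $L^2(0,T;\mathcal{V})\cap H^1(0,T;\mathcal{V}')\hookrightarrow C^0([0,T],\mathcal{H})$. A strong solution is a weak solution which additionally satisfies $\mathbf{u}\in H^1(0,T;\mathcal{H})$ and $\mathrm{div}(\mathbf{H}\nabla\mathbf{u})\in L^2(0,T;\mathcal{H})$ (row-wise divergence: $(\mathrm{div}\,\mathbf{J})_i=\sum_{j=1}^d\partial_{x_j}J_{ij}$). The weak solution on $[0,T]$ exists and is unique under the stated hypotheses. *)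

theory Defs
  imports
    "HOL-Analysis.Analysis"
    "HOL-Probability.Essential_Supremum"
    "HOL-Library.Function_Algebras"
begin

section \<open>Tensors\<close>

text \<open>
  A matrix in \<open>\<real>\<^bsup>k\<times>d\<^esup>\<close> is of type \<^typ>\<open>real^'d^'k\<close>. The library inner product and norm on
  this type and on the type of fourth-order tensors below are the Frobenius ones.
  The entry \<open>H\<^bsub>ijIJ\<^esub>\<close> is \<open>H $ i $ j $ I $ J\<close>.
\<close>

type_synonym ('k, 'd) tensor = "real^'d^'k^'d^'k"

definition tensor_apply :: "('k::finite, 'd::finite) tensor \<Rightarrow> real^'d^'k \<Rightarrow> real^'d^'k" where
  "tensor_apply H D = (\<chi> i j. \<Sum>I\<in>UNIV. \<Sum>J\<in>UNIV. H $ i $ j $ I $ J * D $ I $ J)"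

definition sym_tensors :: "('k::finite, 'd::finite) tensor set" where
  "sym_tensors = {H. \<forall>i j I J. H $ i $ j $ I $ J = H $ I $ J $ i $ j}"

definition sym_tensors_ge :: "real \<Rightarrow> ('k::finite, 'd::finite) tensor set" where
  "sym_tensors_ge \<kappa> = {H \<in> sym_tensors. \<forall>D. tensor_apply H D \<bullet> D \<ge> \<kappa> * (D \<bullet> D)}"


section \<open>Weak derivatives\<close>

definition dir_deriv :: "'a::euclidean_space \<Rightarrow> ('a \<Rightarrow> real) \<Rightarrow> 'a \<Rightarrow> real" where
  "dir_deriv b f x = frechet_derivative f (at x) b"

text \<open>All iterated partial derivatives exist and are (totally) differentiable.\<close>
definition smooth :: "('a::euclidean_space \<Rightarrow> real) \<Rightarrow> bool" where
  "smooth f \<longleftrightarrow> (\<forall>bs. set bs \<subseteq> Basis \<longrightarrow> (\<forall>x. fold dir_deriv bs f differentiable at x))"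

definition test_functions :: "'a::euclidean_space set \<Rightarrow> ('a \<Rightarrow> real) set" where
  "test_functions S = {\<phi>. smooth \<phi> \<and> compact (closure {x. \<phi> x \<noteq> 0}) \<and> closure {x. \<phi> x \<noteq> 0} \<subseteq> S}"

definition locally_integrable :: "'a::euclidean_space set \<Rightarrow> ('a \<Rightarrow> 'b::euclidean_space) \<Rightarrow> bool" where
  "locally_integrable S f \<longleftrightarrow> (\<forall>K. compact K \<and> K \<subseteq> S \<longrightarrow> f absolutely_integrable_on K)"

definition has_weak_deriv ::
  "'a::euclidean_space set \<Rightarrow> 'a \<Rightarrow> ('a \<Rightarrow> 'b::euclidean_space) \<Rightarrow> ('a \<Rightarrow> 'b) \<Rightarrow> bool" where
  "has_weak_deriv S b f g \<longleftrightarrow> locally_integrable S f \<and> locally_integrable S g \<and>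
     (\<forall>\<phi>\<in>test_functions S.
        (LINT x|lebesgue_on S. dir_deriv b \<phi> x *\<^sub>R f x) = - (LINT x|lebesgue_on S. \<phi> x *\<^sub>R g x))"

definition weakly_differentiable_bounded ::
  "real \<Rightarrow> ('a::euclidean_space \<Rightarrow> 'b::euclidean_space) \<Rightarrow> bool" where
  "weakly_differentiable_bounded c f \<longleftrightarrow>
     (\<forall>b\<in>Basis. \<exists>g. has_weak_deriv UNIV b f g \<and> (AE x in lebesgue. norm (g x) \<le> c))"

definition has_weak_jacobian ::
  "(real^'d) set \<Rightarrow> (real^'d \<Rightarrow> real^'k) \<Rightarrow> (real^'d \<Rightarrow> real^'d^'k) \<Rightarrow> bool" where
  "has_weak_jacobian G u J \<longleftrightarrow> (\<forall>j. has_weak_deriv G (axis j 1) u (\<lambda>x. column j (J x)))"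

text \<open>Determined up to a null set whenever a weak Jacobian exists.\<close>
definition weak_jacobian :: "(real^'d) set \<Rightarrow> (real^'d \<Rightarrow> real^'k) \<Rightarrow> real^'d \<Rightarrow> real^'d^'k" where
  "weak_jacobian G u = (SOME J. has_weak_jacobian G u J)"

text \<open>Row-wise divergence in the sense of distributions; the single summands
  \<open>\<partial>\<^sub>j J\<^bsub>ij\<^esub>\<close> need not be functions.\<close>
definition has_weak_divergence ::
  "(real^'d) set \<Rightarrow> (real^'d \<Rightarrow> real^'d^'k) \<Rightarrow> (real^'d \<Rightarrow> real^'k) \<Rightarrow> bool" where
  "has_weak_divergence G J g \<longleftrightarrow> locally_integrable G J \<and> locally_integrable G g \<and>
     (\<forall>\<phi>\<in>test_functions G. \<forall>i.
        (LINT x|lebesgue_on G. (\<Sum>j\<in>UNIV. J x $ i $ j * dir_deriv (axis j 1) \<phi> x))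
          = - (LINT x|lebesgue_on G. g x $ i * \<phi> x))"


section \<open>Functions of time with values in seminormed spaces of functions\<close>

text \<open>
  Since the spaces depend on the set \<open>G\<close>, they are carrier sets in a type of functions, together
  with a seminorm. Elements are representatives; equality in the space is vanishing of
  the seminorm of the difference. The seminorm is only meaningful on the carrier.
\<close>

instantiation "fun" :: (type, real_vector) real_vector
begin

definition scaleR_fun :: "real \<Rightarrow> ('a \<Rightarrow> 'b) \<Rightarrow> 'a \<Rightarrow> 'b" where
  "scaleR_fun r f = (\<lambda>x. r *\<^sub>R f x)"

instance
  by standard (auto simp: scaleR_fun_def fun_eq_iff scaleR_add_right scaleR_add_left)

end

record 'f space_rec =
  carr :: "'f set"
  snorm :: "'f \<Rightarrow> real"

definition strongly_measurable_in ::
  "'a measure \<Rightarrow> 'f::real_vector space_rec \<Rightarrow> ('a \<Rightarrow> 'f) \<Rightarrow> bool" where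
  "strongly_measurable_in M X f \<longleftrightarrow> (AE t in M. f t \<in> carr X) \<and>
     (\<exists>s. (\<forall>n. simple_function M (s n) \<and> s n ` space M \<subseteq> carr X) \<and>
          (AE t in M. (\<lambda>n. snorm X (s n t - f t)) \<longlonglongrightarrow> 0))"

text \<open>The library's \<^const>\<open>has_bochner_integral\<close>, relativized to a seminormed carrier.\<close>
definition has_bochner_integral_in ::
  "'a measure \<Rightarrow> 'f::real_vector space_rec \<Rightarrow> ('a \<Rightarrow> 'f) \<Rightarrow> 'f \<Rightarrow> bool" where
  "has_bochner_integral_in M X f I \<longleftrightarrow> strongly_measurable_in M X f \<and> I \<in> carr X \<and>
     (\<exists>s. (\<forall>n. Bochner_Integration.simple_bochner_integrable M (s n) \<and> s n ` space M \<subseteq> carr X) \<and>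
          (\<lambda>n. \<integral>\<^sup>+t. ennreal (snorm X (s n t - f t)) \<partial>M) \<longlonglongrightarrow> 0 \<and>
          (\<lambda>n. snorm X (Bochner_Integration.simple_bochner_integral M (s n) - I)) \<longlonglongrightarrow> 0)"

definition time_L2 :: "real \<Rightarrow> 'f::real_vector space_rec \<Rightarrow> (real \<Rightarrow> 'f) set" where
  "time_L2 T X = {f. strongly_measurable_in (lebesgue_on {0<..<T}) X f \<and>
     integrable (lebesgue_on {0<..<T}) (\<lambda>t. (snorm X (f t))\<^sup>2)}"

definition time_Linf :: "real \<Rightarrow> 'f::real_vector space_rec \<Rightarrow> (real \<Rightarrow> 'f) set" where
  "time_Linf T X = {f. strongly_measurable_in (lebesgue_on {0<..<T}) X f \<and>
     (\<exists>C. AE t in lebesgue_on {0<..<T}. snorm X (f t) \<le> C)}"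

text \<open>The common value \<open>I\<close> expresses equality in the space, as
  \<^const>\<open>has_bochner_integral_in\<close> determines the integral up to seminorm zero.\<close>
definition has_time_deriv ::
  "real \<Rightarrow> 'f::real_vector space_rec \<Rightarrow> (real \<Rightarrow> 'f) \<Rightarrow> (real \<Rightarrow> 'f) \<Rightarrow> bool" where
  "has_time_deriv T X f g \<longleftrightarrow>
     (\<forall>\<phi>\<in>test_functions {0<..<T}. \<exists>I.
        has_bochner_integral_in (lebesgue_on {0<..<T}) X (\<lambda>t. deriv \<phi> t *\<^sub>R f t) I \<and>
        has_bochner_integral_in (lebesgue_on {0<..<T}) X (\<lambda>t. - \<phi> t *\<^sub>R g t) I)"

definition time_H1 :: "real \<Rightarrow> 'f::real_vector space_rec \<Rightarrow> (real \<Rightarrow> 'f) set" where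
  "time_H1 T X = {f \<in> time_L2 T X. \<exists>g\<in>time_L2 T X. has_time_deriv T X f g}"

definition time_W1inf :: "real \<Rightarrow> 'f::real_vector space_rec \<Rightarrow> (real \<Rightarrow> 'f) set" where
  "time_W1inf T X = {f \<in> time_Linf T X. \<exists>g\<in>time_Linf T X. has_time_deriv T X f g}"

text \<open>The initial value of the representative that is continuous on \<open>[0,T]\<close> with values in \<open>X\<close>.\<close>
definition has_initial_value ::
  "real \<Rightarrow> 'f::real_vector space_rec \<Rightarrow> (real \<Rightarrow> 'f) \<Rightarrow> 'f \<Rightarrow> bool" where
  "has_initial_value T X f f0 \<longleftrightarrow>
     (\<exists>h. (\<forall>t\<in>{0..T}. h t \<in> carr X \<and>
              ((\<lambda>s. snorm X (h s - h t)) \<longlongrightarrow> 0) (at t within {0..T})) \<and>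
          (AE t in lebesgue_on {0<..<T}. snorm X (h t - f t) = 0) \<and>
          snorm X (h 0 - f0) = 0)"


section \<open>The function spaces on the domain\<close>

definition square_integrable_on ::
  "(real^'d) set \<Rightarrow> (real^'d \<Rightarrow> 'b::euclidean_space) \<Rightarrow> bool" where
  "square_integrable_on G u \<longleftrightarrow> u \<in> borel_measurable (lebesgue_on G) \<and>
     integrable (lebesgue_on G) (\<lambda>x. (norm (u x))\<^sup>2)"

definition Hspace :: "(real^'d) set \<Rightarrow> (real^'d \<Rightarrow> real^'k) space_rec" where
  "Hspace G = \<lparr> carr = {u. square_integrable_on G u \<and> (LINT x|lebesgue_on G. u x) = 0},
     snorm = (\<lambda>u. sqrt (LINT x|lebesgue_on G. (norm (u x))\<^sup>2)) \<rparr>"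

definition Vspace :: "(real^'d) set \<Rightarrow> (real^'d \<Rightarrow> real^'k) space_rec" where
  "Vspace G = \<lparr> carr = {u \<in> carr (Hspace G). \<exists>J. has_weak_jacobian G u J \<and> square_integrable_on G J},
     snorm = (\<lambda>u. sqrt ((LINT x|lebesgue_on G. (norm (u x))\<^sup>2) +
                        (LINT x|lebesgue_on G. (norm (weak_jacobian G u x))\<^sup>2))) \<rparr>"

text \<open>Functionals are total functions; only their values on \<open>carr (Vspace G)\<close> matter.\<close>
definition Vdual :: "(real^'d) set \<Rightarrow> ((real^'d \<Rightarrow> real^'k) \<Rightarrow> real) space_rec" where
  "Vdual G = \<lparr> carr = {\<psi>.
       (\<forall>u\<in>carr (Vspace G). \<forall>v\<in>carr (Vspace G). \<psi> (u + v) = \<psi> u + \<psi> v) \<and>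
       (\<forall>r. \<forall>v\<in>carr (Vspace G). \<psi> (r *\<^sub>R v) = r * \<psi> v) \<and>
       (\<exists>C. \<forall>v\<in>carr (Vspace G). \<bar>\<psi> v\<bar> \<le> C * snorm (Vspace G) v)},
     snorm = (\<lambda>\<psi>. SUP v\<in>{v \<in> carr (Vspace G). snorm (Vspace G) v \<le> 1}. \<bar>\<psi> v\<bar>) \<rparr>"

text \<open>The embedding of \<open>\<H>\<close> into \<open>\<V>'\<close> in the Gelfand triple \<open>(\<V>, \<H>, \<V>')\<close>.\<close>
definition gelfand :: "(real^'d) set \<Rightarrow> (real^'d \<Rightarrow> real^'k) \<Rightarrow> (real^'d \<Rightarrow> real^'k) \<Rightarrow> real" where
  "gelfand G u = (\<lambda>v. LINT x|lebesgue_on G. u x \<bullet> v x)"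

definition Linf_sym :: "(real^'d) set \<Rightarrow> (real^'d \<Rightarrow> ('k::finite, 'd::finite) tensor) space_rec" where
  "Linf_sym G = \<lparr> carr = {H. H \<in> borel_measurable (lebesgue_on G) \<and>
       (\<exists>C. AE x in lebesgue_on G. norm (H x) \<le> C) \<and>
       (AE x in lebesgue_on G. H x \<in> sym_tensors)},
     snorm = (\<lambda>H. real_of_ereal (esssup (lebesgue_on G) (\<lambda>x. ereal (norm (H x))))) \<rparr>"

definition Linf_sym_ge :: "(real^'d) set \<Rightarrow> real \<Rightarrow> (real^'d \<Rightarrow> ('k::finite, 'd::finite) tensor) set" where
  "Linf_sym_ge G \<kappa> = {H \<in> carr (Linf_sym G). AE x in lebesgue_on G. H x \<in> sym_tensors_ge \<kappa>}"


section \<open>The system\<close>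

definition op_A ::
  "(real^'d) set \<Rightarrow> (real^'d \<Rightarrow> ('k::finite, 'd::finite) tensor) \<Rightarrow> (real^'d \<Rightarrow> real^'k) \<Rightarrow>
     (real^'d \<Rightarrow> real^'k) \<Rightarrow> real" where
  "op_A G H u = (\<lambda>v. LINT x|lebesgue_on G.
     tensor_apply (H x) (weak_jacobian G u x) \<bullet> weak_jacobian G v x)"

definition mollifier :: "(real^'d \<Rightarrow> real) \<Rightarrow> bool" where
  "mollifier \<rho> \<longleftrightarrow> \<rho> \<in> borel_measurable lebesgue \<and> (\<exists>C. AE x in lebesgue. \<bar>\<rho> x\<bar> \<le> C) \<and>
     (\<exists>C. weakly_differentiable_bounded C \<rho>) \<and>
     (AE x in lebesgue. \<rho> x \<ge> 0) \<and> has_bochner_integral lebesgue \<rho> 1"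

definition scaled_mollifier :: "(real^'d \<Rightarrow> real) \<Rightarrow> real \<Rightarrow> real^'d \<Rightarrow> real" where
  "scaled_mollifier \<rho> \<sigma> x = \<rho> (x /\<^sub>R \<sigma>) / \<sigma> ^ CARD('d)"

definition mollify ::
  "(real^'d) set \<Rightarrow> (real^'d \<Rightarrow> real) \<Rightarrow> real \<Rightarrow> (real^'d \<Rightarrow> real^'k) \<Rightarrow> real^'d \<Rightarrow> real^'k" where
  "mollify G \<rho> \<sigma> u x = (LINT y|lebesgue_on G. scaled_mollifier \<rho> \<sigma> (x - y) *\<^sub>R u y)"

definition F_sigma ::
  "(real^'d) set \<Rightarrow> (real^'d \<Rightarrow> real) \<Rightarrow> real \<Rightarrow> (real^'d^'k \<Rightarrow> ('k::finite, 'd::finite) tensor) \<Rightarrow>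
     (real^'d \<Rightarrow> real^'k) \<Rightarrow> real^'d \<Rightarrow> ('k, 'd) tensor" where
  "F_sigma G \<rho> \<sigma> F u = (\<lambda>x. F (weak_jacobian G (mollify G \<rho> \<sigma> u) x))"

text \<open>For a.e. \<open>t\<close> the two differential equations hold in \<open>\<V>'\<close> and in \<open>L\<^sup>\<infinity>(G)\<close>,
  respectively.\<close>
definition weak_solution ::
  "(real^'d) set \<Rightarrow> real \<Rightarrow> (real^'d \<Rightarrow> real) \<Rightarrow> real \<Rightarrow> (real^'d^'k \<Rightarrow> ('k::finite, 'd::finite) tensor) \<Rightarrow>
     (real^'d \<Rightarrow> real^'k) \<Rightarrow> (real^'d \<Rightarrow> ('k, 'd) tensor) \<Rightarrow> real \<Rightarrow>
     (real \<Rightarrow> real^'d \<Rightarrow> real^'k) \<Rightarrow> (real \<Rightarrow> real^'d \<Rightarrow> ('k, 'd) tensor) \<Rightarrow> bool" where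
  "weak_solution G \<tau> \<rho> \<sigma> F u0 H0 T u H \<longleftrightarrow>
     (\<exists>\<kappa>>0. AE t in lebesgue_on {0<..<T}. AE x in lebesgue_on G. H t x \<in> sym_tensors_ge \<kappa>) \<and>
     u \<in> time_L2 T (Vspace G) \<and>
     (\<lambda>t. gelfand G (u t)) \<in> time_H1 T (Vdual G) \<and>
     H \<in> time_W1inf T (Linf_sym G) \<and>
     (\<exists>w\<in>time_L2 T (Vdual G). has_time_deriv T (Vdual G) (\<lambda>t. gelfand G (u t)) w \<and>
        (AE t in lebesgue_on {0<..<T}. \<forall>v\<in>carr (Vspace G). w t v + op_A G (H t) (u t) v = 0)) \<and>
     (\<exists>K\<in>time_Linf T (Linf_sym G). has_time_deriv T (Linf_sym G) H K \<and>
        (AE t in lebesgue_on {0<..<T}. AE x in lebesgue_on G.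
           \<tau> *\<^sub>R K t x + H t x - F_sigma G \<rho> \<sigma> F (u t) x = 0)) \<and>
     has_initial_value T (Hspace G) u u0 \<and>
     has_initial_value T (Linf_sym G) H H0"

definition strong_solution ::
  "(real^'d) set \<Rightarrow> real \<Rightarrow> (real^'d \<Rightarrow> real) \<Rightarrow> real \<Rightarrow> (real^'d^'k \<Rightarrow> ('k::finite, 'd::finite) tensor) \<Rightarrow>
     (real^'d \<Rightarrow> real^'k) \<Rightarrow> (real^'d \<Rightarrow> ('k, 'd) tensor) \<Rightarrow> real \<Rightarrow>
     (real \<Rightarrow> real^'d \<Rightarrow> real^'k) \<Rightarrow> (real \<Rightarrow> real^'d \<Rightarrow> ('k, 'd) tensor) \<Rightarrow> bool" where
  "strong_solution G \<tau> \<rho> \<sigma> F u0 H0 T u H \<longleftrightarrow>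
     weak_solution G \<tau> \<rho> \<sigma> F u0 H0 T u H \<and>
     u \<in> time_H1 T (Hspace G) \<and>
     (\<exists>g\<in>time_L2 T (Hspace G). AE t in lebesgue_on {0<..<T}.
        has_weak_divergence G (\<lambda>x. tensor_apply (H t x) (weak_jacobian G (u t) x)) (g t))"

end

theory Submission
  imports Defs "HOL-Computational_Algebra.Polynomial"
begin

text \<open>
  Let \<open>a\<^sub>t(x, y)\<close> be the form \<open>\<integral> (\<^bold>H(t) \<nabla>x) : (\<nabla>y)\<close> on \<open>\<V>\<close>. It is symmetric, positive semidefinite and
  Lipschitz continuous in \<open>t\<close>, as \<open>\<^bold>H\<close> is a \<open>W\<^sup>1\<^sup>,\<^sup>\<infinity>\<close> function of time. Testing the integrated equation
  \<open>u(t) - u(t-\<eta>) = - \<integral> A(\<^bold>H(r)) u(r) dr\<close> over \<open>(t-\<eta>, t)\<close> with \<open>u(t) - u(t-\<eta>)\<close> and integrating over \<open>t\<close> gives double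
  integrals of \<open>a\<^sub>r(u(r), u(t))\<close> over two strips \<open>r < t < r+\<eta>\<close>. By symmetry and Lipschitz continuity they
  cancel up to \<open>O(\<eta>\<^sup>2)\<close> except on two triangles at the ends of the time interval. The triangle at \<open>T\<close>
  has the good sign, and the one at \<open>0\<close> is controlled by \<open>u\<^sub>0 \<in> \<V>\<close>. Hence
  \<open>\<integral> \<parallel>u(t) - u(t-\<eta>)\<parallel>\<^sup>2 dt \<le> K \<eta>\<^sup>2\<close> in \<open>\<H>\<close>, and a weak limit \<open>g\<close> of the difference quotients is the time
  derivative of \<open>u\<close> in \<open>L\<^sup>2(0,T;\<H>)\<close>. The equation then reads \<open>a\<^sub>t(u(t), v) = - \<langle>g(t), v\<rangle>\<close> for all
  \<open>v \<in> \<V>\<close>, and test functions minus their means as \<open>v\<close> show that \<open>g(t)\<close> is the divergence of \<open>\<^bold>H \<nabla>u\<close>.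
\<close>

section \<open>Test functions\<close>

text \<open>The time derivative of \<open>u\<close> cannot serve as a test function, since a priori
  it lies only in L^2(0,T;V'). Finite differences replace it, and they must be controlled to order
  \<eta>^2, whereas the weak formulation gives only order \<eta> directly. The critical term is the
  triangle at time 0. With the coefficient frozen there, it is half the squared seminorm of
  \<open>Y \<eta>\<close>, the integral of \<open>u\<close> over (0,\<eta>), and square
  integrability of \<open>u\<close> makes this square only O(\<eta>). The remedy is to continue
  \<open>u\<close> by its initial value to negative times: on (0,\<eta>) the test function becomes
  u(t) - u0, and the same triangle reappears with a minus sign next to a term linear in
  \<open>Y\<close>. As the left-hand side is nonnegative, the seminorms of \<open>Y \<rho>\<close>
  bound themselves through a quadratic inequality and are in fact O(\<eta>). A second obstacle is
  that the spaces are carriers of representatives with seminorms. Products are only semidefinite,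
  limits and integrals are fixed up to null elements, and identities between vectors are reduced to
  scalar ones by bounded functionals.\<close>

fun differentiable_upto :: "nat \<Rightarrow> (real \<Rightarrow> real) \<Rightarrow> bool" where
  "differentiable_upto 0 p \<longleftrightarrow> True"
| "differentiable_upto (Suc n) p \<longleftrightarrow>
     (\<exists>p'. (\<forall>x. (p has_real_derivative p' x) (at x)) \<and> differentiable_upto n p')"

lemma differentiable_upto_SucD: "differentiable_upto (Suc n) p \<Longrightarrow> differentiable_upto n p"
  by (induction n arbitrary: p) auto

lemma differentiable_upto_add:
  "differentiable_upto n p \<Longrightarrow> differentiable_upto n q \<Longrightarrow> differentiable_upto n (\<lambda>x. p x + q x)"
proof (induction n arbitrary: p q)
  case (Suc n)
  then obtain p' q' where "\<forall>x. (p has_real_derivative p' x) (at x)" "differentiable_upto n p'"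
    "\<forall>x. (q has_real_derivative q' x) (at x)" "differentiable_upto n q'" by auto
  then show ?case
    using Suc.IH[of p' q'] by (auto intro!: exI[of _ "\<lambda>x. p' x + q' x"] DERIV_add)
qed simp

lemma differentiable_upto_mult:
  "differentiable_upto n p \<Longrightarrow> differentiable_upto n q \<Longrightarrow> differentiable_upto n (\<lambda>x. p x * q x)"
proof (induction n arbitrary: p q)
  case (Suc n)
  then obtain p' q' where *: "\<forall>x. (p has_real_derivative p' x) (at x)" "differentiable_upto n p'"
    "\<forall>x. (q has_real_derivative q' x) (at x)" "differentiable_upto n q'" by auto
  have "differentiable_upto n (\<lambda>x. p' x * q x + q' x * p x)"
    using * Suc.prems[THEN differentiable_upto_SucD] by (intro differentiable_upto_add Suc.IH) auto
  then show ?case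
    using * by (auto intro!: exI[of _ "\<lambda>x. p' x * q x + q' x * p x"] DERIV_mult)
qed simp

lemma differentiable_upto_const: "differentiable_upto n (\<lambda>x. c)"
  by (induction n arbitrary: c) (auto intro!: exI[of _ "\<lambda>x. 0"])

lemma differentiable_upto_affine:
  "differentiable_upto n p \<Longrightarrow> differentiable_upto n (\<lambda>x. p (a * x + b))"
proof (induction n arbitrary: p)
  case (Suc n)
  then obtain p' where *: "\<forall>x. (p has_real_derivative p' x) (at x)" "differentiable_upto n p'" by auto
  have "((\<lambda>x. p (a * x + b)) has_real_derivative p' (a * x + b) * a) (at x)" for x
    by (rule DERIV_chain2[where f = p]) (use * in \<open>auto intro!: derivative_eq_intros\<close>)
  then show ?case
    using Suc.IH[OF *(2)] differentiable_upto_mult[OF _ differentiable_upto_const]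
    by (auto intro!: exI[of _ "\<lambda>x. p' (a * x + b) * a"])
qed simp

section \<open>Smooth functions that are flat at zero\<close>

definition exp_inv_poly :: "real poly \<Rightarrow> real \<Rightarrow> real" where
  "exp_inv_poly P x = (if x \<le> 0 then 0 else poly P (1 / x) * exp (- 1 / x))"

text \<open>Each coefficient step multiplies the remaining polynomial by \<open>y\<close>; the extra
  power \<open>k\<close>, arbitrary in the induction, absorbs this factor. With \<open>k = 1\<close>
  it also absorbs the division by \<open>h\<close> in a difference quotient at 0.\<close>

lemma poly_over_exp_tendsto_0: "((\<lambda>y. y ^ k * poly P y / exp y) \<longlongrightarrow> (0::real)) at_top"
proof (induction P arbitrary: k)
  case (pCons a P)
  have "((\<lambda>y. a * (y ^ k / exp y) + y ^ Suc k * poly P y / exp y) \<longlongrightarrow> a * 0 + 0) at_top"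
    by (intro tendsto_intros tendsto_power_div_exp_0 pCons.IH)
  then show ?case
    by (simp add: algebra_simps add_divide_distrib)
qed auto

text \<open>With y = 1/x, the derivative of P(y) exp(-y) is y^2 (P(y) - P'(y)) exp(-y), which has
  the same form again. Carrying an arbitrary polynomial \<open>P\<close> closes the family under
  differentiation and gives all orders by induction.\<close>

lemma DERIV_exp_inv_poly:
  "(exp_inv_poly P has_real_derivative exp_inv_poly (monom 1 2 * (P - pderiv P)) x) (at x)"
proof -
  consider "x < 0" | "x = 0" | "x > 0" by linarith
  then show ?thesis
  proof cases
    case 1
    have "((\<lambda>x. 0) has_real_derivative 0) (at x)" by simp
    then have "(exp_inv_poly P has_real_derivative 0) (at x)"
      by (rule has_field_derivative_transform_within_open[of _ _ _ "{..<0}"])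
         (use 1 in \<open>auto simp: exp_inv_poly_def\<close>)
    then show ?thesis using 1 by (simp add: exp_inv_poly_def)
  next
    case 2
    have "((\<lambda>h. exp_inv_poly P h / h) \<longlongrightarrow> 0) (at_left 0)"
      by (rule tendsto_eventually) (auto simp: eventually_at_filter exp_inv_poly_def)
    moreover have "((\<lambda>h. exp_inv_poly P h / h) \<longlongrightarrow> 0) (at_right 0)"
    proof -
      \<comment> \<open>Under y = 1/h the right-hand difference quotient at 0 is y P(y) / exp(y),
        and y tends to infinity.\<close>
      have "((\<lambda>h. inverse h ^ 1 * poly P (inverse h) / exp (inverse h)) \<longlongrightarrow> (0::real)) (at_right 0)"
        by (rule filterlim_compose[OF poly_over_exp_tendsto_0 filterlim_inverse_at_top_right])
      then show ?thesis
        by (rule tendsto_cong[THEN iffD1, rotated])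
           (auto simp: eventually_at_filter exp_inv_poly_def exp_minus divide_simps)
    qed
    ultimately have "((\<lambda>h. exp_inv_poly P h / h) \<longlongrightarrow> 0) (at 0)"
      by (simp add: filterlim_split_at)
    then show ?thesis
      using 2 by (simp add: DERIV_def exp_inv_poly_def)
  next
    case 3
    have "((\<lambda>x. poly P (1 / x) * exp (- 1 / x)) has_real_derivative
        exp_inv_poly (monom 1 2 * (P - pderiv P)) x) (at x)"
      using 3 by (auto intro!: derivative_eq_intros DERIV_chain2[OF poly_DERIV]
          simp: exp_inv_poly_def poly_monom power2_eq_square field_simps)
    then show ?thesis
      by (rule has_field_derivative_transform_within_open[of _ _ _ "{0<..}"])
         (use 3 in \<open>auto simp: exp_inv_poly_def\<close>)
  qed
qed

lemma differentiable_upto_exp_inv_poly: "differentiable_upto n (exp_inv_poly P)"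
  by (induction n arbitrary: P) (auto intro: DERIV_exp_inv_poly)

text \<open>The smooth step, 0 up to the origin and with limit 1 at infinity. Its derivative
  \<open>exp_inv'\<close> is the member of the family with polynomial X^2, because the constant
  polynomial 1 has derivative 0.\<close>

definition exp_inv :: "real \<Rightarrow> real" where
  "exp_inv = exp_inv_poly 1"

definition exp_inv' :: "real \<Rightarrow> real" where
  "exp_inv' = exp_inv_poly (monom 1 2)"

lemma DERIV_exp_inv: "(exp_inv has_real_derivative exp_inv' x) (at x)"
  using DERIV_exp_inv_poly[of 1] by (simp add: exp_inv_def exp_inv'_def pderiv_1)

lemma exp_inv_eq: "exp_inv x = (if x \<le> 0 then 0 else exp (- 1 / x))"
  by (simp add: exp_inv_def exp_inv_poly_def)

lemma exp_inv_bounds: "0 \<le> exp_inv x" "exp_inv x \<le> 1" "exp_inv x = 0 \<longleftrightarrow> x \<le> 0"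
  by (auto simp: exp_inv_eq)

lemma exp_inv'_nonneg: "0 \<le> exp_inv' x"
  by (auto simp: exp_inv'_def exp_inv_poly_def poly_monom)

lemma exp_inv'_eq_0: "x \<le> 0 \<Longrightarrow> exp_inv' x = 0"
  by (auto simp: exp_inv'_def exp_inv_poly_def)

lemma exp_inv_at_top: "(exp_inv \<longlongrightarrow> 1) at_top"
proof -
  have "((\<lambda>x::real. exp (- 1 / x)) \<longlongrightarrow> exp 0) at_top"
    by (intro tendsto_intros tendsto_divide_0[OF tendsto_const] filterlim_at_top_imp_at_infinity
        filterlim_ident)
  moreover have "eventually (\<lambda>x. exp (- 1 / x) = exp_inv x) at_top"
    using eventually_gt_at_top[of 0] by eventually_elim (auto simp: exp_inv_eq)
  ultimately show ?thesis
    by (simp add: tendsto_cong)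
qed

lemma measurable_exp_inv [measurable]: "exp_inv \<in> borel_measurable borel"
  by (intro borel_measurable_continuous_onI DERIV_continuous_on[of _ _ "exp_inv'"])
     (auto intro: DERIV_exp_inv DERIV_subset)

lemma measurable_exp_inv' [measurable]: "exp_inv' \<in> borel_measurable borel"
  unfolding exp_inv'_def
  by (intro borel_measurable_continuous_onI DERIV_continuous_on)
     (auto intro: DERIV_exp_inv_poly DERIV_subset)

text \<open>\<open>exp_inv\<close> climbs from 0 to 1, so its derivative is a probability density on
  the positive half-line. Rescaled, it acts as a one-sided approximate identity at the end points of
  an interval.\<close>

lemma has_bochner_integral_exp_inv': "has_bochner_integral lborel exp_inv' 1"
proof -
  have "(\<integral>\<^sup>+x. ennreal (exp_inv' x) * indicator {0..} x \<partial>lborel) = ennreal (1 - exp_inv 0)"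
    by (rule nn_integral_FTC_atLeast) (auto intro: DERIV_exp_inv exp_inv'_nonneg exp_inv_at_top)
  also have "(\<lambda>x. ennreal (exp_inv' x) * indicator {0..} x) = (\<lambda>x. ennreal (exp_inv' x))"
    by (auto simp: fun_eq_iff exp_inv'_eq_0 indicator_def)
  finally show ?thesis
    by (intro has_bochner_integral_nn_integral) (auto simp: exp_inv_eq exp_inv'_nonneg)
qed

section \<open>Products of one-dimensional functions and bump functions on boxes\<close>

lemma dir_deriv_prod:
  fixes p :: "'a::euclidean_space \<Rightarrow> real \<Rightarrow> real"
  assumes p': "\<And>i x. i \<in> Basis \<Longrightarrow> (p i has_real_derivative p' i x) (at x)" and "b \<in> Basis"
  shows "dir_deriv b (\<lambda>x. \<Prod>i\<in>Basis. p i (x \<bullet> i)) = (\<lambda>x. \<Prod>i\<in>Basis. (p(b := p' b)) i (x \<bullet> i))"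
    and "(\<lambda>x. \<Prod>i\<in>Basis. p i (x \<bullet> i)) differentiable at x"
proof -
  have d: "((\<lambda>x. \<Prod>i\<in>Basis. p i (x \<bullet> i)) has_derivative
      (\<lambda>y. \<Sum>i\<in>Basis. (p' i (x \<bullet> i) * (y \<bullet> i)) * (\<Prod>j\<in>Basis - {i}. p j (x \<bullet> j)))) (at x)" for x
  proof (rule has_derivative_prod)
    fix i :: 'a assume "i \<in> Basis"
    then show "((\<lambda>x. p i (x \<bullet> i)) has_derivative (\<lambda>y. p' i (x \<bullet> i) * (y \<bullet> i))) (at x)"
      using p'[of i "x \<bullet> i"]
      by (intro has_derivative_compose[of "\<lambda>x. x \<bullet> i" _ _ _ "p i"])
         (auto simp: has_field_derivative_def intro!: derivative_eq_intros)
  qed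
  then show "(\<lambda>x. \<Prod>i\<in>Basis. p i (x \<bullet> i)) differentiable at x"
    by (auto simp: differentiable_def)
  show "dir_deriv b (\<lambda>x. \<Prod>i\<in>Basis. p i (x \<bullet> i)) = (\<lambda>x. \<Prod>i\<in>Basis. (p(b := p' b)) i (x \<bullet> i))"
  proof
    fix x
    have "dir_deriv b (\<lambda>x. \<Prod>i\<in>Basis. p i (x \<bullet> i)) x =
        (\<Sum>i\<in>Basis. (p' i (x \<bullet> i) * (b \<bullet> i)) * (\<Prod>j\<in>Basis - {i}. p j (x \<bullet> j)))"
      unfolding dir_deriv_def frechet_derivative_at[OF d, symmetric] ..
    also have "\<dots> = (\<Sum>i\<in>Basis. if i = b then p' b (x \<bullet> b) * (\<Prod>j\<in>Basis - {b}. p j (x \<bullet> j)) else 0)"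
      using \<open>b \<in> Basis\<close> by (intro sum.cong) (auto simp: inner_Basis)
    also have "\<dots> = p' b (x \<bullet> b) * (\<Prod>j\<in>Basis - {b}. p j (x \<bullet> j))"
      using \<open>b \<in> Basis\<close> by simp
    also have "\<dots> = (\<Prod>i\<in>Basis. (p(b := p' b)) i (x \<bullet> i))"
      using \<open>b \<in> Basis\<close> by (subst prod.remove[of _ b]) auto
    finally show "dir_deriv b (\<lambda>x. \<Prod>i\<in>Basis. p i (x \<bullet> i)) x =
        (\<Prod>i\<in>Basis. (p(b := p' b)) i (x \<bullet> i))" .
  qed
qed

lemma differentiable_upto_deriv:
  assumes "\<And>n. differentiable_upto n p"
  shows "(p has_real_derivative deriv p x) (at x)" "differentiable_upto n (deriv p)"
proof -
  obtain p' where *: "\<forall>x. (p has_real_derivative p' x) (at x)" "differentiable_upto n p'"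
    using assms[of "Suc n"] by auto
  then have "p' = deriv p"
    by (auto simp: fun_eq_iff intro!: DERIV_imp_deriv[symmetric])
  with * show "(p has_real_derivative deriv p x) (at x)" "differentiable_upto n (deriv p)" by auto
qed

text \<open>Differentiation in a basis direction replaces one factor by its derivative and keeps the
  product form, so induction on the list of directions works once the factors \<open>p\<close> are
  arbitrary. In the base case any basis vector serves to quote
  \<open>dir_deriv_prod\<close>.\<close>

lemma smooth_prod:
  fixes p :: "'a::euclidean_space \<Rightarrow> real \<Rightarrow> real"
  assumes "\<And>i n. i \<in> Basis \<Longrightarrow> differentiable_upto n (p i)"
  shows "smooth (\<lambda>x. \<Prod>i\<in>Basis. p i (x \<bullet> i))"
proof -
  have "(fold dir_deriv bs (\<lambda>x. \<Prod>i\<in>Basis. p i (x \<bullet> i))) differentiable at x"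
    if "set bs \<subseteq> Basis" for bs x
    using that assms
  proof (induction bs arbitrary: p)
    case Nil
    then show ?case
      by (auto intro!: dir_deriv_prod(2)[of p "\<lambda>i. deriv (p i)" "SOME i. i \<in> Basis"]
          differentiable_upto_deriv some_in_eq[THEN iffD2])
  next
    case (Cons b bs)
    have "fold dir_deriv bs (\<lambda>x. \<Prod>i\<in>Basis. (p(b := deriv (p b))) i (x \<bullet> i)) differentiable at x"
      using Cons.prems by (intro Cons.IH) (auto intro: differentiable_upto_deriv)
    then show ?case
      using Cons.prems by (simp add: dir_deriv_prod(1)[of p "\<lambda>i. deriv (p i)"] differentiable_upto_deriv)
  qed
  then show ?thesis by (auto simp: smooth_def)
qed

text \<open>Each coordinate contributes one smooth step at either face of the box, and the growing
  slope \<open>Suc n\<close> makes the functions tend to the indicator. On the line the derivative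
  splits into a kernel at the left end point minus one at the right; this is how test functions
  reproduce point values later on.\<close>

definition box_bump :: "'a::euclidean_space \<Rightarrow> 'a \<Rightarrow> nat \<Rightarrow> 'a \<Rightarrow> real" where
  "box_bump a b n x =
     (\<Prod>i\<in>Basis. exp_inv (real (Suc n) * (x \<bullet> i - a \<bullet> i)) * exp_inv (real (Suc n) * (b \<bullet> i - x \<bullet> i)))"

lemma box_bump_nonzero: "box_bump a b n x \<noteq> 0 \<longleftrightarrow> x \<in> box a b"
  by (auto simp: box_bump_def exp_inv_bounds mem_box not_le zero_less_mult_iff mult_le_0_iff)

lemma box_bump_bounds: "0 \<le> box_bump a b n x" "box_bump a b n x \<le> 1"
  unfolding box_bump_def
  by (auto intro!: prod_nonneg prod_le_1 mult_le_one mult_nonneg_nonneg exp_inv_bounds)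

lemma box_bump_test_functions:
  assumes "cbox a b \<subseteq> S"
  shows "box_bump a b n \<in> test_functions S"
proof -
  have "smooth (box_bump a b n)"
    unfolding box_bump_def
  proof (rule smooth_prod)
    fix i m
    have "differentiable_upto m (\<lambda>t. exp_inv (real (Suc n) * t + (- real (Suc n) * (a \<bullet> i))) *
        exp_inv (- real (Suc n) * t + real (Suc n) * (b \<bullet> i)))"
      by (intro differentiable_upto_mult differentiable_upto_affine)
         (auto simp: exp_inv_def intro: differentiable_upto_exp_inv_poly)
    then show "differentiable_upto m (\<lambda>t. exp_inv (real (Suc n) * (t - a \<bullet> i)) *
        exp_inv (real (Suc n) * (b \<bullet> i - t)))"
      by (simp add: algebra_simps)
  qed
  moreover have "closure {x. box_bump a b n x \<noteq> 0} \<subseteq> cbox a b"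
    by (rule closure_minimal) (auto simp: box_bump_nonzero box_subset_cbox[THEN subsetD])
  ultimately show ?thesis
    using assms by (auto simp: test_functions_def intro: compact_closure[THEN iffD2]
        bounded_subset[OF bounded_cbox] dest: subset_trans[OF closure_subset])
qed

lemma box_bump_tendsto:
  "(\<lambda>n. box_bump a b n x) \<longlonglongrightarrow> indicator (box a b) x"
proof (cases "x \<in> box a b")
  case True
  have "(\<lambda>n. exp_inv (real (Suc n) * c)) \<longlonglongrightarrow> 1" if "c > 0" for c
    using that
    by (intro filterlim_compose[OF exp_inv_at_top]
        filterlim_at_top_mult_tendsto_pos[OF tendsto_const]
        filterlim_compose[OF filterlim_real_sequentially filterlim_Suc]) auto
  then have "(\<lambda>n. box_bump a b n x) \<longlonglongrightarrow> (\<Prod>i\<in>(Basis::'a set). 1 * 1)"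
    unfolding box_bump_def using True by (intro tendsto_prod tendsto_mult) (auto simp: mem_box)
  then show ?thesis using True by simp
next
  case False
  then have "box_bump a b n x = 0" for n using box_bump_nonzero by blast
  then show ?thesis using False by simp
qed

lemma smooth_differentiable: "smooth f \<Longrightarrow> f differentiable at x"
  unfolding smooth_def by (drule spec[of _ "[]"]) auto

lemma smooth_continuous: "smooth f \<Longrightarrow> continuous_on A f"
  by (intro differentiable_imp_continuous_on)
     (auto simp: differentiable_on_def intro: differentiable_at_withinI smooth_differentiable)

lemma smooth_dir_deriv: fixes f :: "'a::euclidean_space \<Rightarrow> real" shows "smooth f \<Longrightarrow> b \<in> Basis \<Longrightarrow> smooth (dir_deriv b f)"
  unfolding smooth_def
proof (intro allI impI)
  fix bs :: "'a list" and x assume *: "\<forall>bs. set bs \<subseteq> Basis \<longrightarrow> (\<forall>x. fold dir_deriv bs f differentiable at x)"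
    "b \<in> Basis" "set bs \<subseteq> Basis"
  then show "fold dir_deriv bs (dir_deriv b f) differentiable at x"
    using *(1)[rule_format, of "b # bs" x] by simp
qed

lemma dir_deriv_real: "dir_deriv 1 (f :: real \<Rightarrow> real) x = deriv f x" if "f differentiable at x"
proof -
  have "(f has_real_derivative deriv f x) (at x)"
    using that by (simp add: DERIV_deriv_iff_real_differentiable)
  then have "(f has_derivative (\<lambda>h. deriv f x * h)) (at x)"
    by (simp add: has_field_derivative_def)
  then show ?thesis
    unfolding dir_deriv_def by (metis frechet_derivative_at mult.right_neutral)
qed

section \<open>The fundamental lemma of the calculus of variations\<close>

lemma sigma_finite_lebesgue: "sigma_finite_measure (lebesgue :: 'a::euclidean_space measure)"
proof
  obtain A :: "'a set set" where A: "countable A" "A \<subseteq> sets lborel" "\<Union>A = space lborel"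
    "\<forall>a\<in>A. emeasure lborel a \<noteq> \<infinity>"
    using lborel.sigma_finite_countable by metis
  then show "\<exists>A :: 'a set set. countable A \<and> A \<subseteq> sets lebesgue \<and> \<Union>A = space lebesgue \<and>
      (\<forall>a\<in>A. emeasure lebesgue a \<noteq> \<infinity>)"
    by (intro exI[of _ A]) (auto simp: subset_eq)
qed

text \<open>Open boxes are stable under intersection and generate the Borel sets, so the vanishing
  of the integrals spreads to all Borel sets; the assumption on the whole space settles complements.
  A Lebesgue set is Borel up to a null set, and an integrable function is determined a.e. by its
  integrals over measurable sets.\<close>

lemma AE_eq_0_if_box_integrals_0:
  fixes f :: "'a::euclidean_space \<Rightarrow> 'b::euclidean_space"
  assumes f: "integrable lebesgue f" and UNIV0: "(LINT x|lebesgue. f x) = 0"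
    and box0: "\<And>a b. (LINT x:box a b|lebesgue. f x) = 0"
  shows "AE x in lebesgue. f x = 0"
proof -
  have int: "set_integrable lebesgue A f" if "A \<in> sets lebesgue" for A
    using that f by (simp add: set_integrable_def integrable_mult_indicator)
  have borel0: "(LINT x:A|lebesgue. f x) = 0" if "A \<in> sets borel" for A
  proof -
    have "Int_stable (range (\<lambda>(a, b). box a b :: 'a set))"
      by (auto simp: Int_stable_def box_Int_box)
    moreover have "range (\<lambda>(a, b). box a b) \<subseteq> Pow (UNIV :: 'a set)" by auto
    moreover have "A \<in> sigma_sets UNIV (range (\<lambda>(a, b). box a b))"
      using that unfolding borel_eq_box by simp
    ultimately show ?thesis
    proof (induction rule: sigma_sets_induct_disjoint)
      case (basic A) then show ?case by (auto simp: box0)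
    next
      case empty show ?case by (simp add: set_lebesgue_integral_def)
    next
      case (compl A)
      then have A: "A \<in> sets lebesgue" by (simp add: borel_eq_box)
      have "(LINT x:UNIV - A|lebesgue. f x) + (LINT x:A|lebesgue. f x) = (LINT x:UNIV|lebesgue. f x)"
        using A by (subst set_integral_Un[symmetric]) (auto intro!: int)
      then show ?case using compl UNIV0 by (simp add: set_lebesgue_integral_def)
    next
      case (union F)
      then have "\<And>i. F i \<in> sets lebesgue" by (simp add: borel_eq_box subset_eq)
      then have "(LINT x:(\<Union>i. F i)|lebesgue. f x) = (\<Sum>i. LINT x:F i|lebesgue. f x)"
        using union by (intro lebesgue_integral_countable_add int)
          (auto simp: disjoint_family_on_def)
      then show ?case using union by simp
    qed
  qed
  have "(LINT x:A|lebesgue. f x) = 0" if "A \<in> sets lebesgue" for A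
  proof -
    obtain S N N' where A: "A = S \<union> N" "N \<subseteq> N'" "N' \<in> null_sets lborel" "S \<in> sets lborel"
      using sets_completionE[OF \<open>A \<in> sets lebesgue\<close>] .
    have "AE x in lebesgue. x \<notin> N'"
      using A(3) by (intro AE_not_in null_sets_completionI)
    then have "AE x in lebesgue. indicator A x *\<^sub>R f x = indicator S x *\<^sub>R f x"
      by eventually_elim (use A in \<open>auto simp: indicator_def\<close>)
    then have "(LINT x:A|lebesgue. f x) = (LINT x:S|lebesgue. f x)"
      unfolding set_lebesgue_integral_def
      using int[of A] int[of S] that A(4) by (intro integral_cong_AE) (auto simp: set_integrable_def)
    then show ?thesis using borel0 A(4) by simp
  qed
  then show ?thesis
    using f by (intro sigma_finite_measure.density_unique_banach[OF sigma_finite_lebesgue]) (auto simp: set_lebesgue_integral_def)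
qed

text \<open>The bumps of a box with \<open>cbox a b\<close> in \<open>S\<close> converge boundedly
  to the indicator, so testing gives vanishing integrals over all such boxes. Cut off to one box,
  \<open>f\<close> is integrable on the whole space and the previous lemma applies. Countably many
  closed boxes exhaust \<open>S\<close>.\<close>

lemma test_functions_AE_eq_0:
  fixes f :: "'a::euclidean_space \<Rightarrow> 'b::euclidean_space"
  assumes S: "open S" and f: "locally_integrable S f"
    and f0: "\<And>\<phi>. \<phi> \<in> test_functions S \<Longrightarrow> (LINT x|lebesgue_on S. \<phi> x *\<^sub>R f x) = 0"
  shows "AE x in lebesgue_on S. f x = 0"
proof -
  have S': "S \<in> sets lebesgue" using S by simp
  have box0: "(LINT x:box a b|lebesgue. f x) = 0" if ab: "cbox a b \<subseteq> S" for a b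
  proof -
    have int: "integrable lebesgue (\<lambda>x. indicator (cbox a b) x *\<^sub>R f x)"
      using f ab by (auto simp: locally_integrable_def set_integrable_def)
    have "(\<lambda>n. LINT x|lebesgue. box_bump a b n x *\<^sub>R (indicator (cbox a b) x *\<^sub>R f x))
        \<longlonglongrightarrow> (LINT x|lebesgue. indicator (box a b) x *\<^sub>R (indicator (cbox a b) x *\<^sub>R f x))"
    proof (rule integral_dominated_convergence)
      show "integrable lebesgue (\<lambda>x. norm (indicator (cbox a b) x *\<^sub>R f x))"
        by (rule integrable_norm[OF int])
      show "(\<lambda>x. box_bump a b n x *\<^sub>R (indicator (cbox a b) x *\<^sub>R f x)) \<in> borel_measurable lebesgue" for n
        unfolding box_bump_def
        by (intro borel_measurable_scaleR borel_measurable_integrable[OF int] measurable_completion)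
           measurable
      show "AE x in lebesgue. norm (box_bump a b n x *\<^sub>R (indicator (cbox a b) x *\<^sub>R f x))
          \<le> norm (indicator (cbox a b) x *\<^sub>R f x)" for n
        unfolding norm_scaleR[of "box_bump a b n _"]
        by (intro AE_I2 mult_left_le_one_le) (auto simp: box_bump_bounds)
      show "(\<lambda>x. indicator (box a b) x *\<^sub>R (indicator (cbox a b) x *\<^sub>R f x)) \<in> borel_measurable lebesgue"
        by (intro borel_measurable_scaleR[OF _ borel_measurable_integrable[OF int]]
            borel_measurable_indicator) auto
    qed (auto intro!: tendsto_intros box_bump_tendsto)
    moreover have "(LINT x|lebesgue. box_bump a b n x *\<^sub>R (indicator (cbox a b) x *\<^sub>R f x)) = 0" for n
    proof -
      have "indicator S x *\<^sub>R (box_bump a b n x *\<^sub>R f x) =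
          box_bump a b n x *\<^sub>R (indicator (cbox a b) x *\<^sub>R f x)" for x
        using ab box_subset_cbox[of a b] box_bump_nonzero[of a b n x]
        by (cases "x \<in> box a b") (auto simp: indicator_def)
      moreover have "S \<inter> space lebesgue \<in> sets lebesgue" using S' by simp
      ultimately show ?thesis
        using f0[OF box_bump_test_functions[OF ab], of n] by (simp only: integral_restrict_space)
    qed
    moreover have "indicator (box a b) x *\<^sub>R (indicator (cbox a b) x *\<^sub>R f x) =
        indicator (box a b) x *\<^sub>R f x" for x
      using box_subset_cbox[of a b] by (auto simp: indicator_def)
    ultimately show ?thesis by (simp only: LIMSEQ_const_iff set_lebesgue_integral_def)
  qed
  have cbox0: "AE x in lebesgue. x \<in> cbox a b \<longrightarrow> f x = 0" if ab: "cbox a b \<subseteq> S" for a b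
  proof -
    let ?f = "\<lambda>x. indicator (box a b) x *\<^sub>R f x"
    have "integrable lebesgue (\<lambda>x. indicator (box a b) x *\<^sub>R (indicator (cbox a b) x *\<^sub>R f x))"
      using f ab by (intro integrable_mult_indicator[where A = "box a b"])
        (simp_all add: locally_integrable_def set_integrable_def)
    moreover have "indicator (box a b) x *\<^sub>R (indicator (cbox a b) x *\<^sub>R f x) = ?f x" for x
      using box_subset_cbox[of a b] by (auto simp: indicator_def)
    ultimately have int: "integrable lebesgue ?f" by (simp only:)
    have "AE x in lebesgue. ?f x = 0"
    proof (rule AE_eq_0_if_box_integrals_0[OF int])
      show "(LINT x|lebesgue. ?f x) = 0"
        using box0[OF ab] by (simp add: set_lebesgue_integral_def)
      fix c d :: 'a
      obtain c' d' where cd: "box c d \<inter> box a b = box c' d'" using box_Int_box by blast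
      have "(LINT x:box c d|lebesgue. ?f x) = (LINT x:box c' d'|lebesgue. f x)"
        unfolding cd[symmetric] set_lebesgue_integral_def by (simp add: indicator_inter_arith)
      also have "\<dots> = 0"
      \<comment> \<open>If the open box is empty, nothing is known about the closed box with the
        same corners; otherwise the latter is its closure and stays in
        \<open>cbox a b\<close>.\<close>
      proof (cases "box c' d' = {}")
        case False
        have "closure (box c' d') \<subseteq> cbox a b"
          using cd box_subset_cbox[of a b] by (intro closure_minimal) auto
        then have "cbox c' d' \<subseteq> cbox a b"
          using False by simp
        then show ?thesis using ab by (intro box0) auto
      qed (simp add: set_lebesgue_integral_def)
      finally show "(LINT x:box c d|lebesgue. ?f x) = 0" .
    qed
    moreover have "AE x in lebesgue. x \<notin> cbox a b - box a b"
      using negligible_frontier_interval[of a b] negligible_iff_null_sets by (intro AE_not_in) blast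
    ultimately show ?thesis by eventually_elim (auto simp: indicator_def split: if_splits)
  qed
  obtain D where D: "countable D" "D \<subseteq> Pow S" "\<And>X. X \<in> D \<Longrightarrow> \<exists>a b. X = cbox a b" "\<Union>D = S"
    using open_countable_Union_open_cbox[OF S] by metis
  have "\<forall>X\<in>D. AE x in lebesgue. x \<in> X \<longrightarrow> f x = 0"
  proof
    fix X assume "X \<in> D"
    then obtain a b where "X = cbox a b" "cbox a b \<subseteq> S" using D(2,3) by blast
    then show "AE x in lebesgue. x \<in> X \<longrightarrow> f x = 0" using cbox0 by simp
  qed
  then have "AE x in lebesgue. \<forall>X\<in>D. x \<in> X \<longrightarrow> f x = 0"
    by (subst AE_ball_countable[OF D(1)])
  then have "AE x in lebesgue. x \<in> S \<longrightarrow> f x = 0"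
    by eventually_elim (use D(4) in blast)
  then show ?thesis
    using S' by (simp add: AE_restrict_space_iff)
qed

section \<open>Weak derivatives on an interval\<close>

text \<open>After the substitution x = a + y / (n + 1) the kernel is the fixed density
  \<open>exp_inv'\<close> in y, the second step factor tends to 1 and the argument of
  \<open>F\<close> approaches \<open>a\<close>. As the density vanishes for y <= 0, the argument
  comes from the right only, so right continuity at \<open>a\<close> suffices.\<close>

lemma exp_inv'_kernel_tendsto:
  fixes F :: "real \<Rightarrow> real"
  assumes [measurable]: "F \<in> borel_measurable borel" and C: "\<And>x. \<bar>F x\<bar> \<le> C" and ab: "a < b"
    and F: "(F \<longlongrightarrow> F a) (at_right a)"
  shows "(\<lambda>n. LINT x|lborel. real (Suc n) * exp_inv' (real (Suc n) * (x - a)) *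
            exp_inv (real (Suc n) * (b - x)) * F x) \<longlonglongrightarrow> F a"
proof -
  let ?N = "\<lambda>n. real (Suc n)"
  have "(LINT x|lborel. ?N n * exp_inv' (?N n * (x - a)) * exp_inv (?N n * (b - x)) * F x) =
      (LINT y|lborel. exp_inv' y * exp_inv (?N n * (b - a) - y) * F (a + 1 / ?N n * y))" for n
  proof -
    have *: "?N n * (a + 1 / ?N n * y - a) = y" "?N n * (b - (a + 1 / ?N n * y)) = ?N n * (b - a) - y" for y
      by (simp_all add: field_simps del: of_nat_Suc)
    show ?thesis
      by (subst lborel_integral_real_affine[where c = "1 / ?N n" and t = a])
         (simp_all only: *, simp_all add: mult.assoc)
  qed
  moreover have "(\<lambda>n. LINT y|lborel. exp_inv' y * exp_inv (?N n * (b - a) - y) * F (a + 1 / ?N n * y))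
      \<longlonglongrightarrow> (LINT y|lborel. exp_inv' y * 1 * F a)"
  proof (rule integral_dominated_convergence)
    show "integrable lborel (\<lambda>y. exp_inv' y * C)"
      using has_bochner_integral_exp_inv' by (auto simp: has_bochner_integral_iff)
    show "AE y in lborel. (\<lambda>n. exp_inv' y * exp_inv (?N n * (b - a) - y) * F (a + 1 / ?N n * y))
        \<longlonglongrightarrow> exp_inv' y * 1 * F a"
    proof (rule AE_I2)
      fix y :: real
      show "(\<lambda>n. exp_inv' y * exp_inv (?N n * (b - a) - y) * F (a + 1 / ?N n * y))
        \<longlonglongrightarrow> exp_inv' y * 1 * F a"
      proof (cases "y > 0")
        case True
        have "filterlim (\<lambda>n. ?N n * (b - a)) at_top sequentially"
          using ab by (intro filterlim_at_top_mult_tendsto_pos[OF tendsto_const]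
              filterlim_compose[OF filterlim_real_sequentially filterlim_Suc]) auto
        then have 1: "filterlim (\<lambda>n. ?N n * (b - a) - y) at_top sequentially"
          using filterlim_tendsto_add_at_top[OF tendsto_const[of "- y"]] by force
        have "(\<lambda>n. a + inverse (?N n) * y) \<longlonglongrightarrow> a + 0 * y"
          by (intro tendsto_intros LIMSEQ_inverse_real_of_nat)
        then have "filterlim (\<lambda>n. a + 1 / ?N n * y) (at_right a) sequentially"
          using True by (auto simp: filterlim_at inverse_eq_divide)
        then show ?thesis
          by (intro tendsto_mult tendsto_const filterlim_compose[OF exp_inv_at_top 1]
              filterlim_compose[OF F])
      qed (simp add: exp_inv'_eq_0)
    qed
    show "AE y in lborel. norm (exp_inv' y * exp_inv (?N n * (b - a) - y) * F (a + 1 / ?N n * y))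
        \<le> exp_inv' y * C" for n
    proof (rule AE_I2)
      fix y
      have "exp_inv (?N n * (b - a) - y) * \<bar>F (a + 1 / ?N n * y)\<bar> \<le> 1 * C"
        by (intro mult_mono C exp_inv_bounds) auto
      then show "norm (exp_inv' y * exp_inv (?N n * (b - a) - y) * F (a + 1 / ?N n * y)) \<le> exp_inv' y * C"
        using exp_inv'_nonneg[of y]
        by (simp add: abs_mult exp_inv_bounds mult.assoc mult_left_mono del: of_nat_Suc)
    qed
  qed measurable
  moreover have "(LINT y|lborel. exp_inv' y * 1 * F a) = F a"
    using has_bochner_integral_exp_inv' by (simp add: has_bochner_integral_iff)
  ultimately show ?thesis by (simp only:)
qed

text \<open>The test functions are the bumps of the interval (s, t). They tend to its indicator,
  which produces the right-hand side, while their derivatives are a kernel at \<open>s\<close> minus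
  a kernel at \<open>t\<close>, which produce the two values of \<open>f\<close>.\<close>

lemma weak_derivative_interior:
  fixes f g :: "real \<Rightarrow> real"
  assumes f: "continuous_on {0..T} f" and g: "integrable (lebesgue_on {0<..<T}) g"
    and weak: "\<And>\<phi>. \<phi> \<in> test_functions {0<..<T} \<Longrightarrow>
      (LINT t|lebesgue_on {0<..<T}. deriv \<phi> t * f t) = - (LINT t|lebesgue_on {0<..<T}. \<phi> t * g t)"
    and st: "0 < s" "s < t" "t < T"
  shows "f t - f s = (LINT r|lebesgue_on {0<..<T}. indicator {s<..<t} r * g r)"
proof -
  let ?N = "\<lambda>n. real (Suc n)" and ?\<phi> = "box_bump s t"
  \<comment> \<open>Continued by 0, \<open>f\<close> becomes a bounded Borel function on the line
    and substitutions need not respect the interval. The limits only look at the interior points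
    \<open>s\<close> and \<open>t\<close>, where \<open>F\<close> is still continuous.\<close>
  define F where "F = (\<lambda>x. indicator {0..T} x * f x)"
  have F [measurable]: "F \<in> borel_measurable borel"
    using borel_measurable_continuous_on_indicator[OF _ f] by (simp add: F_def)
  obtain C0 where C0: "\<And>x. x \<in> {0..T} \<Longrightarrow> \<bar>f x\<bar> \<le> C0"
    using compact_imp_bounded[OF compact_continuous_image[OF f]]
    by (metis bounded_iff compact_Icc image_eqI real_norm_def)
  have C: "\<bar>F x\<bar> \<le> \<bar>C0\<bar>" for x using C0[of x] by (auto simp: F_def indicator_def)
  have isCont: "isCont F x" if "0 < x" "x < T" for x
  proof -
    have "isCont f x" using f that by (intro continuous_on_interior[of "{0..T}"]) auto
    moreover have "\<forall>\<^sub>F y in nhds x. F y = f y"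
      using that eventually_nhds_in_open[of "{0<..<T}" x]
      by (auto simp: F_def elim!: eventually_mono)
    ultimately show ?thesis by (simp add: isCont_cong)
  qed
  have phi: "?\<phi> n x = exp_inv (?N n * (x - s)) * exp_inv (?N n * (t - x))" for n x
    by (simp add: box_bump_def)
  have "(?\<phi> n has_real_derivative ?N n * exp_inv' (?N n * (x - s)) * exp_inv (?N n * (t - x)) -
      ?N n * exp_inv (?N n * (x - s)) * exp_inv' (?N n * (t - x))) (at x)" for n x
    unfolding phi[abs_def]
    by (rule derivative_eq_intros DERIV_chain2[OF DERIV_exp_inv] refl)+ (simp add: algebra_simps)
  then have deriv: "deriv (?\<phi> n) x = ?N n * exp_inv' (?N n * (x - s)) * exp_inv (?N n * (t - x)) -
      ?N n * exp_inv (?N n * (x - s)) * exp_inv' (?N n * (t - x))" for n x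
    by (rule DERIV_imp_deriv)
  have bound: "integrable lborel (\<lambda>x. exp_inv' (?N n * (x - s)) * c)" for n c
  proof -
    have "integrable lborel (\<lambda>x. exp_inv' (- ?N n * s + ?N n * x))"
      using has_bochner_integral_exp_inv'
      by (intro lborel_integrable_real_affine) (auto simp: has_bochner_integral_iff)
    then show ?thesis by (intro integrable_mult_left) (simp add: algebra_simps)
  qed
  have I1: "integrable lborel (\<lambda>x. ?N n * exp_inv' (?N n * (x - s)) * exp_inv (?N n * (t - x)) * G x)"
    if [measurable]: "G \<in> borel_measurable borel" and "\<And>x. \<bar>G x\<bar> \<le> \<bar>C0\<bar>" for n G
  proof (rule Bochner_Integration.integrable_bound[OF bound[of n "?N n * \<bar>C0\<bar>"]])
    show "AE x in lborel. norm (?N n * exp_inv' (?N n * (x - s)) * exp_inv (?N n * (t - x)) * G x)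
        \<le> norm (exp_inv' (?N n * (x - s)) * (?N n * \<bar>C0\<bar>))"
    proof (rule AE_I2)
      fix x
      have "exp_inv (?N n * (t - x)) * \<bar>G x\<bar> \<le> 1 * \<bar>C0\<bar>"
        by (intro mult_mono that(2) exp_inv_bounds) auto
      then have "?N n * exp_inv' (?N n * (x - s)) * (exp_inv (?N n * (t - x)) * \<bar>G x\<bar>)
          \<le> ?N n * exp_inv' (?N n * (x - s)) * \<bar>C0\<bar>"
        by (intro mult_left_mono) (auto simp: exp_inv'_nonneg)
      then show "norm (?N n * exp_inv' (?N n * (x - s)) * exp_inv (?N n * (t - x)) * G x)
        \<le> norm (exp_inv' (?N n * (x - s)) * (?N n * \<bar>C0\<bar>))"
        by (simp add: abs_mult exp_inv_bounds exp_inv'_nonneg mult_ac del: of_nat_Suc)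
    qed
  qed measurable
  \<comment> \<open>The reflection x -> s + t - x exchanges the end points and turns the kernel at
    \<open>t\<close> into the one at \<open>s\<close>, so a single limit lemma covers both.\<close>
  let ?G = "\<lambda>x. F ((s + t) - x)"
  have right: "(G \<longlongrightarrow> G x) (at_right x)" if "isCont G x" for G :: "real \<Rightarrow> real" and x
    using continuous_at_imp_continuous_at_within[OF that] by (simp add: continuous_within)
  have lim1: "(\<lambda>n. LINT x|lborel. ?N n * exp_inv' (?N n * (x - s)) * exp_inv (?N n * (t - x)) * F x)
      \<longlonglongrightarrow> F s"
    using st by (intro exp_inv'_kernel_tendsto[OF F C] right isCont) auto
  have "isCont ?G s"
    by (rule isCont_o2[where g = F]) (use isCont[of t] st in \<open>auto intro!: continuous_intros\<close>)
  then have lim2: "(\<lambda>n. LINT x|lborel. ?N n * exp_inv' (?N n * (x - s)) * exp_inv (?N n * (t - x)) * ?G x)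
      \<longlonglongrightarrow> ?G s"
    using st C by (intro exp_inv'_kernel_tendsto right) auto
  have refl: "(LINT x|lborel. ?N n * exp_inv (?N n * (x - s)) * exp_inv' (?N n * (t - x)) * F x) =
      (LINT x|lborel. ?N n * exp_inv' (?N n * (x - s)) * exp_inv (?N n * (t - x)) * ?G x)"
    "integrable lborel (\<lambda>x. ?N n * exp_inv (?N n * (x - s)) * exp_inv' (?N n * (t - x)) * F x)" for n
  proof -
    have *: "s + t + - 1 * x - s = t - x" "t - (s + t + - 1 * x) = x - s" "s + t + - 1 * x = s + t - x" for x
      by auto
    show "(LINT x|lborel. ?N n * exp_inv (?N n * (x - s)) * exp_inv' (?N n * (t - x)) * F x) =
      (LINT x|lborel. ?N n * exp_inv' (?N n * (x - s)) * exp_inv (?N n * (t - x)) * ?G x)"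
      by (subst lborel_integral_real_affine[where c = "- 1" and t = "s + t"])
         (auto simp only: * , auto simp: mult_ac)
    have "integrable lborel (\<lambda>x. ?N n * exp_inv' (?N n * (x - s)) * exp_inv (?N n * (t - x)) * ?G x)"
      using C by (intro I1) auto
    from lborel_integrable_real_affine[OF this, of "-1" "s + t"]
    show "integrable lborel (\<lambda>x. ?N n * exp_inv (?N n * (x - s)) * exp_inv' (?N n * (t - x)) * F x)"
      by (simp only: *) (simp add: mult_ac)
  qed
  have "(LINT x|lebesgue_on {0<..<T}. deriv (?\<phi> n) x * f x) =
      (LINT x|lborel. ?N n * exp_inv' (?N n * (x - s)) * exp_inv (?N n * (t - x)) * F x) -
      (LINT x|lborel. ?N n * exp_inv' (?N n * (x - s)) * exp_inv (?N n * (t - x)) * ?G x)" for n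
  proof -
    have "(LINT x|lebesgue_on {0<..<T}. deriv (?\<phi> n) x * f x) =
        (LINT x|lebesgue. deriv (?\<phi> n) x * F x)"
    proof -
      have "indicator {0<..<T} x *\<^sub>R (deriv (?\<phi> n) x * f x) = deriv (?\<phi> n) x * F x" for x
      proof (cases "s < x \<and> x < t")
        case False
        then have "?N n * (x - s) \<le> 0 \<or> ?N n * (t - x) \<le> 0"
          by (simp add: mult_le_0_iff del: of_nat_Suc) linarith
        then have "deriv (?\<phi> n) x = 0"
          unfolding deriv by (metis exp_inv'_eq_0 exp_inv_bounds(3) diff_zero mult_zero_left mult_zero_right)
        then show ?thesis by simp
      qed (use st in \<open>simp add: F_def\<close>)
      then show ?thesis by (subst integral_restrict_space) (simp, simp only:)
    qed
    also have "\<dots> = (LINT x|lborel. deriv (?\<phi> n) x * F x)"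
      unfolding deriv by (rule integral_completion) measurable
    also have "\<dots> = (LINT x|lborel. ?N n * exp_inv' (?N n * (x - s)) * exp_inv (?N n * (t - x)) * F x) -
        (LINT x|lborel. ?N n * exp_inv (?N n * (x - s)) * exp_inv' (?N n * (t - x)) * F x)"
      unfolding deriv left_diff_distrib
      by (intro Bochner_Integration.integral_diff I1 F C refl(2))
    finally show ?thesis unfolding refl .
  qed
  then have "(\<lambda>n. LINT x|lebesgue_on {0<..<T}. deriv (?\<phi> n) x * f x) \<longlonglongrightarrow> F s - F t"
    using tendsto_diff[OF lim1 lim2] by simp
  moreover have "(\<lambda>n. - (LINT x|lebesgue_on {0<..<T}. ?\<phi> n x * g x)) \<longlonglongrightarrow>
      - (LINT x|lebesgue_on {0<..<T}. indicator {s<..<t} x * g x)"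
  proof (intro tendsto_minus integral_dominated_convergence)
    show "integrable (lebesgue_on {0<..<T}) (\<lambda>x. norm (g x))" using g by simp
    show "AE x in lebesgue_on {0<..<T}. (\<lambda>n. ?\<phi> n x * g x) \<longlonglongrightarrow> indicator {s<..<t} x * g x"
      using box_bump_tendsto[of s t] by (auto intro!: tendsto_intros simp: box_real)
    show "AE x in lebesgue_on {0<..<T}. norm (?\<phi> n x * g x) \<le> norm (g x)" for n
      by (auto simp: abs_mult box_bump_bounds intro!: mult_left_le_one_le)
    have "?\<phi> n \<in> borel_measurable (lebesgue_on {0<..<T})" for n
      unfolding phi[abs_def]
      by (intro measurable_restrict_space1 measurable_completion) measurable
    then show "(\<lambda>x. ?\<phi> n x * g x) \<in> borel_measurable (lebesgue_on {0<..<T})" for n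
      using g by (intro borel_measurable_times) auto
    show "(\<lambda>x. indicator {s<..<t} x * g x) \<in> borel_measurable (lebesgue_on {0<..<T})"
      using g st by (intro borel_measurable_times borel_measurable_indicator)
        (auto simp: sets_restrict_space_iff sets_restrict_UNIV)
  qed
  moreover have "(LINT x|lebesgue_on {0<..<T}. deriv (?\<phi> n) x * f x) =
      - (LINT x|lebesgue_on {0<..<T}. ?\<phi> n x * g x)" for n
    using st by (intro weak box_bump_test_functions) auto
  ultimately have "F s - F t = - (LINT x|lebesgue_on {0<..<T}. indicator {s<..<t} x * g x)"
    by (auto intro: LIMSEQ_unique)
  then show ?thesis using st by (simp add: F_def)
qed

text \<open>Interior subintervals exhaust (s, t); continuity of \<open>f\<close> up to the end
  points and dominated convergence carry the identity over. Through this lemma distributional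
  equations in time become integrated equations between arbitrary times, 0 and T included.\<close>

lemma weak_derivative_imp_FTC:
  fixes f g :: "real \<Rightarrow> real"
  assumes f: "continuous_on {0..T} f" and g: "integrable (lebesgue_on {0<..<T}) g"
    and weak: "\<And>\<phi>. \<phi> \<in> test_functions {0<..<T} \<Longrightarrow>
      (LINT t|lebesgue_on {0<..<T}. deriv \<phi> t * f t) = - (LINT t|lebesgue_on {0<..<T}. \<phi> t * g t)"
    and st: "0 \<le> s" "s \<le> t" "t \<le> T"
  shows "f t - f s = (LINT r|lebesgue_on {0<..<T}. indicator {s<..<t} r * g r)"
proof (cases "s = t")
  case False
  \<comment> \<open>The factor (t - s) / 3 keeps \<open>s + e n\<close> strictly below
    \<open>t - e n\<close> for every \<open>n\<close>.\<close>
  define e where "e n = (t - s) / 3 * inverse (real (Suc n))" for n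
  have e: "0 < e n" "e n \<le> (t - s) / 3" for n
  proof -
    show "0 < e n" using False st by (simp add: e_def del: of_nat_Suc)
    have "inverse (real (Suc n)) \<le> 1" by (simp add: field_simps)
    then show "e n \<le> (t - s) / 3"
      unfolding e_def using st by (intro mult_left_le) auto
  qed
  have e0: "e \<longlonglongrightarrow> 0"
    unfolding e_def using tendsto_mult[OF tendsto_const[of "(t - s) / 3"] LIMSEQ_inverse_real_of_nat] by simp
  let ?a = "\<lambda>n. s + e n" and ?b = "\<lambda>n. t - e n"
  have ab: "0 < ?a n" "?a n < ?b n" "?b n < T" for n
    using e[of n] st False by (auto simp: field_simps)
  have ab_lim: "?a \<longlonglongrightarrow> s" "?b \<longlonglongrightarrow> t"
    using tendsto_add[OF tendsto_const e0, of s] tendsto_diff[OF tendsto_const e0, of t] by simp_all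
  have eq: "f (?b n) - f (?a n) = (LINT r|lebesgue_on {0<..<T}. indicator {?a n<..<?b n} r * g r)" for n
    by (rule weak_derivative_interior[OF f g weak ab])
  have "(\<lambda>n. f (?b n) - f (?a n)) \<longlonglongrightarrow> f t - f s"
    using st ab by (intro tendsto_diff continuous_on_tendsto_compose[OF f] ab_lim always_eventually allI)
      (use less_imp_le[OF e(1)] less_imp_le[OF ab(2)] less_imp_le[OF ab(3)] less_imp_le[OF ab(1)]
        in \<open>auto, (smt (verit) e)+\<close>)
  moreover have "(\<lambda>n. LINT r|lebesgue_on {0<..<T}. indicator {?a n<..<?b n} r * g r) \<longlonglongrightarrow>
      (LINT r|lebesgue_on {0<..<T}. indicator {s<..<t} r * g r)"
  proof (rule integral_dominated_convergence)
    show "integrable (lebesgue_on {0<..<T}) (\<lambda>r. norm (g r))" using g by simp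
    have meas: "(\<lambda>r. indicator {c<..<d} r * g r) \<in> borel_measurable (lebesgue_on {0<..<T})" if "0 \<le> c" "d \<le> T" for c d
      using g that by (intro borel_measurable_times borel_measurable_indicator)
        (auto simp: sets_restrict_space_iff sets_restrict_UNIV)
    show "(\<lambda>r. indicator {s<..<t} r * g r) \<in> borel_measurable (lebesgue_on {0<..<T})"
      using st by (intro meas) auto
    show "(\<lambda>r. indicator {?a n<..<?b n} r * g r) \<in> borel_measurable (lebesgue_on {0<..<T})" for n
      using ab[of n] by (intro meas) auto
    show "AE r in lebesgue_on {0<..<T}. (\<lambda>n. indicator {?a n<..<?b n} r * g r) \<longlonglongrightarrow> indicator {s<..<t} r * g r"
    proof (intro AE_I2 tendsto_mult tendsto_const)
      fix r
      show "(\<lambda>n. indicator {?a n<..<?b n} r :: real) \<longlonglongrightarrow> indicator {s<..<t} r"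
      proof (cases "s < r \<and> r < t")
        case True
        then have "\<forall>\<^sub>F n in sequentially. ?a n < r" "\<forall>\<^sub>F n in sequentially. r < ?b n"
          using order_tendstoD[OF ab_lim(1)] order_tendstoD[OF ab_lim(2)] by auto
        then have "\<forall>\<^sub>F n in sequentially. indicator {?a n<..<?b n} r = (indicator {s<..<t} r :: real)"
          by eventually_elim (use True in auto)
        then show ?thesis by (rule tendsto_eventually)
      next
        case False
        then have "indicator {?a n<..<?b n} r = (indicator {s<..<t} r :: real)" for n
          using e[of n] by (auto simp: indicator_def)
        then show ?thesis by simp
      qed
    qed
    show "AE r in lebesgue_on {0<..<T}. norm (indicator {?a n<..<?b n} r * g r) \<le> norm (g r)" for n
      by (auto simp: indicator_def)
  qed
  ultimately show ?thesis
    unfolding eq by (rule LIMSEQ_unique)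
qed simp

section \<open>Difference quotients\<close>

lemma directional_mean_value:
  fixes F :: "'a::euclidean_space \<Rightarrow> real"
  assumes F: "\<And>x. F differentiable at x" and "0 < h"
  obtains z where "0 < z" "z < h" "F (x + h *\<^sub>R b) - F x = h * dir_deriv b F (x + z *\<^sub>R b)"
proof -
  have D: "((\<lambda>t. F (x + t *\<^sub>R b)) has_real_derivative dir_deriv b F (x + t *\<^sub>R b)) (at t)" for t
  proof -
    have "(F has_derivative frechet_derivative F (at (x + t *\<^sub>R b))) (at (x + t *\<^sub>R b))"
      using F by (simp add: frechet_derivative_works[symmetric])
    then have "((\<lambda>t. F (x + t *\<^sub>R b)) has_derivative
        (\<lambda>s. frechet_derivative F (at (x + t *\<^sub>R b)) (s *\<^sub>R b))) (at t)"
      by (intro has_derivative_compose[of "\<lambda>t. x + t *\<^sub>R b" _ _ _ F])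
         (auto intro!: derivative_eq_intros)
    moreover have "frechet_derivative F (at y) (s *\<^sub>R b) = dir_deriv b F y * s" for s y
      using linear_frechet_derivative[OF F] by (simp add: linear_cmul dir_deriv_def)
    ultimately show ?thesis
      by (simp add: has_field_derivative_def)
  qed
  obtain z where "0 < z" "z < h"
    "F (x + h *\<^sub>R b) - F (x + 0 *\<^sub>R b) = (h - 0) * dir_deriv b F (x + z *\<^sub>R b)"
    using MVT2[OF \<open>0 < h\<close> D] by blast
  then show ?thesis using that by simp
qed

text \<open>By the mean value theorem each quotient is a value of the derivative at a nearby point,
  which gives both the pointwise limit and the dominating bound. The weight \<open>k\<close> is 1
  for translation invariance, and a scalar function of time when differences are moved onto a test
  function.\<close>

lemma difference_quotient_tendsto:
  fixes F :: "'a::euclidean_space \<Rightarrow> real"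
  assumes F: "\<And>x. F differentiable at x" "continuous_on UNIV (dir_deriv b F)"
    and R: "\<And>x. x \<notin> cball 0 R \<Longrightarrow> F x = 0" and b: "norm b = 1"
    and [measurable]: "k \<in> borel_measurable borel" and k: "\<And>x. \<bar>k x\<bar> \<le> B"
  shows "(\<lambda>n. LINT x|lborel. (F (x + inverse (real (Suc n)) *\<^sub>R b) - F x) * real (Suc n) * k x)
           \<longlonglongrightarrow> (LINT x|lborel. dir_deriv b F x * k x)"
proof -
  have contF: "continuous_on UNIV F"
    using F(1) by (auto simp: continuous_on_eq_continuous_at differentiable_imp_continuous_within)
  have [measurable]: "F \<in> borel_measurable borel" "dir_deriv b F \<in> borel_measurable borel"
    using contF F(2) by (auto intro: borel_measurable_continuous_onI)
  \<comment> \<open>Steps have length at most 1: the quotients vanish outside radius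
    \<open>R + 1\<close>, and the intermediate points belonging to the inside lie within radius
    \<open>R + 2\<close>.\<close>
  obtain C where C: "\<And>x. x \<in> cball 0 (R + 2) \<Longrightarrow> \<bar>dir_deriv b F x\<bar> \<le> C"
    using compact_imp_bounded[OF compact_continuous_image[OF continuous_on_subset[OF F(2)] compact_cball]]
    by (metis bounded_iff image_eqI real_norm_def subset_UNIV)
  let ?h = "\<lambda>n. inverse (real (Suc n))"
  have h: "0 < ?h n" "?h n \<le> 1" for n by (auto simp: field_simps)
  have mv: "\<exists>z. 0 < z \<and> z < ?h n \<and> (F (x + ?h n *\<^sub>R b) - F x) * real (Suc n) = dir_deriv b F (x + z *\<^sub>R b)" for n and x :: 'a
  proof -
    obtain z where "0 < z" "z < ?h n" "F (x + ?h n *\<^sub>R b) - F x = ?h n * dir_deriv b F (x + z *\<^sub>R b)"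
      using directional_mean_value[OF F(1) h(1)] .
    then show ?thesis by (intro exI[of _ z]) (simp del: of_nat_Suc)
  qed
  show ?thesis
  proof (rule integral_dominated_convergence)
    have "integrable lborel (indicator (cball 0 (R + 1)) :: 'a \<Rightarrow> real)"
      using emeasure_bounded_finite[OF bounded_cball] by (intro integrable_real_indicator) auto
    then show "integrable lborel (\<lambda>x::'a. \<bar>C\<bar> * B * indicator (cball 0 (R + 1)) x)"
      by simp
    show "AE x in lborel. (\<lambda>n. (F (x + ?h n *\<^sub>R b) - F x) * real (Suc n) * k x) \<longlonglongrightarrow> dir_deriv b F x * k x"
    proof (intro AE_I2 tendsto_mult tendsto_const)
      fix x
      obtain z where z: "\<And>n. 0 < z n" "\<And>n. z n < ?h n"
        "\<And>n. (F (x + ?h n *\<^sub>R b) - F x) * real (Suc n) = dir_deriv b F (x + z n *\<^sub>R b)"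
        using mv[of _ x] by metis
      have "z \<longlonglongrightarrow> 0"
        by (rule tendsto_sandwich[OF _ _ tendsto_const LIMSEQ_inverse_real_of_nat])
           (use z in \<open>auto intro!: always_eventually less_imp_le\<close>)
      then have "(\<lambda>n. x + z n *\<^sub>R b) \<longlonglongrightarrow> x + 0 *\<^sub>R b" by (intro tendsto_intros)
      then have "(\<lambda>n. dir_deriv b F (x + z n *\<^sub>R b)) \<longlonglongrightarrow> dir_deriv b F x"
        by (intro continuous_on_tendsto_compose[OF F(2)]) auto
      then show "(\<lambda>n. (F (x + ?h n *\<^sub>R b) - F x) * real (Suc n)) \<longlonglongrightarrow> dir_deriv b F x"
        unfolding z(3) .
    qed
    show "AE x in lborel. norm ((F (x + ?h n *\<^sub>R b) - F x) * real (Suc n) * k x)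
        \<le> \<bar>C\<bar> * B * indicator (cball 0 (R + 1)) x" for n
    proof (rule AE_I2)
      fix x :: 'a
      show "norm ((F (x + ?h n *\<^sub>R b) - F x) * real (Suc n) * k x) \<le> \<bar>C\<bar> * B * indicator (cball 0 (R + 1)) x"
      proof (cases "x \<in> cball 0 (R + 1)")
        case True
        obtain z where z: "0 < z" "z < ?h n" "(F (x + ?h n *\<^sub>R b) - F x) * real (Suc n) = dir_deriv b F (x + z *\<^sub>R b)"
          using mv by blast
        have "norm (z *\<^sub>R b) \<le> 1" using z h[of n] b by simp
        then have "\<bar>dir_deriv b F (x + z *\<^sub>R b)\<bar> \<le> C"
          using True norm_triangle_ineq[of x "z *\<^sub>R b"] by (intro C) simp
        then have "\<bar>dir_deriv b F (x + z *\<^sub>R b)\<bar> * \<bar>k x\<bar> \<le> \<bar>C\<bar> * B"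
          by (intro mult_mono k) auto
        then show ?thesis using True unfolding z(3) by (simp add: abs_mult)
      next
        case False
        have "norm (?h n *\<^sub>R b) \<le> 1" using h[of n] b by simp
        then have "x + ?h n *\<^sub>R b \<notin> cball 0 R"
          using False norm_diff_ineq[of x "?h n *\<^sub>R b"] by auto
        then show ?thesis using False R[of x] R[of "x + ?h n *\<^sub>R b"] by simp
      qed
    qed
  qed measurable
qed

text \<open>Translation invariance makes the integral of every difference quotient vanish, and this
  survives in the limit.\<close>

lemma integral_dir_deriv_eq_0:
  fixes F :: "'a::euclidean_space \<Rightarrow> real"
  assumes F: "\<And>x. F differentiable at x" "continuous_on UNIV (dir_deriv b F)"
    and R: "\<And>x. x \<notin> cball 0 R \<Longrightarrow> F x = 0" and b: "norm b = 1"
  shows "(LINT x|lborel. dir_deriv b F x) = 0"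
proof -
  have contF: "continuous_on UNIV F"
    using F(1) by (auto simp: continuous_on_eq_continuous_at differentiable_imp_continuous_within)
  have intF: "integrable lborel F"
  proof -
    have "integrable lborel (\<lambda>x. indicator (cball 0 R) x *\<^sub>R F x)"
      using contF by (intro borel_integrable_compact) (auto intro: continuous_on_subset)
    moreover have "indicator (cball 0 R) x *\<^sub>R F x = F x" for x
      using R[of x] by (cases "x \<in> cball 0 R") simp_all
    ultimately show ?thesis by (simp only:)
  qed
  have "(LINT x|lborel. (F (x + inverse (real (Suc n)) *\<^sub>R b) - F x) * real (Suc n) * 1) = 0" for n
  proof -
    let ?c = "inverse (real (Suc n)) *\<^sub>R b"
    have [measurable]: "F \<in> borel_measurable borel"
      using contF by (rule borel_measurable_continuous_onI)
    have "integrable (distr lborel borel (\<lambda>x. ?c + x)) F"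
      using intF by (simp only: lborel_distr_plus)
    then have "integrable lborel (\<lambda>x. F (x + ?c))"
      by (subst (asm) integrable_distr_eq) (auto simp: add.commute)
    moreover have "(LINT x|lborel. F (x + ?c)) = (LINT x|lborel. F x)"
    proof -
      have "(LINT x|lborel. F x) = (LINT x|distr lborel borel (\<lambda>x. ?c + x). F x)"
        by (simp only: lborel_distr_plus)
      also have "\<dots> = (LINT x|lborel. F (?c + x))" by (rule integral_distr) measurable
      finally show ?thesis by (simp only: add.commute)
    qed
    ultimately show ?thesis using intF by simp
  qed
  then have "(\<lambda>n. 0) \<longlonglongrightarrow> (LINT x|lborel. dir_deriv b F x * 1)"
    using difference_quotient_tendsto[OF F R b, where k = "\<lambda>_. 1" and B = 1] by simp
  then show ?thesis by (simp add: LIMSEQ_const_iff)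
qed

section \<open>Semi-inner products on carriers\<close>

text \<open>Definiteness cannot be expected for representatives. The locale is instantiated by the
  products of L^2(G) and of the Sobolev space, by their integrals over time, and by the elliptic
  form at a fixed time.\<close>

locale semi_inner =
  fixes S :: "'f::real_vector set" and B :: "'f \<Rightarrow> 'f \<Rightarrow> real"
  assumes S: "subspace S"
    and add_left: "x \<in> S \<Longrightarrow> y \<in> S \<Longrightarrow> z \<in> S \<Longrightarrow> B (x + y) z = B x z + B y z"
    and scale_left: "x \<in> S \<Longrightarrow> z \<in> S \<Longrightarrow> B (r *\<^sub>R x) z = r * B x z"
    and commute: "x \<in> S \<Longrightarrow> y \<in> S \<Longrightarrow> B x y = B y x"
    and nonneg: "x \<in> S \<Longrightarrow> 0 \<le> B x x"
begin

lemma mem [simp, intro]: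
  "0 \<in> S" "x \<in> S \<Longrightarrow> y \<in> S \<Longrightarrow> x + y \<in> S" "x \<in> S \<Longrightarrow> y \<in> S \<Longrightarrow> x - y \<in> S"
  "x \<in> S \<Longrightarrow> r *\<^sub>R x \<in> S" "x \<in> S \<Longrightarrow> - x \<in> S"
  using S by (auto simp: subspace_0 subspace_add subspace_diff subspace_scale subspace_neg)

lemma add_right: "x \<in> S \<Longrightarrow> y \<in> S \<Longrightarrow> z \<in> S \<Longrightarrow> B z (x + y) = B z x + B z y"
  by (simp add: commute[of z] add_left)

lemma scale_right: "x \<in> S \<Longrightarrow> z \<in> S \<Longrightarrow> B z (r *\<^sub>R x) = r * B z x"
  by (simp add: commute[of z] scale_left)

lemma minus_left: "x \<in> S \<Longrightarrow> z \<in> S \<Longrightarrow> B (- x) z = - B x z"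
  using scale_left[of x z "-1"] by simp

lemma minus_right: "x \<in> S \<Longrightarrow> z \<in> S \<Longrightarrow> B z (- x) = - B z x"
  using scale_right[of x z "-1"] by simp

lemma diff_left: "x \<in> S \<Longrightarrow> y \<in> S \<Longrightarrow> z \<in> S \<Longrightarrow> B (x - y) z = B x z - B y z"
  using add_left[of x "- y" z] by (simp add: minus_left)

lemma diff_right: "x \<in> S \<Longrightarrow> y \<in> S \<Longrightarrow> z \<in> S \<Longrightarrow> B z (x - y) = B z x - B z y"
  using add_right[of x "- y" z] by (simp add: minus_right)

lemma zero_left: "z \<in> S \<Longrightarrow> B 0 z = 0"
  using scale_left[of 0 z 0] by simp

lemma zero_right: "z \<in> S \<Longrightarrow> B z 0 = 0"
  by (simp add: commute[of z] zero_left)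

lemmas bilinear_simps = add_left add_right scale_left scale_right minus_left minus_right
  diff_left diff_right zero_left zero_right

lemma Cauchy_Schwarz_square: "x \<in> S \<Longrightarrow> y \<in> S \<Longrightarrow> (B x y)\<^sup>2 \<le> B x x * B y y"
proof -
  assume xy: "x \<in> S" "y \<in> S"
  have quad: "0 \<le> B x x + 2 * r * B x y + r\<^sup>2 * B y y" for r
    using nonneg[of "x + r *\<^sub>R y"] xy commute[of y x]
    by (simp add: bilinear_simps power2_eq_square algebra_simps)
  show ?thesis
  proof (cases "B y y = 0")
    case True
    have "B x y = 0"
    proof (rule ccontr)
      assume "B x y \<noteq> 0"
      \<comment> \<open>With \<open>B y y = 0\<close> the quadratic is affine in \<open>r\<close>,
        and this \<open>r\<close> gives it the value -1.\<close>
      then show False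
        using quad[of "- (B x x + 1) / (2 * B x y)"] True by (simp add: field_simps)
    qed
    then show ?thesis by (simp add: True)
  next
    case False
    then have pos: "0 < B y y" using nonneg[OF xy(2)] by simp
    show ?thesis
      using quad[of "- B x y / B y y"] pos by (simp add: field_simps power2_eq_square)
  qed
qed

definition nrm :: "'f \<Rightarrow> real" where
  "nrm x = sqrt (B x x)"

lemma nrm_nonneg: "x \<in> S \<Longrightarrow> 0 \<le> nrm x"
  by (simp add: nrm_def nonneg)

lemma nrm_square: "x \<in> S \<Longrightarrow> (nrm x)\<^sup>2 = B x x"
  by (simp add: nrm_def nonneg)

lemma Cauchy_Schwarz: "x \<in> S \<Longrightarrow> y \<in> S \<Longrightarrow> \<bar>B x y\<bar> \<le> nrm x * nrm y"
  using Cauchy_Schwarz_square[of x y]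
  by (intro power2_le_imp_le[of "\<bar>B x y\<bar>"]) (simp_all add: nrm_nonneg power_mult_distrib nrm_square)

lemma nrm_triangle: "x \<in> S \<Longrightarrow> y \<in> S \<Longrightarrow> nrm (x + y) \<le> nrm x + nrm y"
proof -
  assume xy: "x \<in> S" "y \<in> S"
  have "(nrm (x + y))\<^sup>2 = B x x + 2 * B x y + B y y"
    using xy commute[of y x] by (simp add: nrm_square bilinear_simps)
  also have "\<dots> \<le> (nrm x + nrm y)\<^sup>2"
    using xy Cauchy_Schwarz[OF xy] by (simp add: power2_sum nrm_square)
  finally show ?thesis
    using xy by (intro power2_le_imp_le[of "nrm (x + y)"]) (simp_all add: nrm_nonneg)
qed

lemma nrm_scale: "x \<in> S \<Longrightarrow> nrm (r *\<^sub>R x) = \<bar>r\<bar> * nrm x"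
  by (simp add: nrm_def bilinear_simps real_sqrt_mult mult.assoc[symmetric])

lemma parallelogram:
  "x \<in> S \<Longrightarrow> y \<in> S \<Longrightarrow> B (x + y) (x + y) + B (x - y) (x - y) = 2 * B x x + 2 * B y y"
  by (simp add: bilinear_simps)

end

text \<open>The limit is that of convex combinations of almost minimal norm: by the parallelogram law
  they form a Cauchy sequence, which replaces weak compactness.\<close>
lemma (in semi_inner) weak_limit_exists:
  assumes complete: "\<And>f. \<lbrakk>\<And>n. f n \<in> S; \<And>e. 0 < e \<Longrightarrow> \<exists>N. \<forall>m\<ge>N. \<forall>n\<ge>N. nrm (f m - f n) < e\<rbrakk>
      \<Longrightarrow> \<exists>l\<in>S. (\<lambda>n. nrm (f n - l)) \<longlonglongrightarrow> 0"
    and D: "\<And>n. D n \<in> S" "\<And>n. nrm (D n) \<le> K"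
  shows "\<exists>g\<in>S. \<forall>\<Lambda> c C. (\<forall>x\<in>S. \<forall>y\<in>S. \<Lambda> (x + y) = \<Lambda> x + \<Lambda> y) \<longrightarrow> (\<forall>r. \<forall>x\<in>S. \<Lambda> (r *\<^sub>R x) = r * \<Lambda> x) \<longrightarrow>
      (\<forall>x\<in>S. \<bar>\<Lambda> x\<bar> \<le> C * nrm x) \<longrightarrow> (\<lambda>n. \<Lambda> (D n)) \<longlonglongrightarrow> c \<longrightarrow> \<Lambda> g = (c :: real)"
proof -
  \<comment> \<open>Tails instead of the whole sequence: a functional that converges along
    \<open>D\<close> is nearly constant on late tails only.\<close>
  define H where "H n = convex hull (D ` {n..})" for n :: nat
  have convS: "convex S" using S by (rule subspace_imp_convex)
  have HS: "H n \<subseteq> S" for n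
    unfolding H_def using D(1) convS by (intro hull_minimal) auto
  have H_ne: "D n \<in> H n" for n unfolding H_def by (rule hull_inc) auto
  then have H_ne': "H n \<noteq> {}" for n by blast
  have H_anti: "H m \<subseteq> H n" if "n \<le> m" for m n
    unfolding H_def using that by (intro hull_mono) auto
  \<comment> \<open>The distance of the \<open>n\<close>-th hull from the origin. It increases as
    the hulls shrink and is bounded by \<open>K\<close>, so it has a limit.\<close>
  define d where "d n = (INF x\<in>H n. nrm x)" for n
  have bdd: "bdd_below (nrm ` H n)" for n
    using HS nrm_nonneg by (intro bdd_belowI[of _ 0]) auto
  have d_le: "d n \<le> nrm x" if "x \<in> H n" for x n
    unfolding d_def using that bdd by (rule cINF_lower[rotated])
  have d_nonneg: "0 \<le> d n" for n
    unfolding d_def using H_ne' HS nrm_nonneg by (intro cINF_greatest) auto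
  have "d n \<le> d m" if "n \<le> m" for n m
    unfolding d_def using H_ne' H_anti[OF that] bdd by (intro cINF_superset_mono) auto
  then have "incseq d" by (simp add: incseq_def)
  moreover have "d n \<le> K" for n using d_le[OF H_ne] D(2) order_trans by blast
  ultimately obtain d0 where d0: "d \<longlonglongrightarrow> d0" by (metis incseq_convergent)
  have "\<exists>y\<in>H n. nrm y < d n + inverse (real (Suc n))" for n
    using cINF_less_iff[of "H n" nrm "d n + inverse (real (Suc n))"] H_ne' bdd
    by (auto simp: d_def)
  then obtain y where y: "\<And>n. y n \<in> H n" "\<And>n. nrm (y n) < d n + inverse (real (Suc n))" by metis
  have yS: "y n \<in> S" for n using y HS by blast
  \<comment> \<open>An upper bound for the square of \<open>nrm (y n)\<close> with the same limit as
    the squares of \<open>d n\<close>; the Cauchy estimate only sees the gap between the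
    two.\<close>
  define E where "E n = (d n + inverse (real (Suc n)))\<^sup>2" for n
  have E: "B (y n) (y n) \<le> E n" for n
    unfolding E_def nrm_square[OF yS, symmetric]
    using y(2)[of n] nrm_nonneg[OF yS] by (intro power_mono) auto
  have "E \<longlonglongrightarrow> (d0 + 0)\<^sup>2"
    unfolding E_def by (intro tendsto_intros d0 LIMSEQ_inverse_real_of_nat)
  then have "(\<lambda>n. E n - (d n)\<^sup>2) \<longlonglongrightarrow> (d0 + 0)\<^sup>2 - d0\<^sup>2"
    using d0 by (intro tendsto_intros)
  then have E0: "(\<lambda>n. E n - (d n)\<^sup>2) \<longlonglongrightarrow> 0" by simp
  \<comment> \<open>The midpoint of \<open>y m\<close> and \<open>y n\<close> stays in the larger
    hull \<open>H n\<close> and thus has norm at least \<open>d n\<close>; the parallelogram law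
    turns this into a bound for the difference.\<close>
  have close: "(nrm (y m - y n))\<^sup>2 \<le> 2 * \<bar>E m - (d n)\<^sup>2\<bar> + 2 * \<bar>E n - (d n)\<^sup>2\<bar>" if "n \<le> m" for m n
  proof -
    have "(1/2) *\<^sub>R y n + (1/2) *\<^sub>R y m \<in> H n"
      using y(1)[of n] y(1)[of m] H_anti[OF that]
      by (intro convexD) (auto simp: H_def convex_convex_hull)
    moreover have "(1/2) *\<^sub>R y n + (1/2) *\<^sub>R y m = (1/2) *\<^sub>R (y m + y n)"
      by (simp add: scaleR_add_right)
    ultimately have "d n \<le> nrm ((1/2) *\<^sub>R (y m + y n))" using d_le by metis
    then have "(d n)\<^sup>2 \<le> (nrm ((1/2) *\<^sub>R (y m + y n)))\<^sup>2"
      using d_nonneg by (intro power_mono)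
    also have "\<dots> = (1/4) * B (y m + y n) (y m + y n)"
      using yS by (simp add: nrm_scale power_divide nrm_square)
    finally have "4 * (d n)\<^sup>2 \<le> B (y m + y n) (y m + y n)" by simp
    then have "B (y m - y n) (y m - y n) \<le> 2 * E m + 2 * E n - 4 * (d n)\<^sup>2"
      using parallelogram[OF yS yS, of m n] E[of m] E[of n] by linarith
    moreover have "x \<le> 2 * \<bar>e1 - q\<bar> + 2 * \<bar>e2 - q\<bar>" if "x \<le> 2 * e1 + 2 * e2 - 4 * q" for x e1 e2 q :: real
      using that by (auto simp: abs_if)
    ultimately show ?thesis
      unfolding nrm_square[OF mem(3)[OF yS yS]] by blast
  qed
  have Cauchy: "\<exists>N. \<forall>m\<ge>N. \<forall>n\<ge>N. nrm (y m - y n) < e" if "0 < e" for e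
  proof -
    have "(\<lambda>n. E n) \<longlonglongrightarrow> d0\<^sup>2" "(\<lambda>n. (d n)\<^sup>2) \<longlonglongrightarrow> d0\<^sup>2"
      using \<open>E \<longlonglongrightarrow> (d0 + 0)\<^sup>2\<close> d0 by (auto intro: tendsto_intros)
    then have "\<forall>\<^sub>F n in sequentially. \<bar>E n - d0\<^sup>2\<bar> < e\<^sup>2 / 16" "\<forall>\<^sub>F n in sequentially. \<bar>(d n)\<^sup>2 - d0\<^sup>2\<bar> < e\<^sup>2 / 16"
      using that tendstoD[of _ "d0\<^sup>2" sequentially "e\<^sup>2 / 16"]
      unfolding dist_real_def by (simp_all only: zero_less_divide_iff zero_less_power) simp_all
    then have "\<forall>\<^sub>F n in sequentially. \<bar>E n - d0\<^sup>2\<bar> < e\<^sup>2 / 16 \<and> \<bar>(d n)\<^sup>2 - d0\<^sup>2\<bar> < e\<^sup>2 / 16"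
      by (rule eventually_conj)
    then obtain N where N: "\<And>n. n \<ge> N \<Longrightarrow> \<bar>E n - d0\<^sup>2\<bar> < e\<^sup>2 / 16" "\<And>n. n \<ge> N \<Longrightarrow> \<bar>(d n)\<^sup>2 - d0\<^sup>2\<bar> < e\<^sup>2 / 16"
      unfolding eventually_sequentially by blast
    have *: "nrm (y m - y n) < e" if "N \<le> n" "n \<le> m" for m n
    proof -
      have "(nrm (y m - y n))\<^sup>2 < e\<^sup>2"
      proof -
        have tri: "\<bar>a - (d n)\<^sup>2\<bar> < e\<^sup>2 / 8" if "\<bar>a - d0\<^sup>2\<bar> < e\<^sup>2 / 16" for a
          using abs_triangle_ineq4[of "a - d0\<^sup>2" "(d n)\<^sup>2 - d0\<^sup>2"] that N(2)[OF \<open>N \<le> n\<close>] by simp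
        have b: "\<bar>E m - (d n)\<^sup>2\<bar> < e\<^sup>2 / 8" "\<bar>E n - (d n)\<^sup>2\<bar> < e\<^sup>2 / 8"
          using that N(1) by (intro tri, simp)+
        have fin: "p < s" if "a < s / 8" "b < s / 8" "p \<le> 2 * a + 2 * b" "0 < s" for a b p s :: real
          using that by linarith
        show ?thesis
          by (rule fin[OF b close[OF that(2)] zero_less_power[OF \<open>0 < e\<close>]])
      qed
      then show ?thesis by (rule power2_less_imp_less) (use \<open>0 < e\<close> in simp)
    qed
    have sym: "nrm (y m - y n) = nrm (y n - y m)" for m n
      using nrm_scale[of "y n - y m" "-1"] yS by simp
    show ?thesis
    proof (intro exI allI impI)
      fix m n assume "N \<le> m" "N \<le> n"
      then show "nrm (y m - y n) < e"
        using *[of n m] *[of m n] sym[of m n] by (cases "n \<le> m") auto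
    qed
  qed
  obtain g where g: "g \<in> S" "(\<lambda>n. nrm (y n - g)) \<longlonglongrightarrow> 0"
    using complete[of y, OF yS Cauchy] by blast
  have "\<Lambda> g = c" if add: "\<forall>x\<in>S. \<forall>y\<in>S. \<Lambda> (x + y) = \<Lambda> x + \<Lambda> y"
    and scale: "\<forall>r. \<forall>x\<in>S. \<Lambda> (r *\<^sub>R x) = r * \<Lambda> x" and bound: "\<forall>x\<in>S. \<bar>\<Lambda> x\<bar> \<le> C * nrm x"
    and lim: "(\<lambda>n. \<Lambda> (D n)) \<longlonglongrightarrow> c" for \<Lambda> C and c :: real
  proof -
    have "(\<lambda>n. \<Lambda> (y n)) \<longlonglongrightarrow> c"
    proof (rule LIMSEQ_I)
      fix e :: real assume "0 < e"
      then obtain N where N: "\<And>n. n \<ge> N \<Longrightarrow> \<bar>\<Lambda> (D n) - c\<bar> < e"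
        using LIMSEQ_D[OF lim] by (metis real_norm_def)
      have "\<bar>\<Lambda> (y n) - c\<bar> < e" if "n \<ge> N" for n
      proof -
        \<comment> \<open>The set where the functional is within \<open>e\<close> of
          \<open>c\<close> is convex and contains the tail of \<open>D\<close>, hence also its hull,
          in which \<open>y n\<close> lies.\<close>
        have "H n \<subseteq> {x \<in> S. \<bar>\<Lambda> x - c\<bar> < e}"
          unfolding H_def
        proof (rule hull_minimal)
          show "convex {x \<in> S. \<bar>\<Lambda> x - c\<bar> < e}"
          proof (rule convexI)
            fix x z and a b :: real
            assume *: "x \<in> {x \<in> S. \<bar>\<Lambda> x - c\<bar> < e}" "z \<in> {x \<in> S. \<bar>\<Lambda> x - c\<bar> < e}" "0 \<le> a" "0 \<le> b" "a + b = 1"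
            then have eq: "\<Lambda> (a *\<^sub>R x + b *\<^sub>R z) = a * \<Lambda> x + b * \<Lambda> z"
              using add scale by simp
            have "{c - e<..<c + e} = {w. \<bar>w - c\<bar> < e}" by auto
            then have "convex {w. \<bar>w - c\<bar> < e}" by (metis convex_real_interval(8))
            then have "a *\<^sub>R \<Lambda> x + b *\<^sub>R \<Lambda> z \<in> {w. \<bar>w - c\<bar> < e}"
              using * by (intro convexD) auto
            then show "a *\<^sub>R x + b *\<^sub>R z \<in> {x \<in> S. \<bar>\<Lambda> x - c\<bar> < e}"
              using * eq by auto
          qed
        qed (use N that D(1) in auto)
        then show ?thesis using y(1) by blast
      qed
      then show "\<exists>N. \<forall>n\<ge>N. norm (\<Lambda> (y n) - c) < e" by auto
    qed
    moreover have "(\<lambda>n. \<Lambda> (y n) - \<Lambda> g) \<longlonglongrightarrow> 0"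
    proof (rule tendsto_rabs_zero_cancel, rule tendsto_sandwich[OF _ _ tendsto_const])
      have "\<Lambda> (y n) - \<Lambda> g = \<Lambda> (y n - g)" for n
        using add[rule_format, of "y n - g" g] yS g by simp
      then show "\<forall>\<^sub>F n in sequentially. \<bar>\<Lambda> (y n) - \<Lambda> g\<bar> \<le> C * nrm (y n - g)"
        using bound yS g by auto
      show "(\<lambda>n. C * nrm (y n - g)) \<longlonglongrightarrow> 0"
        using tendsto_mult[OF tendsto_const g(2)] by simp
    qed auto
    then have "(\<lambda>n. \<Lambda> (y n)) \<longlonglongrightarrow> \<Lambda> g" by (simp add: LIM_zero_iff)
    ultimately show ?thesis by (rule LIMSEQ_unique[symmetric])
  qed
  then show ?thesis using g(1) by blast
qed

section \<open>Bochner integrals in seminormed carriers\<close>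

lemma null_squeeze:
  fixes a b :: "nat \<Rightarrow> real"
  assumes "\<And>n. a n \<le> b n" "\<And>n. 0 \<le> a n" "b \<longlonglongrightarrow> 0"
  shows "a \<longlonglongrightarrow> 0"
  by (rule tendsto_sandwich[OF _ _ tendsto_const assms(3)]) (simp_all add: assms)

text \<open>Completeness makes every function measurable that is a.e. equal to a measurable one.
  Since limits and representatives are fixed only up to null sets, no measurable version has to be
  chosen.\<close>

locale finite_complete_measure = finite_measure M + complete_measure M for M :: "'a measure"
begin

lemma measurable_AE_eq:
  assumes f: "f \<in> borel_measurable M" and fg: "AE t in M. f t = g t"
  shows "g \<in> borel_measurable M"
proof (rule measurableI)
  fix A :: "'b set" assume "A \<in> sets borel"
  then have f': "f -` A \<inter> space M \<in> sets M" by (rule measurable_sets[OF f])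
  have "AE t in M. t \<in> f -` A \<inter> space M \<longleftrightarrow> t \<in> g -` A \<inter> space M"
    using fg by eventually_elim simp
  then show "g -` A \<inter> space M \<in> sets M"
    by (rule in_sets_AE[OF _ f']) simp
qed simp

lemma measurable_AE_LIMSEQ:
  fixes f :: "nat \<Rightarrow> 'a \<Rightarrow> real"
  assumes f: "\<And>n. f n \<in> borel_measurable M" and lim: "AE t in M. (\<lambda>n. f n t) \<longlonglongrightarrow> g t"
  shows "g \<in> borel_measurable M"
proof (rule measurable_AE_eq)
  show "(\<lambda>t. lim (\<lambda>n. f n t)) \<in> borel_measurable M" using f by measurable
  show "AE t in M. lim (\<lambda>n. f n t) = g t" using lim by eventually_elim (rule limI)
qed

lemma AE_null_set:
  assumes "AE t in M. P t"
  obtains N where "N \<in> null_sets M" "\<And>t. t \<in> space M \<Longrightarrow> t \<notin> N \<Longrightarrow> P t"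
  using assms unfolding AE_iff_null_sets by (metis (mono_tags, lifting) mem_Collect_eq)

text \<open>The inequality x <= 2^(-n) + 2^n x^2 turns the L^2 bounds 4^(-n) into summable L^1
  bounds of order 2^(-n), so the sum is integrable and therefore finite a.e. This is the fast
  subsequence argument behind Riesz-Fischer.\<close>

lemma AE_summable:
  fixes r :: "nat \<Rightarrow> 'a \<Rightarrow> real"
  assumes r [measurable]: "\<And>n. r n \<in> borel_measurable M" and r0: "\<And>n. AE t in M. 0 \<le> r n t"
    and int: "\<And>n. integrable M (\<lambda>t. (r n t)\<^sup>2)" "\<And>n. (LINT t|M. (r n t)\<^sup>2) \<le> (1/4) ^ n"
  shows "AE t in M. summable (\<lambda>n. r n t)"
proof -
  let ?c = "measure M (space M) + 1"
  have le: "x \<le> (1/2) ^ n + 2 ^ n * x\<^sup>2" if "0 \<le> x" for x :: real and n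
  proof (cases "x \<le> (1/2) ^ n")
    case False
    then have "1 \<le> 2 ^ n * x" by (simp add: power_one_over field_simps)
    then have "x * 1 \<le> x * (2 ^ n * x)" using that by (intro mult_left_mono)
    then show ?thesis by (simp add: power2_eq_square mult_ac add_increasing)
  qed (simp add: add_increasing2)
  have nn: "(\<integral>\<^sup>+t. ennreal (r n t) \<partial>M) \<le> ennreal ((1/2) ^ n * ?c)" for n
  proof -
    have "(\<integral>\<^sup>+t. ennreal (r n t) \<partial>M) \<le> (\<integral>\<^sup>+t. ennreal ((1/2) ^ n + 2 ^ n * (r n t)\<^sup>2) \<partial>M)"
    proof (rule nn_integral_mono_AE)
      show "AE t in M. ennreal (r n t) \<le> ennreal ((1/2) ^ n + 2 ^ n * (r n t)\<^sup>2)"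
        using r0[of n] by eventually_elim (rule ennreal_leI[OF le])
    qed
    also have "\<dots> = ennreal (LINT t|M. (1/2) ^ n + 2 ^ n * (r n t)\<^sup>2)"
      using int(1)[of n] by (intro nn_integral_eq_integral) auto
    also have "(LINT t|M. (1/2) ^ n + 2 ^ n * (r n t)\<^sup>2) = (1/2) ^ n * measure M (space M) + 2 ^ n * (LINT t|M. (r n t)\<^sup>2)"
      using int(1)[of n] by simp
    also have "\<dots> \<le> (1/2) ^ n * measure M (space M) + 2 ^ n * (1/4) ^ n"
      using int(2)[of n] by (intro add_left_mono mult_left_mono) auto
    also have "\<dots> = (1/2) ^ n * ?c"
      by (simp add: power_mult_distrib[symmetric] algebra_simps)
    finally show ?thesis by (simp add: ennreal_leI)
  qed
  have "(\<integral>\<^sup>+t. (\<Sum>n. ennreal (r n t)) \<partial>M) = (\<Sum>n. \<integral>\<^sup>+t. ennreal (r n t) \<partial>M)"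
    by (rule nn_integral_suminf) measurable
  also have "\<dots> \<le> (\<Sum>n. ennreal ((1/2) ^ n * ?c))"
    using nn by (intro suminf_le) auto
  also have "\<dots> < \<infinity>"
  proof -
    have "summable (\<lambda>n. (1/2) ^ n * ?c :: real)"
      by (intro summable_mult2 summable_geometric) simp
    then show ?thesis by (subst suminf_ennreal2) (auto simp: less_top)
  qed
  finally have "AE t in M. (\<Sum>n. ennreal (r n t)) \<noteq> \<infinity>"
    by (intro nn_integral_PInf_AE) auto
  moreover have "AE t in M. \<forall>n. 0 \<le> r n t" using r0 by (simp add: AE_all_countable)
  ultimately show ?thesis
    by eventually_elim (auto intro!: summable_suminf_not_top)
qed

end

lemma finite_complete_measure_lebesgue_on:
  assumes "S \<in> lmeasurable" shows "finite_complete_measure (lebesgue_on S)"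
proof -
  interpret finite_measure "lebesgue_on S" using assms by (rule finite_measure_lebesgue_on)
  have S: "S \<in> sets lebesgue" using assms by auto
  show ?thesis
  proof
    fix A B assume "B \<subseteq> A" "A \<in> null_sets (lebesgue_on S)"
    then have A: "A \<subseteq> S" "A \<in> null_sets lebesgue" using null_sets_restrict_space[OF S] by blast+
    have "B \<in> sets lebesgue"
      by (rule null_setsD2[OF completion.complete2[OF \<open>B \<subseteq> A\<close> A(2)]])
    moreover have "B \<subseteq> S" using \<open>B \<subseteq> A\<close> A(1) by blast
    ultimately show "B \<in> sets (lebesgue_on S)"
      using S by (subst sets_restrict_space_iff) simp_all
  qed
qed

section \<open>Seminormed carriers\<close>

locale seminormed =
  fixes X :: "'f::real_vector space_rec"
  assumes carr: "subspace (carr X)"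
    and snorm_nonneg: "x \<in> carr X \<Longrightarrow> 0 \<le> snorm X x"
    and snorm_triangle: "x \<in> carr X \<Longrightarrow> y \<in> carr X \<Longrightarrow> snorm X (x + y) \<le> snorm X x + snorm X y"
    and snorm_scale: "x \<in> carr X \<Longrightarrow> snorm X (r *\<^sub>R x) = \<bar>r\<bar> * snorm X x"
begin

lemma mem [simp, intro]:
  "0 \<in> carr X" "x \<in> carr X \<Longrightarrow> y \<in> carr X \<Longrightarrow> x + y \<in> carr X"
  "x \<in> carr X \<Longrightarrow> y \<in> carr X \<Longrightarrow> x - y \<in> carr X"
  "x \<in> carr X \<Longrightarrow> r *\<^sub>R x \<in> carr X" "x \<in> carr X \<Longrightarrow> - x \<in> carr X"
  using carr by (auto simp: subspace_0 subspace_add subspace_diff subspace_scale subspace_neg)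

lemma snorm_0 [simp]: "snorm X 0 = 0"
  using snorm_scale[of 0 0] by simp

lemma snorm_minus: "x \<in> carr X \<Longrightarrow> snorm X (- x) = snorm X x"
  using snorm_scale[of x "-1"] by simp

lemma snorm_minus_commute: "x \<in> carr X \<Longrightarrow> y \<in> carr X \<Longrightarrow> snorm X (x - y) = snorm X (y - x)"
  using snorm_minus[of "x - y"] by simp

lemma snorm_triangle_diff:
  "x \<in> carr X \<Longrightarrow> y \<in> carr X \<Longrightarrow> z \<in> carr X \<Longrightarrow> snorm X (x - z) \<le> snorm X (x - y) + snorm X (y - z)"
  using snorm_triangle[of "x - y" "y - z"] by simp

lemma snorm_triangle_minus: "x \<in> carr X \<Longrightarrow> y \<in> carr X \<Longrightarrow> snorm X (x - y) \<le> snorm X x + snorm X y"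
  using snorm_triangle[of x "- y"] by (simp add: snorm_minus)

lemma snorm_reverse_triangle:
  "x \<in> carr X \<Longrightarrow> y \<in> carr X \<Longrightarrow> \<bar>snorm X x - snorm X y\<bar> \<le> snorm X (x - y)"
  using snorm_triangle[of "x - y" y] snorm_triangle[of "y - x" x] snorm_minus_commute[of x y]
  by simp

lemma snorm_tendsto:
  assumes "\<And>n. s n \<in> carr X" "x \<in> carr X" "(\<lambda>n. snorm X (s n - x)) \<longlonglongrightarrow> 0"
  shows "(\<lambda>n. snorm X (s n)) \<longlonglongrightarrow> snorm X x"
proof (rule LIM_zero_cancel, rule tendsto_rabs_zero_cancel, rule tendsto_sandwich[OF _ _ tendsto_const assms(3)])
  show "\<forall>\<^sub>F n in sequentially. \<bar>snorm X (s n) - snorm X x\<bar> \<le> snorm X (s n - x)"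
    using assms(1,2) snorm_reverse_triangle by simp
qed simp

lemma snorm_sum: "finite A \<Longrightarrow> (\<And>i. i \<in> A \<Longrightarrow> f i \<in> carr X) \<Longrightarrow>
    (\<Sum>i\<in>A. f i) \<in> carr X \<and> snorm X (\<Sum>i\<in>A. f i) \<le> (\<Sum>i\<in>A. snorm X (f i))"
proof (induction A rule: finite_induct)
  case (insert a A)
  then show ?case using snorm_triangle[of "f a" "sum f A"] by auto
qed simp

end

locale complete_seminormed = seminormed +
  assumes complete: "\<lbrakk>\<And>n. f n \<in> carr X; \<And>e. 0 < e \<Longrightarrow> \<exists>N. \<forall>m\<ge>N. \<forall>n\<ge>N. snorm X (f m - f n) < e\<rbrakk>
      \<Longrightarrow> \<exists>l\<in>carr X. (\<lambda>n. snorm X (f n - l)) \<longlonglongrightarrow> 0"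

text \<open>The measure is left open so that one theory covers the Bochner spaces in time and, with
  Euclidean values over \<open>G\<close>, the space L^2(G).\<close>

definition L2set :: "'a measure \<Rightarrow> 'f::real_vector space_rec \<Rightarrow> ('a \<Rightarrow> 'f) set" where
  "L2set M X = {f. strongly_measurable_in M X f \<and> integrable M (\<lambda>t. (snorm X (f t))\<^sup>2)}"

lemma time_L2_eq: "time_L2 T X = L2set (lebesgue_on {0<..<T}) X"
  by (simp add: time_L2_def L2set_def)

section \<open>Strong measurability and square integrability\<close>

locale bochner_space = finite_complete_measure M + seminormed X
  for M :: "'a measure" and X :: "'f::real_vector space_rec"
begin

lemma simple_bochner_integrable_iff: "Bochner_Integration.simple_bochner_integrable M s \<longleftrightarrow> simple_function M s"
  by (simp add: simple_bochner_integrable.simps emeasure_finite)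

lemma simple_snorm: "simple_function M s \<Longrightarrow> (\<lambda>t. snorm X (s t)) \<in> borel_measurable M"
  by (rule borel_measurable_simple_function[OF simple_function_compose1[where g = "snorm X"]])

lemma strongly_measurable_snorm:
  assumes "strongly_measurable_in M X f"
  shows "(\<lambda>t. snorm X (f t)) \<in> borel_measurable M"
proof -
  obtain s where s: "\<And>n. simple_function M (s n)" "\<And>n. s n ` space M \<subseteq> carr X"
    "AE t in M. (\<lambda>n. snorm X (s n t - f t)) \<longlonglongrightarrow> 0"
    using assms by (auto simp: strongly_measurable_in_def)
  have "AE t in M. f t \<in> carr X" using assms by (auto simp: strongly_measurable_in_def)
  then have "AE t in M. (\<lambda>n. snorm X (s n t)) \<longlonglongrightarrow> snorm X (f t)"
    using s(3) AE_space
  proof eventually_elim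
    case (elim t)
    then show ?case using s(2) by (intro snorm_tendsto) blast+
  qed
  then show ?thesis
    by (rule measurable_AE_LIMSEQ[OF simple_snorm[OF s(1)]])
qed

text \<open>On the exceptional null set the values are reset to 0, so membership and convergence
  hold everywhere; this later makes measurability on pairs of times manageable. The truncation
  supplies the domination that dominated convergence needs.\<close>

lemma strongly_measurable_approx:
  assumes "strongly_measurable_in M X f"
  obtains f' s where "\<And>t. f' t \<in> carr X" "AE t in M. f' t = f t" "\<And>n. simple_function M (s n)"
    "\<And>n t. s n t \<in> carr X" "\<And>t. t \<in> space M \<Longrightarrow> (\<lambda>n. snorm X (s n t - f' t)) \<longlonglongrightarrow> 0"
    "\<And>n t. t \<in> space M \<Longrightarrow> snorm X (s n t) \<le> 2 * snorm X (f' t)"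
    "(\<lambda>t. snorm X (f' t)) \<in> borel_measurable M"
proof -
  obtain s0 where s0: "\<And>n. simple_function M (s0 n)" "\<And>n. s0 n ` space M \<subseteq> carr X"
    "AE t in M. (\<lambda>n. snorm X (s0 n t - f t)) \<longlonglongrightarrow> 0"
    using assms by (auto simp: strongly_measurable_in_def)
  have "AE t in M. f t \<in> carr X" using assms by (auto simp: strongly_measurable_in_def)
  then have "AE t in M. f t \<in> carr X \<and> (\<lambda>n. snorm X (s0 n t - f t)) \<longlonglongrightarrow> 0"
    using s0(3) by eventually_elim simp
  then obtain N where N: "N \<in> null_sets M"
    "\<And>t. t \<in> space M \<Longrightarrow> t \<notin> N \<Longrightarrow> f t \<in> carr X \<and> (\<lambda>n. snorm X (s0 n t - f t)) \<longlonglongrightarrow> 0"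
    using AE_null_set by blast
  define f' where "f' t = (if t \<in> space M - N then f t else 0)" for t
  define r where "r n t = (if t \<in> space M - N then s0 n t else 0)" for n t
  \<comment> \<open>The factor 2 leaves room: where the limit has positive seminorm the
    approximations are eventually kept, and where it has seminorm 0 only elements of seminorm 0
    survive.\<close>
  define s where "s n t = (if snorm X (r n t) \<le> 2 * snorm X (f' t) then r n t else 0)" for n t
  have f': "f' t \<in> carr X" for t using N(2) by (simp add: f'_def)
  have r: "r n t \<in> carr X" for n t using s0(2) by (auto simp: r_def)
  have ae: "AE t in M. f' t = f t"
    using AE_not_in[OF N(1)] AE_space by eventually_elim (simp add: f'_def)
  have m: "(\<lambda>t. snorm X (f' t)) \<in> borel_measurable M"
    by (rule measurable_AE_eq[OF strongly_measurable_snorm[OF assms]]) (use ae in \<open>eventually_elim, simp\<close>)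
  have r_simple: "simple_function M (r n)" for n
    unfolding r_def using N(1) s0(1)
    by (intro simple_function_If_set) (auto intro: sets.Diff)
  have lim: "(\<lambda>n. snorm X (r n t - f' t)) \<longlonglongrightarrow> 0" if "t \<in> space M" for t
    using N(2)[of t] that by (cases "t \<in> N") (auto simp: r_def f'_def)
  show ?thesis
  proof (rule that[OF f' ae])
    show "simple_function M (s n)" for n
      unfolding s_def using r_simple simple_snorm[OF r_simple] m
      by (intro simple_function_If) measurable
    show "s n t \<in> carr X" for n t using r by (auto simp: s_def)
    show "(\<lambda>n. snorm X (s n t - f' t)) \<longlonglongrightarrow> 0" if t: "t \<in> space M" for t
    proof (cases "snorm X (f' t) = 0")
      case True
      have "snorm X (s n t - f' t) = 0" for n
      proof -
        have "snorm X (s n t) = 0"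
          using True r[of n t] snorm_nonneg[of "r n t"] by (auto simp: s_def)
        then show ?thesis
          using snorm_triangle_minus[of "s n t" "f' t"] True f' r[of n t]
            snorm_nonneg[of "s n t - f' t"] by (auto simp: s_def split: if_splits)
      qed
      then show ?thesis by simp
    next
      case False
      then have "snorm X (f' t) < 2 * snorm X (f' t)" using snorm_nonneg[OF f'[of t]] by simp
      moreover have "(\<lambda>n. snorm X (r n t)) \<longlonglongrightarrow> snorm X (f' t)"
        using r f' lim[OF t] by (intro snorm_tendsto)
      ultimately have "\<forall>\<^sub>F n in sequentially. snorm X (r n t) < 2 * snorm X (f' t)"
        by (metis order_tendstoD(2))
      then have "\<forall>\<^sub>F n in sequentially. snorm X (r n t - f' t) = snorm X (s n t - f' t)"
        by eventually_elim (simp add: s_def)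
      then show ?thesis using lim[OF t] by (rule Lim_transform_eventually[rotated])
    qed
    show "snorm X (s n t) \<le> 2 * snorm X (f' t)" for n t
      using snorm_nonneg[OF f'[of t]] by (simp add: s_def)
  qed (use m in auto)
qed

lemma strongly_measurable_add:
  assumes "strongly_measurable_in M X f" "strongly_measurable_in M X g"
  shows "strongly_measurable_in M X (\<lambda>t. f t + g t)"
proof -
  obtain s where s: "\<forall>n. simple_function M (s n) \<and> s n ` space M \<subseteq> carr X"
    "AE t in M. (\<lambda>n. snorm X (s n t - f t)) \<longlonglongrightarrow> 0"
    using assms(1) unfolding strongly_measurable_in_def by blast
  obtain r where r: "\<forall>n. simple_function M (r n) \<and> r n ` space M \<subseteq> carr X"
    "AE t in M. (\<lambda>n. snorm X (r n t - g t)) \<longlonglongrightarrow> 0"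
    using assms(2) unfolding strongly_measurable_in_def by blast
  have c: "AE t in M. f t \<in> carr X" "AE t in M. g t \<in> carr X"
    using assms by (auto simp: strongly_measurable_in_def)
  have "AE t in M. (\<lambda>n. snorm X ((s n t + r n t) - (f t + g t))) \<longlonglongrightarrow> 0"
    using s(2) r(2) c AE_space
  proof eventually_elim
    case (elim t)
    have mem_t: "s n t \<in> carr X" "r n t \<in> carr X" for n
      using s(1) r(1) elim(5) by blast+
    have "snorm X ((s n t + r n t) - (f t + g t)) \<le> snorm X (s n t - f t) + snorm X (r n t - g t)" for n
    proof -
      have "(s n t + r n t) - (f t + g t) = (s n t - f t) + (r n t - g t)" by simp
      then show ?thesis
        using snorm_triangle[of "s n t - f t" "r n t - g t"] mem_t[of n] elim(3,4) by (simp only: mem)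
    qed
    moreover have "0 \<le> snorm X ((s n t + r n t) - (f t + g t))" for n
      using elim(3,4) mem_t[of n] by (intro snorm_nonneg mem)
    moreover have "(\<lambda>n. snorm X (s n t - f t) + snorm X (r n t - g t)) \<longlonglongrightarrow> 0"
      using tendsto_add[OF elim(1,2)] by simp
    ultimately show ?case by (rule null_squeeze)
  qed
  moreover have "AE t in M. f t + g t \<in> carr X" using c by eventually_elim simp
  ultimately show ?thesis
    unfolding strongly_measurable_in_def
    using s(1) r(1)
    by (intro conjI exI[of _ "\<lambda>n t. s n t + r n t"]) (auto simp: image_subset_iff simple_function_compose2[where h = "(+)"])
qed

text \<open>Measurable real functions are uniform limits of simple ones only if bounded, hence the
  pointwise approximation of the factor.\<close>
lemma strongly_measurable_mult:
  fixes \<phi> :: "'a \<Rightarrow> real"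
  assumes "strongly_measurable_in M X f" and \<phi>: "\<phi> \<in> borel_measurable M"
  shows "strongly_measurable_in M X (\<lambda>t. \<phi> t *\<^sub>R f t)"
proof -
  obtain s where s: "\<And>n. simple_function M (s n)" "\<And>n. s n ` space M \<subseteq> carr X"
    "AE t in M. (\<lambda>n. snorm X (s n t - f t)) \<longlonglongrightarrow> 0"
    using assms by (auto simp: strongly_measurable_in_def)
  have c: "AE t in M. f t \<in> carr X" using assms by (auto simp: strongly_measurable_in_def)
  obtain p where p: "\<And>n. simple_function M (p n)" "\<And>t. t \<in> space M \<Longrightarrow> (\<lambda>n. p n t) \<longlonglongrightarrow> \<phi> t"
    using borel_measurable_implies_sequence_metric[OF \<phi>, of 0] by blast
  have "AE t in M. (\<lambda>n. snorm X (p n t *\<^sub>R s n t - \<phi> t *\<^sub>R f t)) \<longlonglongrightarrow> 0"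
    using s(3) c AE_space
  proof eventually_elim
    case (elim t)
    have st: "s n t \<in> carr X" for n using s(2)[of n] elim by auto
    have "snorm X (p n t *\<^sub>R s n t - \<phi> t *\<^sub>R f t)
        \<le> \<bar>p n t\<bar> * snorm X (s n t - f t) + \<bar>p n t - \<phi> t\<bar> * snorm X (f t)" for n
    proof -
      have "p n t *\<^sub>R s n t - \<phi> t *\<^sub>R f t = p n t *\<^sub>R (s n t - f t) + (p n t - \<phi> t) *\<^sub>R f t"
        by (simp add: algebra_simps)
      then show ?thesis
        using snorm_triangle[of "p n t *\<^sub>R (s n t - f t)" "(p n t - \<phi> t) *\<^sub>R f t"] st[of n] elim(2)
        by (simp only: snorm_scale mem)
    qed
    moreover have "0 \<le> snorm X (p n t *\<^sub>R s n t - \<phi> t *\<^sub>R f t)" for n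
      using st[of n] elim(2) by (intro snorm_nonneg mem)
    moreover have "(\<lambda>n. \<bar>p n t\<bar> * snorm X (s n t - f t) + \<bar>p n t - \<phi> t\<bar> * snorm X (f t)) \<longlonglongrightarrow>
        \<bar>\<phi> t\<bar> * 0 + \<bar>\<phi> t - \<phi> t\<bar> * snorm X (f t)"
      by (intro tendsto_add tendsto_mult tendsto_rabs tendsto_diff tendsto_const p(2)[OF elim(3)] elim(1))
    then have "(\<lambda>n. \<bar>p n t\<bar> * snorm X (s n t - f t) + \<bar>p n t - \<phi> t\<bar> * snorm X (f t)) \<longlonglongrightarrow> 0"
      by simp
    ultimately show ?case by (rule null_squeeze)
  qed
  moreover have "AE t in M. \<phi> t *\<^sub>R f t \<in> carr X" using c by eventually_elim simp
  ultimately show ?thesis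
    unfolding strongly_measurable_in_def
    using s(1,2) p(1) by (intro conjI exI[of _ "\<lambda>n t. p n t *\<^sub>R s n t"])
      (auto simp: image_subset_iff simple_function_compose2[where h = "(*\<^sub>R)"])
qed

lemma strongly_measurable_const: "x \<in> carr X \<Longrightarrow> strongly_measurable_in M X (\<lambda>t. x)"
  unfolding strongly_measurable_in_def by (intro conjI exI[of _ "\<lambda>n t. x"]) auto

lemma strongly_measurable_scale:
  "strongly_measurable_in M X f \<Longrightarrow> strongly_measurable_in M X (\<lambda>t. r *\<^sub>R f t)"
  by (rule strongly_measurable_mult) auto

lemma strongly_measurable_diff:
  assumes "strongly_measurable_in M X f" "strongly_measurable_in M X g"
  shows "strongly_measurable_in M X (\<lambda>t. f t - g t)"
  using strongly_measurable_add[OF assms(1) strongly_measurable_scale[OF assms(2), of "-1"]] by simp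

lemma strongly_measurable_carr: "strongly_measurable_in M X f \<Longrightarrow> AE t in M. f t \<in> carr X"
  by (simp add: strongly_measurable_in_def)

lemma L2set_add:
  assumes "f \<in> L2set M X" "g \<in> L2set M X"
  shows "(\<lambda>t. f t + g t) \<in> L2set M X"
proof -
  have sm: "strongly_measurable_in M X (\<lambda>t. f t + g t)"
    using assms strongly_measurable_add by (auto simp: L2set_def)
  have c: "AE t in M. f t \<in> carr X" "AE t in M. g t \<in> carr X"
    using assms strongly_measurable_carr by (auto simp: L2set_def)
  have "integrable M (\<lambda>t. (snorm X (f t + g t))\<^sup>2)"
  proof (rule Bochner_Integration.integrable_bound)
    show "integrable M (\<lambda>t. 2 * (snorm X (f t))\<^sup>2 + 2 * (snorm X (g t))\<^sup>2)"
      using assms by (auto simp: L2set_def)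
    show "AE t in M. norm ((snorm X (f t + g t))\<^sup>2) \<le> norm (2 * (snorm X (f t))\<^sup>2 + 2 * (snorm X (g t))\<^sup>2)"
      using c
    proof eventually_elim
      case (elim t)
      have "(snorm X (f t + g t))\<^sup>2 \<le> (snorm X (f t) + snorm X (g t))\<^sup>2"
        using elim by (intro power_mono snorm_triangle snorm_nonneg) auto
      also have "\<dots> \<le> 2 * (snorm X (f t))\<^sup>2 + 2 * (snorm X (g t))\<^sup>2"
        using zero_le_power2[of "snorm X (f t) - snorm X (g t)"]
        by (simp add: power2_sum power2_diff)
      finally show ?case by simp
    qed
  qed (use strongly_measurable_snorm[OF sm] in measurable)
  then show ?thesis using sm by (simp add: L2set_def)
qed

lemma L2set_mult:
  fixes \<phi> :: "'a \<Rightarrow> real"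
  assumes f: "f \<in> L2set M X" and \<phi>: "\<phi> \<in> borel_measurable M" "\<And>t. t \<in> space M \<Longrightarrow> \<bar>\<phi> t\<bar> \<le> C"
  shows "(\<lambda>t. \<phi> t *\<^sub>R f t) \<in> L2set M X"
proof -
  have sm: "strongly_measurable_in M X (\<lambda>t. \<phi> t *\<^sub>R f t)"
    using f \<phi> strongly_measurable_mult by (auto simp: L2set_def)
  have c: "AE t in M. f t \<in> carr X"
    using f strongly_measurable_carr by (auto simp: L2set_def)
  have "integrable M (\<lambda>t. (snorm X (\<phi> t *\<^sub>R f t))\<^sup>2)"
  proof (rule Bochner_Integration.integrable_bound)
    show "integrable M (\<lambda>t. C\<^sup>2 * (snorm X (f t))\<^sup>2)"
      using f by (auto simp: L2set_def)
    show "AE t in M. norm ((snorm X (\<phi> t *\<^sub>R f t))\<^sup>2) \<le> norm (C\<^sup>2 * (snorm X (f t))\<^sup>2)"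
      using c AE_space
    proof eventually_elim
      case (elim t)
      have "(\<bar>\<phi> t\<bar>)\<^sup>2 \<le> C\<^sup>2" using elim \<phi>(2) by (intro power_mono) auto
      then have "(\<phi> t)\<^sup>2 * (snorm X (f t))\<^sup>2 \<le> C\<^sup>2 * (snorm X (f t))\<^sup>2"
        by (intro mult_right_mono) auto
      then show ?case using elim by (simp add: snorm_scale power_mult_distrib)
    qed
  qed (use strongly_measurable_snorm[OF sm] in measurable)
  then show ?thesis using sm by (simp add: L2set_def)
qed

lemma L2set_scale: "f \<in> L2set M X \<Longrightarrow> (\<lambda>t. r *\<^sub>R f t) \<in> L2set M X"
  by (rule L2set_mult[where C = "\<bar>r\<bar>"]) auto

lemma L2set_diff: "f \<in> L2set M X \<Longrightarrow> g \<in> L2set M X \<Longrightarrow> (\<lambda>t. f t - g t) \<in> L2set M X"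
  using L2set_add[OF _ L2set_scale[of g "-1"], of f] by simp

lemma L2set_const: "x \<in> carr X \<Longrightarrow> (\<lambda>t. x) \<in> L2set M X"
  by (simp add: L2set_def strongly_measurable_const)

lemma L2set_subspace: "subspace (L2set M X)"
  unfolding subspace_def
  using L2set_add L2set_scale L2set_const[of 0]
  by (auto simp: plus_fun_def scaleR_fun_def zero_fun_def)

lemma L2set_snorm_integrable: "f \<in> L2set M X \<Longrightarrow> integrable M (\<lambda>t. snorm X (f t))"
  unfolding L2set_def mem_Collect_eq
  by (elim conjE, rule square_integrable_imp_integrable[OF strongly_measurable_snorm])

lemma L2set_AE_eq:
  assumes f: "f \<in> L2set M X" and fg: "AE t in M. f t = g t"
  shows "g \<in> L2set M X"
proof -
  obtain s where s: "\<And>n. simple_function M (s n)" "\<And>n. s n ` space M \<subseteq> carr X"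
    "AE t in M. (\<lambda>n. snorm X (s n t - f t)) \<longlonglongrightarrow> 0"
    using f by (auto simp: L2set_def strongly_measurable_in_def)
  have "AE t in M. f t \<in> carr X" using f by (auto simp: L2set_def strongly_measurable_in_def)
  with fg have "AE t in M. g t \<in> carr X" by eventually_elim simp
  moreover have "AE t in M. (\<lambda>n. snorm X (s n t - g t)) \<longlonglongrightarrow> 0"
    using s(3) fg by eventually_elim simp
  ultimately have sm: "strongly_measurable_in M X g"
    unfolding strongly_measurable_in_def using s(1,2) by blast
  have "integrable M (\<lambda>t. (snorm X (f t))\<^sup>2)" using f by (simp add: L2set_def)
  then have "integrable M (\<lambda>t. (snorm X (g t))\<^sup>2)"
  proof (rule integrable_cong_AE_imp)
    show "(\<lambda>t. (snorm X (g t))\<^sup>2) \<in> borel_measurable M"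
      by (intro borel_measurable_power strongly_measurable_snorm sm)
    show "AE t in M. (snorm X (f t))\<^sup>2 = (snorm X (g t))\<^sup>2"
      using fg by eventually_elim simp
  qed
  then show ?thesis using sm by (simp add: L2set_def)
qed

lemma simple_bochner_integral_carr:
  assumes s: "simple_function M s" "\<And>t. t \<in> space M \<Longrightarrow> s t \<in> carr X"
  shows "Bochner_Integration.simple_bochner_integral M s \<in> carr X"
    and "snorm X (Bochner_Integration.simple_bochner_integral M s) \<le> (LINT t|M. snorm X (s t))"
proof -
  have fin: "finite (s ` space M)" using s(1) by (rule simple_functionD)
  have *: "(\<Sum>y\<in>s ` space M. measure M {x \<in> space M. s x = y} *\<^sub>R y) \<in> carr X \<and>
      snorm X (\<Sum>y\<in>s ` space M. measure M {x \<in> space M. s x = y} *\<^sub>R y)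
        \<le> (\<Sum>y\<in>s ` space M. snorm X (measure M {x \<in> space M. s x = y} *\<^sub>R y))"
    using s(2) by (intro snorm_sum[OF fin]) auto
  then show "Bochner_Integration.simple_bochner_integral M s \<in> carr X"
    by (simp add: simple_bochner_integral_def)
  have sn: "simple_function M (\<lambda>t. snorm X (s t))"
    by (rule simple_function_compose1[OF s(1), where g = "snorm X"])
  have "(\<Sum>y\<in>s ` space M. snorm X (measure M {x \<in> space M. s x = y} *\<^sub>R y))
      = (\<Sum>y\<in>s ` space M. measure M {x \<in> space M. s x = y} *\<^sub>R snorm X y)"
    using s(2) by (intro sum.cong) (auto simp: snorm_scale)
  also have "\<dots> = Bochner_Integration.simple_bochner_integral M (\<lambda>t. snorm X (s t))"
    using sn s(1)
    by (intro simple_bochner_integral_partition[symmetric]) (auto simp: simple_bochner_integrable_iff)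
  also have "\<dots> = (LINT t|M. snorm X (s t))"
    using sn by (intro simple_bochner_integrable_eq_integral) (simp add: simple_bochner_integrable.simps emeasure_finite)
  finally show "snorm X (Bochner_Integration.simple_bochner_integral M s) \<le> (LINT t|M. snorm X (s t))"
    using * by (simp add: simple_bochner_integral_def)
qed

text \<open>The truncation in \<open>strongly_measurable_approx\<close> dominates the error by
  \<open>3 * snorm X (f t)\<close> and its square by 9 times the squared seminorm, so both the L^1
  and the L^2 error tend to 0.\<close>

lemma L2set_approx:
  assumes f: "f \<in> L2set M X"
  obtains s where "\<And>n. simple_function M (s n)" "\<And>n t. s n t \<in> carr X"
    "AE t in M. (\<lambda>n. snorm X (s n t - f t)) \<longlonglongrightarrow> 0"
    "\<And>n. s n \<in> L2set M X"
    "(\<lambda>n. LINT t|M. snorm X (s n t - f t)) \<longlonglongrightarrow> 0"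
    "(\<lambda>n. LINT t|M. (snorm X (s n t - f t))\<^sup>2) \<longlonglongrightarrow> 0"
proof -
  have sm: "strongly_measurable_in M X f" and int: "integrable M (\<lambda>t. (snorm X (f t))\<^sup>2)"
    using f by (auto simp: L2set_def)
  obtain f' s where s: "\<And>t. f' t \<in> carr X" "AE t in M. f' t = f t" "\<And>n. simple_function M (s n)"
    "\<And>n t. s n t \<in> carr X" "\<And>t. t \<in> space M \<Longrightarrow> (\<lambda>n. snorm X (s n t - f' t)) \<longlonglongrightarrow> 0"
    "\<And>n t. t \<in> space M \<Longrightarrow> snorm X (s n t) \<le> 2 * snorm X (f' t)"
    "(\<lambda>t. snorm X (f' t)) \<in> borel_measurable M"
    using strongly_measurable_approx[OF sm] by blast
  have sm_s: "strongly_measurable_in M X (s n)" for n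
    unfolding strongly_measurable_in_def
    using s(3,4) by (intro conjI exI[of _ "\<lambda>_. s n"]) auto
  have meas: "(\<lambda>t. snorm X (s n t - f t)) \<in> borel_measurable M" for n
    by (rule strongly_measurable_snorm[OF strongly_measurable_diff[OF sm_s sm]])
  have lim: "AE t in M. (\<lambda>n. snorm X (s n t - f t)) \<longlonglongrightarrow> 0"
    using s(2) AE_space
  proof eventually_elim
    case (elim t)
    then show ?case using s(5)[of t] by simp
  qed
  have le: "AE t in M. snorm X (s n t - f t) \<le> 3 * snorm X (f t) \<and> 0 \<le> snorm X (s n t - f t)" for n
    using s(2) AE_space
  proof eventually_elim
    case (elim t)
    then have "f t \<in> carr X" using s(1)[of t] by simp
    then show ?case
      using snorm_triangle_minus[of "s n t" "f t"] s(4)[of n t] s(6)[of t n] elim snorm_nonneg[of "s n t - f t"] by simp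
  qed
  have s_L2: "s n \<in> L2set M X" for n
  proof -
    have "integrable M (\<lambda>t. (snorm X (s n t))\<^sup>2)"
    proof (rule Bochner_Integration.integrable_bound)
      show "integrable M (\<lambda>t. 4 * (snorm X (f t))\<^sup>2)" using int by simp
      show "(\<lambda>t. (snorm X (s n t))\<^sup>2) \<in> borel_measurable M"
        by (intro borel_measurable_power strongly_measurable_snorm sm_s)
      show "AE t in M. norm ((snorm X (s n t))\<^sup>2) \<le> norm (4 * (snorm X (f t))\<^sup>2)"
        using s(2) AE_space
      proof eventually_elim
        case (elim t)
        then have "(snorm X (s n t))\<^sup>2 \<le> (2 * snorm X (f t))\<^sup>2"
          using s(6)[of t n] by (intro power_mono snorm_nonneg s(4)) simp
        then show ?case by (simp add: power_mult_distrib)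
      qed
    qed
    then show ?thesis using sm_s by (simp add: L2set_def)
  qed
  have "(\<lambda>n. LINT t|M. snorm X (s n t - f t)) \<longlonglongrightarrow> (LINT t|M. 0)"
  proof (rule integral_dominated_convergence)
    show "integrable M (\<lambda>t. 3 * snorm X (f t))" using L2set_snorm_integrable[OF f] by simp
    show "AE t in M. norm (snorm X (s n t - f t)) \<le> 3 * snorm X (f t)" for n
      using le[of n] by eventually_elim simp
  qed (use meas lim in simp_all)
  moreover have "(\<lambda>n. LINT t|M. (snorm X (s n t - f t))\<^sup>2) \<longlonglongrightarrow> (LINT t|M. 0)"
  proof (rule integral_dominated_convergence)
    show "integrable M (\<lambda>t. 9 * (snorm X (f t))\<^sup>2)" using int by simp
    show "AE t in M. norm ((snorm X (s n t - f t))\<^sup>2) \<le> 9 * (snorm X (f t))\<^sup>2" for n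
      using le[of n]
    proof eventually_elim
      case (elim t)
      then have "(snorm X (s n t - f t))\<^sup>2 \<le> (3 * snorm X (f t))\<^sup>2" by (intro power_mono) auto
      then show ?case by (simp add: power_mult_distrib)
    qed
    show "AE t in M. (\<lambda>n. (snorm X (s n t - f t))\<^sup>2) \<longlonglongrightarrow> 0"
      using lim
    proof eventually_elim
      case (elim t)
      then show ?case using tendsto_power[OF elim, of 2] by simp
    qed
    show "(\<lambda>t. (snorm X (s n t - f t))\<^sup>2) \<in> borel_measurable M" for n
      by (intro borel_measurable_power meas)
  qed simp
  ultimately show ?thesis
    using that[OF s(3,4) lim s_L2] by simp
qed

lemma L2set_carr: "f \<in> L2set M X \<Longrightarrow> AE t in M. f t \<in> carr X"
  by (simp add: L2set_def strongly_measurable_in_def)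

lemma functional_tendsto:
  assumes add: "\<And>x y. x \<in> carr X \<Longrightarrow> y \<in> carr X \<Longrightarrow> \<Lambda> (x + y) = \<Lambda> x + \<Lambda> y"
    and scale: "\<And>r x. x \<in> carr X \<Longrightarrow> \<Lambda> (r *\<^sub>R x) = r * \<Lambda> x"
    and bound: "\<And>x. x \<in> carr X \<Longrightarrow> \<bar>\<Lambda> x\<bar> \<le> C * snorm X x"
    and x: "\<And>n. x n \<in> carr X" "y \<in> carr X" "(\<lambda>n. snorm X (x n - y)) \<longlonglongrightarrow> 0"
  shows "(\<lambda>n. \<Lambda> (x n)) \<longlonglongrightarrow> (\<Lambda> y :: real)"
proof (rule LIM_zero_cancel, rule tendsto_rabs_zero_cancel, rule null_squeeze)
  show "\<bar>\<Lambda> (x n) - \<Lambda> y\<bar> \<le> C * snorm X (x n - y)" for n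
    using bound[of "x n - y"] add[of "x n" "- y"] scale[of y "-1"] x by simp
  show "(\<lambda>n. C * snorm X (x n - y)) \<longlonglongrightarrow> 0" using tendsto_mult[OF tendsto_const x(3)] by simp
qed simp

lemma strongly_measurable_functional:
  assumes sm: "strongly_measurable_in M X f"
    and add: "\<And>x y. x \<in> carr X \<Longrightarrow> y \<in> carr X \<Longrightarrow> \<Lambda> (x + y) = \<Lambda> x + \<Lambda> y"
    and scale: "\<And>r x. x \<in> carr X \<Longrightarrow> \<Lambda> (r *\<^sub>R x) = r * \<Lambda> x"
    and bound: "\<And>x. x \<in> carr X \<Longrightarrow> \<bar>\<Lambda> x\<bar> \<le> C * snorm X x"
  shows "(\<lambda>t. \<Lambda> (f t) :: real) \<in> borel_measurable M"
proof -
  obtain r where r: "\<forall>n. simple_function M (r n) \<and> r n ` space M \<subseteq> carr X"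
    "AE t in M. (\<lambda>n. snorm X (r n t - f t)) \<longlonglongrightarrow> 0"
    using sm unfolding strongly_measurable_in_def by blast
  have "AE t in M. (\<lambda>n. \<Lambda> (r n t)) \<longlonglongrightarrow> \<Lambda> (f t)"
    using r(2) strongly_measurable_carr[OF sm] AE_space
  proof eventually_elim
    case (elim t)
    then have rt: "r n t \<in> carr X" for n using r(1) by blast
    show ?case by (rule functional_tendsto[OF add scale bound rt elim(2,1)])
  qed
  moreover have "(\<lambda>t. \<Lambda> (r n t)) \<in> borel_measurable M" for n
    using r(1) by (intro borel_measurable_simple_function simple_function_compose1[where g = \<Lambda>]) blast
  ultimately show ?thesis by (rule measurable_AE_LIMSEQ[rotated])
qed

text \<open>The functional maps simple approximations to simple real functions, and its bound
  controls the L^1 error, so the scalar integral is reached along the same sequence. This is the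
  device that turns identities between vector-valued integrals into scalar ones.\<close>

lemma has_bochner_integral_in_functional:
  assumes I: "has_bochner_integral_in M X f I"
    and add: "\<And>x y. x \<in> carr X \<Longrightarrow> y \<in> carr X \<Longrightarrow> \<Lambda> (x + y) = \<Lambda> x + \<Lambda> y"
    and scale: "\<And>r x. x \<in> carr X \<Longrightarrow> \<Lambda> (r *\<^sub>R x) = r * \<Lambda> x"
    and bound: "\<And>x. x \<in> carr X \<Longrightarrow> \<bar>\<Lambda> x\<bar> \<le> C * snorm X x"
  shows "has_bochner_integral M (\<lambda>t. \<Lambda> (f t)) (\<Lambda> I :: real)"
proof -
  have diff: "\<Lambda> (x - y) = \<Lambda> x - \<Lambda> y" if "x \<in> carr X" "y \<in> carr X" for x y
    using add[OF that(1), of "- y"] scale[OF that(2), of "-1"] that by simp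
  have sum: "\<Lambda> (\<Sum>i\<in>A. c i *\<^sub>R i) = (\<Sum>i\<in>A. c i * \<Lambda> i)" if "finite A" "A \<subseteq> carr X" for A c
    using that
  proof (induction A rule: finite_induct)
    case empty
    show ?case using scale[of 0 0] by simp
  next
    case (insert a A)
    then have "(\<Sum>i\<in>A. c i *\<^sub>R i) \<in> carr X" by (intro snorm_sum[THEN conjunct1]) auto
    then show ?case using insert by (simp add: add scale)
  qed
  have sm: "strongly_measurable_in M X f" and "I \<in> carr X"
    using I by (auto simp: has_bochner_integral_in_def)
  obtain s where s: "\<forall>n. Bochner_Integration.simple_bochner_integrable M (s n) \<and> s n ` space M \<subseteq> carr X"
    "(\<lambda>n. \<integral>\<^sup>+t. ennreal (snorm X (s n t - f t)) \<partial>M) \<longlonglongrightarrow> 0"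
    "(\<lambda>n. snorm X (Bochner_Integration.simple_bochner_integral M (s n) - I)) \<longlonglongrightarrow> 0"
    using I unfolding has_bochner_integral_in_def by blast
  have s_simple: "simple_function M (s n)" for n using s(1) by (simp add: simple_bochner_integrable_iff)
  have s_carr: "s n t \<in> carr X" if "t \<in> space M" for n t using s(1) that by blast
  have sL: "simple_function M (\<lambda>t. \<Lambda> (s n t))" for n
    by (rule simple_function_compose1[OF s_simple, where g = \<Lambda>])
  have carr_AE: "AE t in M. f t \<in> carr X" by (rule strongly_measurable_carr[OF sm])
  have "(\<lambda>t. \<Lambda> (f t)) \<in> borel_measurable M"
    by (rule strongly_measurable_functional[OF sm add scale bound])
  moreover have "Bochner_Integration.simple_bochner_integrable M (\<lambda>t. \<Lambda> (s n t))" for n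
    using sL by (simp add: simple_bochner_integrable.simps emeasure_finite)
  moreover have "(\<lambda>n. \<integral>\<^sup>+t. norm (\<Lambda> (f t) - \<Lambda> (s n t)) \<partial>M) \<longlonglongrightarrow> 0"
  proof (rule tendsto_sandwich[OF _ _ tendsto_const])
    show "\<forall>\<^sub>F n in sequentially. (\<integral>\<^sup>+t. norm (\<Lambda> (f t) - \<Lambda> (s n t)) \<partial>M)
        \<le> ennreal \<bar>C\<bar> * (\<integral>\<^sup>+t. ennreal (snorm X (s n t - f t)) \<partial>M)"
    proof (intro always_eventually allI)
      fix n
      have "AE t in M. ennreal (norm (\<Lambda> (f t) - \<Lambda> (s n t))) \<le> ennreal \<bar>C\<bar> * ennreal (snorm X (s n t - f t))"
        using carr_AE AE_space
      proof eventually_elim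
        case (elim t)
        note st = s_carr[OF elim(2), of n]
        have "\<bar>\<Lambda> (s n t - f t)\<bar> \<le> C * snorm X (s n t - f t)"
          using st elim by (intro bound) simp
        also have "\<dots> \<le> \<bar>C\<bar> * snorm X (s n t - f t)"
          using st elim by (intro mult_right_mono snorm_nonneg) auto
        finally have "norm (\<Lambda> (f t) - \<Lambda> (s n t)) \<le> \<bar>C\<bar> * snorm X (s n t - f t)"
          using diff[OF st elim(1)] by simp
        then show ?case by (simp add: ennreal_leI flip: ennreal_mult')
      qed
      then have "(\<integral>\<^sup>+t. norm (\<Lambda> (f t) - \<Lambda> (s n t)) \<partial>M)
          \<le> (\<integral>\<^sup>+t. ennreal \<bar>C\<bar> * ennreal (snorm X (s n t - f t)) \<partial>M)"
        by (rule nn_integral_mono_AE)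
      also have "\<dots> = ennreal \<bar>C\<bar> * (\<integral>\<^sup>+t. ennreal (snorm X (s n t - f t)) \<partial>M)"
      proof (rule nn_integral_cmult)
        have "strongly_measurable_in M X (s n)"
          unfolding strongly_measurable_in_def
          using s_simple s_carr by (intro conjI exI[of _ "\<lambda>_. s n"] AE_I2) auto
        then show "(\<lambda>t. ennreal (snorm X (s n t - f t))) \<in> borel_measurable M"
          by (intro measurable_compose[OF _ measurable_ennreal] strongly_measurable_snorm strongly_measurable_diff sm)
      qed
      finally show "(\<integral>\<^sup>+t. norm (\<Lambda> (f t) - \<Lambda> (s n t)) \<partial>M)
        \<le> ennreal \<bar>C\<bar> * (\<integral>\<^sup>+t. ennreal (snorm X (s n t - f t)) \<partial>M)" .
    qed
    show "(\<lambda>n. ennreal \<bar>C\<bar> * (\<integral>\<^sup>+t. ennreal (snorm X (s n t - f t)) \<partial>M)) \<longlonglongrightarrow> 0"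
      using ennreal_tendsto_cmult[OF _ s(2), of "ennreal \<bar>C\<bar>"] by simp
  qed simp
  moreover have "(\<lambda>n. Bochner_Integration.simple_bochner_integral M (\<lambda>t. \<Lambda> (s n t))) \<longlonglongrightarrow> \<Lambda> I"
  proof -
    have "Bochner_Integration.simple_bochner_integral M (\<lambda>t. \<Lambda> (s n t)) =
        \<Lambda> (Bochner_Integration.simple_bochner_integral M (s n))" for n
    proof -
      have "Bochner_Integration.simple_bochner_integral M (\<lambda>t. \<Lambda> (s n t)) =
          (\<Sum>y\<in>s n ` space M. measure M {x \<in> space M. s n x = y} *\<^sub>R \<Lambda> y)"
        using sL s_simple
        by (intro simple_bochner_integral_partition) (auto simp: simple_bochner_integrable.simps emeasure_finite)
      also have "\<dots> = \<Lambda> (Bochner_Integration.simple_bochner_integral M (s n))"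
        using sum[of "s n ` space M" "\<lambda>y. measure M {x \<in> space M. s n x = y}"] simple_functionD(1)[OF s_simple[of n]] s(1)
        by (simp add: simple_bochner_integral_def)
      finally show ?thesis .
    qed
    moreover have "(\<lambda>n. \<Lambda> (Bochner_Integration.simple_bochner_integral M (s n))) \<longlonglongrightarrow> \<Lambda> I"
      by (rule functional_tendsto[OF add scale bound simple_bochner_integral_carr(1)[OF s_simple s_carr] \<open>I \<in> carr X\<close> s(3)])
    ultimately show ?thesis by simp
  qed
  ultimately show ?thesis by (intro has_bochner_integral.intros) auto
qed

text \<open>Integrals in a seminormed carrier are unique only up to seminorm zero; this permits a
  prescribed representative of the value.\<close>

lemma has_bochner_integral_in_cong:
  assumes I: "has_bochner_integral_in M X f I" and J: "J \<in> carr X" "snorm X (I - J) = 0"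
  shows "has_bochner_integral_in M X f J"
proof -
  have "strongly_measurable_in M X f" and IX: "I \<in> carr X"
    using I by (auto simp: has_bochner_integral_in_def)
  obtain s where s: "\<forall>n. Bochner_Integration.simple_bochner_integrable M (s n) \<and> s n ` space M \<subseteq> carr X"
    "(\<lambda>n. \<integral>\<^sup>+t. ennreal (snorm X (s n t - f t)) \<partial>M) \<longlonglongrightarrow> 0"
    "(\<lambda>n. snorm X (Bochner_Integration.simple_bochner_integral M (s n) - I)) \<longlonglongrightarrow> 0"
    using I unfolding has_bochner_integral_in_def by blast
  have sc: "Bochner_Integration.simple_bochner_integral M (s n) \<in> carr X" for n
    using s(1) by (intro simple_bochner_integral_carr(1)) (auto simp: simple_bochner_integrable_iff)
  have "(\<lambda>n. snorm X (Bochner_Integration.simple_bochner_integral M (s n) - J)) \<longlonglongrightarrow> 0"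
  proof (rule null_squeeze[OF _ _ s(3)])
    show "snorm X (Bochner_Integration.simple_bochner_integral M (s n) - J)
        \<le> snorm X (Bochner_Integration.simple_bochner_integral M (s n) - I)" for n
      using snorm_triangle_diff[OF sc IX J(1), of n] J(2) by simp
    show "0 \<le> snorm X (Bochner_Integration.simple_bochner_integral M (s n) - J)" for n
      using sc J(1) by (intro snorm_nonneg) simp
  qed
  then show ?thesis
    unfolding has_bochner_integral_in_def using \<open>strongly_measurable_in M X f\<close> J(1) s(1,2) by blast
qed

end

section \<open>Existence of integrals and completeness\<close>

locale complete_bochner_space = finite_complete_measure M + complete_seminormed X
  for M :: "'a measure" and X :: "'f::real_vector space_rec"
begin

sublocale bochner_space M X ..

text \<open>The integrals of the simple approximations form a Cauchy sequence, because the distance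
  of two of them is at most the sum of the two L^1 errors. Completeness of \<open>X\<close> supplies
  the value.\<close>

lemma has_bochner_integral_in_exists:
  assumes f: "f \<in> L2set M X"
  shows "\<exists>I. has_bochner_integral_in M X f I"
proof -
  obtain s where s: "\<And>n. simple_function M (s n)" "\<And>n t. s n t \<in> carr X"
    "AE t in M. (\<lambda>n. snorm X (s n t - f t)) \<longlonglongrightarrow> 0" "\<And>n. s n \<in> L2set M X"
    "(\<lambda>n. LINT t|M. snorm X (s n t - f t)) \<longlonglongrightarrow> 0"
    "(\<lambda>n. LINT t|M. (snorm X (s n t - f t))\<^sup>2) \<longlonglongrightarrow> 0"
    using L2set_approx[OF f] by blast
  define J where "J n = Bochner_Integration.simple_bochner_integral M (s n)" for n
  have J: "J n \<in> carr X" for n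
    unfolding J_def using s(1,2) by (intro simple_bochner_integral_carr(1))
  have int: "integrable M (\<lambda>t. snorm X (s n t - f t))" for n
    by (rule L2set_snorm_integrable[OF L2set_diff[OF s(4) f]])
  have carr: "AE t in M. f t \<in> carr X" using f by (rule L2set_carr)
  have J_diff: "snorm X (J m - J n) \<le> (LINT t|M. snorm X (s m t - f t)) + (LINT t|M. snorm X (s n t - f t))" for m n
  proof -
    have "J m - J n = Bochner_Integration.simple_bochner_integral M (\<lambda>t. s m t - s n t)"
      unfolding J_def using s(1)
      by (intro simple_bochner_integral_diff[symmetric]) (simp_all add: simple_bochner_integrable_iff)
    moreover have "simple_function M (\<lambda>t. s m t - s n t)"
      by (rule simple_function_compose2[OF s(1) s(1), where h = "(-)"])
    ultimately have "snorm X (J m - J n) \<le> (LINT t|M. snorm X (s m t - s n t))"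
      using simple_bochner_integral_carr(2)[of "\<lambda>t. s m t - s n t"] s(2) by simp
    also have "\<dots> \<le> (LINT t|M. snorm X (s m t - f t) + snorm X (s n t - f t))"
    proof (rule integral_mono_AE)
      show "integrable M (\<lambda>t. snorm X (s m t - s n t))"
        by (rule L2set_snorm_integrable[OF L2set_diff[OF s(4) s(4)]])
      show "AE t in M. snorm X (s m t - s n t) \<le> snorm X (s m t - f t) + snorm X (s n t - f t)"
        using carr
      proof eventually_elim
        case (elim t)
        then show ?case
          using snorm_triangle_diff[OF s(2)[of m t] elim s(2)[of n t]] snorm_minus_commute[OF elim s(2)[of n t]] by simp
      qed
    qed (use int in auto)
    also have "\<dots> = (LINT t|M. snorm X (s m t - f t)) + (LINT t|M. snorm X (s n t - f t))"
      using int by simp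
    finally show ?thesis .
  qed
  have "\<exists>N. \<forall>m\<ge>N. \<forall>n\<ge>N. snorm X (J m - J n) < e" if "0 < e" for e
  proof -
    have "\<forall>\<^sub>F n in sequentially. (LINT t|M. snorm X (s n t - f t)) < e / 2"
      using order_tendstoD(2)[OF s(5), of "e / 2"] that by simp
    then obtain N where N: "\<And>n. n \<ge> N \<Longrightarrow> (LINT t|M. snorm X (s n t - f t)) < e / 2"
      unfolding eventually_sequentially by blast
    have "snorm X (J m - J n) < e" if "m \<ge> N" "n \<ge> N" for m n
      using J_diff[of m n] N[OF that(1)] N[OF that(2)] by linarith
    then show ?thesis by blast
  qed
  then obtain I where I: "I \<in> carr X" "(\<lambda>n. snorm X (J n - I)) \<longlonglongrightarrow> 0"
    using complete[of J, OF J] by blast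
  have "(\<lambda>n. \<integral>\<^sup>+t. ennreal (snorm X (s n t - f t)) \<partial>M) \<longlonglongrightarrow> 0"
  proof -
    have "(\<integral>\<^sup>+t. ennreal (snorm X (s n t - f t)) \<partial>M) = ennreal (LINT t|M. snorm X (s n t - f t))" for n
    proof (rule nn_integral_eq_integral[OF int])
      show "AE t in M. 0 \<le> snorm X (s n t - f t)"
        using carr by eventually_elim (simp add: snorm_nonneg s(2))
    qed
    then show ?thesis using tendsto_ennrealI[OF s(5)] by simp
  qed
  moreover have "strongly_measurable_in M X f" using f by (simp add: L2set_def)
  moreover have "\<forall>n. Bochner_Integration.simple_bochner_integrable M (s n) \<and> s n ` space M \<subseteq> carr X"
    using s(1,2) by (auto simp: simple_bochner_integrable_iff)
  ultimately have "has_bochner_integral_in M X f I"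
    unfolding has_bochner_integral_in_def using I unfolding J_def by blast
  then show ?thesis ..
qed

text \<open>Riesz-Fischer for carriers: a fast subsequence converges a.e. in \<open>X\<close>, and
  Fatou's lemma transfers the Cauchy bounds to the limit. Strong measurability of the limit is a
  separate task, solved by simple functions that follow the subsequence so closely that they
  converge a.e. to the same limit.\<close>

lemma L2set_complete:
  assumes f: "\<And>n. f n \<in> L2set M X"
    and Cauchy: "\<And>e. 0 < e \<Longrightarrow> \<exists>N. \<forall>m\<ge>N. \<forall>n\<ge>N. (LINT t|M. (snorm X (f m t - f n t))\<^sup>2) < e"
  shows "\<exists>g\<in>L2set M X. (\<forall>t. g t \<in> carr X) \<and> (\<lambda>n. LINT t|M. (snorm X (f n t - g t))\<^sup>2) \<longlonglongrightarrow> 0"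
proof -
  have "\<exists>N. \<forall>m\<ge>N. \<forall>n\<ge>N. (LINT t|M. (snorm X (f m t - f n t))\<^sup>2) < (1/4) ^ k" for k
    by (rule Cauchy) simp
  then obtain N where N: "\<And>k m n. m \<ge> N k \<Longrightarrow> n \<ge> N k \<Longrightarrow>
      (LINT t|M. (snorm X (f m t - f n t))\<^sup>2) < (1/4) ^ k"
    by metis
  \<comment> \<open>A partial sum dominates \<open>N i\<close> for each earlier \<open>i\<close>,
    which is the only property of the subsequence that matters.\<close>
  define p where "p k = (\<Sum>i\<le>k. N i)" for k :: nat
  have p: "N k \<le> p m" if "k \<le> m" for k m
    unfolding p_def using that by (intro member_le_sum) auto
  have carr: "AE t in M. \<forall>n. f n t \<in> carr X"
    unfolding AE_all_countable using L2set_carr[OF f] by blast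
  have L2_nonneg: "AE t in M. 0 \<le> snorm X (h t)" if "h \<in> L2set M X" for h
    using L2set_carr[OF that] by eventually_elim (rule snorm_nonneg)
  have L2_meas: "(\<lambda>t. snorm X (h t)) \<in> borel_measurable M" "integrable M (\<lambda>t. (snorm X (h t))\<^sup>2)"
    if "h \<in> L2set M X" for h
    using that strongly_measurable_snorm by (auto simp: L2set_def)
  have "AE t in M. summable (\<lambda>k. snorm X (f (p (Suc k)) t - f (p k) t))"
  proof (rule AE_summable)
    fix k
    note d = L2set_diff[OF f f, of "p (Suc k)" "p k"]
    show "(\<lambda>t. snorm X (f (p (Suc k)) t - f (p k) t)) \<in> borel_measurable M"
      "integrable M (\<lambda>t. (snorm X (f (p (Suc k)) t - f (p k) t))\<^sup>2)"
      "AE t in M. 0 \<le> snorm X (f (p (Suc k)) t - f (p k) t)"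
      using L2_meas[OF d] L2_nonneg[OF d] by auto
    show "(LINT t|M. (snorm X (f (p (Suc k)) t - f (p k) t))\<^sup>2) \<le> (1/4) ^ k"
      using N[of k "p (Suc k)" "p k"] p[of k k] p[of k "Suc k"] by simp
  qed
  then have limit: "AE t in M. \<exists>l\<in>carr X. (\<lambda>k. snorm X (f (p k) t - l)) \<longlonglongrightarrow> 0"
    using carr
  proof eventually_elim
    case (elim t)
    let ?r = "\<lambda>k. snorm X (f (p (Suc k)) t - f (p k) t)"
    have ft: "f n t \<in> carr X" for n using elim by blast
    have le: "snorm X (f (p (n + j)) t - f (p n) t) \<le> sum ?r {n..<n + j}" for n j
    proof (induction j)
      case (Suc j)
      show ?case
        using Suc snorm_triangle_diff[OF ft[of "p (n + Suc j)"] ft[of "p (n + j)"] ft[of "p n"]] by simp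
    qed simp
    show ?case
    proof (rule complete)
      fix e :: real assume "0 < e"
      then obtain K where K: "\<And>m n. m \<ge> K \<Longrightarrow> norm (sum ?r {m..<n}) < e"
        using elim(1) unfolding summable_Cauchy by blast
      have *: "snorm X (f (p m) t - f (p n) t) < e" if "K \<le> n" "n \<le> m" for m n
      proof -
        have "snorm X (f (p m) t - f (p n) t) \<le> sum ?r {n..<m}" using le[of n "m - n"] that by simp
        also have "\<dots> < e" using K[OF that(1), of m] by simp
        finally show ?thesis .
      qed
      show "\<exists>N. \<forall>m\<ge>N. \<forall>n\<ge>N. snorm X (f (p m) t - f (p n) t) < e"
      proof (intro exI allI impI)
        fix m n assume "K \<le> m" "K \<le> n"
        then show "snorm X (f (p m) t - f (p n) t) < e"
          using *[of n m] *[of m n] snorm_minus_commute[OF ft[of "p m"] ft[of "p n"]] by (cases "n \<le> m") auto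
      qed
    qed (rule ft)
  qed
  \<comment> \<open>The default 0 keeps \<open>g\<close> in the carrier at every point.\<close>
  define g where "g t = (if \<exists>l\<in>carr X. (\<lambda>k. snorm X (f (p k) t - l)) \<longlonglongrightarrow> 0
      then SOME l. l \<in> carr X \<and> (\<lambda>k. snorm X (f (p k) t - l)) \<longlonglongrightarrow> 0 else 0)" for t
  have g: "g t \<in> carr X \<and> (\<lambda>k. snorm X (f (p k) t - g t)) \<longlonglongrightarrow> 0"
    if "\<exists>l\<in>carr X. (\<lambda>k. snorm X (f (p k) t - l)) \<longlonglongrightarrow> 0" for t
  proof -
    have "g t = (SOME l. l \<in> carr X \<and> (\<lambda>k. snorm X (f (p k) t - l)) \<longlonglongrightarrow> 0)"
      using that by (simp add: g_def)
    then show ?thesis using someI_ex[OF that[unfolded Bex_def]] by simp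
  qed
  have gX: "g t \<in> carr X" for t
  proof (cases "\<exists>l\<in>carr X. (\<lambda>k. snorm X (f (p k) t - l)) \<longlonglongrightarrow> 0")
    case True
    then show ?thesis by (rule g[THEN conjunct1])
  next
    case False
    then have "g t = 0" unfolding g_def by (rule if_not_P)
    then show ?thesis by simp
  qed
  have glim: "AE t in M. (\<lambda>k. snorm X (f (p k) t - g t)) \<longlonglongrightarrow> 0"
    using limit
  proof eventually_elim
    case (elim t)
    then show ?case by (rule g[THEN conjunct2])
  qed
  have "\<exists>s. simple_function M s \<and> (\<forall>t. s t \<in> carr X) \<and> s \<in> L2set M X \<and>
      (LINT t|M. (snorm X (s t - f (p k) t))\<^sup>2) \<le> (1/4) ^ k" for k
  proof -
    obtain s where s: "\<And>n. simple_function M (s n)" "\<And>n t. s n t \<in> carr X" "\<And>n. s n \<in> L2set M X"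
      "(\<lambda>n. LINT t|M. (snorm X (s n t - f (p k) t))\<^sup>2) \<longlonglongrightarrow> 0"
      by (rule L2set_approx[OF f[of "p k"]]) (rule that)
    have "\<forall>\<^sub>F n in sequentially. (LINT t|M. (snorm X (s n t - f (p k) t))\<^sup>2) < (1/4) ^ k"
      by (rule order_tendstoD(2)[OF s(4)]) simp
    then obtain n where "(LINT t|M. (snorm X (s n t - f (p k) t))\<^sup>2) < (1/4) ^ k"
      unfolding eventually_sequentially by blast
    then show ?thesis using s(1,2,3) by (intro exI[of _ "s n"]) auto
  qed
  then obtain s where s: "\<And>k. simple_function M (s k)" "\<And>k t. s k t \<in> carr X" "\<And>k. s k \<in> L2set M X"
      "\<And>k. (LINT t|M. (snorm X (s k t - f (p k) t))\<^sup>2) \<le> (1/4) ^ k"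
    by metis
  have "AE t in M. summable (\<lambda>k. snorm X (s k t - f (p k) t))"
  proof (rule AE_summable)
    fix k
    note d = L2set_diff[OF s(3) f, of k "p k"]
    show "(\<lambda>t. snorm X (s k t - f (p k) t)) \<in> borel_measurable M"
      "integrable M (\<lambda>t. (snorm X (s k t - f (p k) t))\<^sup>2)"
      "AE t in M. 0 \<le> snorm X (s k t - f (p k) t)"
      using L2_meas[OF d] L2_nonneg[OF d] by auto
  qed (rule s(4))
  then have "AE t in M. (\<lambda>k. snorm X (s k t - g t)) \<longlonglongrightarrow> 0"
    using glim carr
  proof eventually_elim
    case (elim t)
    have ft: "f n t \<in> carr X" for n using elim by blast
    show ?case
    proof (rule null_squeeze)
      show "snorm X (s k t - g t) \<le> snorm X (s k t - f (p k) t) + snorm X (f (p k) t - g t)" for k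
        by (rule snorm_triangle_diff[OF s(2) ft gX])
      show "0 \<le> snorm X (s k t - g t)" for k using s(2) gX by (intro snorm_nonneg) simp
      show "(\<lambda>k. snorm X (s k t - f (p k) t) + snorm X (f (p k) t - g t)) \<longlonglongrightarrow> 0"
        using tendsto_add[OF summable_LIMSEQ_zero[OF elim(1)] elim(2)] by simp
    qed
  qed
  then have g_sm: "strongly_measurable_in M X g"
    unfolding strongly_measurable_in_def using s(1,2) gX by (intro conjI exI[of _ s]) auto
  \<comment> \<open>Fatou along the fast subsequence, with \<open>f n\<close> fixed. The finite
    bound also shows that the difference, and hence \<open>g\<close>, is square integrable.\<close>
  have bound: "(\<integral>\<^sup>+t. ennreal ((snorm X (f n t - g t))\<^sup>2) \<partial>M) \<le> ennreal ((1/4) ^ k)" if "n \<ge> N k" for n k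
  proof -
    have "AE t in M. liminf (\<lambda>m. ennreal ((snorm X (f n t - f (p m) t))\<^sup>2)) = ennreal ((snorm X (f n t - g t))\<^sup>2)"
      using glim carr
    proof eventually_elim
      case (elim t)
      have ft: "f n t \<in> carr X" for n using elim by blast
      have "(\<lambda>m. snorm X (f n t - f (p m) t)) \<longlonglongrightarrow> snorm X (f n t - g t)"
      proof (rule snorm_tendsto)
        have "(f n t - f (p m) t) - (f n t - g t) = g t - f (p m) t" for m by simp
        then show "(\<lambda>m. snorm X ((f n t - f (p m) t) - (f n t - g t))) \<longlonglongrightarrow> 0"
          using elim(1) snorm_minus_commute[OF gX[of t] ft] by simp
      qed (use ft gX in auto)
      then have "(\<lambda>m. ennreal ((snorm X (f n t - f (p m) t))\<^sup>2)) \<longlonglongrightarrow> ennreal ((snorm X (f n t - g t))\<^sup>2)"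
        by (intro tendsto_ennrealI tendsto_power)
      then show ?case by (rule lim_imp_Liminf[OF sequentially_bot])
    qed
    then have "(\<integral>\<^sup>+t. ennreal ((snorm X (f n t - g t))\<^sup>2) \<partial>M) =
        (\<integral>\<^sup>+t. liminf (\<lambda>m. ennreal ((snorm X (f n t - f (p m) t))\<^sup>2)) \<partial>M)"
      by (intro nn_integral_cong_AE) (auto elim: eventually_mono)
    also have "\<dots> \<le> liminf (\<lambda>m. \<integral>\<^sup>+t. ennreal ((snorm X (f n t - f (p m) t))\<^sup>2) \<partial>M)"
      by (intro nn_integral_liminf measurable_compose[OF _ measurable_ennreal] borel_measurable_power
          L2_meas(1) L2set_diff f)
    also have "\<dots> \<le> limsup (\<lambda>m. \<integral>\<^sup>+t. ennreal ((snorm X (f n t - f (p m) t))\<^sup>2) \<partial>M)"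
      by (rule Liminf_le_Limsup[OF sequentially_bot])
    also have "\<dots> \<le> ennreal ((1/4) ^ k)"
    proof (rule Limsup_bounded)
      have "(\<integral>\<^sup>+t. ennreal ((snorm X (f n t - f (p m) t))\<^sup>2) \<partial>M) \<le> ennreal ((1/4) ^ k)" if "m \<ge> k" for m
      proof -
        have "(\<integral>\<^sup>+t. ennreal ((snorm X (f n t - f (p m) t))\<^sup>2) \<partial>M) =
            ennreal (LINT t|M. (snorm X (f n t - f (p m) t))\<^sup>2)"
          by (rule nn_integral_eq_integral[OF L2_meas(2)[OF L2set_diff[OF f f]]]) simp
        also have "\<dots> \<le> ennreal ((1/4) ^ k)"
          using N[OF \<open>n \<ge> N k\<close> p[OF that]] by (intro ennreal_leI) simp
        finally show ?thesis .
      qed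
      then show "\<forall>\<^sub>F m in sequentially. (\<integral>\<^sup>+t. ennreal ((snorm X (f n t - f (p m) t))\<^sup>2) \<partial>M) \<le> ennreal ((1/4) ^ k)"
        unfolding eventually_sequentially by blast
    qed
    finally show ?thesis .
  qed
  have d_sm: "strongly_measurable_in M X (\<lambda>t. f n t - g t)" for n
    using f g_sm by (intro strongly_measurable_diff) (auto simp: L2set_def)
  have d_meas: "(\<lambda>t. (snorm X (f n t - g t))\<^sup>2) \<in> borel_measurable M" for n
    by (intro borel_measurable_power strongly_measurable_snorm d_sm)
  have d_int: "integrable M (\<lambda>t. (snorm X (f n t - g t))\<^sup>2)" if "n \<ge> N k" for n k
    using d_meas bound[OF that] by (intro integrableI_bounded) (auto simp: le_less_trans)
  have gL2: "g \<in> L2set M X"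
  proof -
    have "(\<lambda>t. f (N 0) t - g t) \<in> L2set M X"
      using d_sm d_int[OF order_refl] by (simp add: L2set_def)
    from L2set_diff[OF f this, of "N 0"] show ?thesis by simp
  qed
  have d_le: "(LINT t|M. (snorm X (f n t - g t))\<^sup>2) \<le> (1/4) ^ k" if "n \<ge> N k" for n k
    using bound[OF that] nn_integral_eq_integral[OF d_int[OF that]] by simp
  have "(\<lambda>n. LINT t|M. (snorm X (f n t - g t))\<^sup>2) \<longlonglongrightarrow> 0"
  proof (rule LIMSEQ_I)
    fix e :: real assume "0 < e"
    then obtain k where k: "(1/4) ^ k < e" using real_arch_pow_inv[of e "1/4"] by auto
    have "norm ((LINT t|M. (snorm X (f n t - g t))\<^sup>2) - 0) < e" if "n \<ge> N k" for n
      using d_le[OF that] k by (simp add: integral_nonneg_AE)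
    then show "\<exists>n0. \<forall>n\<ge>n0. norm ((LINT t|M. (snorm X (f n t - g t))\<^sup>2) - 0) < e" by blast
  qed
  then show ?thesis using gL2 gX by blast
qed

end

section \<open>Carriers whose seminorm comes from a product\<close>

locale inner_carrier = semi_inner "carr X" B
  for X :: "'f::real_vector space_rec" and B :: "'f \<Rightarrow> 'f \<Rightarrow> real" +
  assumes snorm_eq: "x \<in> carr X \<Longrightarrow> snorm X x = sqrt (B x x)"
begin

lemma snorm_nrm: "x \<in> carr X \<Longrightarrow> snorm X x = nrm x"
  by (simp add: snorm_eq nrm_def)

lemma snorm_square: "x \<in> carr X \<Longrightarrow> (snorm X x)\<^sup>2 = B x x"
  by (simp add: snorm_nrm nrm_square)

lemma seminormed: "seminormed X"
  by standard (simp_all add: S snorm_nrm nrm_nonneg nrm_triangle nrm_scale)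

lemma Cauchy_Schwarz_snorm: "x \<in> carr X \<Longrightarrow> y \<in> carr X \<Longrightarrow> \<bar>B x y\<bar> \<le> snorm X x * snorm X y"
  using Cauchy_Schwarz by (simp add: snorm_nrm)

text \<open>Polarisation expresses \<open>B (f t) (g t)\<close> by squared seminorms, so
  measurability and integrability are inherited from theirs.\<close>

lemma integrable_L2set:
  assumes M: "finite_complete_measure M" and f: "f \<in> L2set M X" and g: "g \<in> L2set M X"
  shows "integrable M (\<lambda>t. B (f t) (g t))"
proof -
  interpret X: seminormed X by (rule seminormed)
  interpret M: finite_complete_measure M by (rule M)
  interpret bochner_space M X ..
  have fg: "(\<lambda>t. f t + g t) \<in> L2set M X" using f g by (rule L2set_add)
  have int: "integrable M (\<lambda>t. ((snorm X (f t + g t))\<^sup>2 - (snorm X (f t))\<^sup>2 - (snorm X (g t))\<^sup>2) / 2)"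
    using f g fg by (auto simp: L2set_def)
  have "AE t in M. ((snorm X (f t + g t))\<^sup>2 - (snorm X (f t))\<^sup>2 - (snorm X (g t))\<^sup>2) / 2 = B (f t) (g t)"
    using L2set_carr[OF f] L2set_carr[OF g]
  proof eventually_elim
    case (elim t)
    then show ?case using commute[OF elim] by (simp add: snorm_square bilinear_simps)
  qed
  note ae = this
  have "(\<lambda>t. B (f t) (g t)) \<in> borel_measurable M"
    by (rule M.measurable_AE_eq[OF borel_measurable_integrable[OF int] ae])
  then show ?thesis using ae by (rule integrable_cong_AE_imp[OF int])
qed

text \<open>Makes the abstract \<open>weak_limit_exists\<close> applicable to functions of time. All
  four laws hold pointwise a.e. and are then integrated.\<close>

lemma semi_inner_L2set:
  assumes M: "finite_complete_measure M"
  shows "semi_inner (L2set M X) (\<lambda>f g. LINT t|M. B (f t) (g t))"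
proof -
  interpret X: seminormed X by (rule seminormed)
  interpret M: finite_complete_measure M by (rule M)
  interpret bochner_space M X ..
  note int = integrable_L2set[OF M]
  show ?thesis
  proof
    show "subspace (L2set M X)" by (rule L2set_subspace)
    fix f g h :: "_ \<Rightarrow> 'f" and r :: real
    assume fgh: "f \<in> L2set M X" "h \<in> L2set M X"
    note c = L2set_carr[OF fgh(1)] L2set_carr[OF fgh(2)]
    have fm: "(\<lambda>t. r *\<^sub>R f t) \<in> L2set M X" using fgh(1) by (rule L2set_scale)
    show "(LINT t|M. B ((r *\<^sub>R f) t) (h t)) = r * (LINT t|M. B (f t) (h t))"
    proof -
      have "(LINT t|M. B (r *\<^sub>R f t) (h t)) = (LINT t|M. r * B (f t) (h t))"
      proof (intro integral_cong_AE borel_measurable_integrable[OF int[OF fm fgh(2)]]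
            borel_measurable_times borel_measurable_const borel_measurable_integrable[OF int[OF fgh]])
        show "AE t in M. B (r *\<^sub>R f t) (h t) = r * B (f t) (h t)"
          using c by eventually_elim (simp add: scale_left)
      qed
      then show ?thesis by (simp add: scaleR_fun_def)
    qed
    show "(LINT t|M. B (f t) (h t)) = (LINT t|M. B (h t) (f t))"
    proof (intro integral_cong_AE borel_measurable_integrable int fgh)
      show "AE t in M. B (f t) (h t) = B (h t) (f t)"
        using c by eventually_elim (simp add: commute)
    qed
    show "0 \<le> (LINT t|M. B (f t) (f t))"
    proof (rule integral_nonneg_AE)
      show "AE t in M. 0 \<le> B (f t) (f t)" using c(1) by eventually_elim (rule nonneg)
    qed
    assume g: "g \<in> L2set M X"
    show "(LINT t|M. B ((f + g) t) (h t)) = (LINT t|M. B (f t) (h t)) + (LINT t|M. B (g t) (h t))"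
    proof -
      have "(LINT t|M. B (f t + g t) (h t)) = (LINT t|M. B (f t) (h t) + B (g t) (h t))"
      proof (intro integral_cong_AE borel_measurable_integrable Bochner_Integration.integrable_add int L2set_add fgh g)
        show "AE t in M. B (f t + g t) (h t) = B (f t) (h t) + B (g t) (h t)"
          using c L2set_carr[OF g] by eventually_elim (simp add: add_left)
      qed
      then show ?thesis using int fgh g by simp
    qed
  qed
qed

text \<open>The functionals tested are pairings with \<phi> v for bounded scalar \<phi>, which is
  enough to identify weak derivatives. No subsequence is chosen: \<open>g\<close> attains the limit
  value whenever the pairing converges along the whole sequence.\<close>

lemma L2set_weak_limit:
  assumes M: "finite_complete_measure M" and X: "complete_seminormed X"
    and D: "\<And>n. D n \<in> L2set M X" "\<And>n. (LINT t|M. (snorm X (D n t))\<^sup>2) \<le> K"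
  shows "\<exists>g\<in>L2set M X. (\<forall>t. g t \<in> carr X) \<and>
    (\<forall>\<phi> v c C. \<phi> \<in> borel_measurable M \<longrightarrow> (\<forall>t\<in>space M. \<bar>\<phi> t\<bar> \<le> C) \<longrightarrow> v \<in> carr X \<longrightarrow>
      (\<lambda>n. LINT t|M. \<phi> t * B (D n t) v) \<longlonglongrightarrow> c \<longrightarrow> (LINT t|M. \<phi> t * B (g t) v) = c)"
proof -
  interpret X: complete_seminormed X by (rule X)
  interpret M: finite_complete_measure M by (rule M)
  interpret complete_bochner_space M X ..
  note int = integrable_L2set[OF M]
  interpret L: semi_inner "L2set M X" "\<lambda>f g. LINT t|M. B (f t) (g t)"
    by (rule semi_inner_L2set[OF M])
  have L_nrm: "L.nrm f = sqrt (LINT t|M. (snorm X (f t))\<^sup>2)" if "f \<in> L2set M X" for f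
  proof -
    have "(LINT t|M. B (f t) (f t)) = (LINT t|M. (snorm X (f t))\<^sup>2)"
    proof (rule integral_cong_AE)
      show "AE t in M. B (f t) (f t) = (snorm X (f t))\<^sup>2"
        using L2set_carr[OF that] by eventually_elim (simp add: snorm_square)
    qed (use int[OF that that] that in \<open>auto simp: L2set_def\<close>)
    then show ?thesis by (simp add: L.nrm_def)
  qed
  have "\<exists>l\<in>L2set M X. (\<lambda>n. L.nrm (f n - l)) \<longlonglongrightarrow> 0"
    if f: "\<And>n. f n \<in> L2set M X" and Cauchy: "\<And>e. 0 < e \<Longrightarrow> \<exists>N. \<forall>m\<ge>N. \<forall>n\<ge>N. L.nrm (f m - f n) < e" for f
  proof -
    have "\<exists>N. \<forall>m\<ge>N. \<forall>n\<ge>N. (LINT t|M. (snorm X (f m t - f n t))\<^sup>2) < e" if "0 < e" for e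
    proof -
      obtain N where N: "\<And>m n. m \<ge> N \<Longrightarrow> n \<ge> N \<Longrightarrow> L.nrm (f m - f n) < sqrt e"
        using Cauchy[of "sqrt e"] \<open>0 < e\<close> by auto
      have "(LINT t|M. (snorm X (f m t - f n t))\<^sup>2) < e" if "m \<ge> N" "n \<ge> N" for m n
        using N[OF that] L_nrm[OF L.mem(3)[OF f f], of m n] by simp
      then show ?thesis by blast
    qed
    note C = this
    have "\<exists>g\<in>L2set M X. (\<forall>t. g t \<in> carr X) \<and> (\<lambda>n. LINT t|M. (snorm X (f n t - g t))\<^sup>2) \<longlonglongrightarrow> 0"
      by (rule L2set_complete[OF f C])
    then obtain g where g: "g \<in> L2set M X" "(\<lambda>n. LINT t|M. (snorm X (f n t - g t))\<^sup>2) \<longlonglongrightarrow> 0"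
      by (elim bexE conjE)
    have "(\<lambda>n. L.nrm (f n - g)) \<longlonglongrightarrow> 0"
      using tendsto_real_sqrt[OF g(2)] L_nrm[OF L.mem(3)[OF f g(1)]] by simp
    then show ?thesis using g(1) by blast
  qed
  note complete_L2 = this
  have D_le: "L.nrm (D n) \<le> sqrt K" for n
    using D(2)[of n] L_nrm[OF D(1)] by simp
  have "\<exists>g\<in>L2set M X. \<forall>\<Lambda> c C. (\<forall>x\<in>L2set M X. \<forall>y\<in>L2set M X. \<Lambda> (x + y) = \<Lambda> x + \<Lambda> y) \<longrightarrow>
      (\<forall>r. \<forall>x\<in>L2set M X. \<Lambda> (r *\<^sub>R x) = r * \<Lambda> x) \<longrightarrow>
      (\<forall>x\<in>L2set M X. \<bar>\<Lambda> x\<bar> \<le> C * L.nrm x) \<longrightarrow> (\<lambda>n. \<Lambda> (D n)) \<longlonglongrightarrow> c \<longrightarrow> \<Lambda> g = (c :: real)"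
    by (rule L.weak_limit_exists[OF complete_L2 D(1) D_le])
  then obtain g0 where g0: "g0 \<in> L2set M X" "\<And>\<Lambda> c C. (\<forall>x\<in>L2set M X. \<forall>y\<in>L2set M X. \<Lambda> (x + y) = \<Lambda> x + \<Lambda> y) \<Longrightarrow>
      (\<forall>r. \<forall>x\<in>L2set M X. \<Lambda> (r *\<^sub>R x) = r * \<Lambda> x) \<Longrightarrow>
      (\<forall>x\<in>L2set M X. \<bar>\<Lambda> x\<bar> \<le> C * L.nrm x) \<Longrightarrow> (\<lambda>n. \<Lambda> (D n)) \<longlonglongrightarrow> c \<Longrightarrow> \<Lambda> g0 = (c :: real)"
    by blast
  \<comment> \<open>A change on a null set puts \<open>g\<close> into the carrier at every
    time.\<close>
  define g where "g t = (if g0 t \<in> carr X then g0 t else 0)" for t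
  have gX: "g t \<in> carr X" for t by (simp add: g_def)
  have ae: "AE t in M. g0 t = g t"
    using L2set_carr[OF g0(1)] by eventually_elim (simp add: g_def)
  have g: "g \<in> L2set M X" by (rule L2set_AE_eq[OF g0(1) ae])
  show ?thesis
  proof (intro bexI[OF _ g] conjI allI impI)
    fix \<phi> :: "_ \<Rightarrow> real" and v c C
    assume \<phi>: "\<phi> \<in> borel_measurable M" "\<forall>t\<in>space M. \<bar>\<phi> t\<bar> \<le> C" and v: "v \<in> carr X"
      and lim: "(\<lambda>n. LINT t|M. \<phi> t * B (D n t) v) \<longlonglongrightarrow> c"
    have \<phi>v: "(\<lambda>t. \<phi> t *\<^sub>R v) \<in> L2set M X"
      using \<phi> by (intro L2set_mult[OF L2set_const[OF v]]) auto
    have eq: "(LINT t|M. \<phi> t * B (f t) v) = (LINT t|M. B (f t) (\<phi> t *\<^sub>R v))" if f: "f \<in> L2set M X" for f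
    proof (rule integral_cong_AE)
      show "AE t in M. \<phi> t * B (f t) v = B (f t) (\<phi> t *\<^sub>R v)"
        using L2set_carr[OF f] by eventually_elim (simp add: scale_right v)
      show "(\<lambda>t. \<phi> t * B (f t) v) \<in> borel_measurable M"
        by (intro borel_measurable_times \<phi>(1) borel_measurable_integrable[OF int[OF f L2set_const[OF v]]])
      show "(\<lambda>t. B (f t) (\<phi> t *\<^sub>R v)) \<in> borel_measurable M"
        by (intro borel_measurable_integrable[OF int[OF f \<phi>v]])
    qed
    have "(LINT t|M. B (g0 t) (\<phi> t *\<^sub>R v)) = c"
    proof (rule g0(2))
      show "\<forall>x\<in>L2set M X. \<bar>LINT t|M. B (x t) (\<phi> t *\<^sub>R v)\<bar> \<le> L.nrm (\<lambda>t. \<phi> t *\<^sub>R v) * L.nrm x"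
        using L.Cauchy_Schwarz[OF _ \<phi>v] by (simp add: mult.commute)
      show "(\<lambda>n. LINT t|M. B (D n t) (\<phi> t *\<^sub>R v)) \<longlonglongrightarrow> c"
        using lim eq[OF D(1)] by simp
    qed (use L.add_left[OF _ _ \<phi>v] L.scale_left[OF _ \<phi>v] in simp_all)
    moreover have "(LINT t|M. \<phi> t * B (g t) v) = (LINT t|M. \<phi> t * B (g0 t) v)"
    proof (rule integral_cong_AE)
      show "AE t in M. \<phi> t * B (g t) v = \<phi> t * B (g0 t) v"
        using ae by eventually_elim simp
    qed (intro borel_measurable_times \<phi>(1) borel_measurable_integrable[OF int[OF _ L2set_const[OF v]]] g g0(1))+
    ultimately show "(LINT t|M. \<phi> t * B (g t) v) = c" using eq[OF g0(1)] by simp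
  qed (rule gX)
qed

end

section \<open>Square integrable functions\<close>

lemma (in semi_inner) B_tendsto:
  assumes "\<And>n. f n \<in> S" "g \<in> S" "v \<in> S" "(\<lambda>n. nrm (f n - g)) \<longlonglongrightarrow> 0"
  shows "(\<lambda>n. B (f n) v) \<longlonglongrightarrow> B g v"
proof (rule LIM_zero_cancel, rule tendsto_rabs_zero_cancel, rule null_squeeze)
  show "\<bar>B (f n) v - B g v\<bar> \<le> nrm (f n - g) * nrm v" for n
    using Cauchy_Schwarz[of "f n - g" v] assms by (simp add: diff_left)
  show "(\<lambda>n. nrm (f n - g) * nrm v) \<longlonglongrightarrow> 0"
    using tendsto_mult[OF assms(4) tendsto_const] by simp
qed simp

text \<open>With a Euclidean space as value record, L^2(G) becomes an instance of
  \<open>L2set\<close> and inherits its product and its completeness.\<close>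

definition euclidean_rec :: "'b::euclidean_space space_rec" where
  "euclidean_rec = \<lparr>carr = UNIV, snorm = norm\<rparr>"

lemma inner_carrier_euclidean: "inner_carrier (euclidean_rec :: 'b::euclidean_space space_rec) (\<bullet>)"
  by standard (auto simp: euclidean_rec_def inner_add_left inner_add_right inner_commute norm_eq_sqrt_inner)

lemma complete_euclidean: "complete_seminormed (euclidean_rec :: 'b::euclidean_space space_rec)"
proof -
  interpret seminormed "euclidean_rec :: 'b space_rec"
    by (rule inner_carrier.seminormed[OF inner_carrier_euclidean])
  show ?thesis
  proof
    fix f :: "nat \<Rightarrow> 'b"
    assume "\<And>e. 0 < e \<Longrightarrow> \<exists>N. \<forall>m\<ge>N. \<forall>n\<ge>N. snorm euclidean_rec (f m - f n) < e"
    then have "Cauchy f"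
      by (intro CauchyI) (simp add: euclidean_rec_def)
    then obtain l where "f \<longlonglongrightarrow> l" by (auto simp: Cauchy_convergent_iff convergent_def)
    then have "(\<lambda>n. norm (f n - l)) \<longlonglongrightarrow> 0"
      by (simp add: tendsto_norm_zero LIM_zero)
    then show "\<exists>l\<in>carr euclidean_rec. (\<lambda>n. snorm euclidean_rec (f n - l)) \<longlonglongrightarrow> 0"
      by (auto simp: euclidean_rec_def)
  qed
qed

lemma (in finite_complete_measure) L2set_euclidean:
  fixes u :: "'a \<Rightarrow> 'b::euclidean_space"
  shows "u \<in> L2set M euclidean_rec \<longleftrightarrow>
    u \<in> borel_measurable M \<and> integrable M (\<lambda>x. (norm (u x))\<^sup>2)"
proof -
  have "strongly_measurable_in M euclidean_rec u \<longleftrightarrow> u \<in> borel_measurable M"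
  proof
    assume "u \<in> borel_measurable M"
    from borel_measurable_implies_sequence_metric[OF this, of 0]
    obtain s where s: "\<forall>i. simple_function M (s i)" "\<forall>x\<in>space M. (\<lambda>i. s i x) \<longlonglongrightarrow> u x" by blast
    then have "AE x in M. (\<lambda>i. norm (s i x - u x)) \<longlonglongrightarrow> 0"
      by (intro AE_I2) (simp add: tendsto_norm_zero LIM_zero)
    then show "strongly_measurable_in M euclidean_rec u"
      using s(1) by (auto simp: strongly_measurable_in_def euclidean_rec_def)
  next
    assume "strongly_measurable_in M euclidean_rec u"
    then obtain s where s: "\<And>i. simple_function M (s i)" "AE x in M. (\<lambda>i. norm (s i x - u x)) \<longlonglongrightarrow> 0"
      by (auto simp: strongly_measurable_in_def euclidean_rec_def)
    show "u \<in> borel_measurable M"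
    proof (rule borel_measurable_euclidean_space[THEN iffD2], rule ballI)
      fix b :: 'b assume "b \<in> Basis"
      show "(\<lambda>x. u x \<bullet> b) \<in> borel_measurable M"
      proof (rule measurable_AE_LIMSEQ)
        show "(\<lambda>x. s i x \<bullet> b) \<in> borel_measurable M" for i
          by (rule borel_measurable_simple_function[OF simple_function_compose1[OF s(1), where g = "\<lambda>y. y \<bullet> b"]])
        show "AE x in M. (\<lambda>i. s i x \<bullet> b) \<longlonglongrightarrow> u x \<bullet> b"
          using s(2)
        proof eventually_elim
          case (elim x)
          then have "(\<lambda>i. s i x) \<longlonglongrightarrow> u x"
            by (rule LIM_zero_cancel[OF tendsto_norm_zero_cancel])
          then show ?case by (intro tendsto_inner tendsto_const)
        qed
      qed
    qed
  qed
  then show ?thesis by (simp add: L2set_def euclidean_rec_def)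
qed

locale bounded_domain =
  fixes G :: "(real^'d) set"
  assumes open_G: "open G" and bounded_G: "bounded G"
begin

lemma lmeasurable_G: "G \<in> lmeasurable"
  using open_G bounded_G by (intro bounded_set_imp_lmeasurable) auto

lemma sets_G [simp]: "G \<in> sets lebesgue"
  using lmeasurable_G by auto

sublocale finite_complete_measure "lebesgue_on G"
  by (rule finite_complete_measure_lebesgue_on[OF lmeasurable_G])

lemma square_integrable_iff:
  "square_integrable_on G u \<longleftrightarrow> u \<in> L2set (lebesgue_on G) euclidean_rec"
  by (simp add: square_integrable_on_def L2set_euclidean)

definition ip :: "(real^'d \<Rightarrow> 'b::euclidean_space) \<Rightarrow> (real^'d \<Rightarrow> 'b) \<Rightarrow> real" where
  "ip u v = (LINT x|lebesgue_on G. u x \<bullet> v x)"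

lemma ip_semi_inner: "semi_inner {u :: real^'d \<Rightarrow> 'b::euclidean_space. square_integrable_on G u} ip"
  using inner_carrier.semi_inner_L2set[OF inner_carrier_euclidean finite_complete_measure_axioms]
  unfolding ip_def[abs_def] square_integrable_iff by simp

lemma integrable_inner:
  "square_integrable_on G u \<Longrightarrow> square_integrable_on G v \<Longrightarrow> integrable (lebesgue_on G) (\<lambda>x. u x \<bullet> v x)"
  unfolding square_integrable_iff
  by (rule inner_carrier.integrable_L2set[OF inner_carrier_euclidean finite_complete_measure_axioms])

lemma square_integrable_complete:
  fixes f :: "nat \<Rightarrow> real^'d \<Rightarrow> 'b::euclidean_space"
  assumes "\<And>n. square_integrable_on G (f n)"
    and "\<And>e. 0 < e \<Longrightarrow> \<exists>N. \<forall>m\<ge>N. \<forall>n\<ge>N. (LINT x|lebesgue_on G. (norm (f m x - f n x))\<^sup>2) < e"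
  shows "\<exists>g. square_integrable_on G g \<and> (\<lambda>n. LINT x|lebesgue_on G. (norm (f n x - g x))\<^sup>2) \<longlonglongrightarrow> 0"
proof -
  interpret E: complete_seminormed "euclidean_rec :: 'b space_rec" by (rule complete_euclidean)
  interpret complete_bochner_space "lebesgue_on G" "euclidean_rec :: 'b space_rec" ..
  have sn: "snorm euclidean_rec = (norm :: 'b \<Rightarrow> real)" by (simp add: euclidean_rec_def)
  have "\<exists>g\<in>L2set (lebesgue_on G) euclidean_rec. (\<forall>t. g t \<in> carr euclidean_rec) \<and>
      (\<lambda>n. LINT t|lebesgue_on G. (snorm euclidean_rec (f n t - g t))\<^sup>2) \<longlonglongrightarrow> 0"
    by (rule L2set_complete) (use assms in \<open>simp_all add: square_integrable_iff sn\<close>)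
  then show ?thesis by (auto simp: square_integrable_iff sn)
qed

lemma nrm_ip: "semi_inner.nrm ip u = sqrt (LINT x|lebesgue_on G. (norm (u x))\<^sup>2)"
  by (simp add: semi_inner.nrm_def[OF ip_semi_inner] ip_def power2_norm_eq_inner)

lemma square_integrable_const: "square_integrable_on G (\<lambda>x. c)"
  by (simp add: square_integrable_on_def)

lemma square_integrable_integrable:
  assumes "square_integrable_on G u" shows "integrable (lebesgue_on G) u"
proof -
  have m: "u \<in> borel_measurable (lebesgue_on G)" using assms by (simp add: square_integrable_on_def)
  moreover have "integrable (lebesgue_on G) (\<lambda>x. norm (u x))"
  proof (rule square_integrable_imp_integrable)
    show "(\<lambda>x. norm (u x)) \<in> borel_measurable (lebesgue_on G)"
      by (rule measurable_compose[OF m borel_measurable_norm])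
    show "integrable (lebesgue_on G) (\<lambda>x. (norm (u x))\<^sup>2)"
      using assms by (simp add: square_integrable_on_def)
  qed
  ultimately show ?thesis by (simp add: integrable_norm_iff)
qed

lemma integral_eq_ip:
  assumes "square_integrable_on G u"
  shows "(LINT x|lebesgue_on G. u x) \<bullet> b = ip u (\<lambda>x. b)"
  using square_integrable_integrable[OF assms] by (simp add: ip_def)

lemma square_integrable_tendsto_ip:
  fixes g v :: "real^'d \<Rightarrow> 'b::euclidean_space"
  assumes "\<And>n. square_integrable_on G (f n)" "square_integrable_on G g" "square_integrable_on G v"
    and "(\<lambda>n. LINT x|lebesgue_on G. (norm (f n x - g x))\<^sup>2) \<longlonglongrightarrow> 0"
  shows "(\<lambda>n. ip (f n) v) \<longlonglongrightarrow> ip g v"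
proof -
  interpret semi_inner "{u :: real^'d \<Rightarrow> 'b. square_integrable_on G u}" ip by (rule ip_semi_inner)
  have "(\<lambda>n. nrm (f n - g)) \<longlonglongrightarrow> 0"
    using tendsto_real_sqrt[OF assms(4)] by (simp add: nrm_ip)
  then show ?thesis using assms(1-3) by (intro B_tendsto) auto
qed

lemma square_integrable_bounded_mult:
  fixes u :: "real^'d \<Rightarrow> 'b::euclidean_space" and w :: "real^'d \<Rightarrow> 'c::euclidean_space"
  assumes u: "square_integrable_on G u" and m: "w \<in> borel_measurable (lebesgue_on G)"
    and le: "AE x in lebesgue_on G. norm (w x) \<le> C * norm (u x)"
  shows "square_integrable_on G w"
proof -
  have "integrable (lebesgue_on G) (\<lambda>x. (norm (w x))\<^sup>2)"
  proof (rule Bochner_Integration.integrable_bound)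
    show "integrable (lebesgue_on G) (\<lambda>x. C\<^sup>2 * (norm (u x))\<^sup>2)"
      using u by (simp add: square_integrable_on_def)
    show "AE x in lebesgue_on G. norm ((norm (w x))\<^sup>2) \<le> norm (C\<^sup>2 * (norm (u x))\<^sup>2)"
      using le
    proof eventually_elim
      case (elim x)
      then have "(norm (w x))\<^sup>2 \<le> (C * norm (u x))\<^sup>2" by (intro power_mono) auto
      then show ?case by (simp add: power_mult_distrib)
    qed
  qed (use m in measurable)
  then show ?thesis using m by (simp add: square_integrable_on_def)
qed

lemma square_integrable_AE_eq:
  assumes u: "square_integrable_on G u" and ae: "AE x in lebesgue_on G. u x = w x"
  shows "square_integrable_on G w"
proof (rule square_integrable_bounded_mult[OF u measurable_AE_eq[OF _ ae], where C = 1])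
  show "AE x in lebesgue_on G. norm (w x) \<le> 1 * norm (u x)"
    using ae by eventually_elim simp
qed (use u in \<open>simp add: square_integrable_on_def\<close>)

lemma square_integrable_imp_locally_integrable:
  assumes "square_integrable_on G u" shows "locally_integrable G u"
  unfolding locally_integrable_def
proof (intro allI impI)
  fix K assume K: "compact K \<and> K \<subseteq> G"
  have "set_integrable lebesgue G u"
    using square_integrable_integrable[OF assms]
    by (simp add: integrable_restrict_space set_integrable_def)
  then show "u absolutely_integrable_on K"
    by (rule set_integrable_subset) (use K fmeasurableD[OF lmeasurable_compact] in blast)+
qed

section \<open>The space of mean-free functions\<close>

lemma Hspace_carr: "u \<in> carr (Hspace G) \<longleftrightarrow> square_integrable_on G u \<and> (LINT x|lebesgue_on G. u x) = 0"
  by (simp add: Hspace_def)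

lemma Hspace_snorm: "snorm (Hspace G) u = sqrt (LINT x|lebesgue_on G. (norm (u x))\<^sup>2)"
  by (simp add: Hspace_def)

lemma inner_carrier_Hspace: "inner_carrier (Hspace G :: (real^'d \<Rightarrow> real^'k) space_rec) ip"
proof -
  interpret semi_inner "{u :: real^'d \<Rightarrow> real^'k. square_integrable_on G u}" ip by (rule ip_semi_inner)
  show ?thesis
  proof
    show "subspace (carr (Hspace G :: (real^'d \<Rightarrow> real^'k) space_rec))"
      unfolding subspace_def
    proof (intro conjI ballI allI)
      show "0 \<in> carr (Hspace G :: (real^'d \<Rightarrow> real^'k) space_rec)"
        using mem(1) by (simp add: Hspace_carr zero_fun_def)
      fix u v :: "real^'d \<Rightarrow> real^'k" and r :: real
      assume u: "u \<in> carr (Hspace G)"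
      then have iu: "integrable (lebesgue_on G) u" by (simp add: Hspace_carr square_integrable_integrable)
      show "r *\<^sub>R u \<in> carr (Hspace G)"
        using u iu mem(4)[of u r] by (simp add: Hspace_carr scaleR_fun_def)
      assume v: "v \<in> carr (Hspace G)"
      then have iv: "integrable (lebesgue_on G) v" by (simp add: Hspace_carr square_integrable_integrable)
      show "u + v \<in> carr (Hspace G)"
        using u v iu iv mem(2)[of u v] by (simp add: Hspace_carr plus_fun_def)
    qed
    show "snorm (Hspace G) u = sqrt (ip u u)" for u :: "real^'d \<Rightarrow> real^'k"
      by (simp add: Hspace_snorm ip_def power2_norm_eq_inner)
  qed (auto simp: Hspace_carr bilinear_simps commute nonneg)
qed

text \<open>The mean is a pairing with constants, hence continuous in L^2(G), so limits of mean-free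
  functions are mean-free.\<close>

lemma complete_Hspace: "complete_seminormed (Hspace G :: (real^'d \<Rightarrow> real^'k) space_rec)"
proof -
  interpret H: inner_carrier "Hspace G :: (real^'d \<Rightarrow> real^'k) space_rec" ip by (rule inner_carrier_Hspace)
  interpret seminormed "Hspace G :: (real^'d \<Rightarrow> real^'k) space_rec" by (rule H.seminormed)
  show ?thesis
  proof
    fix f :: "nat \<Rightarrow> real^'d \<Rightarrow> real^'k"
    assume f: "\<And>n. f n \<in> carr (Hspace G)"
      and Cauchy: "\<And>e. 0 < e \<Longrightarrow> \<exists>N. \<forall>m\<ge>N. \<forall>n\<ge>N. snorm (Hspace G) (f m - f n) < e"
    have sq: "square_integrable_on G (f n)" for n using f by (simp add: Hspace_carr)
    have C: "\<exists>N. \<forall>m\<ge>N. \<forall>n\<ge>N. (LINT x|lebesgue_on G. (norm (f m x - f n x))\<^sup>2) < e" if "0 < e" for e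
      using Cauchy[of "sqrt e"] that by (simp add: Hspace_snorm)
    have "\<exists>g. square_integrable_on G g \<and> (\<lambda>n. LINT x|lebesgue_on G. (norm (f n x - g x))\<^sup>2) \<longlonglongrightarrow> 0"
      by (rule square_integrable_complete[OF sq C])
    then obtain g where g: "square_integrable_on G g"
      "(\<lambda>n. LINT x|lebesgue_on G. (norm (f n x - g x))\<^sup>2) \<longlonglongrightarrow> 0" by blast
    have "(LINT x|lebesgue_on G. g x) = 0"
    proof (rule euclidean_eqI)
      fix b :: "real^'k"
      have "(\<lambda>n. ip (f n) (\<lambda>x. b)) \<longlonglongrightarrow> ip g (\<lambda>x. b)"
        by (rule square_integrable_tendsto_ip[OF sq g(1) square_integrable_const g(2)])
      moreover have "ip (f n) (\<lambda>x. b) = 0" for n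
        using f[of n] integral_eq_ip[OF sq, of n b] by (simp add: Hspace_carr)
      ultimately show "(LINT x|lebesgue_on G. g x) \<bullet> b = 0 \<bullet> b"
        using integral_eq_ip[OF g(1), of b] by (simp add: LIMSEQ_const_iff)
    qed
    moreover have "(\<lambda>n. snorm (Hspace G) (f n - g)) \<longlonglongrightarrow> 0"
      using tendsto_real_sqrt[OF g(2)] by (simp add: Hspace_snorm)
    ultimately show "\<exists>l\<in>carr (Hspace G). (\<lambda>n. snorm (Hspace G) (f n - l)) \<longlonglongrightarrow> 0"
      using g(1) by (intro bexI[of _ g]) (simp_all add: Hspace_carr)
  qed
qed

end

section \<open>Weak derivatives and the Sobolev space\<close>

lemma continuous_compact_mult_integrable:
  fixes f :: "'a::euclidean_space \<Rightarrow> 'b::euclidean_space" and \<psi> :: "'a \<Rightarrow> real"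
  assumes S: "S \<in> sets lebesgue" and f: "locally_integrable S f" and \<psi>: "continuous_on UNIV \<psi>"
    and K: "compact K" "K \<subseteq> S" "\<And>x. x \<notin> K \<Longrightarrow> \<psi> x = 0"
  shows "integrable (lebesgue_on S) (\<lambda>x. \<psi> x *\<^sub>R f x)"
proof -
  have int: "integrable lebesgue (\<lambda>x. indicator K x *\<^sub>R f x)"
    using f K by (simp add: locally_integrable_def set_integrable_def)
  obtain B where B: "\<And>x. x \<in> K \<Longrightarrow> \<bar>\<psi> x\<bar> \<le> B"
    using compact_imp_bounded[OF compact_continuous_image[OF continuous_on_subset[OF \<psi> subset_UNIV] K(1)]]
    by (metis bounded_iff image_eqI real_norm_def)
  have "integrable lebesgue (\<lambda>x. \<psi> x *\<^sub>R (indicator K x *\<^sub>R f x))"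
  proof (rule Bochner_Integration.integrable_bound)
    show "integrable lebesgue (\<lambda>x. B * norm (indicator K x *\<^sub>R f x))"
      by (intro integrable_mult_right integrable_norm int)
    show "(\<lambda>x. \<psi> x *\<^sub>R (indicator K x *\<^sub>R f x)) \<in> borel_measurable lebesgue"
      by (intro borel_measurable_scaleR borel_measurable_integrable[OF int] measurable_completion)
         (use \<psi> in \<open>simp add: borel_measurable_continuous_onI\<close>)
    show "AE x in lebesgue. norm (\<psi> x *\<^sub>R (indicator K x *\<^sub>R f x)) \<le> norm (B * norm (indicator K x *\<^sub>R f x))"
    proof (rule AE_I2)
      fix x
      show "norm (\<psi> x *\<^sub>R (indicator K x *\<^sub>R f x)) \<le> norm (B * norm (indicator K x *\<^sub>R f x))"
      proof (cases "x \<in> K")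
        case True
        then have "\<bar>\<psi> x\<bar> \<le> \<bar>B\<bar>" using B[of x] by simp
        then show ?thesis using True by (simp add: abs_mult mult_right_mono)
      qed simp
    qed
  qed
  moreover have "\<psi> x *\<^sub>R (indicator K x *\<^sub>R f x) = indicator S x *\<^sub>R (\<psi> x *\<^sub>R f x)" for x
    using K(2) K(3)[of x] by (auto simp: indicator_def)
  ultimately have "integrable lebesgue (\<lambda>x. indicator S x *\<^sub>R (\<psi> x *\<^sub>R f x))" by (simp only:)
  moreover have "S \<inter> space lebesgue \<in> sets lebesgue" using S by simp
  ultimately show ?thesis by (simp only: integrable_restrict_space)
qed

lemma test_functionD:
  fixes \<phi> :: "'a::euclidean_space \<Rightarrow> real"
  assumes "\<phi> \<in> test_functions S"
  obtains K where "compact K" "K \<subseteq> S" "\<And>x. x \<notin> K \<Longrightarrow> \<phi> x = 0"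
    "\<And>b x. x \<notin> K \<Longrightarrow> dir_deriv b \<phi> x = 0" "smooth \<phi>"
    "continuous_on UNIV \<phi>" "\<And>b. b \<in> Basis \<Longrightarrow> continuous_on UNIV (dir_deriv b \<phi>)"
proof -
  let ?K = "closure {x. \<phi> x \<noteq> 0}"
  have s: "smooth \<phi>" and K: "compact ?K" "?K \<subseteq> S" using assms by (auto simp: test_functions_def)
  have out: "\<phi> x = 0" if "x \<notin> ?K" for x using that closure_subset[of "{x. \<phi> x \<noteq> 0}"] by auto
  have D: "dir_deriv b \<phi> x = 0" if "x \<notin> ?K" for b x
  proof -
    have d: "((\<lambda>x. 0) has_derivative (\<lambda>h. 0)) (at x)" by simp
    have "(\<phi> has_derivative (\<lambda>h. 0)) (at x)"
    proof (rule has_derivative_transform_within_open[OF d open_Compl[OF closed_closure]])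
      show "x \<in> - ?K" using that by simp
      show "0 = \<phi> y" if "y \<in> - ?K" for y by (rule out[symmetric]) (use that in simp)
    qed
    then have "frechet_derivative \<phi> (at x) = (\<lambda>h. 0)"
      by (rule frechet_derivative_at[symmetric])
    then show ?thesis by (simp add: dir_deriv_def)
  qed
  show ?thesis
    by (rule that[OF K out D s smooth_continuous[OF s] smooth_continuous[OF smooth_dir_deriv[OF s]]])
qed

text \<open>Both derivatives give the same integrals against all test functions, so the fundamental
  lemma applies to their difference.\<close>

lemma weak_deriv_unique:
  assumes S: "open S" and "has_weak_deriv S b f g" "has_weak_deriv S b f h"
  shows "AE x in lebesgue_on S. g x = h x"
proof -
  have lg: "locally_integrable S g" "locally_integrable S h"
    using assms by (auto simp: has_weak_deriv_def)
  have S': "S \<in> sets lebesgue" using S by simp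
  have "AE x in lebesgue_on S. g x - h x = 0"
  proof (rule test_functions_AE_eq_0[OF S])
    show "locally_integrable S (\<lambda>x. g x - h x)"
      using lg by (auto simp: locally_integrable_def intro: set_integral_diff)
    fix \<phi> assume \<phi>: "\<phi> \<in> test_functions S"
    obtain K where K: "compact K" "K \<subseteq> S" "\<And>x. x \<notin> K \<Longrightarrow> \<phi> x = 0" "continuous_on UNIV \<phi>"
      using test_functionD[OF \<phi>] by metis
    have "integrable (lebesgue_on S) (\<lambda>x. \<phi> x *\<^sub>R g x)" "integrable (lebesgue_on S) (\<lambda>x. \<phi> x *\<^sub>R h x)"
      by (rule continuous_compact_mult_integrable[OF S' lg(1) K(4,1,2,3)]
          continuous_compact_mult_integrable[OF S' lg(2) K(4,1,2,3)], assumption)+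
    moreover have "(LINT x|lebesgue_on S. \<phi> x *\<^sub>R g x) = (LINT x|lebesgue_on S. \<phi> x *\<^sub>R h x)"
      using assms(2,3) \<phi> by (auto simp: has_weak_deriv_def)
    ultimately show "(LINT x|lebesgue_on S. \<phi> x *\<^sub>R (g x - h x)) = 0"
      by (simp add: scaleR_diff_right)
  qed
  then show ?thesis by eventually_elim simp
qed

lemma has_weak_deriv_linear:
  assumes S: "open S" and "has_weak_deriv S b f f'" "has_weak_deriv S b g g'" "b \<in> Basis"
  shows "has_weak_deriv S b (\<lambda>x. r *\<^sub>R f x + s *\<^sub>R g x) (\<lambda>x. r *\<^sub>R f' x + s *\<^sub>R g' x)"
proof -
  have l: "locally_integrable S f" "locally_integrable S f'" "locally_integrable S g" "locally_integrable S g'"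
    using assms by (auto simp: has_weak_deriv_def)
  have S': "S \<in> sets lebesgue" using S by simp
  have lin: "(LINT x|lebesgue_on S. \<psi> x *\<^sub>R (r *\<^sub>R u x + s *\<^sub>R v x)) =
      r *\<^sub>R (LINT x|lebesgue_on S. \<psi> x *\<^sub>R u x) + s *\<^sub>R (LINT x|lebesgue_on S. \<psi> x *\<^sub>R v x)"
    if "integrable (lebesgue_on S) (\<lambda>x. \<psi> x *\<^sub>R u x)" "integrable (lebesgue_on S) (\<lambda>x. \<psi> x *\<^sub>R v x)"
    for \<psi> :: "_ \<Rightarrow> real" and u v
  proof -
    have "\<psi> x *\<^sub>R (r *\<^sub>R u x + s *\<^sub>R v x) = r *\<^sub>R (\<psi> x *\<^sub>R u x) + s *\<^sub>R (\<psi> x *\<^sub>R v x)" for x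
      by (simp add: scaleR_add_right mult.commute)
    then show ?thesis using that by (simp only: Bochner_Integration.integral_add integrable_scaleR_right integral_scaleR_right)
  qed
  show ?thesis
    unfolding has_weak_deriv_def
  proof (intro conjI ballI)
    show "locally_integrable S (\<lambda>x. r *\<^sub>R f x + s *\<^sub>R g x)" "locally_integrable S (\<lambda>x. r *\<^sub>R f' x + s *\<^sub>R g' x)"
      using l by (auto simp: locally_integrable_def intro!: set_integral_add absolutely_integrable_scaleR_left)
    fix \<phi> assume \<phi>: "\<phi> \<in> test_functions S"
    obtain K where K: "compact K" "K \<subseteq> S" "\<And>x. x \<notin> K \<Longrightarrow> \<phi> x = 0" "\<And>x. x \<notin> K \<Longrightarrow> dir_deriv b \<phi> x = 0"
      "continuous_on UNIV \<phi>" "continuous_on UNIV (dir_deriv b \<phi>)"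
      using test_functionD[OF \<phi>] \<open>b \<in> Basis\<close> by metis
    have "(LINT x|lebesgue_on S. dir_deriv b \<phi> x *\<^sub>R f x) = - (LINT x|lebesgue_on S. \<phi> x *\<^sub>R f' x)"
      "(LINT x|lebesgue_on S. dir_deriv b \<phi> x *\<^sub>R g x) = - (LINT x|lebesgue_on S. \<phi> x *\<^sub>R g' x)"
      using assms \<phi> by (auto simp: has_weak_deriv_def)
    moreover note lin[OF continuous_compact_mult_integrable[OF S' l(1) K(6,1,2,4)]
        continuous_compact_mult_integrable[OF S' l(3) K(6,1,2,4)]]
      lin[OF continuous_compact_mult_integrable[OF S' l(2) K(5,1,2,3)]
        continuous_compact_mult_integrable[OF S' l(4) K(5,1,2,3)]]
    ultimately show "(LINT x|lebesgue_on S. dir_deriv b \<phi> x *\<^sub>R (r *\<^sub>R f x + s *\<^sub>R g x)) =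
        - (LINT x|lebesgue_on S. \<phi> x *\<^sub>R (r *\<^sub>R f' x + s *\<^sub>R g' x))"
      by simp
  qed
qed

lemma linear_column: "linear (column j :: real^'d^'k \<Rightarrow> real^'k)"
  by (rule linearI) (simp_all add: column_def vec_eq_iff)

lemma norm_column_le: "norm (column j (A :: real^'d^'k)) \<le> norm A"
proof -
  have "norm (column j A) \<le> L2_set (\<lambda>i. norm (A $ i)) UNIV"
    unfolding norm_vec_def[of "column j A"]
    by (intro L2_set_mono norm_ge_zero) (simp only: column_def vec_lambda_beta Finite_Cartesian_Product.norm_nth_le)
  then show ?thesis by (simp add: norm_vec_def)
qed

lemma matrix_eq_columns: "A = (B :: real^'d^'k) \<longleftrightarrow> (\<forall>j. column j A = column j B)"
  by (auto simp: vec_eq_iff column_def)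

lemma axis_1_in_Basis [simp]: "axis j (1::real) \<in> Basis"
  by (simp add: axis_in_Basis_iff)

lemma has_weak_jacobian_linear:
  assumes G: "open G" and "has_weak_jacobian G u J" "has_weak_jacobian G v K"
  shows "has_weak_jacobian G (\<lambda>x. r *\<^sub>R u x + s *\<^sub>R v x) (\<lambda>x. r *\<^sub>R J x + s *\<^sub>R K x)"
  unfolding has_weak_jacobian_def
proof
  fix j
  have "column j (r *\<^sub>R J x + s *\<^sub>R K x) = r *\<^sub>R column j (J x) + s *\<^sub>R column j (K x)" for x
    by (simp add: linear_add[OF linear_column] linear_cmul[OF linear_column])
  then show "has_weak_deriv G (axis j 1) (\<lambda>x. r *\<^sub>R u x + s *\<^sub>R v x) (\<lambda>x. column j (r *\<^sub>R J x + s *\<^sub>R K x))"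
    using has_weak_deriv_linear[OF G, of "axis j 1" u _ v] assms(2,3) by (simp add: has_weak_jacobian_def)
qed

lemma has_weak_jacobian_unique:
  assumes G: "open G" and "has_weak_jacobian G u J" "has_weak_jacobian G u K"
  shows "AE x in lebesgue_on G. J x = K x"
proof -
  have "AE x in lebesgue_on G. column j (J x) = column j (K x)" for j
    using assms by (intro weak_deriv_unique[OF G]) (auto simp: has_weak_jacobian_def)
  then have "AE x in lebesgue_on G. \<forall>j\<in>UNIV. column j (J x) = column j (K x)"
    by (intro AE_finite_all[THEN iffD2] ballI) simp_all
  then show ?thesis by eventually_elim (simp add: matrix_eq_columns)
qed

lemma weak_jacobian: "has_weak_jacobian G u J \<Longrightarrow> has_weak_jacobian G u (weak_jacobian G u)"
  unfolding weak_jacobian_def by (rule someI[of "has_weak_jacobian G u"])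

context bounded_domain
begin

lemma weak_jacobian_AE:
  "has_weak_jacobian G u J \<Longrightarrow> AE x in lebesgue_on G. weak_jacobian G u x = J x"
  using has_weak_jacobian_unique[OF open_G weak_jacobian] by blast

lemma Vspace_carr:
  "u \<in> carr (Vspace G) \<longleftrightarrow> u \<in> carr (Hspace G) \<and> (\<exists>J. has_weak_jacobian G u J \<and> square_integrable_on G J)"
  by (simp add: Vspace_def)

lemma Vspace_jacobian:
  assumes "u \<in> carr (Vspace G)"
  shows "has_weak_jacobian G u (weak_jacobian G u)" "square_integrable_on G (weak_jacobian G u)"
proof -
  obtain J where J: "has_weak_jacobian G u J" "square_integrable_on G J"
    using assms by (auto simp: Vspace_carr)
  show "has_weak_jacobian G u (weak_jacobian G u)" by (rule weak_jacobian[OF J(1)])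
  have "AE x in lebesgue_on G. J x = weak_jacobian G u x"
    using weak_jacobian_AE[OF J(1)] by eventually_elim simp
  then show "square_integrable_on G (weak_jacobian G u)"
    by (rule square_integrable_AE_eq[OF J(2)])
qed

lemma Vspace_Hspace: "u \<in> carr (Vspace G) \<Longrightarrow> u \<in> carr (Hspace G)"
  by (simp add: Vspace_carr)

definition ipV :: "(real^'d \<Rightarrow> real^'k) \<Rightarrow> (real^'d \<Rightarrow> real^'k) \<Rightarrow> real" where
  "ipV u v = ip u v + ip (weak_jacobian G u) (weak_jacobian G v)"

text \<open>\<open>weak_jacobian\<close> is a choice made separately for each function, so its
  linearity holds only outside a null set that depends on the functions. All bilinearity of gradient
  terms passes through this statement.\<close>

lemma Vspace_linear:
  fixes u v :: "real^'d \<Rightarrow> real^'k"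
  assumes u: "u \<in> carr (Vspace G)" and v: "v \<in> carr (Vspace G)"
  shows "(\<lambda>x. r *\<^sub>R u x + s *\<^sub>R v x) \<in> carr (Vspace G)"
    and "AE x in lebesgue_on G. weak_jacobian G (\<lambda>x. r *\<^sub>R u x + s *\<^sub>R v x) x =
      r *\<^sub>R weak_jacobian G u x + s *\<^sub>R weak_jacobian G v x"
proof -
  interpret H: inner_carrier "Hspace G :: (real^'d \<Rightarrow> real^'k) space_rec" ip by (rule inner_carrier_Hspace)
  interpret semi_inner "{u :: real^'d \<Rightarrow> real^'d^'k. square_integrable_on G u}" ip by (rule ip_semi_inner)
  have J: "has_weak_jacobian G (\<lambda>x. r *\<^sub>R u x + s *\<^sub>R v x)
      (\<lambda>x. r *\<^sub>R weak_jacobian G u x + s *\<^sub>R weak_jacobian G v x)"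
    using assms by (intro has_weak_jacobian_linear[OF open_G] Vspace_jacobian)
  moreover have "square_integrable_on G (\<lambda>x. r *\<^sub>R weak_jacobian G u x + s *\<^sub>R weak_jacobian G v x)"
  proof -
    have "r *\<^sub>R weak_jacobian G u + s *\<^sub>R weak_jacobian G v \<in> {u. square_integrable_on G u}"
      using Vspace_jacobian(2)[OF u] Vspace_jacobian(2)[OF v] by (intro mem) simp_all
    then show ?thesis by (simp add: plus_fun_def scaleR_fun_def)
  qed
  moreover have "r *\<^sub>R u + s *\<^sub>R v \<in> carr (Hspace G)"
    using assms by (intro H.mem Vspace_Hspace)
  ultimately show "(\<lambda>x. r *\<^sub>R u x + s *\<^sub>R v x) \<in> carr (Vspace G)"
    by (auto simp: Vspace_carr plus_fun_def scaleR_fun_def)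
  show "AE x in lebesgue_on G. weak_jacobian G (\<lambda>x. r *\<^sub>R u x + s *\<^sub>R v x) x =
      r *\<^sub>R weak_jacobian G u x + s *\<^sub>R weak_jacobian G v x"
    by (rule weak_jacobian_AE[OF J])
qed

lemma Vspace_add:
  assumes u: "u \<in> carr (Vspace G)" and v: "v \<in> carr (Vspace G)"
  shows "u + v \<in> carr (Vspace G)"
    "AE x in lebesgue_on G. weak_jacobian G (u + v) x = weak_jacobian G u x + weak_jacobian G v x"
  using Vspace_linear[OF u v, of 1 1] by (simp_all add: plus_fun_def)

lemma Vspace_scale:
  assumes u: "u \<in> carr (Vspace G)"
  shows "r *\<^sub>R u \<in> carr (Vspace G)"
    "AE x in lebesgue_on G. weak_jacobian G (r *\<^sub>R u) x = r *\<^sub>R weak_jacobian G u x"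
  using Vspace_linear[OF u u, of r 0] by (simp_all add: scaleR_fun_def)

lemma ip_cong_AE:
  fixes u v w :: "real^'d \<Rightarrow> 'b::euclidean_space"
  assumes "AE x in lebesgue_on G. u x = w x" "square_integrable_on G u" "square_integrable_on G v"
  shows "ip u v = ip w v"
  unfolding ip_def
proof (rule integral_cong_AE)
  have w: "square_integrable_on G w" by (rule square_integrable_AE_eq[OF assms(2,1)])
  show "(\<lambda>x. u x \<bullet> v x) \<in> borel_measurable (lebesgue_on G)" "(\<lambda>x. w x \<bullet> v x) \<in> borel_measurable (lebesgue_on G)"
    using integrable_inner[OF assms(2,3)] integrable_inner[OF w assms(3)] by auto
  show "AE x in lebesgue_on G. u x \<bullet> v x = w x \<bullet> v x"
    using assms(1) by eventually_elim simp
qed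

lemma inner_carrier_Vspace: "inner_carrier (Vspace G :: (real^'d \<Rightarrow> real^'k) space_rec) ipV"
proof -
  interpret H: inner_carrier "Hspace G :: (real^'d \<Rightarrow> real^'k) space_rec" ip by (rule inner_carrier_Hspace)
  interpret L: semi_inner "{u :: real^'d \<Rightarrow> real^'d^'k. square_integrable_on G u}" ip by (rule ip_semi_inner)
  note sq = Vspace_jacobian(2)
  note H = Vspace_Hspace
  show ?thesis
  proof
    fix u v w :: "real^'d \<Rightarrow> real^'k" and r :: real
    show "snorm (Vspace G) u = sqrt (ipV u u)"
      by (simp add: Vspace_def ipV_def ip_def power2_norm_eq_inner)
    show "subspace (carr (Vspace G :: (real^'d \<Rightarrow> real^'k) space_rec))"
      unfolding subspace_def
    proof (intro conjI ballI allI)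
      show "0 \<in> carr (Vspace G :: (real^'d \<Rightarrow> real^'k) space_rec)"
      proof -
        have "has_weak_jacobian G 0 (\<lambda>x. 0 :: real^'d^'k)"
        proof -
          have "column j (0 :: real^'d^'k) = 0" for j by (simp add: column_def vec_eq_iff)
          then show ?thesis
            by (simp add: has_weak_jacobian_def has_weak_deriv_def locally_integrable_def
                zero_fun_def set_integrable_def)
        qed
        then show ?thesis
          unfolding Vspace_carr using H.mem(1) square_integrable_const[of 0] by blast
      qed
    qed (use Vspace_add(1) Vspace_scale(1) in blast)+
    assume u: "u \<in> carr (Vspace G)"
    show "0 \<le> ipV u u"
      unfolding ipV_def using H.nonneg[OF H[OF u]] L.nonneg[of "weak_jacobian G u"] sq[OF u] by simp
    assume w: "w \<in> carr (Vspace G)"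
    show "ipV u w = ipV w u"
      unfolding ipV_def using H.commute[OF H[OF u] H[OF w]] L.commute[of "weak_jacobian G u" "weak_jacobian G w"] sq[OF u] sq[OF w] by simp
    have "ip (weak_jacobian G (r *\<^sub>R u)) (weak_jacobian G w) = ip (r *\<^sub>R weak_jacobian G u) (weak_jacobian G w)"
      using Vspace_scale[OF u, of r] by (intro ip_cong_AE sq w) (simp_all add: scaleR_fun_def)
    then show "ipV (r *\<^sub>R u) w = r * ipV u w"
      unfolding ipV_def using H.scale_left[OF H[OF u] H[OF w], of r] L.scale_left[of "weak_jacobian G u" "weak_jacobian G w" r] sq[OF u] sq[OF w]
      by (simp add: distrib_left)
    assume v: "v \<in> carr (Vspace G)"
    have "ip (weak_jacobian G (u + v)) (weak_jacobian G w) = ip (weak_jacobian G u + weak_jacobian G v) (weak_jacobian G w)"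
      using Vspace_add[OF u v] by (intro ip_cong_AE sq w) (simp_all add: plus_fun_def)
    then show "ipV (u + v) w = ipV u w + ipV v w"
      unfolding ipV_def using H.add_left[OF H[OF u] H[OF v] H[OF w]] L.add_left[of "weak_jacobian G u" "weak_jacobian G v" "weak_jacobian G w"] sq[OF u] sq[OF v] sq[OF w]
      by simp
  qed
qed

lemma Vspace_snorm_bounds:
  assumes u: "u \<in> carr (Vspace G)"
  shows "(LINT x|lebesgue_on G. (norm (u x))\<^sup>2) \<le> (snorm (Vspace G) u)\<^sup>2"
    "(LINT x|lebesgue_on G. (norm (weak_jacobian G u x))\<^sup>2) \<le> (snorm (Vspace G) u)\<^sup>2"
    "snorm (Hspace G) u \<le> snorm (Vspace G) u"
  using assms by (auto simp: Vspace_def Hspace_snorm integral_nonneg_AE)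

lemma square_integrable_column:
  fixes J :: "real^'d \<Rightarrow> real^'d^'k"
  assumes "square_integrable_on G J" shows "square_integrable_on G (\<lambda>x. column j (J x))"
proof (rule square_integrable_bounded_mult[OF assms, where C = 1])
  have "bounded_linear (column j :: real^'d^'k \<Rightarrow> real^'k)"
    by (rule linear_conv_bounded_linear[THEN iffD1, OF linear_column])
  then show "(\<lambda>x. column j (J x)) \<in> borel_measurable (lebesgue_on G)"
    using assms unfolding square_integrable_on_def
    by (elim conjE) (rule measurable_compose[OF _ borel_measurable_continuous_onI[OF linear_continuous_on]])
qed (simp add: norm_column_le)

text \<open>For a fixed test function both sides of the defining identity are L^2 pairings with
  bounded functions, and such pairings are continuous. Products with a fixed vector \<open>c\<close>
  reduce the vector-valued integrals to \<open>ip\<close>.\<close>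

lemma has_weak_deriv_limit:
  fixes f g :: "nat \<Rightarrow> real^'d \<Rightarrow> real^'k"
  assumes b: "b \<in> Basis" and fg: "\<And>n. has_weak_deriv G b (f n) (g n)"
    and f: "\<And>n. square_integrable_on G (f n)" "square_integrable_on G u"
      "(\<lambda>n. LINT x|lebesgue_on G. (norm (f n x - u x))\<^sup>2) \<longlonglongrightarrow> 0"
    and g: "\<And>n. square_integrable_on G (g n)" "square_integrable_on G w"
      "(\<lambda>n. LINT x|lebesgue_on G. (norm (g n x - w x))\<^sup>2) \<longlonglongrightarrow> 0"
  shows "has_weak_deriv G b u w"
  unfolding has_weak_deriv_def
proof (intro conjI ballI)
  show l: "locally_integrable G u" "locally_integrable G w"
    using f g by (auto intro: square_integrable_imp_locally_integrable)
  fix \<phi> assume \<phi>: "\<phi> \<in> test_functions G"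
  obtain K where K: "compact K" "K \<subseteq> G" "\<And>x. x \<notin> K \<Longrightarrow> \<phi> x = 0" "\<And>x. x \<notin> K \<Longrightarrow> dir_deriv b \<phi> x = 0"
    "continuous_on UNIV \<phi>" "continuous_on UNIV (dir_deriv b \<phi>)"
    using test_functionD[OF \<phi>] b by metis
  have sq: "square_integrable_on G (\<lambda>x. \<psi> x *\<^sub>R c)" if \<psi>: "continuous_on UNIV \<psi>" "\<And>x. x \<notin> K \<Longrightarrow> \<psi> x = 0"
    for \<psi> :: "real^'d \<Rightarrow> real" and c :: "real^'k"
  proof -
    obtain B where B: "\<And>x. x \<in> K \<Longrightarrow> \<bar>\<psi> x\<bar> \<le> B"
      using compact_imp_bounded[OF compact_continuous_image[OF continuous_on_subset[OF \<psi>(1) subset_UNIV] K(1)]]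
      by (metis bounded_iff image_eqI real_norm_def)
    have le: "\<bar>\<psi> x\<bar> \<le> \<bar>B\<bar>" for x using B[of x] \<psi>(2)[of x] by (cases "x \<in> K") auto
    show ?thesis
    proof (rule square_integrable_bounded_mult[OF square_integrable_const[of c], where C = "\<bar>B\<bar>"])
      have "\<psi> \<in> borel_measurable borel" using \<psi>(1) by (rule borel_measurable_continuous_onI)
      then have "\<psi> \<in> borel_measurable (lebesgue_on G)"
        by (intro measurable_restrict_space1 measurable_completion) simp
      then show "(\<lambda>x. \<psi> x *\<^sub>R c) \<in> borel_measurable (lebesgue_on G)"
        by (intro borel_measurable_scaleR) auto
      show "AE x in lebesgue_on G. norm (\<psi> x *\<^sub>R c) \<le> \<bar>B\<bar> * norm c"
        using le by (intro AE_I2) (simp add: mult_right_mono)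
    qed
  qed
  have pair: "(LINT x|lebesgue_on G. \<psi> x *\<^sub>R h x) \<bullet> c = ip h (\<lambda>x. \<psi> x *\<^sub>R c)"
    if \<psi>: "continuous_on UNIV \<psi>" "\<And>x. x \<notin> K \<Longrightarrow> \<psi> x = 0" and h: "square_integrable_on G h"
    for \<psi> :: "real^'d \<Rightarrow> real" and h and c :: "real^'k"
  proof -
    have "integrable (lebesgue_on G) (\<lambda>x. \<psi> x *\<^sub>R h x)"
      by (rule continuous_compact_mult_integrable[OF sets_G square_integrable_imp_locally_integrable[OF h] \<psi>(1) K(1,2) \<psi>(2)])
    then have "(LINT x|lebesgue_on G. \<psi> x *\<^sub>R h x) \<bullet> c = (LINT x|lebesgue_on G. (\<psi> x *\<^sub>R h x) \<bullet> c)"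
      by (intro integral_inner_left[symmetric])
    then show ?thesis by (simp add: ip_def)
  qed
  show "(LINT x|lebesgue_on G. dir_deriv b \<phi> x *\<^sub>R u x) = - (LINT x|lebesgue_on G. \<phi> x *\<^sub>R w x)"
  proof (rule euclidean_eqI)
    fix c :: "real^'k"
    have "(\<lambda>n. ip (f n) (\<lambda>x. dir_deriv b \<phi> x *\<^sub>R c)) \<longlonglongrightarrow> ip u (\<lambda>x. dir_deriv b \<phi> x *\<^sub>R c)"
      by (rule square_integrable_tendsto_ip[OF f(1,2) sq[OF K(6,4)] f(3)])
    moreover have "(\<lambda>n. - ip (g n) (\<lambda>x. \<phi> x *\<^sub>R c)) \<longlonglongrightarrow> - ip w (\<lambda>x. \<phi> x *\<^sub>R c)"
      by (rule tendsto_minus[OF square_integrable_tendsto_ip[OF g(1,2) sq[OF K(5,3)] g(3)]])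
    moreover have "ip (f n) (\<lambda>x. dir_deriv b \<phi> x *\<^sub>R c) = - ip (g n) (\<lambda>x. \<phi> x *\<^sub>R c)" for n
      using fg[of n] \<phi> pair[OF K(6,4) f(1), of n c] pair[OF K(5,3) g(1), of n c]
      by (simp add: has_weak_deriv_def)
    ultimately have "ip u (\<lambda>x. dir_deriv b \<phi> x *\<^sub>R c) = - ip w (\<lambda>x. \<phi> x *\<^sub>R c)"
      by (simp add: LIMSEQ_unique)
    then show "(LINT x|lebesgue_on G. dir_deriv b \<phi> x *\<^sub>R u x) \<bullet> c = - (LINT x|lebesgue_on G. \<phi> x *\<^sub>R w x) \<bullet> c"
      using pair[OF K(6,4) f(2), of c] pair[OF K(5,3) g(2), of c] by simp
  qed
qed

text \<open>Functions and gradients converge separately in L^2(G); closedness of weak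
  differentiation identifies the limit of the gradients as the gradient of the limit.\<close>

lemma complete_Vspace: "complete_seminormed (Vspace G :: (real^'d \<Rightarrow> real^'k) space_rec)"
proof -
  interpret V: inner_carrier "Vspace G :: (real^'d \<Rightarrow> real^'k) space_rec" ipV by (rule inner_carrier_Vspace)
  interpret seminormed "Vspace G :: (real^'d \<Rightarrow> real^'k) space_rec" by (rule V.seminormed)
  interpret H: complete_seminormed "Hspace G :: (real^'d \<Rightarrow> real^'k) space_rec" by (rule complete_Hspace)
  show ?thesis
  proof
    fix f :: "nat \<Rightarrow> real^'d \<Rightarrow> real^'k"
    assume f: "\<And>n. f n \<in> carr (Vspace G)"
      and Cauchy: "\<And>e. 0 < e \<Longrightarrow> \<exists>N. \<forall>m\<ge>N. \<forall>n\<ge>N. snorm (Vspace G) (f m - f n) < e"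
    let ?D = "weak_jacobian G"
    have D_diff: "(LINT x|lebesgue_on G. (norm (?D v x - J x))\<^sup>2) = (LINT x|lebesgue_on G. (norm (?D (v - w) x))\<^sup>2)"
      if v: "v \<in> carr (Vspace G)" and w: "w \<in> carr (Vspace G)" and J: "AE x in lebesgue_on G. ?D w x = J x"
      for v w :: "real^'d \<Rightarrow> real^'k" and J
    proof (rule integral_cong_AE)
      have "AE x in lebesgue_on G. ?D (v - w) x = ?D v x - ?D w x"
        using Vspace_linear(2)[OF v w, of 1 "-1"] by (simp add: fun_diff_def)
      then show ae: "AE x in lebesgue_on G. (norm (?D v x - J x))\<^sup>2 = (norm (?D (v - w) x))\<^sup>2"
        using J by eventually_elim simp
      show m: "(\<lambda>x. (norm (?D (v - w) x))\<^sup>2) \<in> borel_measurable (lebesgue_on G)"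
        using Vspace_jacobian(2)[OF mem(3)[OF v w]] unfolding square_integrable_on_def
        by (elim conjE) (rule borel_measurable_integrable)
      show "(\<lambda>x. (norm (?D v x - J x))\<^sup>2) \<in> borel_measurable (lebesgue_on G)"
        by (rule measurable_AE_eq[OF m]) (use ae in \<open>eventually_elim, simp\<close>)
    qed
    have "\<exists>N. \<forall>m\<ge>N. \<forall>n\<ge>N. snorm (Hspace G) (f m - f n) < e" if "0 < e" for e
    proof -
      obtain N where N: "\<And>m n. m \<ge> N \<Longrightarrow> n \<ge> N \<Longrightarrow> snorm (Vspace G) (f m - f n) < e"
        using Cauchy[OF \<open>0 < e\<close>] by blast
      have "snorm (Hspace G) (f m - f n) < e" if "m \<ge> N" "n \<ge> N" for m n
        using N[OF that] Vspace_snorm_bounds(3)[OF mem(3)[OF f f], of m n] by simp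
      then show ?thesis by blast
    qed
    note HC = this
    have "\<exists>u\<in>carr (Hspace G). (\<lambda>n. snorm (Hspace G) (f n - u)) \<longlonglongrightarrow> 0"
      by (rule H.complete[OF Vspace_Hspace[OF f] HC])
    then obtain u where u: "u \<in> carr (Hspace G)" "(\<lambda>n. snorm (Hspace G) (f n - u)) \<longlonglongrightarrow> 0" by blast
    have u2: "(\<lambda>n. LINT x|lebesgue_on G. (norm (f n x - u x))\<^sup>2) \<longlonglongrightarrow> 0"
      using tendsto_power[OF u(2), of 2] by (simp add: Hspace_snorm integral_nonneg_AE)
    have DC: "\<exists>N. \<forall>m\<ge>N. \<forall>n\<ge>N. (LINT x|lebesgue_on G. (norm (?D (f m) x - ?D (f n) x))\<^sup>2) < e" if "0 < e" for e
    proof -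
      obtain N where N: "\<And>m n. m \<ge> N \<Longrightarrow> n \<ge> N \<Longrightarrow> snorm (Vspace G) (f m - f n) < sqrt e"
        using Cauchy[of "sqrt e"] \<open>0 < e\<close> by auto
      have "(LINT x|lebesgue_on G. (norm (?D (f m) x - ?D (f n) x))\<^sup>2) < e" if "m \<ge> N" "n \<ge> N" for m n
      proof -
        have "(snorm (Vspace G) (f m - f n))\<^sup>2 < (sqrt e)\<^sup>2"
          using N[OF that] snorm_nonneg[OF mem(3)[OF f f]] by (intro power_strict_mono) auto
        then show ?thesis
          using D_diff[OF f f, of n "?D (f n)" m] Vspace_snorm_bounds(2)[OF mem(3)[OF f f], of m n] \<open>0 < e\<close> by simp
      qed
      then show ?thesis by blast
    qed
    have "\<exists>J. square_integrable_on G J \<and> (\<lambda>n. LINT x|lebesgue_on G. (norm (?D (f n) x - J x))\<^sup>2) \<longlonglongrightarrow> 0"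
      by (rule square_integrable_complete[OF Vspace_jacobian(2)[OF f] DC])
    then obtain J where J: "square_integrable_on G J"
      "(\<lambda>n. LINT x|lebesgue_on G. (norm (?D (f n) x - J x))\<^sup>2) \<longlonglongrightarrow> 0" by blast
    have uJ: "has_weak_jacobian G u J"
      unfolding has_weak_jacobian_def
    proof
      fix j
      show "has_weak_deriv G (axis j 1) u (\<lambda>x. column j (J x))"
      proof (rule has_weak_deriv_limit)
        show "has_weak_deriv G (axis j 1) (f n) (\<lambda>x. column j (?D (f n) x))" for n
          using Vspace_jacobian(1)[OF f[of n]] by (simp add: has_weak_jacobian_def)
        show "square_integrable_on G (f n)" "square_integrable_on G u" for n
          using Vspace_Hspace[OF f[of n]] u(1) by (simp_all add: Hspace_carr)
        show "square_integrable_on G (\<lambda>x. column j (?D (f n) x))" "square_integrable_on G (\<lambda>x. column j (J x))" for n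
          by (intro square_integrable_column Vspace_jacobian(2) f J(1))+
        show "(\<lambda>n. LINT x|lebesgue_on G. (norm (column j (?D (f n) x) - column j (J x)))\<^sup>2) \<longlonglongrightarrow> 0"
        proof (rule null_squeeze[OF _ _ J(2)])
          interpret L: semi_inner "{u :: real^'d \<Rightarrow> real^'d^'k. square_integrable_on G u}" ip by (rule ip_semi_inner)
          fix n
          have d: "square_integrable_on G (\<lambda>x. ?D (f n) x - J x)"
            using L.mem(3)[of "?D (f n)" J] Vspace_jacobian(2)[OF f[of n]] J(1) by (simp add: fun_diff_def)
          have cd: "column j (?D (f n) x) - column j (J x) = column j (?D (f n) x - J x)" for x
            by (simp add: linear_diff[OF linear_column])
          show "(LINT x|lebesgue_on G. (norm (column j (?D (f n) x) - column j (J x)))\<^sup>2)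
              \<le> (LINT x|lebesgue_on G. (norm (?D (f n) x - J x))\<^sup>2)"
            unfolding cd using d square_integrable_column[OF d, of j]
            by (intro integral_mono) (auto simp: square_integrable_on_def intro: power_mono norm_column_le)
        qed (simp add: integral_nonneg_AE)
        show "axis j 1 \<in> (Basis :: (real^'d) set)" by simp
      qed (rule u2)
    qed
    have uV: "u \<in> carr (Vspace G)" unfolding Vspace_carr using u(1) uJ J(1) by blast
    have "(\<lambda>n. snorm (Vspace G) (f n - u)) \<longlonglongrightarrow> 0"
    proof -
      have "snorm (Vspace G) (f n - u) = sqrt ((LINT x|lebesgue_on G. (norm (f n x - u x))\<^sup>2) +
          (LINT x|lebesgue_on G. (norm (?D (f n) x - J x))\<^sup>2))" for n
        using D_diff[OF f uV weak_jacobian_AE[OF uJ], of n] by (simp add: Vspace_def)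
      then show ?thesis
        using tendsto_real_sqrt[OF tendsto_add[OF u2 J(2)]] by simp
    qed
    then show "\<exists>l\<in>carr (Vspace G). (\<lambda>n. snorm (Vspace G) (f n - l)) \<longlonglongrightarrow> 0"
      using uV by blast
  qed
qed

end

section \<open>Integration by parts and weak divergence\<close>

lemma integral_lebesgue_on_eq_lborel:
  fixes f :: "'a::euclidean_space \<Rightarrow> real"
  assumes "S \<in> sets lebesgue" "f \<in> borel_measurable borel" "\<And>x. x \<notin> S \<Longrightarrow> f x = 0"
  shows "(LINT x|lebesgue_on S. f x) = (LINT x|lborel. f x)"
proof -
  have "(LINT x|lebesgue_on S. f x) = (LINT x|lebesgue. indicator S x *\<^sub>R f x)"
    by (rule integral_restrict_space) (use assms(1) in simp)
  also have "\<dots> = (LINT x|lebesgue. f x)"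
    using assms(3) by (intro Bochner_Integration.integral_cong refl) (auto simp: indicator_def)
  also have "\<dots> = (LINT x|lborel. f x)" by (rule integral_completion) (use assms(2) in simp)
  finally show ?thesis .
qed

lemma dir_deriv_mult:
  assumes "f differentiable at x" "g differentiable at x"
  shows "dir_deriv b (\<lambda>x. f x * g x) x = f x * dir_deriv b g x + dir_deriv b f x * g x"
proof -
  have "((\<lambda>x. f x * g x) has_derivative
      (\<lambda>h. f x * frechet_derivative g (at x) h + frechet_derivative f (at x) h * g x)) (at x)"
    using assms by (intro has_derivative_mult) (simp_all flip: frechet_derivative_works)
  then show ?thesis by (simp add: dir_deriv_def flip: frechet_derivative_at)
qed

lemma test_function_integral_dir_deriv:
  fixes \<psi> :: "'a::euclidean_space \<Rightarrow> real"
  assumes S: "S \<in> sets lebesgue" and \<psi>: "\<psi> \<in> test_functions S" and b: "b \<in> Basis"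
  shows "(LINT x|lebesgue_on S. dir_deriv b \<psi> x) = 0"
proof -
  obtain K where K: "compact K" "K \<subseteq> S" "\<And>x. x \<notin> K \<Longrightarrow> \<psi> x = 0"
    "\<And>b x. x \<notin> K \<Longrightarrow> dir_deriv b \<psi> x = 0" "smooth \<psi>"
    "continuous_on UNIV \<psi>" "\<And>b. b \<in> Basis \<Longrightarrow> continuous_on UNIV (dir_deriv b \<psi>)"
    using test_functionD[OF \<psi>] by metis
  obtain R where R: "\<And>x. x \<in> K \<Longrightarrow> norm x \<le> R"
    using compact_imp_bounded[OF K(1)] by (auto simp: bounded_iff)
  have "(LINT x|lebesgue_on S. dir_deriv b \<psi> x) = (LINT x|lborel. dir_deriv b \<psi> x)"
    using K(2,4) by (intro integral_lebesgue_on_eq_lborel S borel_measurable_continuous_onI K(7) b) auto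
  also have "\<dots> = 0"
  proof (rule integral_dir_deriv_eq_0[OF smooth_differentiable[OF K(5)] K(7)[OF b]])
    show "\<psi> x = 0" if "x \<notin> cball 0 R" for x
      using that R[of x] by (intro K(3)) auto
  qed (use b in simp)
  finally show ?thesis .
qed

text \<open>The product of the two functions has compact support, so the integral of its derivative
  vanishes. This is what makes the classical gradient of a test function its weak gradient.\<close>

lemma test_function_integration_by_parts:
  fixes \<phi> \<psi> :: "'a::euclidean_space \<Rightarrow> real"
  assumes S: "S \<in> sets lebesgue" and \<psi>: "\<psi> \<in> test_functions S" and \<phi>: "\<phi> \<in> test_functions S" and b: "b \<in> Basis"
  shows "(LINT x|lebesgue_on S. dir_deriv b \<psi> x * \<phi> x) = - (LINT x|lebesgue_on S. \<psi> x * dir_deriv b \<phi> x)"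
proof -
  obtain K where K: "compact K" "K \<subseteq> S" "\<And>x. x \<notin> K \<Longrightarrow> \<psi> x = 0"
    "\<And>b x. x \<notin> K \<Longrightarrow> dir_deriv b \<psi> x = 0" "smooth \<psi>"
    "continuous_on UNIV \<psi>" "\<And>b. b \<in> Basis \<Longrightarrow> continuous_on UNIV (dir_deriv b \<psi>)"
    using test_functionD[OF \<psi>] by metis
  obtain K' where K': "smooth \<phi>" "continuous_on UNIV \<phi>" "\<And>b. b \<in> Basis \<Longrightarrow> continuous_on UNIV (dir_deriv b \<phi>)"
    using test_functionD[OF \<phi>] by metis
  have loc: "locally_integrable S f" if f: "continuous_on UNIV f" for f :: "'a \<Rightarrow> real"
    unfolding locally_integrable_def
  proof (intro allI impI)
    fix C assume "compact C \<and> C \<subseteq> S"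
    then have "integrable lborel (\<lambda>x. indicator C x *\<^sub>R f x)"
      using f by (intro borel_integrable_compact) (auto intro: continuous_on_subset)
    then have "integrable lebesgue (\<lambda>x. indicator C x *\<^sub>R f x)"
      by (subst integrable_completion) auto
    then show "f absolutely_integrable_on C" by (simp add: set_integrable_def)
  qed
  have int: "integrable (lebesgue_on S) (\<lambda>x. dir_deriv b \<psi> x * \<phi> x)"
    "integrable (lebesgue_on S) (\<lambda>x. \<psi> x * dir_deriv b \<phi> x)"
    using continuous_compact_mult_integrable[OF S loc[OF K'(2)] K(7)[OF b] K(1,2,4)]
      continuous_compact_mult_integrable[OF S loc[OF K'(3)[OF b]] K(6) K(1,2,3)] by simp_all
  obtain R where R: "\<And>x. x \<in> K \<Longrightarrow> norm x \<le> R"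
    using compact_imp_bounded[OF K(1)] by (auto simp: bounded_iff)
  have diff: "\<psi> differentiable at x" "\<phi> differentiable at x" for x
    using smooth_differentiable K(5) K'(1) by blast+
  have prod: "dir_deriv b (\<lambda>x. \<psi> x * \<phi> x) = (\<lambda>x. \<psi> x * dir_deriv b \<phi> x + dir_deriv b \<psi> x * \<phi> x)"
    by (rule ext) (rule dir_deriv_mult[OF diff])
  have cont: "continuous_on UNIV (dir_deriv b (\<lambda>x. \<psi> x * \<phi> x))"
    unfolding prod by (intro continuous_intros K(6) K(7) K'(2) K'(3) b)
  have "(LINT x|lebesgue_on S. dir_deriv b (\<lambda>x. \<psi> x * \<phi> x) x) = (LINT x|lborel. dir_deriv b (\<lambda>x. \<psi> x * \<phi> x) x)"
  proof (rule integral_lebesgue_on_eq_lborel[OF S borel_measurable_continuous_onI[OF cont]])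
    fix x assume "x \<notin> S"
    then have "x \<notin> K" using K(2) by blast
    then show "dir_deriv b (\<lambda>x. \<psi> x * \<phi> x) x = 0" by (simp add: prod K(3,4))
  qed
  also have "\<dots> = 0"
  proof (rule integral_dir_deriv_eq_0[OF _ cont])
    show "(\<lambda>x. \<psi> x * \<phi> x) differentiable at x" for x by (intro differentiable_mult diff)
    show "\<psi> x * \<phi> x = 0" if "x \<notin> cball 0 R" for x
    proof -
      have "x \<notin> K" using that R[of x] by auto
      then show ?thesis by (simp add: K(3))
    qed
  qed (use b in simp)
  finally show ?thesis using int by (simp add: prod)
qed

context bounded_domain
begin

lemma square_integrable_linear:
  "square_integrable_on G A \<Longrightarrow> square_integrable_on G B \<Longrightarrow> square_integrable_on G (\<lambda>x. A x + B x)"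
  "square_integrable_on G A \<Longrightarrow> square_integrable_on G B \<Longrightarrow> square_integrable_on G (\<lambda>x. A x - B x)"
proof -
  interpret E: semi_inner "{A :: real^'d \<Rightarrow> 'b::euclidean_space. square_integrable_on G A}" ip by (rule ip_semi_inner)
  show "square_integrable_on G A \<Longrightarrow> square_integrable_on G B \<Longrightarrow> square_integrable_on G (\<lambda>x. A x + B x)"
    "square_integrable_on G A \<Longrightarrow> square_integrable_on G B \<Longrightarrow> square_integrable_on G (\<lambda>x. A x - B x)"
    for A B :: "real^'d \<Rightarrow> 'b"
    using E.mem(2,3)[of A B] by (simp_all add: plus_fun_def fun_diff_def)
qed

lemma square_integrable_continuous_compact:
  fixes f :: "real^'d \<Rightarrow> real"
  assumes f: "continuous_on UNIV f" and K: "compact K" "\<And>x. x \<notin> K \<Longrightarrow> f x = 0"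
  shows "square_integrable_on G (\<lambda>x. f x *\<^sub>R (c :: 'b::euclidean_space))"
proof -
  obtain B where "\<forall>x\<in>K. \<bar>f x\<bar> \<le> B"
    using compact_imp_bounded[OF compact_continuous_image[OF continuous_on_subset[OF f subset_UNIV] K(1)]]
    by (auto simp: bounded_iff)
  then have B: "\<bar>f x\<bar> \<le> max 0 B" for x using K(2)[of x] by (cases "x \<in> K") auto
  have "f \<in> borel_measurable lborel" using f by (simp add: borel_measurable_continuous_onI)
  then have m: "f \<in> borel_measurable (lebesgue_on G)"
    by (intro measurable_restrict_space1 measurable_completion)
  show ?thesis
  proof (rule square_integrable_bounded_mult[OF square_integrable_const])
    show "(\<lambda>x. f x *\<^sub>R c) \<in> borel_measurable (lebesgue_on G)" using m by simp
    show "AE x in lebesgue_on G. norm (f x *\<^sub>R c) \<le> max 0 B * norm c"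
      using B by (intro AE_I2) (auto intro!: mult_right_mono)
  qed
qed

lemma square_integrable_mean_free:
  fixes v :: "real^'d \<Rightarrow> real^'k"
  assumes v: "square_integrable_on G v"
  shows "\<exists>c. (\<lambda>x. v x - c) \<in> carr (Hspace G)"
proof -
  let ?m = "measure (lebesgue_on G) (space (lebesgue_on G))"
  let ?c = "inverse ?m *\<^sub>R (LINT x|lebesgue_on G. v x)"
  have "(LINT x|lebesgue_on G. v x - ?c) = (LINT x|lebesgue_on G. v x) - ?m *\<^sub>R ?c"
    using square_integrable_integrable[OF v] by simp
  also have "\<dots> = 0"
  \<comment> \<open>\<open>inverse 0 = 0\<close>: on a null domain nothing is subtracted, but there
    the integral is already 0.\<close>
  proof (cases "?m = 0")
    case True
    then have "emeasure (lebesgue_on G) (space (lebesgue_on G)) = 0" by (simp add: emeasure_eq_measure)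
    then have "AE x in lebesgue_on G. v x = 0" by (intro AE_I[of _ _ "space (lebesgue_on G)"]) auto
    then show ?thesis using True by (simp add: integral_eq_zero_AE)
  qed simp
  finally show ?thesis
    using square_integrable_linear(2)[OF v square_integrable_const[of ?c]]
    by (intro exI[of _ ?c]) (simp add: Hspace_carr)
qed

text \<open>Test functions become admissible in the weak formulation after subtraction of their mean,
  which changes neither the gradient nor, as \<open>g\<close> is mean-free, the pairing with \<open>g\<close>.\<close>
lemma has_weak_divergence_if_weak_form:
  fixes A :: "real^'d \<Rightarrow> real^'d^'k" and g :: "real^'d \<Rightarrow> real^'k"
  assumes A: "square_integrable_on G A" and g: "g \<in> carr (Hspace G)"
    and weak: "\<And>v. v \<in> carr (Vspace G) \<Longrightarrow> ip g v + ip A (weak_jacobian G v) = 0"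
  shows "has_weak_divergence G A g"
  unfolding has_weak_divergence_def
proof (intro conjI ballI allI)
  have g2: "square_integrable_on G g" and g0: "(LINT x|lebesgue_on G. g x) = 0"
    using g by (auto simp: Hspace_carr)
  show "locally_integrable G A" "locally_integrable G g"
    using A g2 by (auto intro: square_integrable_imp_locally_integrable)
  fix \<phi> i assume \<phi>: "\<phi> \<in> test_functions G"
  obtain K where K: "compact K" "K \<subseteq> G" "\<And>x. x \<notin> K \<Longrightarrow> \<phi> x = 0"
    "\<And>b x. x \<notin> K \<Longrightarrow> dir_deriv b \<phi> x = 0" "smooth \<phi>"
    "continuous_on UNIV \<phi>" "\<And>b. b \<in> Basis \<Longrightarrow> continuous_on UNIV (dir_deriv b \<phi>)"
    using test_functionD[OF \<phi>] by metis
  let ?e = "axis i 1 :: real^'k"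
  have \<phi>2: "square_integrable_on G (\<lambda>x. \<phi> x *\<^sub>R ?e)"
    by (rule square_integrable_continuous_compact[OF K(6,1,3)])
  obtain c where c: "(\<lambda>x. \<phi> x *\<^sub>R ?e - c) \<in> carr (Hspace G)"
    using square_integrable_mean_free[OF \<phi>2] by blast
  define v where "v = (\<lambda>x. \<phi> x *\<^sub>R ?e - c)"
  \<comment> \<open>The classical Jacobian of \<open>v\<close>: row \<open>i\<close> is the gradient
    of \<phi>, all other rows vanish.\<close>
  define J :: "real^'d \<Rightarrow> real^'d^'k" where
    "J x = (\<Sum>j\<in>UNIV. dir_deriv (axis j 1) \<phi> x *\<^sub>R axis i (axis j 1))" for x
  have J2: "square_integrable_on G J"
  proof -
    interpret E: semi_inner "{A :: real^'d \<Rightarrow> real^'d^'k. square_integrable_on G A}" ip by (rule ip_semi_inner)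
    have "(\<lambda>x. \<Sum>j\<in>I. dir_deriv (axis j 1) \<phi> x *\<^sub>R axis i (axis j 1) :: real^'d^'k)
        \<in> {A. square_integrable_on G A}" if "finite I" for I :: "'d set"
      using that
    proof (induction I rule: finite_induct)
      case empty
      then show ?case by (simp add: square_integrable_const)
    next
      case (insert j I)
      then show ?case
        using square_integrable_linear(1)[OF square_integrable_continuous_compact[OF K(7)[OF axis_1_in_Basis] K(1,4)]]
        by simp
    qed
    from this[of UNIV] show ?thesis by (simp add: J_def[abs_def])
  qed
  have Jcol: "column j (J x) = dir_deriv (axis j 1) \<phi> x *\<^sub>R ?e" for j x
    by (simp add: J_def column_def vec_eq_iff axis_def if_distrib[of "\<lambda>y. _ * y"] if_distribR
        if_distrib[of "\<lambda>y. y $ _"] cong: if_cong)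
  have v2: "square_integrable_on G v" using c by (simp add: v_def Hspace_carr)
  have "has_weak_jacobian G v J"
    unfolding has_weak_jacobian_def has_weak_deriv_def Jcol
  proof (intro allI conjI ballI)
    fix j
    show "locally_integrable G v" by (rule square_integrable_imp_locally_integrable[OF v2])
    show "locally_integrable G (\<lambda>x. dir_deriv (axis j 1) \<phi> x *\<^sub>R ?e)"
      by (rule square_integrable_imp_locally_integrable[OF
            square_integrable_continuous_compact[OF K(7)[OF axis_1_in_Basis] K(1,4)]])
    fix \<psi> assume \<psi>: "\<psi> \<in> test_functions G"
    obtain K' where K': "compact K'" "K' \<subseteq> G" "\<And>x. x \<notin> K' \<Longrightarrow> \<psi> x = 0"
      "\<And>b x. x \<notin> K' \<Longrightarrow> dir_deriv b \<psi> x = 0" "smooth \<psi>"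
      "continuous_on UNIV \<psi>" "\<And>b. b \<in> Basis \<Longrightarrow> continuous_on UNIV (dir_deriv b \<psi>)"
      using test_functionD[OF \<psi>] by metis
    have loc: "locally_integrable G \<phi>"
      using square_integrable_imp_locally_integrable[OF square_integrable_continuous_compact[OF K(6,1,3), where c = "1::real"]]
      by simp
    have loc1: "locally_integrable G (\<lambda>x. 1 :: real)"
      by (rule square_integrable_imp_locally_integrable[OF square_integrable_const])
    have i1: "integrable (lebesgue_on G) (\<lambda>x. dir_deriv (axis j 1) \<psi> x * \<phi> x)"
      using continuous_compact_mult_integrable[OF sets_G loc K'(7)[OF axis_1_in_Basis] K'(1,2,4)] by simp
    have i2: "integrable (lebesgue_on G) (dir_deriv (axis j 1) \<psi>)"
      using continuous_compact_mult_integrable[OF sets_G loc1 K'(7)[OF axis_1_in_Basis] K'(1,2,4)] by simp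
    have "(LINT x|lebesgue_on G. dir_deriv (axis j 1) \<psi> x *\<^sub>R v x) =
        (LINT x|lebesgue_on G. (dir_deriv (axis j 1) \<psi> x * \<phi> x) *\<^sub>R ?e - dir_deriv (axis j 1) \<psi> x *\<^sub>R c)"
      by (simp add: v_def scaleR_diff_right)
    also have "\<dots> = (LINT x|lebesgue_on G. (dir_deriv (axis j 1) \<psi> x * \<phi> x) *\<^sub>R ?e)
        - (LINT x|lebesgue_on G. dir_deriv (axis j 1) \<psi> x *\<^sub>R c)"
      by (intro Bochner_Integration.integral_diff integrable_scaleR_left i1 i2)
    also have "\<dots> = (LINT x|lebesgue_on G. dir_deriv (axis j 1) \<psi> x * \<phi> x) *\<^sub>R ?e
        - (LINT x|lebesgue_on G. dir_deriv (axis j 1) \<psi> x) *\<^sub>R c"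
      by (simp only: integral_scaleR_left i1 i2)
    also have "\<dots> = - ((LINT x|lebesgue_on G. \<psi> x * dir_deriv (axis j 1) \<phi> x) *\<^sub>R ?e)"
      using test_function_integration_by_parts[OF sets_G \<psi> \<phi> axis_1_in_Basis[of j]]
        test_function_integral_dir_deriv[OF sets_G \<psi> axis_1_in_Basis[of j]] by simp
    also have "(LINT x|lebesgue_on G. \<psi> x * dir_deriv (axis j 1) \<phi> x) *\<^sub>R ?e =
        (LINT x|lebesgue_on G. (\<psi> x * dir_deriv (axis j 1) \<phi> x) *\<^sub>R ?e)"
    proof (rule integral_scaleR_left[symmetric])
      have "locally_integrable G (dir_deriv (axis j 1) \<phi>)"
        using square_integrable_imp_locally_integrable[OF
            square_integrable_continuous_compact[OF K(7)[OF axis_1_in_Basis] K(1,4), where c = "1::real"]] by simp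
      then show "integrable (lebesgue_on G) (\<lambda>x. \<psi> x * dir_deriv (axis j 1) \<phi> x)"
        using continuous_compact_mult_integrable[where f = "dir_deriv (axis j 1) \<phi>", OF sets_G _ K'(6,1,2,3)] by simp
    qed
    finally show "(LINT x|lebesgue_on G. dir_deriv (axis j 1) \<psi> x *\<^sub>R v x) =
        - (LINT x|lebesgue_on G. \<psi> x *\<^sub>R (dir_deriv (axis j 1) \<phi> x *\<^sub>R ?e))" by simp
  qed
  then have v: "v \<in> carr (Vspace G)" and Jv: "AE x in lebesgue_on G. weak_jacobian G v x = J x"
    using c J2 by (auto simp: Vspace_carr v_def intro: weak_jacobian_AE)
  \<comment> \<open>Pairing with \<open>J\<close> picks out row \<open>i\<close> of
    \<open>A\<close>, which is the left-hand side of the divergence identity; the weak form then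
    exchanges it for a pairing with \<open>g\<close>.\<close>
  have "(LINT x|lebesgue_on G. (\<Sum>j\<in>UNIV. A x $ i $ j * dir_deriv (axis j 1) \<phi> x)) = ip J A"
    unfolding ip_def J_def
    by (intro Bochner_Integration.integral_cong refl) (simp add: inner_sum_left inner_axis' mult.commute)
  also have "\<dots> = ip (weak_jacobian G v) A"
    using Jv by (intro ip_cong_AE J2 A) (auto elim: eventually_mono)
  also have "\<dots> = ip A (weak_jacobian G v)" by (simp add: ip_def inner_commute)
  also have "\<dots> = - ip g v" using weak[OF v] by simp
  also have "ip g v = ip g (\<lambda>x. \<phi> x *\<^sub>R ?e) - ip g (\<lambda>x. c)"
    using integrable_inner[OF g2 \<phi>2] integrable_inner[OF g2 square_integrable_const]
    by (simp add: ip_def v_def inner_diff_right)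
  also have "ip g (\<lambda>x. c) = 0" using integral_eq_ip[OF g2, of c] g0 by simp
  also have "ip g (\<lambda>x. \<phi> x *\<^sub>R ?e) = (LINT x|lebesgue_on G. g x $ i * \<phi> x)"
    by (simp add: ip_def inner_axis mult.commute)
  finally show "(LINT x|lebesgue_on G. (\<Sum>j\<in>UNIV. A x $ i $ j * dir_deriv (axis j 1) \<phi> x)) =
      - (LINT x|lebesgue_on G. g x $ i * \<phi> x)" by simp
qed

end

section \<open>The energy estimate\<close>

text \<open>\<open>X\<close> and \<open>HS\<close> play the roles of \<open>\<V>\<close> and \<open>\<H>\<close>, and \<open>h\<close> is the continuous representative of \<open>f\<close>.\<close>
locale energy_setting = V: inner_carrier X BX + H: semi_inner HS ip
  for X :: "'f::real_vector space_rec" and BX and HS :: "'f set" and ip +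
  fixes T C L :: real and a :: "real \<Rightarrow> 'f \<Rightarrow> 'f \<Rightarrow> real" and f h :: "real \<Rightarrow> 'f"
    and s :: "nat \<Rightarrow> real \<Rightarrow> 'f" and u0 :: 'f
  assumes complete_X: "complete_seminormed X" and sub: "carr X \<subseteq> HS"
    and T: "0 < T" and C: "0 \<le> C" and L: "0 \<le> L"
    and a_inner: "t \<in> {0..T} \<Longrightarrow> semi_inner (carr X) (a t)"
    and a_bound: "t \<in> {0..T} \<Longrightarrow> x \<in> carr X \<Longrightarrow> y \<in> carr X \<Longrightarrow> \<bar>a t x y\<bar> \<le> C * (snorm X x * snorm X y)"
    and a_lip: "t \<in> {0..T} \<Longrightarrow> t' \<in> {0..T} \<Longrightarrow> x \<in> carr X \<Longrightarrow> y \<in> carr X \<Longrightarrow>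
      \<bar>a t x y - a t' x y\<bar> \<le> L * \<bar>t - t'\<bar> * (snorm X x * snorm X y)"
    and f_L2: "f \<in> L2set (lebesgue_on {0<..<T}) X" and f_carr: "f t \<in> carr X"
    and s_simple: "simple_function (lebesgue_on {0<..<T}) (s n)" and s_carr: "s n t \<in> carr X"
    and s_lim: "t \<in> {0<..<T} \<Longrightarrow> (\<lambda>n. snorm X (s n t - f t)) \<longlonglongrightarrow> 0"
    and h_mem: "t \<in> {0..T} \<Longrightarrow> h t \<in> HS"
    and hf: "AE t in lebesgue_on {0<..<T}. ip (h t - f t) (h t - f t) = 0"
    and u0: "u0 \<in> carr X" and h0: "ip (h 0 - u0) (h 0 - u0) = 0"
    and weak: "v \<in> carr X \<Longrightarrow> 0 \<le> t' \<Longrightarrow> t' \<le> t \<Longrightarrow> t \<le> T \<Longrightarrow>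
      ip (h t - h t') v = - (LINT r|lebesgue_on {0<..<T}. indicator {t'<..<t} r * a r (f r) v)"
begin

abbreviation "M \<equiv> lebesgue_on {0<..<T}"

abbreviation "P \<equiv> M \<Otimes>\<^sub>M M"

abbreviation "N t \<equiv> snorm X (f t)"

sublocale M: finite_complete_measure M
  by (rule finite_complete_measure_lebesgue_on) simp

sublocale P: pair_sigma_finite M M ..

sublocale X: complete_seminormed X
  by (rule complete_X)

sublocale B: complete_bochner_space M X ..

lemma space_P: "space P = {0<..<T} \<times> {0<..<T}"
  by (simp add: space_pair_measure)

lemma id_measurable_M: "(\<lambda>t. t) \<in> borel_measurable M"
  by (intro measurable_restrict_space1 measurable_completion) simp

lemma fst_P [measurable]: "fst \<in> borel_measurable P" and snd_P [measurable]: "snd \<in> borel_measurable P"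
  by (auto intro: measurable_compose[OF measurable_fst id_measurable_M]
      measurable_compose[OF measurable_snd id_measurable_M])

lemma N_nonneg: "0 \<le> N t"
  by (rule X.snorm_nonneg[OF f_carr])

lemma N_int: "integrable M N" "integrable M (\<lambda>t. (N t)\<^sup>2)"
  using B.L2set_snorm_integrable[OF f_L2] f_L2 by (auto simp: L2set_def)

lemma a_cont:
  assumes x: "x \<in> carr X" "y \<in> carr X" shows "continuous_on {0..T} (\<lambda>t. a t x y)"
proof (rule lipschitz_on_continuous_on)
  show "(L * (snorm X x * snorm X y))-lipschitz_on {0..T} (\<lambda>t. a t x y)"
  proof (rule lipschitz_onI)
    fix t t' assume "t \<in> {0..T}" "t' \<in> {0..T}"
    then show "dist (a t x y) (a t' x y) \<le> L * (snorm X x * snorm X y) * dist t t'"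
      using a_lip[of t t' x y] x by (simp add: dist_real_def mult_ac)
  qed (intro mult_nonneg_nonneg L X.snorm_nonneg x)
qed

text \<open>For constant arguments the form is continuous in time, hence measurable along \<tau>.
  Simple functions have countably many values, so this can be glued, and the bound of the form
  allows passage to the limit. The time \<tau> is independent of the arguments so that the
  coefficient may be taken at either time of a pair or frozen.\<close>

lemma form_measurable:
  assumes \<tau>: "\<tau> \<in> borel_measurable Q" "\<And>z. z \<in> space Q \<Longrightarrow> \<tau> z \<in> {0..T}"
    and x: "\<And>n. simple_function Q (xs n)" "\<And>n z. xs n z \<in> carr X" "\<And>z. x z \<in> carr X"
      "\<And>z. z \<in> space Q \<Longrightarrow> (\<lambda>n. snorm X (xs n z - x z)) \<longlonglongrightarrow> 0"
    and y: "\<And>n. simple_function Q (ys n)" "\<And>n z. ys n z \<in> carr X" "\<And>z. y z \<in> carr X"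
      "\<And>z. z \<in> space Q \<Longrightarrow> (\<lambda>n. snorm X (ys n z - y z)) \<longlonglongrightarrow> 0"
  shows "(\<lambda>z. a (\<tau> z) (x z) (y z)) \<in> borel_measurable Q"
proof (rule borel_measurable_LIMSEQ_real)
  show "(\<lambda>z. a (\<tau> z) (xs n z) (ys n z)) \<in> borel_measurable Q" for n
  proof -
    have fin: "countable (xs n ` space Q)" "countable (ys n ` space Q)"
      using simple_functionD(1)[OF x(1)] simple_functionD(1)[OF y(1)] by (auto intro: countable_finite)
    have ms: "xs n \<in> measurable Q (count_space (xs n ` space Q))" "ys n \<in> measurable Q (count_space (ys n ` space Q))"
      using simple_functionD[OF x(1)[of n]] simple_functionD[OF y(1)[of n]]
      by (auto simp: measurable_count_space_eq2)
    have 1: "(\<lambda>z. a (\<tau> z) c d) \<in> borel_measurable Q" if "c \<in> carr X" "d \<in> carr X" for c d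
    proof -
      \<comment> \<open>Continuity in time is known on [0,T] only; outside, the form is cut
        off.\<close>
      have "(\<lambda>t. indicator {0..T} t * a t c d) \<in> borel_measurable borel"
        using borel_measurable_continuous_on_indicator[OF _ a_cont[OF that]] by simp
      from measurable_compose[OF \<tau>(1) this] show ?thesis
        by (rule measurable_cong[THEN iffD1, rotated]) (use \<tau>(2) in simp)
    qed
    have 2: "(\<lambda>z. a (\<tau> z) c (ys n z)) \<in> borel_measurable Q" if "c \<in> carr X" for c
      by (rule measurable_compose_countable'[OF _ ms(2) fin(2)]) (use 1 that y(2) in auto)
    show ?thesis
      by (rule measurable_compose_countable'[OF _ ms(1) fin(1)]) (use 2 x(2) in auto)
  qed
  fix z assume z: "z \<in> space Q"
  interpret A: semi_inner "carr X" "a (\<tau> z)" by (rule a_inner[OF \<tau>(2)[OF z]])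
  note b = a_bound[OF \<tau>(2)[OF z]]
  have ys: "(\<lambda>n. snorm X (ys n z)) \<longlonglongrightarrow> snorm X (y z)"
    by (rule X.snorm_tendsto[OF y(2,3) y(4)[OF z]])
  show "(\<lambda>n. a (\<tau> z) (xs n z) (ys n z)) \<longlonglongrightarrow> a (\<tau> z) (x z) (y z)"
  proof (rule LIM_zero_cancel, rule tendsto_rabs_zero_cancel, rule null_squeeze)
    show "\<bar>a (\<tau> z) (xs n z) (ys n z) - a (\<tau> z) (x z) (y z)\<bar> \<le>
        C * (snorm X (xs n z - x z) * snorm X (ys n z)) + C * (snorm X (x z) * snorm X (ys n z - y z))" for n
    proof -
      have "a (\<tau> z) (xs n z) (ys n z) - a (\<tau> z) (x z) (y z) =
          a (\<tau> z) (xs n z - x z) (ys n z) + a (\<tau> z) (x z) (ys n z - y z)"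
        using x(2,3) y(2,3) by (simp add: A.diff_left A.diff_right)
      then show ?thesis
        using b[of "xs n z - x z" "ys n z"] b[of "x z" "ys n z - y z"] x(2,3) y(2,3) by simp
    qed
    have "(\<lambda>n. C * (snorm X (xs n z - x z) * snorm X (ys n z)) + C * (snorm X (x z) * snorm X (ys n z - y z)))
        \<longlonglongrightarrow> C * (0 * snorm X (y z)) + C * (snorm X (x z) * 0)"
      by (intro tendsto_add tendsto_mult tendsto_const x(4)[OF z] y(4)[OF z] ys)
    then show "(\<lambda>n. C * (snorm X (xs n z - x z) * snorm X (ys n z)) + C * (snorm X (x z) * snorm X (ys n z - y z)))
        \<longlonglongrightarrow> 0" by simp
  qed simp
qed

lemma form_measurable_fst_snd:
  assumes "\<tau> \<in> borel_measurable P" "\<And>z. z \<in> space P \<Longrightarrow> \<tau> z \<in> {0..T}"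
  shows "(\<lambda>z. a (\<tau> z) (f (snd z)) (f (fst z))) \<in> borel_measurable P"
  by (rule form_measurable[OF assms, where xs = "\<lambda>n z. s n (snd z)" and ys = "\<lambda>n z. s n (fst z)"])
     (auto simp: space_P f_carr s_carr intro!: s_lim simple_function_comp[OF measurable_fst s_simple]
       simple_function_comp[OF measurable_snd s_simple])

lemma form_measurable_const:
  assumes "\<tau> \<in> borel_measurable M" "\<And>r. r \<in> space M \<Longrightarrow> \<tau> r \<in> {0..T}" "v \<in> carr X"
  shows "(\<lambda>r. a (\<tau> r) (f r) v) \<in> borel_measurable M"
  by (rule form_measurable[OF assms(1,2), where xs = "\<lambda>n. s n" and ys = "\<lambda>n z. v"])
     (auto simp: f_carr s_carr assms(3) intro!: s_lim s_simple)

lemma NN_int: "integrable P (\<lambda>z. N (fst z) * N (snd z))"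
proof (rule P.Fubini_integrable)
  show "(\<lambda>z. N (fst z) * N (snd z)) \<in> borel_measurable P"
    by (intro borel_measurable_times measurable_compose[OF measurable_fst] measurable_compose[OF measurable_snd]
        borel_measurable_integrable[OF N_int(1)])
  have "(LINT r|M. norm (N (fst (t, r)) * N (snd (t, r)))) = N t * (LINT r|M. N r)" for t
    using N_nonneg by (simp add: abs_mult)
  then show "integrable M (\<lambda>t. LINT r|M. norm (N (fst (t, r)) * N (snd (t, r))))"
    using N_int(1) by simp
  show "AE t in M. integrable M (\<lambda>r. N (fst (t, r)) * N (snd (t, r)))"
    using N_int(1) by simp
qed

lemma form_int:
  assumes "\<tau> \<in> borel_measurable P" "\<And>z. z \<in> space P \<Longrightarrow> \<tau> z \<in> {0..T}"
  shows "integrable P (\<lambda>z. a (\<tau> z) (f (snd z)) (f (fst z)))"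
proof (rule Bochner_Integration.integrable_bound)
  show "integrable P (\<lambda>z. C * (N (fst z) * N (snd z)))" using NN_int by simp
  show "AE z in P. norm (a (\<tau> z) (f (snd z)) (f (fst z))) \<le> norm (C * (N (fst z) * N (snd z)))"
  proof (rule AE_I2)
    fix z assume "z \<in> space P"
    then show "norm (a (\<tau> z) (f (snd z)) (f (fst z))) \<le> norm (C * (N (fst z) * N (snd z)))"
      using a_bound[OF assms(2) f_carr f_carr, of z "snd z" "fst z"] C N_nonneg by (simp add: abs_mult mult_ac)
  qed
qed (rule form_measurable_fst_snd[OF assms])

lemma form_int_snd: "integrable P (\<lambda>z. a (snd z) (f (snd z)) (f (fst z)))"
  by (auto intro!: form_int simp: space_P)

lemma form_int_at: "c \<in> {0..T} \<Longrightarrow> integrable P (\<lambda>z. a c (f (snd z)) (f (fst z)))"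
  by (auto intro!: form_int simp: space_P)

lemma indicator_int:
  assumes "A \<in> sets P" "integrable P q"
  shows "integrable P (\<lambda>z. indicator A z * (q z :: real))"
  using integrable_mult_indicator[OF assms] by simp

lemma sets_P_pred: "Measurable.pred P Q \<Longrightarrow> {z \<in> space P. Q z} \<in> sets P"
  by (simp add: pred_def)

section \<open>Strips and triangles in the square of times\<close>

definition "N2 = (LINT t|M. (N t)\<^sup>2)"

lemma N2_nonneg: "0 \<le> N2"
  by (simp add: N2_def integral_nonneg_AE)

lemma measure_interval: "(LINT r|M. indicator {t - \<eta>..t + \<eta>} r) \<le> 2 * \<eta>" if "0 \<le> \<eta>" for t \<eta> :: real
proof -
  have "(LINT r|M. indicator {t - \<eta>..t + \<eta>} r :: real) = measure M ({t - \<eta>..t + \<eta>} \<inter> {0<..<T})"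
    by (simp add: Bochner_Integration.integral_indicator)
  also have "\<dots> = measure lebesgue ({t - \<eta>..t + \<eta>} \<inter> {0<..<T})"
    by (subst measure_restrict_space) auto
  also have "\<dots> \<le> measure lebesgue {t - \<eta>..t + \<eta>}"
    by (intro measure_mono_fmeasurable) auto
  also have "\<dots> = 2 * \<eta>" using that by simp
  finally show ?thesis .
qed

text \<open>The product is at most the mean of the two squares. Enlarging \<open>A\<close> to the
  full strip makes the region symmetric, so only one of the squares has to be integrated, and each
  section of the strip has length at most 2 \<eta>.\<close>

lemma strip_bound:
  assumes A: "A \<in> sets P" "\<And>z. z \<in> A \<Longrightarrow> \<bar>fst z - snd z\<bar> \<le> \<eta>" and \<eta>: "0 \<le> \<eta>"
  shows "(LINT z|P. indicator A z * (N (fst z) * N (snd z))) \<le> 2 * \<eta> * N2"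
proof -
  define S where "S = {z \<in> space P. \<bar>fst z - snd z\<bar> \<le> \<eta>}"
  have S: "S \<in> sets P" unfolding S_def by measurable
  have Nsq: "integrable P (\<lambda>z. (N (fst z))\<^sup>2)"
  proof (rule P.Fubini_integrable)
    show "(\<lambda>z. (N (fst z))\<^sup>2) \<in> borel_measurable P"
      by (rule measurable_compose[OF measurable_fst borel_measurable_integrable[OF N_int(2)]])
    show "integrable M (\<lambda>t. LINT r|M. norm ((N (fst (t, r)))\<^sup>2))" using N_int(2) by simp
  qed simp
  have Nsq': "integrable P (\<lambda>z. (N (snd z))\<^sup>2)"
    using P.integrable_product_swap[OF Nsq] by (simp add: case_prod_unfold)
  have swap: "(LINT z|P. indicator S z * (N (snd z))\<^sup>2) = (LINT z|P. indicator S z * (N (fst z))\<^sup>2)"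
  proof -
    have "(LINT z|P. indicator S z * (N (fst z))\<^sup>2) =
        (LINT z|P. (\<lambda>(x, y). indicator S (y, x) * (N (fst (y, x)))\<^sup>2) z)"
      by (rule P.integral_product_swap[symmetric])
         (rule borel_measurable_integrable[OF indicator_int[OF S Nsq]])
    also have "\<dots> = (LINT z|P. indicator S z * (N (snd z))\<^sup>2)"
      by (intro Bochner_Integration.integral_cong refl)
         (auto simp: S_def space_P indicator_def abs_minus_commute split: prod.splits)
    finally show ?thesis by simp
  qed
  have "(LINT z|P. indicator A z * (N (fst z) * N (snd z)))
      \<le> (LINT z|P. (indicator S z * (N (fst z))\<^sup>2 + indicator S z * (N (snd z))\<^sup>2) / 2)"
  proof (rule integral_mono)
    show "integrable P (\<lambda>z. indicator A z * (N (fst z) * N (snd z)))"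
      by (rule indicator_int[OF A(1) NN_int])
    show "integrable P (\<lambda>z. (indicator S z * (N (fst z))\<^sup>2 + indicator S z * (N (snd z))\<^sup>2) / 2)"
      using indicator_int[OF S Nsq] indicator_int[OF S Nsq'] by simp
    fix z assume z: "z \<in> space P"
    have "2 * (N (fst z) * N (snd z)) \<le> (N (fst z))\<^sup>2 + (N (snd z))\<^sup>2"
      using zero_le_power2[of "N (fst z) - N (snd z)"] by (simp add: power2_diff)
    moreover have "z \<in> A \<Longrightarrow> z \<in> S" using A(2) z by (simp add: S_def)
    ultimately show "indicator A z * (N (fst z) * N (snd z)) \<le>
        (indicator S z * (N (fst z))\<^sup>2 + indicator S z * (N (snd z))\<^sup>2) / 2"
      by (cases "z \<in> A"; cases "z \<in> S") (simp_all add: add_nonneg_nonneg)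
  qed
  also have "\<dots> = (LINT z|P. indicator S z * (N (fst z))\<^sup>2)"
    using indicator_int[OF S Nsq] indicator_int[OF S Nsq'] by (simp add: swap)
  also have "\<dots> = (LINT t|M. LINT r|M. indicator S (t, r) * (N (fst (t, r)))\<^sup>2)"
    by (rule P.integral_fst'[OF indicator_int[OF S Nsq], symmetric])
  also have "\<dots> \<le> (LINT t|M. 2 * \<eta> * (N t)\<^sup>2)"
  proof (rule integral_mono)
    show "integrable M (\<lambda>t. LINT r|M. indicator S (t, r) * (N (fst (t, r)))\<^sup>2)"
      by (rule P.integrable_fst'[OF indicator_int[OF S Nsq]])
    show "integrable M (\<lambda>t. 2 * \<eta> * (N t)\<^sup>2)" using N_int(2) by simp
    fix t assume t: "t \<in> space M"
    have "(LINT r|M. indicator S (t, r) * (N (fst (t, r)))\<^sup>2) = (LINT r|M. indicator {t - \<eta>..t + \<eta>} r) * (N t)\<^sup>2"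
    proof -
      have "(LINT r|M. indicator S (t, r) * (N (fst (t, r)))\<^sup>2) = (LINT r|M. indicator {t - \<eta>..t + \<eta>} r * (N t)\<^sup>2)"
        using t by (intro Bochner_Integration.integral_cong refl) (auto simp: S_def space_P indicator_def)
      then show ?thesis by simp
    qed
    also have "\<dots> \<le> 2 * \<eta> * (N t)\<^sup>2"
      by (rule mult_right_mono[OF measure_interval[OF \<eta>]]) simp
    finally show "(LINT r|M. indicator S (t, r) * (N (fst (t, r)))\<^sup>2) \<le> 2 * \<eta> * (N t)\<^sup>2" .
  qed
  also have "\<dots> = 2 * \<eta> * N2" by (simp add: N2_def)
  finally show ?thesis .
qed

text \<open>Moving the time of the coefficient by at most \<eta> costs a factor L \<eta>, and the
  strip contributes another 2 \<eta> \<open>N2\<close>. The error is therefore of the order \<eta>^2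
  that the energy estimate tolerates.\<close>

lemma freeze:
  assumes A: "A \<in> sets P" "\<And>z. z \<in> A \<Longrightarrow> \<bar>fst z - snd z\<bar> \<le> \<eta>" and \<eta>: "0 \<le> \<eta>"
    and \<tau>: "\<tau> \<in> borel_measurable P" "\<And>z. z \<in> space P \<Longrightarrow> \<tau> z \<in> {0..T}"
    and near: "\<And>z. z \<in> A \<Longrightarrow> \<bar>\<tau> z - snd z\<bar> \<le> \<eta>"
  shows "\<bar>(LINT z|P. indicator A z * a (\<tau> z) (f (snd z)) (f (fst z))) -
    (LINT z|P. indicator A z * a (snd z) (f (snd z)) (f (fst z)))\<bar> \<le> 2 * L * N2 * \<eta>\<^sup>2"
proof -
  note i1 = indicator_int[OF A(1) form_int[OF \<tau>]] and i2 = indicator_int[OF A(1) form_int_snd]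
  have "\<bar>(LINT z|P. indicator A z * a (\<tau> z) (f (snd z)) (f (fst z))) -
      (LINT z|P. indicator A z * a (snd z) (f (snd z)) (f (fst z)))\<bar> =
      norm (LINT z|P. indicator A z * a (\<tau> z) (f (snd z)) (f (fst z)) - indicator A z * a (snd z) (f (snd z)) (f (fst z)))"
    using i1 i2 by simp
  also have "\<dots> \<le> (LINT z|P. norm (indicator A z * a (\<tau> z) (f (snd z)) (f (fst z)) - indicator A z * a (snd z) (f (snd z)) (f (fst z))))"
    by (rule integral_norm_bound)
  also have "\<dots> \<le> (LINT z|P. L * \<eta> * (indicator A z * (N (fst z) * N (snd z))))"
  proof (rule integral_mono)
    show "integrable P (\<lambda>z. norm (indicator A z * a (\<tau> z) (f (snd z)) (f (fst z)) - indicator A z * a (snd z) (f (snd z)) (f (fst z))))"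
      by (intro integrable_norm Bochner_Integration.integrable_diff i1 i2)
    show "integrable P (\<lambda>z. L * \<eta> * (indicator A z * (N (fst z) * N (snd z))))"
      by (intro integrable_mult_right indicator_int[OF A(1) NN_int])
    fix z assume z: "z \<in> space P"
    show "norm (indicator A z * a (\<tau> z) (f (snd z)) (f (fst z)) - indicator A z * a (snd z) (f (snd z)) (f (fst z)))
        \<le> L * \<eta> * (indicator A z * (N (fst z) * N (snd z)))"
    proof (cases "z \<in> A")
      case True
      have "\<bar>a (\<tau> z) (f (snd z)) (f (fst z)) - a (snd z) (f (snd z)) (f (fst z))\<bar>
          \<le> L * \<bar>\<tau> z - snd z\<bar> * (N (snd z) * N (fst z))"
        by (rule a_lip[OF \<tau>(2)[OF z] _ f_carr f_carr]) (use z in \<open>auto simp: space_P\<close>)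
      also have "\<dots> \<le> L * \<eta> * (N (snd z) * N (fst z))"
        by (intro mult_right_mono mult_left_mono near True L mult_nonneg_nonneg N_nonneg)
      finally show ?thesis using True by (simp add: mult_ac)
    qed simp
  qed
  also have "\<dots> = L * \<eta> * (LINT z|P. indicator A z * (N (fst z) * N (snd z)))" by simp
  also have "\<dots> \<le> L * \<eta> * (2 * \<eta> * N2)"
    by (intro mult_left_mono strip_bound A \<eta> mult_nonneg_nonneg L)
  also have "\<dots> = 2 * L * N2 * \<eta>\<^sup>2" by (simp add: power2_eq_square)
  finally show ?thesis .
qed

text \<open>\<open>I\<close> is the Bochner integral of \<open>f\<close> over \<open>B\<close>. Each
  frozen form with fixed second argument is a bounded functional on \<open>X\<close>, so one and the
  same \<open>I\<close> serves every time \<open>c\<close>.\<close>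

lemma integral_over:
  assumes B: "B \<in> sets M"
  obtains I where "I \<in> carr X" "\<And>c v. c \<in> {0..T} \<Longrightarrow> v \<in> carr X \<Longrightarrow>
    has_bochner_integral M (\<lambda>r. indicator B r * a c (f r) v) (a c I v)"
proof -
  have "(\<lambda>r. indicator B r *\<^sub>R f r) \<in> L2set M X"
    using B by (intro B.L2set_mult[OF f_L2, where C = 1]) (auto simp: indicator_def)
  then obtain I where I: "has_bochner_integral_in M X (\<lambda>r. indicator B r *\<^sub>R f r) I"
    using B.has_bochner_integral_in_exists by blast
  have "has_bochner_integral M (\<lambda>r. indicator B r * a c (f r) v) (a c I v)"
    if c: "c \<in> {0..T}" and v: "v \<in> carr X" for c v
  proof -
    interpret A: semi_inner "carr X" "a c" by (rule a_inner[OF c])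
    have "has_bochner_integral M (\<lambda>r. a c (indicator B r *\<^sub>R f r) v) (a c I v)"
    proof (rule B.has_bochner_integral_in_functional[OF I, where C = "C * snorm X v"])
      fix x assume "x \<in> carr X"
      then show "\<bar>a c x v\<bar> \<le> C * snorm X v * snorm X x" using a_bound[OF c _ v, of x] by (simp add: mult_ac)
    qed (use A.add_left A.scale_left v in auto)
    then show ?thesis by (simp add: A.scale_left f_carr v)
  qed
  moreover have "I \<in> carr X" using I by (simp add: has_bochner_integral_in_def)
  ultimately show ?thesis using that by blast
qed

lemma diagonal_null: "AE z in P. fst z \<noteq> snd z"
proof (rule P.AE_pair_measure)
  show "{z \<in> space P. fst z \<noteq> snd z} \<in> sets P" by measurable
  have "AE r in M. r \<noteq> t" for t
  proof -
    have "AE r in lebesgue. r \<noteq> t"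
      by (rule AE_completion) (rule AE_lborel_singleton)
    then show ?thesis by (rule AE_restrict_space_iff[THEN iffD2, rotated, OF eventually_mono]) auto
  qed
  then have "AE r in M. t \<noteq> r" for t by (metis (mono_tags, lifting) eventually_mono)
  then show "AE t in M. AE r in M. fst (t, r) \<noteq> snd (t, r)" by simp
qed

text \<open>For a frozen symmetric form the triangles on the two sides of the diagonal carry equal
  integrals, and the diagonal is null. Twice one triangle is thus the integral over the square
  \<open>B \<times> B\<close>, which by bilinearity is the form at the integral of
  \<open>f\<close>.\<close>

lemma triangle:
  assumes B: "B \<in> sets M" and c: "c \<in> {0..T}" and I: "I \<in> carr X"
    "\<And>v. v \<in> carr X \<Longrightarrow> has_bochner_integral M (\<lambda>r. indicator B r * a c (f r) v) (a c I v)"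
  shows "2 * (LINT z|P. indicator {z \<in> space P. snd z < fst z \<and> fst z \<in> B \<and> snd z \<in> B} z *
    a c (f (snd z)) (f (fst z))) = a c I I"
proof -
  interpret A: semi_inner "carr X" "a c" by (rule a_inner[OF c])
  let ?A = "{z \<in> space P. snd z < fst z \<and> fst z \<in> B \<and> snd z \<in> B}"
  let ?A' = "{z \<in> space P. fst z < snd z \<and> fst z \<in> B \<and> snd z \<in> B}"
  let ?q = "\<lambda>z. a c (f (snd z)) (f (fst z))"
  have BP [measurable]: "Measurable.pred P (\<lambda>z. fst z \<in> B)" "Measurable.pred P (\<lambda>z. snd z \<in> B)"
    using pred_sets2[OF B measurable_fst] pred_sets2[OF B measurable_snd] by auto
  have A: "?A \<in> sets P" "?A' \<in> sets P" "B \<times> B \<in> sets P"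
    using B by (auto intro: sets_P_pred)
  note q = form_int_at[OF c]
  have "(LINT z|P. indicator ?A z * ?q z) = (LINT z|P. (\<lambda>(x, y). indicator ?A (y, x) * ?q (y, x)) z)"
    by (rule P.integral_product_swap[symmetric])
       (rule borel_measurable_integrable[OF indicator_int[OF A(1) q]])
  also have "\<dots> = (LINT z|P. indicator ?A' z * ?q z)"
    by (intro Bochner_Integration.integral_cong refl)
       (auto simp: space_P indicator_def A.commute f_carr split: prod.splits)
  finally have "2 * (LINT z|P. indicator ?A z * ?q z) =
      (LINT z|P. indicator ?A z * ?q z + indicator ?A' z * ?q z)"
    using indicator_int[OF A(1) q] indicator_int[OF A(2) q] by simp
  also have "\<dots> = (LINT z|P. indicator (B \<times> B) z * ?q z)"
  proof (intro integral_cong_AE borel_measurable_integrable Bochner_Integration.integrable_add indicator_int A q)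
    show "AE z in P. indicator ?A z * ?q z + indicator ?A' z * ?q z = indicator (B \<times> B) z * ?q z"
      using diagonal_null AE_space by eventually_elim (auto simp: indicator_def)
  qed
  also have "\<dots> = (LINT t|M. LINT r|M. indicator (B \<times> B) (t, r) * ?q (t, r))"
    by (rule P.integral_fst'[OF indicator_int[OF A(3) q], symmetric])
  also have "\<dots> = (LINT t|M. indicator B t * a c (f t) I)"
  proof (intro Bochner_Integration.integral_cong refl)
    fix t
    have "(LINT r|M. indicator (B \<times> B) (t, r) * ?q (t, r)) = indicator B t * (LINT r|M. indicator B r * a c (f r) (f t))"
      by (simp add: indicator_times mult.assoc)
    also have "(LINT r|M. indicator B r * a c (f r) (f t)) = a c I (f t)"
      using I(2)[OF f_carr] by (simp add: has_bochner_integral_iff)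
    finally show "(LINT r|M. indicator (B \<times> B) (t, r) * ?q (t, r)) = indicator B t * a c (f t) I"
      using A.commute[OF I(1) f_carr] by simp
  qed
  also have "\<dots> = a c I I" using I(2)[OF I(1)] by (simp add: has_bochner_integral_iff)
  finally show ?thesis .
qed

end

text \<open>Translation preserves null sets. It is needed because the agreement of \<open>h\<close>
  and \<open>f\<close> must hold at the shifted time too.\<close>

lemma AE_lebesgue_on_interval_shift:
  fixes \<eta> T :: real
  assumes "AE t in lebesgue_on {0<..<T}. Q t" "0 \<le> \<eta>"
  shows "AE t in lebesgue_on {0<..<T}. \<eta> < t \<longrightarrow> Q (t - \<eta>)"
proof -
  have "AE t in lebesgue. t \<in> {0<..<T} \<longrightarrow> Q t"
    using assms(1) by (simp add: AE_restrict_space_iff)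
  then have neg: "negligible {t. \<not> (t \<in> {0<..<T} \<longrightarrow> Q t)}"
    by (simp add: completion.AE_iff_null_sets negligible_iff_null_sets)
  have "AE t in lebesgue. t \<notin> (+) \<eta> ` {t. \<not> (t \<in> {0<..<T} \<longrightarrow> Q t)}"
    using negligible_translation[OF neg, of \<eta>] by (intro AE_not_in) (simp add: negligible_iff_null_sets)
  then have "AE t in lebesgue. t \<in> {0<..<T} \<longrightarrow> \<eta> < t \<longrightarrow> Q (t - \<eta>)"
  proof eventually_elim
    case (elim t)
    show ?case
    proof (intro impI, rule ccontr)
      assume "t \<in> {0<..<T}" "\<eta> < t" "\<not> Q (t - \<eta>)"
      then have "t - \<eta> \<in> {t. \<not> (t \<in> {0<..<T} \<longrightarrow> Q t)}" using assms(2) by simp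
      then have "\<eta> + (t - \<eta>) \<in> (+) \<eta> ` {t. \<not> (t \<in> {0<..<T} \<longrightarrow> Q t)}" by (rule imageI)
      then show False using elim by simp
    qed
  qed
  then show ?thesis by (simp add: AE_restrict_space_iff)
qed

context energy_setting
begin

lemma ip_eq:
  assumes "x \<in> HS" "y \<in> HS" "v \<in> HS" "ip (x - y) (x - y) = 0"
  shows "ip x v = ip y v"
proof -
  have "(ip (x - y) v)\<^sup>2 \<le> 0"
    using H.Cauchy_Schwarz_square[of "x - y" v] assms by simp
  then show ?thesis using assms by (simp add: H.diff_left)
qed

lemma f_HS [simp]: "f t \<in> HS" and u0_HS [simp]: "u0 \<in> HS"
  using sub f_carr u0 by auto

text \<open>Exchanges one factor of a squared difference for representatives in the smaller space.
  Differences of \<open>h\<close> lie only in \<open>HS\<close>, while the equation admits test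
  vectors from \<open>carr X\<close> alone.\<close>

lemma ip_diff_eq:
  assumes "x \<in> HS" "x' \<in> HS" "y \<in> HS" "y' \<in> HS" "ip (x - x') (x - x') = 0" "ip (y - y') (y - y') = 0"
  shows "ip (x - y) (x - y) = ip (x - y) (x' - y')"
proof -
  have "ip x v = ip x' v" "ip y v = ip y' v" if "v \<in> HS" for v
    using ip_eq[OF assms(1,2) that assms(5)] ip_eq[OF assms(3,4) that assms(6)] .
  then have "ip (x - y) x = ip (x - y) x'" "ip (x - y) y = ip (x - y) y'"
    using assms(1-4) H.commute[of "x - y"] by auto
  then show ?thesis using assms(1-4) by (simp add: H.diff_right)
qed

lemma form_int_const:
  assumes B: "B \<in> sets M" and v: "v \<in> carr X"
  shows "integrable M (\<lambda>r. indicator B r * a r (f r) v)"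
proof -
  have "integrable M (\<lambda>r. a r (f r) v)"
  proof (rule Bochner_Integration.integrable_bound)
    show "integrable M (\<lambda>r. C * snorm X v * N r)" using N_int(1) by simp
    show "(\<lambda>r. a r (f r) v) \<in> borel_measurable M"
      by (rule form_measurable_const[OF id_measurable_M _ v]) auto
    show "AE r in M. norm (a r (f r) v) \<le> norm (C * snorm X v * N r)"
    proof (rule AE_I2)
      fix r assume "r \<in> space M"
      then show "norm (a r (f r) v) \<le> norm (C * snorm X v * N r)"
        using a_bound[of r "f r" v] f_carr v C N_nonneg[of r] X.snorm_nonneg[OF v] by (simp add: abs_mult mult_ac)
    qed
  qed
  from integrable_mult_indicator[OF B this] show ?thesis by simp
qed

lemma sets_M_interval [simp]: "{c<..<d} \<inter> {0<..<T} \<in> sets M" "0 \<le> c \<Longrightarrow> d \<le> T \<Longrightarrow> {c<..<d} \<in> sets M"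
  "0 < c \<Longrightarrow> d \<le> T \<Longrightarrow> {c..<d} \<in> sets M"
  by (auto simp: sets_restrict_space_iff)

definition "N1 = (LINT t|M. N t)"

lemma N1_nonneg: "0 \<le> N1"
  by (simp add: N1_def integral_nonneg_AE N_nonneg)

text \<open>For t < \<eta> the shifted time is replaced by 0, that is, the solution is continued by
  its initial value. This is the place where the initial datum enters the difference
  estimate.\<close>

definition e :: "real \<Rightarrow> real \<Rightarrow> real" where
  "e \<eta> t = ip (h t - h (max 0 (t - \<eta>))) (h t - h (max 0 (t - \<eta>)))"

text \<open>\<open>Y \<rho>\<close> is the integral of \<open>f\<close> over \<open>(0, \<rho>)\<close>, which is determined up to seminorm zero only.\<close>
definition Y :: "real \<Rightarrow> 'f" where
  "Y \<rho> = (SOME I. I \<in> carr X \<and> (\<forall>c v. c \<in> {0..T} \<longrightarrow> v \<in> carr X \<longrightarrow>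
    has_bochner_integral M (\<lambda>r. indicator {0<..<\<rho>} r * a c (f r) v) (a c I v)))"

lemma Y:
  assumes "\<rho> \<le> T"
  shows "Y \<rho> \<in> carr X" and "c \<in> {0..T} \<Longrightarrow> v \<in> carr X \<Longrightarrow>
    has_bochner_integral M (\<lambda>r. indicator {0<..<\<rho>} r * a c (f r) v) (a c (Y \<rho>) v)"
proof -
  have "\<exists>I. I \<in> carr X \<and> (\<forall>c v. c \<in> {0..T} \<longrightarrow> v \<in> carr X \<longrightarrow>
    has_bochner_integral M (\<lambda>r. indicator {0<..<\<rho>} r * a c (f r) v) (a c I v))"
  proof -
    have "{0<..<\<rho>} \<in> sets M" using assms by simp
    then show ?thesis by (rule integral_over) blast
  qed
  from someI_ex[OF this] show "Y \<rho> \<in> carr X" "c \<in> {0..T} \<Longrightarrow> v \<in> carr X \<Longrightarrow>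
    has_bochner_integral M (\<lambda>r. indicator {0<..<\<rho>} r * a c (f r) v) (a c (Y \<rho>) v)"
    unfolding Y_def by blast+
qed

lemma zero_in: "0 \<in> {0..T}" and T_in: "T \<in> {0..T}"
  using T by auto

interpretation A0: semi_inner "carr X" "a 0"
  by (rule a_inner[OF zero_in])

text \<open>Pairing \<open>Y \<rho>\<close> with itself and applying Cauchy-Schwarz under the
  integral gives a crude bound. Its purpose is to make the supremum in \<open>nrm0_Y_linear\<close>
  finite.\<close>

lemma nrm0_Y_bounded:
  assumes "\<rho> \<le> T" shows "A0.nrm (Y \<rho>) \<le> sqrt C * N1"
proof (cases "A0.nrm (Y \<rho>) = 0")
  case True
  then show ?thesis using N1_nonneg C by simp
next
  case False
  note Y = Y[OF assms]
  have pos: "0 < A0.nrm (Y \<rho>)" using False A0.nrm_nonneg[OF Y(1)] by simp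
  have le: "indicator {0<..<\<rho>} r * a 0 (f r) (Y \<rho>) \<le> A0.nrm (Y \<rho>) * sqrt C * N r" for r
  proof -
    have "A0.nrm (f r) \<le> sqrt (C * (N r * N r))"
      unfolding A0.nrm_def using a_bound[OF zero_in f_carr f_carr, of r r] by simp
    also have "\<dots> = sqrt C * N r" using N_nonneg by (simp add: real_sqrt_mult)
    finally have "A0.nrm (f r) * A0.nrm (Y \<rho>) \<le> sqrt C * N r * A0.nrm (Y \<rho>)"
      using pos by (intro mult_right_mono) auto
    then have "\<bar>a 0 (f r) (Y \<rho>)\<bar> \<le> A0.nrm (Y \<rho>) * sqrt C * N r"
      using A0.Cauchy_Schwarz[OF f_carr Y(1), of r] by (simp add: mult_ac)
    moreover have "0 \<le> A0.nrm (Y \<rho>) * sqrt C * N r" using pos C N_nonneg by simp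
    ultimately show ?thesis by (cases "r \<in> {0<..<\<rho>}") (simp_all add: abs_le_iff)
  qed
  have "(A0.nrm (Y \<rho>))\<^sup>2 = (LINT r|M. indicator {0<..<\<rho>} r * a 0 (f r) (Y \<rho>))"
    using Y(2)[OF zero_in Y(1)] A0.nrm_square[OF Y(1)] by (simp add: has_bochner_integral_iff)
  also have "\<dots> \<le> (LINT r|M. A0.nrm (Y \<rho>) * sqrt C * N r)"
    using Y(2)[OF zero_in Y(1)] N_int(1) le by (intro integral_mono) (auto simp: has_bochner_integral_iff)
  also have "\<dots> = A0.nrm (Y \<rho>) * (sqrt C * N1)" by (simp add: N1_def)
  finally show ?thesis using pos by (simp add: power2_eq_square)
qed

text \<open>In a pair the first component is the time of the test vector and the second the
  integration variable of the equation, at which the coefficient is evaluated. \<open>A3\<close> and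
  \<open>A4\<close> are the triangles below the diagonal at the two ends of the time
  interval.\<close>

abbreviation "p z \<equiv> a (snd z) (f (snd z)) (f (fst z))"

abbreviation "A3 \<eta> \<equiv> {z \<in> space P. snd z < fst z \<and> fst z \<in> {0<..<\<eta>} \<and> snd z \<in> {0<..<\<eta>}}"

abbreviation "A4 \<eta> \<equiv> {z \<in> space P. snd z < fst z \<and> fst z \<in> {T-\<eta>..<T} \<and> snd z \<in> {T-\<eta>..<T}}"

lemma sets_A3: "A3 \<eta> \<in> sets P" and sets_A4: "A4 \<eta> \<in> sets P"
  by (auto intro!: sets_P_pred simp only: greaterThanLessThan_iff atLeastLessThan_iff) measurable

lemma initial_triangle:
  assumes "0 < \<eta>" "\<eta> \<le> T"
  shows "\<bar>(LINT z|P. indicator (A3 \<eta>) z * p z) - (A0.nrm (Y \<eta>))\<^sup>2 / 2\<bar> \<le> 2 * L * N2 * \<eta>\<^sup>2"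
proof -
  note Y = Y[OF assms(2)]
  have "2 * (LINT z|P. indicator (A3 \<eta>) z * a 0 (f (snd z)) (f (fst z))) = a 0 (Y \<eta>) (Y \<eta>)"
    using assms by (intro triangle zero_in Y) auto
  then have "(LINT z|P. indicator (A3 \<eta>) z * a 0 (f (snd z)) (f (fst z))) = (A0.nrm (Y \<eta>))\<^sup>2 / 2"
    using A0.nrm_square[OF Y(1)] by simp
  moreover have "\<bar>(LINT z|P. indicator (A3 \<eta>) z * a 0 (f (snd z)) (f (fst z))) - (LINT z|P. indicator (A3 \<eta>) z * p z)\<bar>
      \<le> 2 * L * N2 * \<eta>\<^sup>2"
    using assms T by (intro freeze[where \<tau> = "\<lambda>_. 0"] sets_A3) auto
  ultimately show ?thesis by (simp add: abs_minus_commute)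
qed

text \<open>Frozen at T, the triangle is half of a nonnegative square. A lower bound suffices,
  because this triangle enters the estimate with a minus sign.\<close>

lemma final_triangle:
  assumes "0 < \<eta>" "\<eta> < T"
  shows "- (2 * L * N2 * \<eta>\<^sup>2) \<le> (LINT z|P. indicator (A4 \<eta>) z * p z)"
proof -
  interpret AT: semi_inner "carr X" "a T" by (rule a_inner[OF T_in])
  have B: "{T - \<eta>..<T} \<in> sets M" using assms by simp
  obtain I where I: "I \<in> carr X" "\<And>c v. c \<in> {0..T} \<Longrightarrow> v \<in> carr X \<Longrightarrow>
    has_bochner_integral M (\<lambda>r. indicator {T - \<eta>..<T} r * a c (f r) v) (a c I v)"
    using integral_over[OF B] by metis
  have "2 * (LINT z|P. indicator (A4 \<eta>) z * a T (f (snd z)) (f (fst z))) = a T I I"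
    by (rule triangle[OF B T_in I(1) I(2)[OF T_in]])
  then have "0 \<le> (LINT z|P. indicator (A4 \<eta>) z * a T (f (snd z)) (f (fst z)))"
    using AT.nonneg[OF I(1)] by simp
  moreover have "\<bar>(LINT z|P. indicator (A4 \<eta>) z * a T (f (snd z)) (f (fst z))) - (LINT z|P. indicator (A4 \<eta>) z * p z)\<bar>
      \<le> 2 * L * N2 * \<eta>\<^sup>2"
    using assms T by (intro freeze[where \<tau> = "\<lambda>_. T"] sets_A4) auto
  ultimately show ?thesis by (simp add: abs_le_iff)
qed

text \<open>For t < \<eta> the equation over (0, t) is tested with \<open>f t - u0\<close>. The part
  with \<open>f t\<close> integrates to minus the triangle \<open>A3\<close>, that is, to minus half
  the square of \<open>Y \<eta>\<close>. The part with \<open>u0\<close> is linear in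
  \<open>Y t\<close> once the coefficient is frozen at time 0, and \<open>S\<close> bounds it. The
  negative square is what makes the estimate a bound for \<open>Y\<close> itself.\<close>

lemma initial_layer_estimate:
  assumes \<eta>: "0 < \<eta>" "\<eta> \<le> T" and int: "integrable M (e \<eta>)"
    and S: "\<And>\<rho>. 0 < \<rho> \<Longrightarrow> \<rho> \<le> \<eta> \<Longrightarrow> A0.nrm (Y \<rho>) \<le> S"
  shows "(LINT t|M. indicator {0<..<\<eta>} t * e \<eta> t) \<le>
    - (A0.nrm (Y \<eta>))\<^sup>2 / 2 + 2 * L * N2 * \<eta>\<^sup>2 + \<eta> * (A0.nrm u0 * S + L * \<eta> * snorm X u0 * N1)"
proof -
  define k where "k = A0.nrm u0 * S + L * \<eta> * snorm X u0 * N1"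
  have e_eq: "AE t in M. indicator {0<..<\<eta>} t * e \<eta> t \<le>
      - (LINT r|M. indicator (A3 \<eta>) (t, r) * p (t, r)) + indicator {0<..<\<eta>} t * k"
    using hf AE_space
  proof eventually_elim
    case (elim t)
    then have t: "0 < t" "t < T" by auto
    show ?case
    proof (cases "t < \<eta>")
      case False
      then show ?thesis by (simp add: indicator_def)
    next
      case True
      have B: "{0<..<t} \<in> sets M" using t by simp
      have "e \<eta> t = ip (h t - h 0) (h t - h 0)" using True by (simp add: e_def max_def)
      also have "\<dots> = ip (h t - h 0) (f t - u0)"
        using elim(1) h0 t T by (intro ip_diff_eq h_mem) auto
      also have "\<dots> = - (LINT r|M. indicator {0<..<t} r * a r (f r) (f t - u0))"
        using t by (intro weak V.mem f_carr u0) auto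
      also have "(LINT r|M. indicator {0<..<t} r * a r (f r) (f t - u0)) =
          (LINT r|M. indicator {0<..<t} r * a r (f r) (f t) - indicator {0<..<t} r * a r (f r) u0)"
      proof (intro Bochner_Integration.integral_cong refl)
        fix r assume "r \<in> space M"
        then interpret Ar: semi_inner "carr X" "a r" by (intro a_inner) auto
        show "indicator {0<..<t} r * a r (f r) (f t - u0) =
            indicator {0<..<t} r * a r (f r) (f t) - indicator {0<..<t} r * a r (f r) u0"
          using f_carr u0 by (simp add: Ar.diff_right right_diff_distrib)
      qed
      also have "\<dots> = (LINT r|M. indicator {0<..<t} r * a r (f r) (f t)) - (LINT r|M. indicator {0<..<t} r * a r (f r) u0)"
        by (intro Bochner_Integration.integral_diff form_int_const B f_carr u0)
      also have "(LINT r|M. indicator {0<..<t} r * a r (f r) (f t)) = (LINT r|M. indicator (A3 \<eta>) (t, r) * p (t, r))"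
        using t True \<eta> by (intro Bochner_Integration.integral_cong refl) (auto simp: indicator_def space_P)
      finally have e: "e \<eta> t = - (LINT r|M. indicator (A3 \<eta>) (t, r) * p (t, r)) +
          (LINT r|M. indicator {0<..<t} r * a r (f r) u0)" by simp
      have Yt: "Y t \<in> carr X" "has_bochner_integral M (\<lambda>r. indicator {0<..<t} r * a 0 (f r) u0) (a 0 (Y t) u0)"
        using Y[of t] t zero_in u0 by auto
      \<comment> \<open>Freezing at time 0 produces \<open>a 0 (Y t) u0\<close>, to which
        \<open>S\<close> applies. The price is L \<eta> times the seminorms of \<open>f r\<close>
        and \<open>u0\<close>, and integration of the former gives \<open>N1\<close>.\<close>
      have "(LINT r|M. indicator {0<..<t} r * a r (f r) u0) \<le>
          (LINT r|M. indicator {0<..<t} r * a 0 (f r) u0 + L * \<eta> * snorm X u0 * N r)"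
      proof (rule integral_mono)
        show "integrable M (\<lambda>r. indicator {0<..<t} r * a r (f r) u0)" by (rule form_int_const[OF B u0])
        show "integrable M (\<lambda>r. indicator {0<..<t} r * a 0 (f r) u0 + L * \<eta> * snorm X u0 * N r)"
          using Yt(2) N_int(1) by (simp add: has_bochner_integral_iff)
        fix r assume r: "r \<in> space M"
        have nn: "0 \<le> L * \<eta> * snorm X u0 * N r"
          using L \<eta> N_nonneg X.snorm_nonneg[OF u0] by simp
        show "indicator {0<..<t} r * a r (f r) u0 \<le> indicator {0<..<t} r * a 0 (f r) u0 + L * \<eta> * snorm X u0 * N r"
        proof (cases "r \<in> {0<..<t}")
          case True
          have "\<bar>a r (f r) u0 - a 0 (f r) u0\<bar> \<le> L * \<bar>r - 0\<bar> * (N r * snorm X u0)"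
            using r T by (intro a_lip f_carr u0) auto
          also have "\<dots> \<le> L * \<eta> * (N r * snorm X u0)"
            using True \<open>t < \<eta>\<close> by (intro mult_right_mono mult_left_mono L mult_nonneg_nonneg N_nonneg X.snorm_nonneg u0) auto
          finally show ?thesis using True by (simp add: abs_le_iff mult_ac)
        qed (use nn in simp)
      qed
      also have "\<dots> = a 0 (Y t) u0 + L * \<eta> * snorm X u0 * N1"
        using Yt(2) N_int(1) by (simp add: has_bochner_integral_iff N1_def)
      also have "a 0 (Y t) u0 \<le> A0.nrm u0 * S"
      proof -
        have "a 0 (Y t) u0 \<le> A0.nrm (Y t) * A0.nrm u0"
          using A0.Cauchy_Schwarz[OF Yt(1) u0] by (simp add: abs_le_iff)
        also have "\<dots> \<le> S * A0.nrm u0"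
          using S[of t] t True by (intro mult_right_mono A0.nrm_nonneg u0) auto
        finally show ?thesis by (simp add: mult.commute)
      qed
      finally show ?thesis using e t True by (simp add: k_def)
    qed
  qed
  have "(LINT t|M. indicator {0<..<\<eta>} t * e \<eta> t) \<le>
      (LINT t|M. - (LINT r|M. indicator (A3 \<eta>) (t, r) * p (t, r)) + indicator {0<..<\<eta>} t * k)"
  proof (rule integral_mono_AE[OF _ _ e_eq])
    have "{0<..<\<eta>} \<in> sets M" using \<eta> by simp
    then show "integrable M (\<lambda>t. indicator {0<..<\<eta>} t * e \<eta> t)"
      "integrable M (\<lambda>t. - (LINT r|M. indicator (A3 \<eta>) (t, r) * p (t, r)) + indicator {0<..<\<eta>} t * k)"
      using integrable_mult_indicator[OF _ int, of "{0<..<\<eta>}"] P.integrable_fst'[OF indicator_int[OF sets_A3 form_int_snd], of \<eta>]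
      by (auto simp: M.emeasure_finite less_top[symmetric])
  qed
  also have "\<dots> = - (LINT z|P. indicator (A3 \<eta>) z * p z) + \<eta> * k"
  proof -
    have m: "(LINT t|M. indicator {0<..<\<eta>} t :: real) = \<eta>"
    proof -
      have "{0<..<\<eta>} \<inter> {0<..<T} = {0<..<\<eta>}" using \<eta> by auto
      then have "(LINT t|M. indicator {0<..<\<eta>} t :: real) = measure M {0<..<\<eta>}"
        by (simp add: Bochner_Integration.integral_indicator)
      also have "\<dots> = measure lebesgue {0<..<\<eta>}" using \<eta> by (subst measure_restrict_space) auto
      finally show ?thesis using \<eta> by simp
    qed
    have "integrable M (\<lambda>t. indicator {0<..<\<eta>} t * k)"
      using \<eta> by (intro integrable_mult_left integrable_real_indicator) (auto simp: M.emeasure_finite less_top[symmetric])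
    moreover have "integrable M (\<lambda>t. LINT r|M. indicator (A3 \<eta>) (t, r) * p (t, r))"
      by (rule P.integrable_fst'[OF indicator_int[OF sets_A3 form_int_snd]])
    ultimately have "(LINT t|M. - (LINT r|M. indicator (A3 \<eta>) (t, r) * p (t, r)) + indicator {0<..<\<eta>} t * k) =
        - (LINT t|M. LINT r|M. indicator (A3 \<eta>) (t, r) * p (t, r)) + (LINT t|M. indicator {0<..<\<eta>} t) * k"
      by simp
    then show ?thesis
      using P.integral_fst'[OF indicator_int[OF sets_A3 form_int_snd], of \<eta>] m by simp
  qed
  also have "\<dots> \<le> - (A0.nrm (Y \<eta>))\<^sup>2 / 2 + 2 * L * N2 * \<eta>\<^sup>2 + \<eta> * k"
    using initial_triangle[OF \<eta>] by (simp add: abs_le_iff)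
  finally show ?thesis by (simp add: k_def)
qed

text \<open>As the left-hand side of the previous estimate is nonnegative, the supremum of the norms of
  \<open>Y \<rho>\<close> for \<open>\<rho> \<le> \<eta>\<close> satisfies a quadratic inequality.\<close>
lemma nrm0_Y_linear:
  assumes int: "\<And>\<eta>. 0 < \<eta> \<Longrightarrow> integrable M (e \<eta>)"
    and pos: "\<And>\<eta> t. 0 < \<eta> \<Longrightarrow> t \<in> {0<..<T} \<Longrightarrow> 0 \<le> e \<eta> t"
  shows "\<exists>K\<ge>0. \<forall>\<eta>. 0 < \<eta> \<longrightarrow> \<eta> \<le> T \<longrightarrow> A0.nrm (Y \<eta>) \<le> K * \<eta>"
proof -
  \<comment> \<open>The coefficients of \<eta>^2 in \<open>initial_layer_estimate\<close> after
    multiplication by 2, which clears the factor 1/2 in front of the square of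
    \<open>Y\<close>.\<close>
  define k where "k = 4 * L * N2 + 2 * L * snorm X u0 * N1"
  let ?\<nu> = "A0.nrm u0"
  have nn: "0 \<le> ?\<nu>" "0 \<le> k"
    using A0.nrm_nonneg[OF u0] L N2_nonneg N1_nonneg X.snorm_nonneg[OF u0] by (simp_all add: k_def)
  \<comment> \<open>\<open>K * \<eta>\<close> is the larger root of S^2 = 2 \<eta> \<nu> S + k
    \<eta>^2, where \<nu> is the seminorm of \<open>u0\<close> for the form at time 0.\<close>
  define K where "K = ?\<nu> + sqrt (?\<nu>\<^sup>2 + k)"
  have "A0.nrm (Y \<eta>) \<le> K * \<eta>" if \<eta>: "0 < \<eta>" "\<eta> \<le> T" for \<eta>
  proof -
    let ?Z = "(\<lambda>\<rho>. A0.nrm (Y \<rho>)) ` {0<..\<eta>}"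
    define S where "S = Sup ?Z"
    have bdd: "bdd_above ?Z"
      using nrm0_Y_bounded \<eta>(2) by (intro bdd_aboveI2[where M = "sqrt C * N1"]) auto
    have S: "A0.nrm (Y \<rho>) \<le> S" if "0 < \<rho>" "\<rho> \<le> \<eta>" for \<rho>
      unfolding S_def using that bdd by (intro cSup_upper) auto
    have S0: "0 \<le> S" using S[OF \<eta>(1) order_refl] A0.nrm_nonneg[OF Y(1)[OF \<eta>(2)]] by simp
    have sq: "(A0.nrm (Y \<rho>))\<^sup>2 \<le> 2 * \<eta> * ?\<nu> * S + k * \<eta>\<^sup>2" if \<rho>: "0 < \<rho>" "\<rho> \<le> \<eta>" for \<rho>
    proof -
      have "0 \<le> (LINT t|M. indicator {0<..<\<rho>} t * e \<rho> t)"
        using pos[OF \<rho>(1)] by (intro integral_nonneg_AE AE_I2) (simp add: indicator_def)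
      also have "\<dots> \<le> - (A0.nrm (Y \<rho>))\<^sup>2 / 2 + 2 * L * N2 * \<rho>\<^sup>2 + \<rho> * (?\<nu> * S + L * \<rho> * snorm X u0 * N1)"
        using \<rho> \<eta> by (intro initial_layer_estimate int S) auto
      finally have "(A0.nrm (Y \<rho>))\<^sup>2 \<le> 2 * \<rho> * (?\<nu> * S) + k * \<rho>\<^sup>2"
        by (simp add: k_def power2_eq_square algebra_simps)
      also have "\<dots> \<le> 2 * \<eta> * (?\<nu> * S) + k * \<eta>\<^sup>2"
        using \<rho> nn S0 by (intro add_mono mult_right_mono mult_left_mono power_mono) auto
      finally show ?thesis by simp
    qed
    \<comment> \<open>The bound in \<open>sq\<close> no longer depends on \<rho>, so the supremum
      obeys the same inequality and appears on both sides.\<close>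
    have "S \<le> sqrt (2 * \<eta> * ?\<nu> * S + k * \<eta>\<^sup>2)"
      unfolding S_def
    proof (rule cSup_least)
      show "?Z \<noteq> {}" using \<eta> by auto
      show "x \<le> sqrt (2 * \<eta> * ?\<nu> * Sup ?Z + k * \<eta>\<^sup>2)" if "x \<in> ?Z" for x
        using that sq by (auto simp: S_def intro!: real_le_rsqrt)
    qed
    then have "S\<^sup>2 \<le> 2 * \<eta> * ?\<nu> * S + k * \<eta>\<^sup>2"
      using S0 nn \<eta> by (metis real_sqrt_le_iff real_sqrt_unique)
    then have "(S - \<eta> * ?\<nu>)\<^sup>2 \<le> (?\<nu>\<^sup>2 + k) * \<eta>\<^sup>2"
      by (simp add: power2_diff power_mult_distrib algebra_simps)
    then have "S - \<eta> * ?\<nu> \<le> sqrt ((?\<nu>\<^sup>2 + k) * \<eta>\<^sup>2)" by (rule real_le_rsqrt)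
    also have "\<dots> = sqrt (?\<nu>\<^sup>2 + k) * \<eta>" using \<eta> by (simp add: real_sqrt_mult)
    finally have "S \<le> K * \<eta>" by (simp add: K_def algebra_simps)
    then show ?thesis using S[OF \<eta>(1) order_refl] by simp
  qed
  moreover have "0 \<le> K" using nn by (simp add: K_def)
  ultimately show ?thesis by blast
qed

text \<open>\<open>A1\<close> collects the pairs that arise from testing with \<open>f t\<close> for
  times t beyond \<eta>, and \<open>A2\<close> those from testing with
  \<open>f (t - \<eta>)\<close>, with the test time relabelled. \<open>A2'\<close> is the mirror
  image of \<open>A2\<close> at the diagonal.\<close>

abbreviation "A1 \<eta> \<equiv> {z \<in> space P. \<eta> \<le> fst z \<and> snd z < fst z \<and> fst z < snd z + \<eta>}"

abbreviation "A2 \<eta> \<equiv> {z \<in> space P. fst z < T - \<eta> \<and> fst z < snd z \<and> snd z < fst z + \<eta>}"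

abbreviation "A2' \<eta> \<equiv> {z \<in> space P. snd z < T - \<eta> \<and> snd z < fst z \<and> fst z < snd z + \<eta>}"

lemma sets_A1: "A1 \<eta> \<in> sets P" and sets_A2: "A2 \<eta> \<in> sets P" and sets_A2': "A2' \<eta> \<in> sets P"
  by (intro sets_P_pred; measurable)+

text \<open>Swapping the variables and using symmetry of the form maps \<open>A2\<close> to
  \<open>A2'\<close>, but leaves the coefficient at the first time instead of the second.
  \<open>freeze\<close> corrects this.\<close>

lemma transposed_strip:
  assumes "0 < \<eta>"
  shows "(LINT z|P. indicator (A2 \<eta>) z * p z) \<le> (LINT z|P. indicator (A2' \<eta>) z * p z) + 2 * L * N2 * \<eta>\<^sup>2"
proof -
  have "(LINT z|P. indicator (A2 \<eta>) z * p z) = (LINT z|P. (\<lambda>(x, y). indicator (A2 \<eta>) (y, x) * p (y, x)) z)"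
    by (rule P.integral_product_swap[symmetric])
       (rule borel_measurable_integrable[OF indicator_int[OF sets_A2 form_int_snd]])
  also have "\<dots> = (LINT z|P. indicator (A2' \<eta>) z * a (fst z) (f (snd z)) (f (fst z)))"
  proof (intro Bochner_Integration.integral_cong refl)
    fix z assume z: "z \<in> space P"
    then interpret A: semi_inner "carr X" "a (fst z)" by (intro a_inner) (auto simp: space_P)
    show "(\<lambda>(x, y). indicator (A2 \<eta>) (y, x) * p (y, x)) z = indicator (A2' \<eta>) z * a (fst z) (f (snd z)) (f (fst z))"
      using A.commute[OF f_carr f_carr, of "fst z" "snd z"]
      by (auto simp: indicator_def space_P split: prod.splits)
  qed
  finally have "(LINT z|P. indicator (A2 \<eta>) z * p z) =
      (LINT z|P. indicator (A2' \<eta>) z * a (fst z) (f (snd z)) (f (fst z)))" .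
  moreover have "\<bar>(LINT z|P. indicator (A2' \<eta>) z * a (fst z) (f (snd z)) (f (fst z))) - (LINT z|P. indicator (A2' \<eta>) z * p z)\<bar>
      \<le> 2 * L * N2 * \<eta>\<^sup>2"
    using assms by (intro freeze[where \<tau> = fst] sets_A2' fst_P) (auto simp: space_P)
  ultimately show ?thesis by (simp add: abs_le_iff)
qed

text \<open>The strips \<open>A1\<close> and \<open>A2'\<close> differ by the triangles \<open>A3\<close> and \<open>A4\<close>:
  \<open>1\<^bsub>A2'\<^esub> - 1\<^bsub>A1\<^esub> = 1\<^bsub>A3\<^esub> - 1\<^bsub>A4\<^esub>\<close>.\<close>
lemma interior_estimate:
  assumes \<eta>: "0 < \<eta>" "\<eta> < T" and int: "integrable M (e \<eta>)"
  shows "(LINT t|M. indicator {\<eta><..<T} t * e \<eta> t) \<le> (A0.nrm (Y \<eta>))\<^sup>2 / 2 + 6 * L * N2 * \<eta>\<^sup>2"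
proof -
  \<comment> \<open>The inner integral over the sections of \<open>A2\<close>, continued by 0 to the
    whole line, so that the shift by \<eta> is a plain change of variables.\<close>
  define \<psi> where "\<psi> t = indicator {0<..<T} t * (LINT r|M. indicator (A2 \<eta>) (t, r) * p (t, r))" for t
  have \<psi>_out: "\<psi> t = 0" if "\<not> (0 < t \<and> t < T - \<eta>)" for t
  proof (cases "t \<in> {0<..<T}")
    case True
    then have "indicator (A2 \<eta>) (t, r) = (0::real)" for r using that by simp
    then show ?thesis by (simp add: \<psi>_def)
  qed (simp add: \<psi>_def)
  have inner2: "integrable M (\<lambda>t. LINT r|M. indicator (A2 \<eta>) (t, r) * p (t, r))"
    by (rule P.integrable_fst'[OF indicator_int[OF sets_A2 form_int_snd]])
  have \<psi>_int: "integrable lebesgue \<psi>"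
    using inner2 unfolding \<psi>_def by (subst (asm) integrable_restrict_space) simp_all
  have \<psi>_eq: "(LINT t|lebesgue. \<psi> t) = (LINT z|P. indicator (A2 \<eta>) z * p z)"
  proof -
    have "(LINT t|lebesgue. \<psi> t) = (LINT t|M. LINT r|M. indicator (A2 \<eta>) (t, r) * p (t, r))"
      unfolding \<psi>_def by (subst integral_restrict_space) simp_all
    then show ?thesis
      using P.integral_fst'[OF indicator_int[OF sets_A2 form_int_snd], of \<eta>] by simp
  qed
  have shift: "has_bochner_integral lebesgue (\<lambda>t. \<psi> (t - \<eta>)) (LINT t|lebesgue. \<psi> t)"
    using has_bochner_integral_lebesgue_real_affine_iff[of 1 \<psi> "LINT t|lebesgue. \<psi> t" "- \<eta>"]
      has_bochner_integral_integrable[OF \<psi>_int] by simp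
  have \<psi>_M: "has_bochner_integral M (\<lambda>t. \<psi> (t - \<eta>)) (LINT t|lebesgue. \<psi> t)"
  proof -
    have "indicator {0<..<T} t *\<^sub>R \<psi> (t - \<eta>) = \<psi> (t - \<eta>)" for t
      using \<psi>_out[of "t - \<eta>"] \<eta> by (cases "0 < t - \<eta> \<and> t - \<eta> < T - \<eta>") auto
    then have "has_bochner_integral lebesgue (\<lambda>t. indicator {0<..<T} t *\<^sub>R \<psi> (t - \<eta>)) (LINT t|lebesgue. \<psi> t)"
      using shift by (simp only:)
    then show ?thesis by (subst has_bochner_integral_restrict_space) simp_all
  qed
  have "AE t in M. t \<noteq> \<eta>"
  proof -
    have "AE t in lebesgue. t \<noteq> \<eta>" by (rule AE_completion) (rule AE_lborel_singleton)
    then show ?thesis by (rule AE_restrict_space_iff[THEN iffD2, rotated, OF eventually_mono]) auto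
  qed
  then have e_eq: "AE t in M. indicator {\<eta><..<T} t * e \<eta> t =
      - (LINT r|M. indicator (A1 \<eta>) (t, r) * p (t, r)) + \<psi> (t - \<eta>)"
    using hf AE_lebesgue_on_interval_shift[OF hf less_imp_le[OF \<eta>(1)]] AE_space
  proof eventually_elim
    case (elim t)
    then have t: "0 < t" "t < T" by auto
    show ?case
    proof (cases "\<eta> < t")
      case False
      then have "t < \<eta>" using elim by simp
      then have "indicator (A1 \<eta>) (t, r) = (0::real)" for r by simp
      then show ?thesis using False \<psi>_out[of "t - \<eta>"] by simp
    next
      case True
      have B: "{t - \<eta><..<t} \<in> sets M" using t True by simp
      have te: "t - \<eta> \<in> {0..T}" "t \<in> {0..T}" using t True \<eta> by auto
      have "e \<eta> t = ip (h t - h (t - \<eta>)) (h t - h (t - \<eta>))" using True by (simp add: e_def max_def)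
      also have "\<dots> = ip (h t - h (t - \<eta>)) (f t - f (t - \<eta>))"
        using elim True te by (intro ip_diff_eq h_mem f_HS) auto
      also have "\<dots> = - (LINT r|M. indicator {t - \<eta><..<t} r * a r (f r) (f t - f (t - \<eta>)))"
        using t True \<eta> by (intro weak V.mem f_carr) auto
      also have "(LINT r|M. indicator {t - \<eta><..<t} r * a r (f r) (f t - f (t - \<eta>))) =
          (LINT r|M. indicator {t - \<eta><..<t} r * a r (f r) (f t) - indicator {t - \<eta><..<t} r * a r (f r) (f (t - \<eta>)))"
      proof (intro Bochner_Integration.integral_cong refl)
        fix r assume "r \<in> space M"
        then interpret Ar: semi_inner "carr X" "a r" by (intro a_inner) auto
        show "indicator {t - \<eta><..<t} r * a r (f r) (f t - f (t - \<eta>)) =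
            indicator {t - \<eta><..<t} r * a r (f r) (f t) - indicator {t - \<eta><..<t} r * a r (f r) (f (t - \<eta>))"
          using f_carr by (simp add: Ar.diff_right right_diff_distrib)
      qed
      also have "\<dots> = (LINT r|M. indicator {t - \<eta><..<t} r * a r (f r) (f t)) -
          (LINT r|M. indicator {t - \<eta><..<t} r * a r (f r) (f (t - \<eta>)))"
        by (intro Bochner_Integration.integral_diff form_int_const B f_carr)
      also have "(LINT r|M. indicator {t - \<eta><..<t} r * a r (f r) (f t)) = (LINT r|M. indicator (A1 \<eta>) (t, r) * p (t, r))"
        using t True \<eta> by (intro Bochner_Integration.integral_cong refl) (auto simp: indicator_def space_P)
      also have "(LINT r|M. indicator {t - \<eta><..<t} r * a r (f r) (f (t - \<eta>))) =
          (LINT r|M. indicator (A2 \<eta>) (t - \<eta>, r) * p (t - \<eta>, r))"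
        using t True \<eta> by (intro Bochner_Integration.integral_cong refl) (auto simp: indicator_def space_P)
      also have "\<dots> = \<psi> (t - \<eta>)" using True t \<eta> by (simp add: \<psi>_def)
      finally show ?thesis using True t by simp
    qed
  qed
  have "(LINT t|M. indicator {\<eta><..<T} t * e \<eta> t) =
      (LINT t|M. - (LINT r|M. indicator (A1 \<eta>) (t, r) * p (t, r)) + \<psi> (t - \<eta>))"
  proof (rule integral_cong_AE[OF _ _ e_eq])
    have "{\<eta><..<T} \<in> sets M" using \<eta> by simp
    from integrable_mult_indicator[OF this int]
    show "(\<lambda>t. indicator {\<eta><..<T} t * e \<eta> t) \<in> borel_measurable M" by simp
    show "(\<lambda>t. - (LINT r|M. indicator (A1 \<eta>) (t, r) * p (t, r)) + \<psi> (t - \<eta>)) \<in> borel_measurable M"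
      using \<psi>_M P.integrable_fst'[OF indicator_int[OF sets_A1 form_int_snd], of \<eta>]
      by (intro borel_measurable_add borel_measurable_uminus borel_measurable_integrable) (auto simp: has_bochner_integral_iff)
  qed
  also have "\<dots> = - (LINT z|P. indicator (A1 \<eta>) z * p z) + (LINT z|P. indicator (A2 \<eta>) z * p z)"
    using \<psi>_M P.integrable_fst'[OF indicator_int[OF sets_A1 form_int_snd], of \<eta>]
      P.integral_fst'[OF indicator_int[OF sets_A1 form_int_snd], of \<eta>] \<psi>_eq
    by (simp add: has_bochner_integral_iff)
  also have "\<dots> \<le> ((LINT z|P. indicator (A2' \<eta>) z * p z) - (LINT z|P. indicator (A1 \<eta>) z * p z)) + 2 * L * N2 * \<eta>\<^sup>2"
    using transposed_strip[OF \<eta>(1)] by simp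
  also have "(LINT z|P. indicator (A2' \<eta>) z * p z) - (LINT z|P. indicator (A1 \<eta>) z * p z) =
      (LINT z|P. indicator (A3 \<eta>) z * p z) - (LINT z|P. indicator (A4 \<eta>) z * p z)"
  proof -
    have "(LINT z|P. indicator (A2' \<eta>) z * p z - indicator (A1 \<eta>) z * p z) =
        (LINT z|P. indicator (A3 \<eta>) z * p z - indicator (A4 \<eta>) z * p z)"
      using \<eta> by (intro Bochner_Integration.integral_cong refl) (auto simp: indicator_def space_P)
    then show ?thesis
      using indicator_int[OF sets_A1 form_int_snd, of \<eta>] indicator_int[OF sets_A2' form_int_snd, of \<eta>]
        indicator_int[OF sets_A3 form_int_snd, of \<eta>] indicator_int[OF sets_A4 form_int_snd, of \<eta>] by simp
  qed
  \<comment> \<open>Transposition, initial triangle and final triangle contribute an error 2 L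
    \<open>N2\<close> \<eta>^2 each, hence the factor 6.\<close>
  also have "(LINT z|P. indicator (A3 \<eta>) z * p z) - (LINT z|P. indicator (A4 \<eta>) z * p z) + 2 * L * N2 * \<eta>\<^sup>2
      \<le> (A0.nrm (Y \<eta>))\<^sup>2 / 2 + 6 * L * N2 * \<eta>\<^sup>2"
    using initial_triangle[OF \<eta>(1) less_imp_le[OF \<eta>(2)]] final_triangle[OF \<eta>] by (simp add: abs_le_iff)
  finally show ?thesis .
qed

text \<open>The linear bound for \<open>Y\<close> is used twice: with \<open>S = K * \<eta>\<close>
  it raises the term with \<open>u0\<close> in the initial layer to order \<eta>^2, and it bounds
  the positive square of \<open>Y \<eta>\<close> left over by the interior estimate. The negative
  square in the initial layer is dropped.\<close>

lemma energy_estimate: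
  assumes int: "\<And>\<eta>. 0 < \<eta> \<Longrightarrow> integrable M (e \<eta>)"
  shows "\<exists>K. \<forall>\<eta>. 0 < \<eta> \<longrightarrow> \<eta> < T \<longrightarrow> (LINT t|M. e \<eta> t) \<le> K * \<eta>\<^sup>2"
proof -
  have pos: "0 \<le> e \<eta> t" if "0 < \<eta>" "t \<in> {0<..<T}" for \<eta> t
    unfolding e_def using that by (intro H.nonneg H.mem h_mem) (auto simp: max_def)
  obtain K where K: "0 \<le> K" "\<And>\<eta>. 0 < \<eta> \<Longrightarrow> \<eta> \<le> T \<Longrightarrow> A0.nrm (Y \<eta>) \<le> K * \<eta>"
    using nrm0_Y_linear[OF int pos] by blast
  define K' where "K' = 2 * L * N2 + A0.nrm u0 * K + L * snorm X u0 * N1 + K\<^sup>2 / 2 + 6 * L * N2"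
  have "(LINT t|M. e \<eta> t) \<le> K' * \<eta>\<^sup>2" if \<eta>: "0 < \<eta>" "\<eta> < T" for \<eta>
  proof -
    note i = integrable_mult_indicator[OF _ int[OF \<eta>(1)]]
    have s: "{0<..<\<eta>} \<in> sets M" "{\<eta><..<T} \<in> sets M" using \<eta> by simp_all
    have neq: "AE t in M. t \<noteq> \<eta>"
    proof -
      have "AE t in lebesgue. t \<noteq> \<eta>" by (rule AE_completion) (rule AE_lborel_singleton)
      then show ?thesis by (rule AE_restrict_space_iff[THEN iffD2, rotated, OF eventually_mono]) auto
    qed
    have "(LINT t|M. e \<eta> t) = (LINT t|M. indicator {0<..<\<eta>} t * e \<eta> t + indicator {\<eta><..<T} t * e \<eta> t)"
    proof (rule integral_cong_AE)
      show "AE t in M. e \<eta> t = indicator {0<..<\<eta>} t * e \<eta> t + indicator {\<eta><..<T} t * e \<eta> t"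
        using neq AE_space by eventually_elim (auto simp: indicator_def)
    qed (use int[OF \<eta>(1)] i[OF s(1)] i[OF s(2)] in auto)
    also have "\<dots> = (LINT t|M. indicator {0<..<\<eta>} t * e \<eta> t) + (LINT t|M. indicator {\<eta><..<T} t * e \<eta> t)"
      using i[OF s(1)] i[OF s(2)] by simp
    also have "(LINT t|M. indicator {0<..<\<eta>} t * e \<eta> t) \<le>
        - (A0.nrm (Y \<eta>))\<^sup>2 / 2 + 2 * L * N2 * \<eta>\<^sup>2 + \<eta> * (A0.nrm u0 * (K * \<eta>) + L * \<eta> * snorm X u0 * N1)"
    proof (rule initial_layer_estimate)
      fix \<rho> assume "0 < \<rho>" "\<rho> \<le> \<eta>"
      then have "A0.nrm (Y \<rho>) \<le> K * \<rho>" using \<eta> by (intro K) auto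
      also have "\<dots> \<le> K * \<eta>" using K(1) \<open>\<rho> \<le> \<eta>\<close> by (rule mult_left_mono[rotated])
      finally show "A0.nrm (Y \<rho>) \<le> K * \<eta>" .
    qed (use \<eta> int in auto)
    also have "\<dots> \<le> 2 * L * N2 * \<eta>\<^sup>2 + A0.nrm u0 * K * \<eta>\<^sup>2 + L * snorm X u0 * N1 * \<eta>\<^sup>2"
      by (simp add: power2_eq_square algebra_simps)
    also have "(LINT t|M. indicator {\<eta><..<T} t * e \<eta> t) \<le> (A0.nrm (Y \<eta>))\<^sup>2 / 2 + 6 * L * N2 * \<eta>\<^sup>2"
      by (rule interior_estimate[OF \<eta> int[OF \<eta>(1)]])
    also have "(A0.nrm (Y \<eta>))\<^sup>2 \<le> (K * \<eta>)\<^sup>2"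
      using \<eta> K(2)[of \<eta>] A0.nrm_nonneg[OF Y(1)] by (intro power_mono) auto
    finally show ?thesis by (simp add: K'_def power_mult_distrib algebra_simps)
  qed
  then show ?thesis by blast
qed

end

section \<open>Tensor fields and functionals\<close>

lemma bounded_bilinear_tensor_apply:
  "bounded_bilinear (tensor_apply :: ('k::finite, 'd::finite) tensor \<Rightarrow> real^'d^'k \<Rightarrow> real^'d^'k)"
proof (rule bilinear_conv_bounded_bilinear[THEN iffD1])
  show "bilinear (tensor_apply :: ('k, 'd) tensor \<Rightarrow> real^'d^'k \<Rightarrow> real^'d^'k)"
    unfolding bilinear_def
    by (auto intro!: linearI simp: tensor_apply_def vec_eq_iff algebra_simps sum.distrib sum_distrib_left)
qed

lemma tensor_apply_symmetric:
  fixes H :: "('k::finite, 'd::finite) tensor"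
  assumes "H \<in> sym_tensors"
  shows "tensor_apply H D \<bullet> E = tensor_apply H E \<bullet> D"
proof -
  have sym: "H $ i $ j $ I $ J = H $ I $ J $ i $ j" for i j I J
    using assms by (simp add: sym_tensors_def)
  have expand: "tensor_apply H D \<bullet> E = (\<Sum>i\<in>UNIV. \<Sum>j\<in>UNIV. \<Sum>I\<in>UNIV. \<Sum>J\<in>UNIV. H $ i $ j $ I $ J * D $ I $ J * E $ i $ j)" for D E
    by (simp add: tensor_apply_def inner_vec_def sum_distrib_right)
  have "tensor_apply H D \<bullet> E = (\<Sum>i\<in>UNIV. \<Sum>I\<in>UNIV. \<Sum>j\<in>UNIV. \<Sum>J\<in>UNIV. H $ i $ j $ I $ J * D $ I $ J * E $ i $ j)"
    unfolding expand by (intro sum.cong refl sum.swap)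
  also have "\<dots> = (\<Sum>I\<in>UNIV. \<Sum>i\<in>UNIV. \<Sum>j\<in>UNIV. \<Sum>J\<in>UNIV. H $ i $ j $ I $ J * D $ I $ J * E $ i $ j)"
    by (rule sum.swap)
  also have "\<dots> = (\<Sum>I\<in>UNIV. \<Sum>i\<in>UNIV. \<Sum>J\<in>UNIV. \<Sum>j\<in>UNIV. H $ i $ j $ I $ J * D $ I $ J * E $ i $ j)"
    by (intro sum.cong refl sum.swap)
  also have "\<dots> = (\<Sum>I\<in>UNIV. \<Sum>J\<in>UNIV. \<Sum>i\<in>UNIV. \<Sum>j\<in>UNIV. H $ i $ j $ I $ J * D $ I $ J * E $ i $ j)"
    by (intro sum.cong refl sum.swap)
  also have "\<dots> = tensor_apply H E \<bullet> D"
    unfolding expand by (intro sum.cong refl) (simp add: sym mult_ac)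
  finally show ?thesis .
qed

lemma subspace_sym_tensors: "subspace (sym_tensors :: ('k::finite, 'd::finite) tensor set)"
  by (auto simp: subspace_def sym_tensors_def)

context bounded_domain
begin

section \<open>Essentially bounded symmetric tensor fields\<close>

lemma Linf_carr: "K \<in> carr (Linf_sym G) \<longleftrightarrow> K \<in> borel_measurable (lebesgue_on G) \<and>
    (\<exists>C. AE x in lebesgue_on G. norm (K x) \<le> C) \<and> (AE x in lebesgue_on G. K x \<in> sym_tensors)"
  by (simp add: Linf_sym_def)

lemma Linf_snorm: "snorm (Linf_sym G) K = real_of_ereal (esssup (lebesgue_on G) (\<lambda>x. ereal (norm (K x))))"
  by (simp add: Linf_sym_def)

text \<open>\<open>real_of_ereal\<close> maps both infinities to 0, so they have to be excluded. The
  value +infinity contradicts the essential bound, and -infinity contradicts the inequality at any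
  single point where it holds.\<close>

lemma Linf_AE_le:
  assumes "K \<in> carr (Linf_sym G)"
  shows "AE x in lebesgue_on G. norm (K x) \<le> snorm (Linf_sym G) K"
proof -
  let ?E = "esssup (lebesgue_on G) (\<lambda>x. ereal (norm (K x)))"
  obtain C where C: "AE x in lebesgue_on G. norm (K x) \<le> C" and m: "K \<in> borel_measurable (lebesgue_on G)"
    using assms by (auto simp: Linf_carr)
  have m': "(\<lambda>x. ereal (norm (K x))) \<in> borel_measurable (lebesgue_on G)"
    using m by (intro borel_measurable_ereal measurable_compose[OF m borel_measurable_norm])
  have "AE x in lebesgue_on G. ereal (norm (K x)) \<le> ereal C" using C by eventually_elim simp
  then have "?E \<le> ereal C" by (rule esssup_I[OF m'])
  then have top: "?E \<noteq> \<infinity>" by auto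
  have "AE x in lebesgue_on G. ereal (norm (K x)) \<le> ?E" by (rule esssup_AE)
  then show ?thesis
  proof eventually_elim
    case (elim x)
    then have "?E \<noteq> - \<infinity>" by auto
    then have "ereal (real_of_ereal ?E) = ?E" using top by (cases ?E) auto
    then show ?case using elim by (metis Linf_snorm ereal_less_eq(3))
  qed
qed

lemma Linf_snorm_le:
  assumes "K \<in> carr (Linf_sym G)" "AE x in lebesgue_on G. norm (K x) \<le> c" "0 \<le> c"
  shows "snorm (Linf_sym G) K \<le> c"
proof -
  have m: "K \<in> borel_measurable (lebesgue_on G)" using assms by (simp add: Linf_carr)
  have m': "(\<lambda>x. ereal (norm (K x))) \<in> borel_measurable (lebesgue_on G)"
    by (intro borel_measurable_ereal measurable_compose[OF m borel_measurable_norm])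
  have "AE x in lebesgue_on G. ereal (norm (K x)) \<le> ereal c" using assms(2) by eventually_elim simp
  then have "esssup (lebesgue_on G) (\<lambda>x. ereal (norm (K x))) \<le> ereal c" by (rule esssup_I[OF m'])
  then show ?thesis
    unfolding Linf_snorm using assms(3)
    by (cases "esssup (lebesgue_on G) (\<lambda>x. ereal (norm (K x)))") auto
qed

text \<open>A negative value is possible only if almost no point exists. Then the essential supremum
  is -infinity, and its real value is 0 after all.\<close>

lemma Linf_snorm_nonneg: "0 \<le> snorm (Linf_sym G) K" if K: "K \<in> carr (Linf_sym G)"
proof (rule ccontr)
  assume "\<not> 0 \<le> snorm (Linf_sym G) K"
  then have neg: "snorm (Linf_sym G) K < 0" by simp
  have "AE x in lebesgue_on G. False"
    using Linf_AE_le[OF K]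
  proof eventually_elim
    case (elim x)
    then show False using neg norm_ge_zero[of "K x"] by linarith
  qed
  then have "AE x in lebesgue_on G. ereal (norm (K x)) \<le> - \<infinity>" by eventually_elim simp
  moreover have m: "K \<in> borel_measurable (lebesgue_on G)" using K by (simp add: Linf_carr)
  have "(\<lambda>x. ereal (norm (K x))) \<in> borel_measurable (lebesgue_on G)"
    by (intro borel_measurable_ereal measurable_compose[OF m borel_measurable_norm])
  ultimately have "esssup (lebesgue_on G) (\<lambda>x. ereal (norm (K x))) \<le> - \<infinity>" by (intro esssup_I)
  then show False using neg by (simp add: Linf_snorm)
qed

lemma seminormed_Linf: "seminormed (Linf_sym G :: (real^'d \<Rightarrow> ('k::finite, 'd) tensor) space_rec)"
proof -
  have lin: "r *\<^sub>R K + s *\<^sub>R K' \<in> carr (Linf_sym G)"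
    if K: "K \<in> carr (Linf_sym G)" "K' \<in> carr (Linf_sym G)" for r s and K K' :: "real^'d \<Rightarrow> ('k, 'd) tensor"
  proof -
    have "AE x in lebesgue_on G. norm ((r *\<^sub>R K + s *\<^sub>R K') x) \<le> \<bar>r\<bar> * snorm (Linf_sym G) K + \<bar>s\<bar> * snorm (Linf_sym G) K'"
      using Linf_AE_le[OF K(1)] Linf_AE_le[OF K(2)]
    proof eventually_elim
      case (elim x)
      have "norm (r *\<^sub>R K x + s *\<^sub>R K' x) \<le> \<bar>r\<bar> * norm (K x) + \<bar>s\<bar> * norm (K' x)"
        using norm_triangle_ineq[of "r *\<^sub>R K x" "s *\<^sub>R K' x"] by simp
      also have "\<dots> \<le> \<bar>r\<bar> * snorm (Linf_sym G) K + \<bar>s\<bar> * snorm (Linf_sym G) K'"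
        by (intro add_mono mult_left_mono elim) auto
      finally show ?case by (simp add: scaleR_fun_def)
    qed
    moreover have "AE x in lebesgue_on G. (r *\<^sub>R K + s *\<^sub>R K') x \<in> sym_tensors"
    proof -
      have "AE x in lebesgue_on G. K x \<in> sym_tensors" "AE x in lebesgue_on G. K' x \<in> sym_tensors"
        using K by (auto simp: Linf_carr)
      then show ?thesis
        by eventually_elim (simp add: scaleR_fun_def subspace_add[OF subspace_sym_tensors] subspace_scale[OF subspace_sym_tensors])
    qed
    moreover have "(r *\<^sub>R K + s *\<^sub>R K') \<in> borel_measurable (lebesgue_on G)"
      using K by (auto simp: Linf_carr plus_fun_def scaleR_fun_def
          intro!: borel_measurable_add borel_measurable_scaleR borel_measurable_const)
    ultimately show ?thesis unfolding Linf_carr by blast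
  qed
  have scale_le: "snorm (Linf_sym G) (r *\<^sub>R K) \<le> \<bar>r\<bar> * snorm (Linf_sym G) K"
    if K: "K \<in> carr (Linf_sym G)" for r and K :: "real^'d \<Rightarrow> ('k, 'd) tensor"
  proof (rule Linf_snorm_le)
    show "r *\<^sub>R K \<in> carr (Linf_sym G)" using lin[OF K K, of r 0] by simp
    show "AE x in lebesgue_on G. norm ((r *\<^sub>R K) x) \<le> \<bar>r\<bar> * snorm (Linf_sym G) K"
      using Linf_AE_le[OF K] by eventually_elim (simp add: scaleR_fun_def mult_left_mono)
  qed (simp add: Linf_snorm_nonneg[OF K])
  have zero: "0 \<in> carr (Linf_sym G :: (real^'d \<Rightarrow> ('k, 'd) tensor) space_rec)"
    using subspace_0[OF subspace_sym_tensors] by (auto simp: Linf_carr zero_fun_def)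
  show ?thesis
  proof
    show "subspace (carr (Linf_sym G :: (real^'d \<Rightarrow> ('k, 'd) tensor) space_rec))"
      unfolding subspace_def
      using zero lin[of _ _ 1 1] lin[of _ _ _ 0] by simp
    fix K K' :: "real^'d \<Rightarrow> ('k, 'd) tensor" and r :: real
    assume K: "K \<in> carr (Linf_sym G)"
    show "0 \<le> snorm (Linf_sym G) K" by (rule Linf_snorm_nonneg[OF K])
    show "snorm (Linf_sym G) (r *\<^sub>R K) = \<bar>r\<bar> * snorm (Linf_sym G) K"
    proof (cases "r = 0")
      case True
      have "snorm (Linf_sym G) (0 :: real^'d \<Rightarrow> ('k, 'd) tensor) = 0"
        using scale_le[OF zero, of 0] Linf_snorm_nonneg[OF zero] by simp
      then show ?thesis using True by simp
    next
      case False
      have "snorm (Linf_sym G) (inverse r *\<^sub>R (r *\<^sub>R K)) \<le> \<bar>inverse r\<bar> * snorm (Linf_sym G) (r *\<^sub>R K)"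
        using lin[OF K K, of r 0] by (intro scale_le) simp
      then have "\<bar>r\<bar> * snorm (Linf_sym G) K \<le> snorm (Linf_sym G) (r *\<^sub>R K)"
        using False by (simp add: field_simps abs_inverse)
      then show ?thesis using scale_le[OF K, of r] by simp
    qed
    assume K': "K' \<in> carr (Linf_sym G)"
    show "snorm (Linf_sym G) (K + K') \<le> snorm (Linf_sym G) K + snorm (Linf_sym G) K'"
    proof (rule Linf_snorm_le)
      show "K + K' \<in> carr (Linf_sym G)" using lin[OF K K', of 1 1] by simp
      show "AE x in lebesgue_on G. norm ((K + K') x) \<le> snorm (Linf_sym G) K + snorm (Linf_sym G) K'"
        using Linf_AE_le[OF K] Linf_AE_le[OF K']
      proof eventually_elim
        case (elim x)
        then show ?case using norm_triangle_ineq[of "K x" "K' x"] by simp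
      qed
    qed (simp add: Linf_snorm_nonneg K K')
  qed
qed

text \<open>The tensor field comes last, because for fixed gradients this is a bounded linear
  functional of it. In this way the time regularity of the coefficient passes to the elliptic
  form.\<close>

definition tform :: "(real^'d \<Rightarrow> real^'d^'k) \<Rightarrow> (real^'d \<Rightarrow> real^'d^'k) \<Rightarrow> (real^'d \<Rightarrow> ('k::finite, 'd) tensor) \<Rightarrow> real" where
  "tform A B K = (LINT x|lebesgue_on G. tensor_apply (K x) (A x) \<bullet> B x)"

lemma tensor_apply_square_integrable:
  fixes A :: "real^'d \<Rightarrow> real^'d^'k::finite"
  assumes "K \<in> carr (Linf_sym G)" "square_integrable_on G A"
  shows "square_integrable_on G (\<lambda>x. tensor_apply (K x) (A x))"
proof -
  obtain c where c: "0 \<le> c" "\<And>H D. norm (tensor_apply (H :: ('k, 'd) tensor) D) \<le> norm H * norm D * c"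
    using bounded_bilinear.nonneg_bounded[OF bounded_bilinear_tensor_apply] by blast
  show ?thesis
  proof (rule square_integrable_bounded_mult[OF assms(2), where C = "snorm (Linf_sym G) K * c"])
    show "(\<lambda>x. tensor_apply (K x) (A x)) \<in> borel_measurable (lebesgue_on G)"
    proof (rule borel_measurable_continuous_Pair[where H = tensor_apply])
      show "continuous_on UNIV (\<lambda>x. tensor_apply (fst x) (snd x :: real^'d^'k))"
        by (intro bounded_bilinear.continuous_on[OF bounded_bilinear_tensor_apply] continuous_intros)
    qed (use assms in \<open>auto simp: Linf_carr square_integrable_on_def\<close>)
    show "AE x in lebesgue_on G. norm (tensor_apply (K x) (A x)) \<le> snorm (Linf_sym G) K * c * norm (A x)"
      using Linf_AE_le[OF assms(1)]
    proof eventually_elim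
      case (elim x)
      have "norm (tensor_apply (K x) (A x)) \<le> norm (K x) * (norm (A x) * c)" using c(2)[of "K x" "A x"] by simp
      also have "\<dots> \<le> snorm (Linf_sym G) K * (norm (A x) * c)"
        using elim c(1) by (intro mult_right_mono) auto
      finally show ?case by (simp add: mult_ac)
    qed
  qed
qed

lemma tform_eq_ip: "tform A B K = ip (\<lambda>x. tensor_apply (K x) (A x)) B"
  by (simp add: tform_def ip_def)

lemma tform_integrable:
  "K \<in> carr (Linf_sym G) \<Longrightarrow> square_integrable_on G A \<Longrightarrow> square_integrable_on G B \<Longrightarrow>
    integrable (lebesgue_on G) (\<lambda>x. tensor_apply (K x) (A x) \<bullet> B x)"
  by (intro integrable_inner tensor_apply_square_integrable)

lemma tform_bound:
  "\<exists>c\<ge>0. \<forall>K A B. K \<in> carr (Linf_sym G) \<longrightarrow> square_integrable_on G A \<longrightarrow> square_integrable_on G B \<longrightarrow>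
    \<bar>tform A B (K :: real^'d \<Rightarrow> ('k::finite, 'd) tensor)\<bar> \<le> c * snorm (Linf_sym G) K *
      (sqrt (LINT x|lebesgue_on G. (norm (A x))\<^sup>2) * sqrt (LINT x|lebesgue_on G. (norm (B x))\<^sup>2))"
proof -
  obtain c where c: "0 \<le> c" "\<And>H D. norm (tensor_apply (H :: ('k, 'd) tensor) D) \<le> norm H * norm D * c"
    using bounded_bilinear.nonneg_bounded[OF bounded_bilinear_tensor_apply] by blast
  interpret semi_inner "{u :: real^'d \<Rightarrow> real^'d^'k. square_integrable_on G u}" ip by (rule ip_semi_inner)
  have "\<bar>tform A B K\<bar> \<le> c * snorm (Linf_sym G) K *
      (sqrt (LINT x|lebesgue_on G. (norm (A x))\<^sup>2) * sqrt (LINT x|lebesgue_on G. (norm (B x))\<^sup>2))"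
    if K: "K \<in> carr (Linf_sym G)" and A: "square_integrable_on G A" and B: "square_integrable_on G B"
    for K :: "real^'d \<Rightarrow> ('k, 'd) tensor" and A B
  proof -
    note KA = tensor_apply_square_integrable[OF K A]
    let ?k = "c * snorm (Linf_sym G) K"
    have k: "0 \<le> ?k" using c(1) Linf_snorm_nonneg[OF K] by simp
    have "(LINT x|lebesgue_on G. (norm (tensor_apply (K x) (A x)))\<^sup>2) \<le> (LINT x|lebesgue_on G. ?k\<^sup>2 * (norm (A x))\<^sup>2)"
    proof (rule integral_mono_AE)
      show "AE x in lebesgue_on G. (norm (tensor_apply (K x) (A x)))\<^sup>2 \<le> ?k\<^sup>2 * (norm (A x))\<^sup>2"
        using Linf_AE_le[OF K]
      proof eventually_elim
        case (elim x)
        have "norm (tensor_apply (K x) (A x)) \<le> norm (K x) * (norm (A x) * c)" using c(2)[of "K x" "A x"] by simp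
        also have "\<dots> \<le> snorm (Linf_sym G) K * (norm (A x) * c)"
          using elim c(1) by (intro mult_right_mono) auto
        finally have "norm (tensor_apply (K x) (A x)) \<le> ?k * norm (A x)" by (simp add: mult_ac)
        then show ?case by (simp add: power_mono flip: power_mult_distrib)
      qed
    qed (use KA A in \<open>auto simp: square_integrable_on_def\<close>)
    then have "sqrt (LINT x|lebesgue_on G. (norm (tensor_apply (K x) (A x)))\<^sup>2) \<le> sqrt (?k\<^sup>2 * (LINT x|lebesgue_on G. (norm (A x))\<^sup>2))"
      by simp
    also have "\<dots> = ?k * sqrt (LINT x|lebesgue_on G. (norm (A x))\<^sup>2)"
      using k by (simp add: real_sqrt_mult)
    finally have "nrm (\<lambda>x. tensor_apply (K x) (A x)) \<le> ?k * sqrt (LINT x|lebesgue_on G. (norm (A x))\<^sup>2)"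
      by (simp add: nrm_ip)
    then have "nrm (\<lambda>x. tensor_apply (K x) (A x)) * nrm B \<le> ?k * sqrt (LINT x|lebesgue_on G. (norm (A x))\<^sup>2) * nrm B"
      using B by (intro mult_right_mono nrm_nonneg) auto
    then show ?thesis
      using Cauchy_Schwarz[of "\<lambda>x. tensor_apply (K x) (A x)" B] KA B by (simp add: tform_eq_ip nrm_ip mult.assoc)
  qed
  then show ?thesis using c(1) by blast
qed

lemma tform_linear:
  fixes K K' :: "real^'d \<Rightarrow> ('k::finite, 'd) tensor"
  assumes "square_integrable_on G A" "square_integrable_on G B" "K \<in> carr (Linf_sym G)"
  shows "K' \<in> carr (Linf_sym G) \<Longrightarrow> tform A B (K + K') = tform A B K + tform A B K'"
    and "tform A B (r *\<^sub>R K) = r * tform A B K"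
proof -
  note bb = bounded_bilinear_tensor_apply
  show "tform A B (r *\<^sub>R K) = r * tform A B K"
    by (simp add: tform_def scaleR_fun_def bounded_bilinear.scaleR_left[OF bb])
  assume "K' \<in> carr (Linf_sym G)"
  then show "tform A B (K + K') = tform A B K + tform A B K'"
    using tform_integrable[OF _ assms(1,2)] assms(3)
    by (simp add: tform_def bounded_bilinear.add_left[OF bb] inner_add_left)
qed

lemma op_A_eq: "op_A G K u v = tform (weak_jacobian G u) (weak_jacobian G v) K"
  by (simp add: op_A_def tform_def)

section \<open>The dual space\<close>

lemma Vdual_carr: "\<psi> \<in> carr (Vdual G) \<longleftrightarrow>
   (\<forall>u\<in>carr (Vspace G). \<forall>v\<in>carr (Vspace G). \<psi> (u + v) = \<psi> u + \<psi> v) \<and>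
   (\<forall>r. \<forall>v\<in>carr (Vspace G). \<psi> (r *\<^sub>R v) = r * \<psi> v) \<and>
   (\<exists>C. \<forall>v\<in>carr (Vspace G). \<bar>\<psi> v\<bar> \<le> C * snorm (Vspace G) v)"
  by (simp add: Vdual_def)

abbreviation "V1 \<equiv> {v \<in> carr (Vspace G). snorm (Vspace G) v \<le> 1}"

lemma Vdual_snorm: "snorm (Vdual G) \<psi> = (SUP v\<in>V1. \<bar>\<psi> v\<bar>)"
  by (simp add: Vdual_def)

lemma V1_0: "0 \<in> (V1 :: (real^'d \<Rightarrow> real^'k) set)"
proof -
  interpret V: inner_carrier "Vspace G :: (real^'d \<Rightarrow> real^'k) space_rec" ipV by (rule inner_carrier_Vspace)
  interpret seminormed "Vspace G :: (real^'d \<Rightarrow> real^'k) space_rec" by (rule V.seminormed)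
  show ?thesis by simp
qed

lemma Vdual_bdd:
  assumes "\<And>v. v \<in> carr (Vspace G) \<Longrightarrow> \<bar>\<psi> v\<bar> \<le> C * snorm (Vspace G) v"
  shows "v \<in> V1 \<Longrightarrow> \<bar>\<psi> v\<bar> \<le> \<bar>C\<bar>"
proof -
  interpret V: inner_carrier "Vspace G :: (real^'d \<Rightarrow> real^'a) space_rec" ipV by (rule inner_carrier_Vspace)
  interpret seminormed "Vspace G :: (real^'d \<Rightarrow> real^'a) space_rec" by (rule V.seminormed)
  assume v: "v \<in> V1"
  have "\<bar>\<psi> v\<bar> \<le> C * snorm (Vspace G) v" using v assms by simp
  also have "\<dots> \<le> \<bar>C\<bar> * 1" using v snorm_nonneg by (intro mult_mono) auto
  finally show ?thesis by simp
qed

lemma Vdual_snorm_le: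
  assumes "\<And>v. v \<in> carr (Vspace G) \<Longrightarrow> \<bar>\<psi> v\<bar> \<le> c * snorm (Vspace G) v" "0 \<le> c"
  shows "snorm (Vdual G) \<psi> \<le> c"
  unfolding Vdual_snorm using Vdual_bdd[OF assms(1)] assms(2) V1_0
  by (intro cSUP_least) (blast, fastforce)

lemma Vdual_upper:
  assumes "\<psi> \<in> carr (Vdual G)" "v \<in> V1"
  shows "\<bar>\<psi> v\<bar> \<le> snorm (Vdual G) \<psi>"
proof -
  obtain C where C: "\<And>v. v \<in> carr (Vspace G) \<Longrightarrow> \<bar>\<psi> v\<bar> \<le> C * snorm (Vspace G) v"
    using assms(1) unfolding Vdual_carr by blast
  have "bdd_above ((\<lambda>v. \<bar>\<psi> v\<bar>) ` V1)"
    using Vdual_bdd[OF C] by (intro bdd_aboveI2) blast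
  then show ?thesis unfolding Vdual_snorm using assms(2) by (rule cSUP_upper[rotated])
qed

lemma Vdual_apply_le:
  fixes v :: "real^'d \<Rightarrow> real^'k"
  assumes \<psi>: "\<psi> \<in> carr (Vdual G)" and v: "v \<in> carr (Vspace G)"
  shows "\<bar>\<psi> v\<bar> \<le> snorm (Vdual G) \<psi> * snorm (Vspace G) v"
proof -
  interpret V: inner_carrier "Vspace G :: (real^'d \<Rightarrow> real^'k) space_rec" ipV by (rule inner_carrier_Vspace)
  interpret seminormed "Vspace G :: (real^'d \<Rightarrow> real^'k) space_rec" by (rule V.seminormed)
  obtain C where C: "\<And>v. v \<in> carr (Vspace G) \<Longrightarrow> \<bar>\<psi> v\<bar> \<le> C * snorm (Vspace G) v"
    and sc: "\<And>r v. v \<in> carr (Vspace G) \<Longrightarrow> \<psi> (r *\<^sub>R v) = r * \<psi> v"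
    using \<psi> unfolding Vdual_carr by blast
  show ?thesis
  \<comment> \<open>Null vectors cannot be rescaled to the unit sphere; on them \<psi> vanishes by
    its own bound.\<close>
  proof (cases "snorm (Vspace G) v = 0")
    case True
    then show ?thesis using C[OF v] by simp
  next
    case False
    then have pos: "0 < snorm (Vspace G) v" using snorm_nonneg[OF v] by simp
    let ?v = "inverse (snorm (Vspace G) v) *\<^sub>R v"
    have "?v \<in> V1" using v pos by (simp add: snorm_scale)
    from Vdual_upper[OF \<psi> this] show ?thesis
      using pos sc[OF v] by (simp add: abs_mult field_simps)
  qed
qed

lemma seminormed_Vdual: "seminormed (Vdual G :: ((real^'d \<Rightarrow> real^'k) \<Rightarrow> real) space_rec)"
proof -
  interpret V: inner_carrier "Vspace G :: (real^'d \<Rightarrow> real^'k) space_rec" ipV by (rule inner_carrier_Vspace)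
  interpret VS: seminormed "Vspace G :: (real^'d \<Rightarrow> real^'k) space_rec" by (rule V.seminormed)
  have nn: "0 \<le> snorm (Vdual G) \<psi>" if "\<psi> \<in> carr (Vdual G)" for \<psi> :: "(real^'d \<Rightarrow> real^'k) \<Rightarrow> real"
    using Vdual_upper[OF that V1_0] abs_ge_zero order_trans by blast
  have lin: "(\<lambda>v. r * \<psi> v + s * \<omega> v) \<in> carr (Vdual G)"
    and le: "snorm (Vdual G) (\<lambda>v. r * \<psi> v + s * \<omega> v) \<le> \<bar>r\<bar> * snorm (Vdual G) \<psi> + \<bar>s\<bar> * snorm (Vdual G) \<omega>"
    if \<psi>: "\<psi> \<in> carr (Vdual G)" and \<omega>: "\<omega> \<in> carr (Vdual G)" for r s and \<psi> \<omega> :: "(real^'d \<Rightarrow> real^'k) \<Rightarrow> real"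
  proof -
    have b: "\<bar>r * \<psi> v + s * \<omega> v\<bar> \<le> (\<bar>r\<bar> * snorm (Vdual G) \<psi> + \<bar>s\<bar> * snorm (Vdual G) \<omega>) * snorm (Vspace G) v"
      if v: "v \<in> carr (Vspace G)" for v
    proof -
      have "\<bar>r * \<psi> v + s * \<omega> v\<bar> \<le> \<bar>r\<bar> * \<bar>\<psi> v\<bar> + \<bar>s\<bar> * \<bar>\<omega> v\<bar>"
        using abs_triangle_ineq[of "r * \<psi> v" "s * \<omega> v"] by (simp add: abs_mult)
      also have "\<dots> \<le> \<bar>r\<bar> * (snorm (Vdual G) \<psi> * snorm (Vspace G) v) + \<bar>s\<bar> * (snorm (Vdual G) \<omega> * snorm (Vspace G) v)"
        by (intro add_mono mult_left_mono Vdual_apply_le \<psi> \<omega> v) auto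
      finally show ?thesis by (simp add: algebra_simps)
    qed
    have "\<forall>u\<in>carr (Vspace G). \<forall>v\<in>carr (Vspace G). \<psi> (u + v) = \<psi> u + \<psi> v"
      "\<forall>u\<in>carr (Vspace G). \<forall>v\<in>carr (Vspace G). \<omega> (u + v) = \<omega> u + \<omega> v"
      "\<forall>r. \<forall>v\<in>carr (Vspace G). \<psi> (r *\<^sub>R v) = r * \<psi> v" "\<forall>r. \<forall>v\<in>carr (Vspace G). \<omega> (r *\<^sub>R v) = r * \<omega> v"
      using \<psi> \<omega> by (simp_all add: Vdual_carr)
    then show "(\<lambda>v. r * \<psi> v + s * \<omega> v) \<in> carr (Vdual G)"
      unfolding Vdual_carr
      by (intro conjI exI[of _ "\<bar>r\<bar> * snorm (Vdual G) \<psi> + \<bar>s\<bar> * snorm (Vdual G) \<omega>"] ballI allI b)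
         (simp_all add: distrib_left mult.left_commute)
    show "snorm (Vdual G) (\<lambda>v. r * \<psi> v + s * \<omega> v) \<le> \<bar>r\<bar> * snorm (Vdual G) \<psi> + \<bar>s\<bar> * snorm (Vdual G) \<omega>"
      using b nn[OF \<psi>] nn[OF \<omega>] by (intro Vdual_snorm_le) auto
  qed
  have zero: "0 \<in> carr (Vdual G :: ((real^'d \<Rightarrow> real^'k) \<Rightarrow> real) space_rec)"
    unfolding Vdual_carr by (auto simp: zero_fun_def intro: exI[of _ 0])
  show ?thesis
  proof
    show "subspace (carr (Vdual G :: ((real^'d \<Rightarrow> real^'k) \<Rightarrow> real) space_rec))"
      unfolding subspace_def
    proof (intro conjI ballI allI zero)
      fix \<psi> \<omega> :: "(real^'d \<Rightarrow> real^'k) \<Rightarrow> real" and r :: real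
      assume \<psi>: "\<psi> \<in> carr (Vdual G)"
      show "r *\<^sub>R \<psi> \<in> carr (Vdual G)" using lin[OF \<psi> \<psi>, of r 0] by (simp add: scaleR_fun_def)
      assume \<omega>: "\<omega> \<in> carr (Vdual G)"
      show "\<psi> + \<omega> \<in> carr (Vdual G)" using lin[OF \<psi> \<omega>, of 1 1] by (simp add: plus_fun_def)
    qed
    fix \<psi> \<omega> :: "(real^'d \<Rightarrow> real^'k) \<Rightarrow> real" and r :: real
    assume \<psi>: "\<psi> \<in> carr (Vdual G)"
    show "0 \<le> snorm (Vdual G) \<psi>" by (rule nn[OF \<psi>])
    show "snorm (Vdual G) (r *\<^sub>R \<psi>) = \<bar>r\<bar> * snorm (Vdual G) \<psi>"
    proof (cases "r = 0")
      case True
      have "snorm (Vdual G) (\<lambda>v. 0 * \<psi> v + 0 * \<psi> v) = 0"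
        using le[OF \<psi> \<psi>, of 0 0] nn[OF lin[OF \<psi> \<psi>, of 0 0]] by simp
      then show ?thesis using True by (simp add: scaleR_fun_def)
    next
      case False
      have r: "snorm (Vdual G) (\<lambda>v. r * \<psi> v) \<le> \<bar>r\<bar> * snorm (Vdual G) \<psi>" and rc: "(\<lambda>v. r * \<psi> v) \<in> carr (Vdual G)"
        using le[OF \<psi> \<psi>, of r 0] lin[OF \<psi> \<psi>, of r 0] by simp_all
      have "snorm (Vdual G) (\<lambda>v. inverse r * (r * \<psi> v) + 0 * \<psi> v) \<le> \<bar>inverse r\<bar> * snorm (Vdual G) (\<lambda>v. r * \<psi> v)"
        using le[OF rc \<psi>, of "inverse r" 0] by simp
      moreover have "(\<lambda>v. inverse r * (r * \<psi> v) + 0 * \<psi> v) = \<psi>" using False by (simp add: fun_eq_iff)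
      ultimately have "\<bar>r\<bar> * snorm (Vdual G) \<psi> \<le> snorm (Vdual G) (\<lambda>v. r * \<psi> v)"
        using False by (simp add: field_simps abs_inverse)
      then show ?thesis using r by (simp add: scaleR_fun_def)
    qed
    assume \<omega>: "\<omega> \<in> carr (Vdual G)"
    show "snorm (Vdual G) (\<psi> + \<omega>) \<le> snorm (Vdual G) \<psi> + snorm (Vdual G) \<omega>"
      using le[OF \<psi> \<omega>, of 1 1] by (simp add: plus_fun_def)
  qed
qed

text \<open>The supremum over the unit ball need not be attained, but it is reached up to the factor
  2. \<open>Vdual_AE_eq_0\<close> represents each of countably many functionals by one such
  vector.\<close>

lemma Vdual_norming:
  fixes \<psi> :: "(real^'d \<Rightarrow> real^'k) \<Rightarrow> real"
  assumes "\<psi> \<in> carr (Vdual G)"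
  shows "\<exists>v\<in>V1. snorm (Vdual G) \<psi> \<le> 2 * \<bar>\<psi> v\<bar>"
proof (cases "snorm (Vdual G) \<psi> = 0")
  case True
  then show ?thesis using V1_0 by (intro bexI[of _ 0]) auto
next
  case False
  then have "snorm (Vdual G) \<psi> / 2 < (SUP v\<in>V1. \<bar>\<psi> v\<bar>)"
    using seminormed.snorm_nonneg[OF seminormed_Vdual assms] by (simp add: Vdual_snorm)
  then obtain v where "v \<in> V1" "snorm (Vdual G) \<psi> / 2 < \<bar>\<psi> v\<bar>"
  proof (subst (asm) less_cSUP_iff)
    show "(V1 :: (real^'d \<Rightarrow> real^'k) set) \<noteq> {}" using V1_0 by blast
    show "bdd_above ((\<lambda>v. \<bar>\<psi> v\<bar>) ` V1)"
      by (rule bdd_aboveI2[OF Vdual_upper[OF assms]])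
  qed blast
  then show ?thesis by (intro bexI[of _ v]) auto
qed

end

context bounded_domain
begin

lemma tform_Vspace_bound:
  "\<exists>c\<ge>0. \<forall>K x y. K \<in> carr (Linf_sym G) \<longrightarrow> x \<in> carr (Vspace G) \<longrightarrow> y \<in> carr (Vspace G) \<longrightarrow>
    \<bar>tform (weak_jacobian G x) (weak_jacobian G y) (K :: real^'d \<Rightarrow> ('k::finite, 'd) tensor)\<bar> \<le>
      c * snorm (Linf_sym G) K * (snorm (Vspace G) x * snorm (Vspace G) y)"
proof -
  obtain c where c: "0 \<le> c" "\<And>K A B. K \<in> carr (Linf_sym G) \<Longrightarrow> square_integrable_on G A \<Longrightarrow> square_integrable_on G B \<Longrightarrow>
    \<bar>tform A B (K :: real^'d \<Rightarrow> ('k, 'd) tensor)\<bar> \<le> c * snorm (Linf_sym G) K *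
      (sqrt (LINT x|lebesgue_on G. (norm (A x))\<^sup>2) * sqrt (LINT x|lebesgue_on G. (norm (B x))\<^sup>2))"
    using tform_bound by metis
  have "\<bar>tform (weak_jacobian G x) (weak_jacobian G y) K\<bar> \<le>
      c * snorm (Linf_sym G) K * (snorm (Vspace G) x * snorm (Vspace G) y)"
    if K: "K \<in> carr (Linf_sym G)" and x: "x \<in> carr (Vspace G)" and y: "y \<in> carr (Vspace G)"
    for K :: "real^'d \<Rightarrow> ('k, 'd) tensor" and x y
  proof -
    have le: "sqrt (LINT z|lebesgue_on G. (norm (weak_jacobian G x z))\<^sup>2) \<le> snorm (Vspace G) x"
      if "x \<in> carr (Vspace G)" for x :: "real^'d \<Rightarrow> real^'k"
    proof -
      interpret V: inner_carrier "Vspace G :: (real^'d \<Rightarrow> real^'k) space_rec" ipV by (rule inner_carrier_Vspace)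
      interpret V: seminormed "Vspace G :: (real^'d \<Rightarrow> real^'k) space_rec" by (rule V.seminormed)
      show ?thesis using Vspace_snorm_bounds(2)[OF that] V.snorm_nonneg[OF that]
        by (simp add: real_le_lsqrt)
    qed
    have nn: "0 \<le> snorm (Vspace G) x" using le[OF x] by (rule order_trans[rotated]) simp
    have "\<bar>tform (weak_jacobian G x) (weak_jacobian G y) K\<bar> \<le> c * snorm (Linf_sym G) K *
      (sqrt (LINT z|lebesgue_on G. (norm (weak_jacobian G x z))\<^sup>2) * sqrt (LINT z|lebesgue_on G. (norm (weak_jacobian G y z))\<^sup>2))"
      by (rule c(2)[OF K Vspace_jacobian(2)[OF x] Vspace_jacobian(2)[OF y]])
    also have "\<dots> \<le> c * snorm (Linf_sym G) K * (snorm (Vspace G) x * snorm (Vspace G) y)"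
      using le[OF x] le[OF y] c(1) Linf_snorm_nonneg[OF K] nn
      by (intro mult_left_mono mult_mono) auto
    finally show ?thesis .
  qed
  then show ?thesis using c(1) by blast
qed

lemma tform_cong_AE:
  fixes K K' :: "real^'d \<Rightarrow> ('k::finite, 'd) tensor"
  assumes K: "K \<in> carr (Linf_sym G)" "K' \<in> carr (Linf_sym G)"
    and A: "square_integrable_on G A" "square_integrable_on G A'" and B: "square_integrable_on G B" "square_integrable_on G B'"
    and ae: "AE x in lebesgue_on G. K x = K' x" "AE x in lebesgue_on G. A x = A' x" "AE x in lebesgue_on G. B x = B' x"
  shows "tform A B K = tform A' B' K'"
  unfolding tform_def
proof (rule integral_cong_AE)
  show "(\<lambda>x. tensor_apply (K x) (A x) \<bullet> B x) \<in> borel_measurable (lebesgue_on G)"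
    "(\<lambda>x. tensor_apply (K' x) (A' x) \<bullet> B' x) \<in> borel_measurable (lebesgue_on G)"
    using tform_integrable[OF K(1) A(1) B(1)] tform_integrable[OF K(2) A(2) B(2)] by auto
  show "AE x in lebesgue_on G. tensor_apply (K x) (A x) \<bullet> B x = tensor_apply (K' x) (A' x) \<bullet> B' x"
    using ae by eventually_elim simp
qed

lemma Linf_diff_0_AE_eq:
  assumes "K \<in> carr (Linf_sym G)" "K' \<in> carr (Linf_sym G)" "snorm (Linf_sym G) (K - K') = 0"
  shows "AE x in lebesgue_on G. K x = K' x"
proof -
  interpret seminormed "Linf_sym G" by (rule seminormed_Linf)
  have "AE x in lebesgue_on G. norm ((K - K') x) \<le> snorm (Linf_sym G) (K - K')"
    by (rule Linf_AE_le[OF mem(3)[OF assms(1,2)]])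
  then show ?thesis by eventually_elim (simp add: assms(3))
qed

lemma semi_inner_tform:
  fixes K :: "real^'d \<Rightarrow> ('k::finite, 'd) tensor"
  assumes K: "K \<in> carr (Linf_sym G)"
    and pos: "\<And>x. x \<in> carr (Vspace G) \<Longrightarrow> 0 \<le> tform (weak_jacobian G x) (weak_jacobian G x) K"
  shows "semi_inner (carr (Vspace G)) (\<lambda>x y. tform (weak_jacobian G x) (weak_jacobian G y) K)"
proof -
  interpret V: inner_carrier "Vspace G :: (real^'d \<Rightarrow> real^'k) space_rec" ipV by (rule inner_carrier_Vspace)
  interpret E: semi_inner "{A :: real^'d \<Rightarrow> real^'d^'k. square_integrable_on G A}" ip by (rule ip_semi_inner)
  interpret T: bounded_bilinear "tensor_apply :: ('k, 'd) tensor \<Rightarrow> real^'d^'k \<Rightarrow> real^'d^'k"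
    by (rule bounded_bilinear_tensor_apply)
  have int: "integrable (lebesgue_on G) (\<lambda>x. tensor_apply (K x) (weak_jacobian G u x) \<bullet> weak_jacobian G v x)"
    if "u \<in> carr (Vspace G)" "v \<in> carr (Vspace G)" for u v :: "real^'d \<Rightarrow> real^'k"
    by (intro tform_integrable K Vspace_jacobian that)
  show ?thesis
  proof (unfold_locales)
    fix x y z :: "real^'d \<Rightarrow> real^'k" and r :: real
    assume x: "x \<in> carr (Vspace G)" and z: "z \<in> carr (Vspace G)"
    show "tform (weak_jacobian G (r *\<^sub>R x)) (weak_jacobian G z) K = r * tform (weak_jacobian G x) (weak_jacobian G z) K"
    proof -
      have "tform (weak_jacobian G (r *\<^sub>R x)) (weak_jacobian G z) K =
          (LINT t|lebesgue_on G. r * (tensor_apply (K t) (weak_jacobian G x t) \<bullet> weak_jacobian G z t))"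
        unfolding tform_def
      proof (rule integral_cong_AE)
        show "(\<lambda>t. tensor_apply (K t) (weak_jacobian G (r *\<^sub>R x) t) \<bullet> weak_jacobian G z t) \<in> borel_measurable (lebesgue_on G)"
          using int[OF V.mem(4)[OF x] z] by auto
        show "(\<lambda>t. r * (tensor_apply (K t) (weak_jacobian G x t) \<bullet> weak_jacobian G z t)) \<in> borel_measurable (lebesgue_on G)"
          using int[OF x z] by auto
        show "AE t in lebesgue_on G. tensor_apply (K t) (weak_jacobian G (r *\<^sub>R x) t) \<bullet> weak_jacobian G z t =
            r * (tensor_apply (K t) (weak_jacobian G x t) \<bullet> weak_jacobian G z t)"
          using Vspace_scale(2)[OF x, of r] by eventually_elim (simp add: T.scaleR_right)
      qed
      then show ?thesis by (simp add: tform_def)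
    qed
    show "tform (weak_jacobian G x) (weak_jacobian G z) K = tform (weak_jacobian G z) (weak_jacobian G x) K"
      unfolding tform_def
    proof (rule integral_cong_AE)
      show "(\<lambda>t. tensor_apply (K t) (weak_jacobian G x t) \<bullet> weak_jacobian G z t) \<in> borel_measurable (lebesgue_on G)"
        "(\<lambda>t. tensor_apply (K t) (weak_jacobian G z t) \<bullet> weak_jacobian G x t) \<in> borel_measurable (lebesgue_on G)"
        using int x z by auto
      have "AE t in lebesgue_on G. K t \<in> sym_tensors" using K by (simp add: Linf_carr)
      then show "AE t in lebesgue_on G. tensor_apply (K t) (weak_jacobian G x t) \<bullet> weak_jacobian G z t =
          tensor_apply (K t) (weak_jacobian G z t) \<bullet> weak_jacobian G x t"
        by eventually_elim (rule tensor_apply_symmetric)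
    qed
    show "0 \<le> tform (weak_jacobian G x) (weak_jacobian G x) K" by (rule pos[OF x])
    assume y: "y \<in> carr (Vspace G)"
    show "tform (weak_jacobian G (x + y)) (weak_jacobian G z) K =
        tform (weak_jacobian G x) (weak_jacobian G z) K + tform (weak_jacobian G y) (weak_jacobian G z) K"
    proof -
      have "tform (weak_jacobian G (x + y)) (weak_jacobian G z) K =
          (LINT t|lebesgue_on G. tensor_apply (K t) (weak_jacobian G x t) \<bullet> weak_jacobian G z t +
            tensor_apply (K t) (weak_jacobian G y t) \<bullet> weak_jacobian G z t)"
        unfolding tform_def
      proof (rule integral_cong_AE)
        show "(\<lambda>t. tensor_apply (K t) (weak_jacobian G (x + y) t) \<bullet> weak_jacobian G z t) \<in> borel_measurable (lebesgue_on G)"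
          using int[OF V.mem(2)[OF x y] z] by auto
        show "(\<lambda>t. tensor_apply (K t) (weak_jacobian G x t) \<bullet> weak_jacobian G z t +
            tensor_apply (K t) (weak_jacobian G y t) \<bullet> weak_jacobian G z t) \<in> borel_measurable (lebesgue_on G)"
          using int[OF x z] int[OF y z] by auto
        show "AE t in lebesgue_on G. tensor_apply (K t) (weak_jacobian G (x + y) t) \<bullet> weak_jacobian G z t =
            tensor_apply (K t) (weak_jacobian G x t) \<bullet> weak_jacobian G z t +
            tensor_apply (K t) (weak_jacobian G y t) \<bullet> weak_jacobian G z t"
          using Vspace_add(2)[OF x y] by eventually_elim (simp add: T.add_right inner_add_left)
      qed
      then show ?thesis using int[OF x z] int[OF y z] by (simp add: tform_def)
    qed
  qed (use V.S in simp)
qed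

end

section \<open>Weak time derivatives\<close>

lemma test_function_real:
  fixes \<phi> :: "real \<Rightarrow> real"
  assumes "\<phi> \<in> test_functions {0<..<T}"
  obtains K C where "compact K" "K \<subseteq> {0<..<T}" "\<And>x. x \<notin> K \<Longrightarrow> \<phi> x = 0" "\<And>x. x \<notin> K \<Longrightarrow> deriv \<phi> x = 0"
    "continuous_on UNIV \<phi>" "continuous_on UNIV (deriv \<phi>)" "\<And>x. \<phi> differentiable at x" "dir_deriv 1 \<phi> = deriv \<phi>"
    "\<And>x. \<bar>\<phi> x\<bar> \<le> C" "\<And>x. \<bar>deriv \<phi> x\<bar> \<le> C"
    "\<phi> \<in> borel_measurable (lebesgue_on {0<..<T})" "deriv \<phi> \<in> borel_measurable (lebesgue_on {0<..<T})"
proof -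
  obtain K where K: "compact K" "K \<subseteq> {0<..<T}" "\<And>x. x \<notin> K \<Longrightarrow> \<phi> x = 0"
    "\<And>b x. x \<notin> K \<Longrightarrow> dir_deriv b \<phi> x = 0" "smooth \<phi>"
    "continuous_on UNIV \<phi>" "\<And>b. b \<in> Basis \<Longrightarrow> continuous_on UNIV (dir_deriv b \<phi>)"
    by (rule test_functionD[OF assms]) (rule that)
  have diff: "\<phi> differentiable at x" for x by (rule smooth_differentiable[OF K(5)])
  have d: "dir_deriv 1 \<phi> = deriv \<phi>" using dir_deriv_real[OF diff] by auto
  have cont: "continuous_on UNIV (deriv \<phi>)" using K(7)[of 1] d by simp
  have bdd: "\<exists>C. \<forall>x. \<bar>\<psi> x\<bar> \<le> C" if \<psi>: "continuous_on UNIV \<psi>" "\<And>x. x \<notin> K \<Longrightarrow> \<psi> x = 0" for \<psi> :: "real \<Rightarrow> real"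
  proof -
    obtain B where B: "\<And>x. x \<in> K \<Longrightarrow> \<bar>\<psi> x\<bar> \<le> B"
      using compact_imp_bounded[OF compact_continuous_image[OF continuous_on_subset[OF \<psi>(1) subset_UNIV] K(1)]]
      by (metis bounded_iff image_eqI real_norm_def)
    have "\<bar>\<psi> x\<bar> \<le> \<bar>B\<bar>" for x using B[of x] \<psi>(2)[of x] by (cases "x \<in> K") auto
    then show ?thesis by blast
  qed
  have d0: "\<And>x. x \<notin> K \<Longrightarrow> deriv \<phi> x = 0" using K(4)[of _ 1] d by simp
  obtain C1 where C1: "\<And>x. \<bar>\<phi> x\<bar> \<le> C1" using bdd[OF K(6,3)] by blast
  obtain C2 where C2: "\<And>x. \<bar>deriv \<phi> x\<bar> \<le> C2" using bdd[OF cont d0] by blast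
  have m: "\<psi> \<in> borel_measurable (lebesgue_on {0<..<T})" if "continuous_on UNIV \<psi>" for \<psi> :: "real \<Rightarrow> real"
    using borel_measurable_continuous_onI[OF that]
    by (intro measurable_restrict_space1 measurable_completion) simp
  show ?thesis
  proof (rule that[OF K(1-3) d0 K(6) cont diff d])
    show "\<bar>\<phi> x\<bar> \<le> max C1 C2" "\<bar>deriv \<phi> x\<bar> \<le> max C1 C2" for x
      using C1[of x] C2[of x] by auto
    show "\<phi> \<in> borel_measurable (lebesgue_on {0<..<T})" "deriv \<phi> \<in> borel_measurable (lebesgue_on {0<..<T})"
      by (rule m[OF K(6)], rule m[OF cont])
  qed assumption+
qed

lemma test_function_real_measurable:
  fixes \<phi> :: "real \<Rightarrow> real"
  assumes "\<phi> \<in> test_functions {0<..<T}"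
  shows "\<phi> \<in> borel_measurable (lebesgue_on {0<..<T})" "deriv \<phi> \<in> borel_measurable (lebesgue_on {0<..<T})"
  by (rule test_function_real[OF assms], assumption)+

text \<open>The set where \<open>f\<close> is nonnegative is closed and has full measure in the open
  interval, so it contains this interval and its end points.\<close>

lemma nonneg_everywhere_if_AE:
  fixes f :: "real \<Rightarrow> real"
  assumes T: "0 < T" and f: "continuous_on {0..T} f" and ae: "AE t in lebesgue_on {0<..<T}. 0 \<le> f t"
    and t: "t \<in> {0..T}"
  shows "0 \<le> f t"
proof -
  let ?C = "{t \<in> {0..T}. 0 \<le> f t}"
  have C: "closed ?C"
  proof -
    have "?C = {0..T} \<inter> f -` {0..}" by auto
    then show ?thesis
      using continuous_closed_preimage[OF f closed_atLeastAtMost closed_atLeast[of 0]] by (simp only:)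
  qed
  have "AE t in lebesgue. t \<in> {0<..<T} \<longrightarrow> 0 \<le> f t"
    using ae by (simp add: AE_restrict_space_iff)
  then have ae': "AE t\<in>{0<..<T} in lebesgue. t \<in> ?C"
    by eventually_elim auto
  have "{0<..<T} \<subseteq> ?C"
    using mem_closed_if_AE_lebesgue_open[OF open_greaterThanLessThan C ae'] by blast
  then have "closure {0<..<T} \<subseteq> ?C" using C by (rule closure_minimal)
  then show ?thesis using t T by auto
qed

section \<open>Continuous representatives in time\<close>

definition continuous_in :: "real \<Rightarrow> 'f::real_vector space_rec \<Rightarrow> (real \<Rightarrow> 'f) \<Rightarrow> bool" where
  "continuous_in T X h \<longleftrightarrow> (\<forall>t\<in>{0..T}. h t \<in> carr X \<and>
     ((\<lambda>s. snorm X (h s - h t)) \<longlongrightarrow> 0) (at t within {0..T}))"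

lemma continuous_in_carr: "continuous_in T X h \<Longrightarrow> t \<in> {0..T} \<Longrightarrow> h t \<in> carr X"
  by (simp add: continuous_in_def)

lemma (in seminormed) continuous_in_functional:
  assumes h: "continuous_in T X h"
    and bound: "\<And>x y. x \<in> carr X \<Longrightarrow> y \<in> carr X \<Longrightarrow> \<bar>\<Lambda> x - \<Lambda> y\<bar> \<le> C * snorm X (x - y)"
  shows "continuous_on {0..T} (\<lambda>t. \<Lambda> (h t) :: real)"
  unfolding continuous_on_def
proof
  fix t assume t: "t \<in> {0..T}"
  show "((\<lambda>t. \<Lambda> (h t)) \<longlongrightarrow> \<Lambda> (h t)) (at t within {0..T})"
  proof (rule LIM_zero_cancel, rule tendsto_rabs_zero_cancel, rule tendsto_sandwich[OF _ _ tendsto_const])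
    show "\<forall>\<^sub>F s in at t within {0..T}. \<bar>\<Lambda> (h s) - \<Lambda> (h t)\<bar> \<le> C * snorm X (h s - h t)"
      using bound continuous_in_carr[OF h] t by (auto simp: eventually_at_filter)
    have "((\<lambda>s. snorm X (h s - h t)) \<longlongrightarrow> 0) (at t within {0..T})"
      using h t by (simp add: continuous_in_def)
    from tendsto_mult[OF tendsto_const this, of C]
    show "((\<lambda>s. C * snorm X (h s - h t)) \<longlongrightarrow> 0) (at t within {0..T})" by simp
  qed simp
qed

lemma (in seminormed) continuous_in_snorm:
  "continuous_in T X h \<Longrightarrow> continuous_on {0..T} (\<lambda>t. snorm X (h t))"
  by (rule continuous_in_functional[where C = 1 and \<Lambda> = "snorm X"]) (auto simp: snorm_reverse_triangle)

lemma (in seminormed) continuous_in_diff_shift: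
  assumes h: "continuous_in T X h" and T: "0 < T" and \<eta>: "0 < \<eta>"
  shows "continuous_in T X (\<lambda>t. c *\<^sub>R (h t - h (max 0 (t - \<eta>))))"
  unfolding continuous_in_def
proof (intro ballI conjI)
  fix t assume t: "t \<in> {0..T}"
  have mem_s: "h s \<in> carr X" "h (max 0 (s - \<eta>)) \<in> carr X" if "s \<in> {0..T}" for s
    using that T \<eta> by (auto intro!: continuous_in_carr[OF h])
  show "c *\<^sub>R (h t - h (max 0 (t - \<eta>))) \<in> carr X" using mem_s[OF t] by simp
  have cont: "continuous_on {0..T} (\<lambda>s. snorm X (h s - h r))" if "r \<in> {0..T}" for r
  proof (rule continuous_in_functional[OF h, where C = 1 and \<Lambda> = "\<lambda>x. snorm X (x - h r)"])
    fix x y assume "x \<in> carr X" "y \<in> carr X"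
    then show "\<bar>snorm X (x - h r) - snorm X (y - h r)\<bar> \<le> 1 * snorm X (x - y)"
      using snorm_reverse_triangle[of "x - h r" "y - h r"] continuous_in_carr[OF h that] by simp
  qed
  let ?r = "max 0 (t - \<eta>)"
  have r: "?r \<in> {0..T}" using t T \<eta> by auto
  have "continuous_on {0..T} (\<lambda>s. \<bar>c\<bar> * (snorm X (h s - h t) + snorm X (h (max 0 (s - \<eta>)) - h ?r)))"
    using T \<eta> by (intro continuous_intros cont[OF t] continuous_on_compose2[OF cont[OF r]]) auto
  then have lim: "((\<lambda>s. \<bar>c\<bar> * (snorm X (h s - h t) + snorm X (h (max 0 (s - \<eta>)) - h ?r))) \<longlongrightarrow> 0) (at t within {0..T})"
    using t unfolding continuous_on_def by (drule_tac bspec[OF _ t]) simp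
  show "((\<lambda>s. snorm X (c *\<^sub>R (h s - h (max 0 (s - \<eta>))) - c *\<^sub>R (h t - h ?r))) \<longlongrightarrow> 0) (at t within {0..T})"
  proof (rule tendsto_sandwich[OF _ _ tendsto_const lim])
    have *: "0 \<le> snorm X (c *\<^sub>R (h s - h (max 0 (s - \<eta>))) - c *\<^sub>R (h t - h ?r)) \<and>
        snorm X (c *\<^sub>R (h s - h (max 0 (s - \<eta>))) - c *\<^sub>R (h t - h ?r)) \<le>
        \<bar>c\<bar> * (snorm X (h s - h t) + snorm X (h (max 0 (s - \<eta>)) - h ?r))" if s: "s \<in> {0..T}" for s
    proof -
      have eq: "c *\<^sub>R (h s - h (max 0 (s - \<eta>))) - c *\<^sub>R (h t - h ?r) =
          c *\<^sub>R ((h s - h t) - (h (max 0 (s - \<eta>)) - h ?r))" by (simp add: algebra_simps)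
      have m: "h s - h t \<in> carr X" "h (max 0 (s - \<eta>)) - h ?r \<in> carr X"
        using mem_s[OF s] mem_s[OF t] by auto
      then show ?thesis
        unfolding eq using snorm_triangle_minus[OF m]
        by (simp add: snorm_scale mult_left_mono snorm_nonneg)
    qed
    show "\<forall>\<^sub>F s in at t within {0..T}. 0 \<le> snorm X (c *\<^sub>R (h s - h (max 0 (s - \<eta>))) - c *\<^sub>R (h t - h ?r))"
      "\<forall>\<^sub>F s in at t within {0..T}. snorm X (c *\<^sub>R (h s - h (max 0 (s - \<eta>))) - c *\<^sub>R (h t - h ?r)) \<le>
        \<bar>c\<bar> * (snorm X (h s - h t) + snorm X (h (max 0 (s - \<eta>)) - h ?r))"
      using * unfolding eventually_at_filter by (auto intro!: always_eventually)
  qed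
qed

lemma finite_complete_measure_interval: "finite_complete_measure (lebesgue_on {0<..<T::real})"
  by (rule finite_complete_measure_lebesgue_on) simp

text \<open>Sampling at time rounded down to multiples of 1/(n+1) gives simple functions that
  converge by continuity. Rounding down keeps the sample points between 0 and \<open>t\<close>,
  where \<open>h\<close> is controlled. Boundedness on the compact interval gives square
  integrability.\<close>

lemma (in seminormed) continuous_in_imp_L2set:
  assumes h: "continuous_in T X h" and T: "0 < T"
  shows "h \<in> L2set (lebesgue_on {0<..<T}) X"
proof -
  let ?M = "lebesgue_on {0<..<T}"
  interpret M: finite_complete_measure ?M by (rule finite_complete_measure_interval)
  interpret bochner_space ?M X ..
  define q where "q n t = real_of_int \<lfloor>t * real (Suc n)\<rfloor> / real (Suc n)" for n t
  have q_le: "q n t \<le> t" "t - inverse (real (Suc n)) \<le> q n t" for n t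
  proof -
    have "real_of_int \<lfloor>t * real (Suc n)\<rfloor> \<le> t * real (Suc n)" by (rule of_int_floor_le)
    then show "q n t \<le> t" unfolding q_def by (simp add: divide_le_eq del: of_nat_Suc)
    have "t * real (Suc n) - 1 \<le> real_of_int \<lfloor>t * real (Suc n)\<rfloor>" by linarith
    then have "(t * real (Suc n) - 1) / real (Suc n) \<le> q n t"
      unfolding q_def by (intro divide_right_mono) auto
    then show "t - inverse (real (Suc n)) \<le> q n t"
      by (simp add: diff_divide_distrib inverse_eq_divide del: of_nat_Suc)
  qed
  have q_nonneg: "0 \<le> q n t" if "0 \<le> t" for n t using that by (simp add: q_def)
  have q_in: "q n t \<in> {0..T}" if "t \<in> {0<..<T}" for n t
    using q_le(1)[of n t] q_nonneg[of t n] that by auto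
  have q_simple: "simple_function ?M (q n)" for n
  proof (rule simple_function_borel_measurable)
    show "q n \<in> borel_measurable ?M"
      unfolding q_def by (intro measurable_restrict_space1 measurable_completion) measurable
    have "q n ` space ?M \<subseteq> (\<lambda>k. real_of_int k / real (Suc n)) ` {0..\<lfloor>T * real (Suc n)\<rfloor>}"
    proof
      fix y assume "y \<in> q n ` space ?M"
      then obtain t where t: "t \<in> {0<..<T}" "y = q n t" by auto
      have "\<lfloor>t * real (Suc n)\<rfloor> \<in> {0..\<lfloor>T * real (Suc n)\<rfloor>}"
        using t by (auto intro!: floor_mono mult_right_mono simp del: of_nat_Suc)
      then show "y \<in> (\<lambda>k. real_of_int k / real (Suc n)) ` {0..\<lfloor>T * real (Suc n)\<rfloor>}"
        unfolding t(2) q_def by (rule imageI)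
    qed
    then show "finite (q n ` space ?M)" by (rule finite_subset) simp
  qed
  have lim: "(\<lambda>n. snorm X (h (q n t) - h t)) \<longlonglongrightarrow> 0" if t: "t \<in> {0<..<T}" for t
  proof -
    have tT: "t \<in> {0..T}" using t by auto
    have "continuous_on {0..T} (\<lambda>s. snorm X (h s - h t))"
    proof (rule continuous_in_functional[OF h, where C = 1 and \<Lambda> = "\<lambda>x. snorm X (x - h t)"])
      fix x y assume "x \<in> carr X" "y \<in> carr X"
      then show "\<bar>snorm X (x - h t) - snorm X (y - h t)\<bar> \<le> 1 * snorm X (x - y)"
        using snorm_reverse_triangle[of "x - h t" "y - h t"] continuous_in_carr[OF h tT] by simp
    qed
    moreover have "(\<lambda>n. q n t) \<longlonglongrightarrow> t"
    proof (rule tendsto_sandwich[OF _ _ _ tendsto_const])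
      show "(\<lambda>n. t - inverse (real (Suc n))) \<longlonglongrightarrow> t"
        using tendsto_diff[OF tendsto_const LIMSEQ_inverse_real_of_nat, of t] by simp
    qed (use q_le in auto)
    ultimately have "(\<lambda>n. snorm X (h (q n t) - h t)) \<longlonglongrightarrow> snorm X (h t - h t)"
      by (rule continuous_on_tendsto_compose) (use tT q_in[OF t] in auto)
    then show ?thesis by simp
  qed
  have sm: "strongly_measurable_in ?M X h"
    unfolding strongly_measurable_in_def
  proof (intro conjI exI[of _ "\<lambda>n t. h (q n t)"] allI)
    show "AE t in ?M. h t \<in> carr X" by (intro AE_I2 continuous_in_carr[OF h]) auto
    show "simple_function ?M (\<lambda>t. h (q n t))" for n
      by (rule simple_function_compose1[OF q_simple, where g = h])
    show "(\<lambda>t. h (q n t)) ` space ?M \<subseteq> carr X" for n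
      using continuous_in_carr[OF h] q_in by auto
    show "AE t in ?M. (\<lambda>n. snorm X (h (q n t) - h t)) \<longlonglongrightarrow> 0"
      by (intro AE_I2 lim) simp
  qed
  obtain B where B: "\<And>t. t \<in> {0..T} \<Longrightarrow> \<bar>snorm X (h t)\<bar> \<le> B"
    using compact_imp_bounded[OF compact_continuous_image[OF continuous_in_snorm[OF h] compact_Icc]]
    by (metis bounded_iff image_eqI real_norm_def)
  have "integrable ?M (\<lambda>t. (snorm X (h t))\<^sup>2)"
  proof (rule M.integrable_const_bound[where B = "B\<^sup>2"])
    show "AE t in ?M. norm ((snorm X (h t))\<^sup>2) \<le> B\<^sup>2"
    proof (rule AE_I2)
      fix t assume "t \<in> space ?M"
      then have "\<bar>snorm X (h t)\<bar>\<^sup>2 \<le> B\<^sup>2" by (intro power_mono B) auto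
      then show "norm ((snorm X (h t))\<^sup>2) \<le> B\<^sup>2" by simp
    qed
    show "(\<lambda>t. (snorm X (h t))\<^sup>2) \<in> borel_measurable ?M"
      by (intro borel_measurable_power strongly_measurable_snorm sm)
  qed
  then show ?thesis using sm by (simp add: L2set_def)
qed

text \<open>The functional is applied to both integrals in the definition of the weak derivative,
  which share the value \<open>I\<close>. The scalar identity that results is the input of
  \<open>weak_derivative_imp_FTC\<close>.\<close>

lemma (in seminormed) time_deriv_functional:
  assumes fg: "has_time_deriv T X f g"
    and f: "strongly_measurable_in (lebesgue_on {0<..<T}) X f" and g: "strongly_measurable_in (lebesgue_on {0<..<T}) X g"
    and add: "\<And>x y. x \<in> carr X \<Longrightarrow> y \<in> carr X \<Longrightarrow> \<Lambda> (x + y) = \<Lambda> x + \<Lambda> y"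
    and scale: "\<And>r x. x \<in> carr X \<Longrightarrow> \<Lambda> (r *\<^sub>R x) = r * \<Lambda> x"
    and bound: "\<And>x. x \<in> carr X \<Longrightarrow> \<bar>\<Lambda> x\<bar> \<le> C * snorm X x"
    and \<phi>: "\<phi> \<in> test_functions {0<..<T}"
  shows "(LINT t|lebesgue_on {0<..<T}. deriv \<phi> t * \<Lambda> (f t)) = - (LINT t|lebesgue_on {0<..<T}. \<phi> t * (\<Lambda> (g t) :: real))"
proof -
  let ?M = "lebesgue_on {0<..<T}"
  interpret M: finite_complete_measure ?M by (rule finite_complete_measure_interval)
  interpret bochner_space ?M X ..
  obtain I where I: "has_bochner_integral_in ?M X (\<lambda>t. deriv \<phi> t *\<^sub>R f t) I"
    "has_bochner_integral_in ?M X (\<lambda>t. - \<phi> t *\<^sub>R g t) I"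
    using fg \<phi> unfolding has_time_deriv_def by blast
  note m = test_function_real_measurable[OF \<phi>]
  have eq: "(LINT t|?M. \<psi> t * \<Lambda> (k t)) = \<Lambda> I"
    if I: "has_bochner_integral_in ?M X (\<lambda>t. \<psi> t *\<^sub>R k t) I" and \<psi>: "\<psi> \<in> borel_measurable ?M"
      and k: "strongly_measurable_in ?M X k" for \<psi> k
  proof -
    have i: "has_bochner_integral ?M (\<lambda>t. \<Lambda> (\<psi> t *\<^sub>R k t)) (\<Lambda> I)"
      by (rule has_bochner_integral_in_functional[OF I add scale bound])
    have "(LINT t|?M. \<psi> t * \<Lambda> (k t)) = (LINT t|?M. \<Lambda> (\<psi> t *\<^sub>R k t))"
    proof (rule integral_cong_AE)
      show "(\<lambda>t. \<psi> t * \<Lambda> (k t)) \<in> borel_measurable ?M"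
        by (intro borel_measurable_times \<psi> strongly_measurable_functional[OF k add scale bound])
      show "(\<lambda>t. \<Lambda> (\<psi> t *\<^sub>R k t)) \<in> borel_measurable ?M" using i by (rule borel_measurable_has_bochner_integral)
      show "AE t in ?M. \<psi> t * \<Lambda> (k t) = \<Lambda> (\<psi> t *\<^sub>R k t)"
        using strongly_measurable_carr[OF k] by eventually_elim (simp add: scale)
    qed
    then show ?thesis using i by (simp add: has_bochner_integral_iff)
  qed
  have "(LINT t|?M. - \<phi> t * \<Lambda> (g t)) = \<Lambda> I"
    by (rule eq[OF I(2) _ g]) (use m(1) in simp)
  then show ?thesis using eq[OF I(1) m(2) f] by simp
qed

section \<open>Weak time derivatives and the product\<close>

context inner_carrier
begin

lemma B_functional_bound: "x \<in> carr X \<Longrightarrow> v \<in> carr X \<Longrightarrow> \<bar>B x v\<bar> \<le> snorm X v * snorm X x"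
  using Cauchy_Schwarz_snorm[of x v] by (simp add: mult.commute)

text \<open>Both Bochner integrals exist by completeness. Their values \<open>I\<close> and
  \<open>J\<close> have the same product with every \<open>v\<close>, and the choice
  \<open>v = J - I\<close> shows that they differ by a null element, so \<open>I\<close> can be used
  for both.\<close>

lemma has_time_derivI:
  assumes X: "complete_seminormed X"
    and f: "f \<in> time_L2 T X" and g: "g \<in> time_L2 T X"
    and weak: "\<And>\<phi> v. \<phi> \<in> test_functions {0<..<T} \<Longrightarrow> v \<in> carr X \<Longrightarrow>
      (LINT t|lebesgue_on {0<..<T}. \<phi> t * B (g t) v) = - (LINT t|lebesgue_on {0<..<T}. deriv \<phi> t * B (f t) v)"
  shows "has_time_deriv T X f g"
  unfolding has_time_deriv_def
proof
  fix \<phi> assume \<phi>: "\<phi> \<in> test_functions {0<..<T}"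
  let ?M = "lebesgue_on {0<..<T}"
  interpret M: finite_complete_measure ?M by (rule finite_complete_measure_interval)
  interpret X: complete_seminormed X by (rule X)
  interpret complete_bochner_space ?M X ..
  obtain C where C: "\<And>x. \<bar>\<phi> x\<bar> \<le> C" "\<And>x. \<bar>deriv \<phi> x\<bar> \<le> C"
    by (rule test_function_real[OF \<phi>]) (rule that)
  note C = C test_function_real_measurable[OF \<phi>]
  have fg: "f \<in> L2set ?M X" "g \<in> L2set ?M X" using f g by (simp_all add: time_L2_eq)
  have "(\<lambda>t. deriv \<phi> t *\<^sub>R f t) \<in> L2set ?M X" by (rule L2set_mult[OF fg(1) C(4) C(2)])
  then obtain I where I: "has_bochner_integral_in ?M X (\<lambda>t. deriv \<phi> t *\<^sub>R f t) I"
    using has_bochner_integral_in_exists by blast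
  have "(\<lambda>t. - \<phi> t *\<^sub>R g t) \<in> L2set ?M X"
    using C(1,3) by (intro L2set_mult[OF fg(2), where C = C]) auto
  then obtain J where J: "has_bochner_integral_in ?M X (\<lambda>t. - \<phi> t *\<^sub>R g t) J"
    using has_bochner_integral_in_exists by blast
  have IJ: "I \<in> carr X" "J \<in> carr X" using I J by (auto simp: has_bochner_integral_in_def)
  have pair: "(LINT t|?M. \<psi> t * B (k t) v) = B I v"
    if I: "has_bochner_integral_in ?M X (\<lambda>t. \<psi> t *\<^sub>R k t) I" and \<psi>: "\<psi> \<in> borel_measurable ?M"
      and k: "k \<in> L2set ?M X" and v: "v \<in> carr X" for \<psi> k I v
  proof -
    have i: "has_bochner_integral ?M (\<lambda>t. B (\<psi> t *\<^sub>R k t) v) (B I v)"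
      by (rule has_bochner_integral_in_functional[OF I, where C = "snorm X v"])
         (simp_all add: add_left scale_left v B_functional_bound)
    have "(LINT t|?M. \<psi> t * B (k t) v) = (LINT t|?M. B (\<psi> t *\<^sub>R k t) v)"
    proof (rule integral_cong_AE)
      show "(\<lambda>t. \<psi> t * B (k t) v) \<in> borel_measurable ?M"
        by (intro borel_measurable_times \<psi> borel_measurable_integrable
            integrable_L2set[OF M.finite_complete_measure_axioms k L2set_const[OF v]])
      show "(\<lambda>t. B (\<psi> t *\<^sub>R k t) v) \<in> borel_measurable ?M" using i by (rule borel_measurable_has_bochner_integral)
      show "AE t in ?M. \<psi> t * B (k t) v = B (\<psi> t *\<^sub>R k t) v"
        using L2set_carr[OF k] by eventually_elim (simp add: scale_left v)
    qed
    then show ?thesis using i by (simp add: has_bochner_integral_iff)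
  qed
  have eq: "B J v = B I v" if v: "v \<in> carr X" for v
  proof -
    have "B J v = (LINT t|?M. - \<phi> t * B (g t) v)"
      by (rule pair[OF J _ fg(2) v, symmetric]) (use C(3) in simp)
    also have "\<dots> = (LINT t|?M. deriv \<phi> t * B (f t) v)"
      using weak[OF \<phi> v] by simp
    also have "\<dots> = B I v" by (rule pair[OF I C(4) fg(1) v])
    finally show ?thesis .
  qed
  have "B (J - I) (J - I) = 0"
    using eq[of "J - I"] IJ by (simp add: diff_left)
  then have "snorm X (J - I) = 0" using IJ by (simp add: snorm_eq)
  then have "has_bochner_integral_in ?M X (\<lambda>t. - \<phi> t *\<^sub>R g t) I"
    by (rule has_bochner_integral_in_cong[OF J IJ(1)])
  then show "\<exists>I. has_bochner_integral_in ?M X (\<lambda>t. deriv \<phi> t *\<^sub>R f t) I \<and>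
      has_bochner_integral_in ?M X (\<lambda>t. - \<phi> t *\<^sub>R g t) I"
    using I by blast
qed

text \<open>The assumption says that the backward difference quotients have squared L^2 norm at most
  \<open>K\<close>. A weak limit \<open>g\<close> exists, and it is identified by moving the
  differences onto the test function, where they converge to its derivative.\<close>

lemma weak_time_derivative_exists:
  assumes X: "complete_seminormed X" and T: "0 < T" and h: "continuous_in T X h"
    and K: "\<And>\<eta>. 0 < \<eta> \<Longrightarrow> \<eta> < T \<Longrightarrow>
      (LINT t|lebesgue_on {0<..<T}. B (h t - h (max 0 (t - \<eta>))) (h t - h (max 0 (t - \<eta>)))) \<le> K * \<eta>\<^sup>2"
  shows "\<exists>g\<in>time_L2 T X. (\<forall>t. g t \<in> carr X) \<and> (\<forall>\<phi> v. \<phi> \<in> test_functions {0<..<T} \<longrightarrow> v \<in> carr X \<longrightarrow>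
    (LINT t|lebesgue_on {0<..<T}. \<phi> t * B (g t) v) = - (LINT t|lebesgue_on {0<..<T}. deriv \<phi> t * B (h t) v))"
proof -
  let ?M = "lebesgue_on {0<..<T}"
  interpret M: finite_complete_measure ?M by (rule finite_complete_measure_interval)
  interpret X: complete_seminormed X by (rule X)
  interpret complete_bochner_space ?M X ..
  \<comment> \<open>The index shift makes every step shorter than T, as the bound requires.\<close>
  obtain n0 where n0: "inverse (real (Suc n0)) < T" using reals_Archimedean[OF T] by blast
  define \<eta> where "\<eta> n = inverse (real (Suc (n + n0)))" for n
  have \<eta>: "0 < \<eta> n" "\<eta> n < T" for n
  proof -
    show "0 < \<eta> n" by (simp add: \<eta>_def)
    have "\<eta> n \<le> inverse (real (Suc n0))" unfolding \<eta>_def by (intro le_imp_inverse_le) auto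
    then show "\<eta> n < T" using n0 by simp
  qed
  define D where "D n t = inverse (\<eta> n) *\<^sub>R (h t - h (max 0 (t - \<eta> n)))" for n t
  have D_L2: "D n \<in> L2set ?M X" for n
    unfolding D_def[abs_def]
    by (rule X.continuous_in_imp_L2set[OF X.continuous_in_diff_shift[OF h T \<eta>(1)] T])
  have h_mem: "h t \<in> carr X \<and> h (max 0 (t - \<eta> n)) \<in> carr X" if "t \<in> {0<..<T}" for t n
    using that \<eta>(1)[of n] by (auto intro!: continuous_in_carr[OF h])
  have D_bound: "(LINT t|?M. (snorm X (D n t))\<^sup>2) \<le> K" for n
  proof -
    have "(LINT t|?M. (snorm X (D n t))\<^sup>2) =
        (LINT t|?M. inverse (\<eta> n) ^ 2 * B (h t - h (max 0 (t - \<eta> n))) (h t - h (max 0 (t - \<eta> n))))"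
    proof (intro Bochner_Integration.integral_cong refl)
      fix t assume "t \<in> space ?M"
      then have "h t - h (max 0 (t - \<eta> n)) \<in> carr X" using h_mem[of t n] by simp
      then show "(snorm X (D n t))\<^sup>2 = inverse (\<eta> n) ^ 2 * B (h t - h (max 0 (t - \<eta> n))) (h t - h (max 0 (t - \<eta> n)))"
        using \<eta>(1)[of n] by (simp add: D_def X.snorm_scale power_mult_distrib snorm_square)
    qed
    also have "\<dots> = inverse (\<eta> n) ^ 2 * (LINT t|?M. B (h t - h (max 0 (t - \<eta> n))) (h t - h (max 0 (t - \<eta> n))))"
      by simp
    also have "\<dots> \<le> inverse (\<eta> n) ^ 2 * (K * (\<eta> n)\<^sup>2)"
      by (intro mult_left_mono K \<eta>) simp
    also have "\<dots> = K" using \<eta>(1)[of n] by (simp add: field_simps)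
    finally show ?thesis .
  qed
  obtain g where g: "g \<in> L2set ?M X" "\<forall>t. g t \<in> carr X"
    "\<And>\<phi> v c C. \<phi> \<in> borel_measurable ?M \<Longrightarrow> (\<forall>t\<in>space ?M. \<bar>\<phi> t\<bar> \<le> C) \<Longrightarrow> v \<in> carr X \<Longrightarrow>
      (\<lambda>n. LINT t|?M. \<phi> t * B (D n t) v) \<longlonglongrightarrow> c \<Longrightarrow> (LINT t|?M. \<phi> t * B (g t) v) = c"
    using L2set_weak_limit[OF M.finite_complete_measure_axioms X, where D = D and K = K, OF D_L2 D_bound] by blast
  have "(LINT t|?M. \<phi> t * B (g t) v) = - (LINT t|?M. deriv \<phi> t * B (h t) v)"
    if \<phi>: "\<phi> \<in> test_functions {0<..<T}" and v: "v \<in> carr X" for \<phi> v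
  proof -
    obtain Kc C where \<phi>p: "compact Kc" "Kc \<subseteq> {0<..<T}" "\<And>x. x \<notin> Kc \<Longrightarrow> \<phi> x = 0" "\<And>x. x \<notin> Kc \<Longrightarrow> deriv \<phi> x = 0"
      "continuous_on UNIV \<phi>" "continuous_on UNIV (deriv \<phi>)" "\<And>x. \<phi> differentiable at x" "dir_deriv 1 \<phi> = deriv \<phi>"
      "\<And>x. \<bar>\<phi> x\<bar> \<le> C" "\<And>x. \<bar>deriv \<phi> x\<bar> \<le> C" "\<phi> \<in> borel_measurable ?M" "deriv \<phi> \<in> borel_measurable ?M"
      by (rule test_function_real[OF \<phi>]) (rule that)
    \<comment> \<open>The scalar function of time, continued by its boundary values. To the left of
      0 this agrees with the cut-off \<open>max 0 (t - \<eta>)\<close>, and shifts on the whole line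
      become possible.\<close>
    define k where "k t = B (h (max 0 (min T t))) v" for t
    have contB: "continuous_on {0..T} (\<lambda>t. B (h t) v)"
    proof (rule X.continuous_in_functional[OF h, where C = "snorm X v"])
      fix x y assume "x \<in> carr X" "y \<in> carr X"
      then show "\<bar>B x v - B y v\<bar> \<le> snorm X v * snorm X (x - y)"
        using B_functional_bound[of "x - y" v] v by (simp add: diff_left)
    qed
    have "continuous_on UNIV k"
      unfolding k_def using T by (intro continuous_on_compose2[OF contB] continuous_intros) auto
    then have k_meas [measurable]: "k \<in> borel_measurable borel" by (rule borel_measurable_continuous_onI)
    have \<phi>_meas [measurable]: "\<phi> \<in> borel_measurable borel" "deriv \<phi> \<in> borel_measurable borel"
      using \<phi>p(5,6) by (auto intro: borel_measurable_continuous_onI)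
    obtain Bk where Bk0: "\<And>t. t \<in> {0..T} \<Longrightarrow> \<bar>B (h t) v\<bar> \<le> Bk"
      using compact_imp_bounded[OF compact_continuous_image[OF contB compact_Icc]]
      by (metis bounded_iff image_eqI real_norm_def)
    have Bk: "\<bar>k t\<bar> \<le> Bk" for t unfolding k_def using T by (intro Bk0) auto
    have conv: "(LINT t|?M. F t) = (LINT t|lborel. F' t)"
      if "\<And>t. t \<in> {0<..<T} \<Longrightarrow> F t = F' t" "\<And>t. t \<notin> {0<..<T} \<Longrightarrow> F' t = 0" "F' \<in> borel_measurable borel"
      for F F' :: "real \<Rightarrow> real"
    proof -
      have "(LINT t|?M. F t) = (LINT t|?M. F' t)"
        using that(1) by (intro Bochner_Integration.integral_cong refl) simp
      also have "\<dots> = (LINT t|lborel. F' t)" by (rule integral_lebesgue_on_eq_lborel) (use that(2,3) in auto)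
      finally show ?thesis .
    qed
    have int\<phi>k: "integrable lborel (\<lambda>t. \<phi> (t + c) * k t)" for c
    proof -
      have "bounded Kc" using \<phi>p(1) by (rule compact_imp_bounded)
      then obtain R where R: "\<And>x. x \<in> Kc \<Longrightarrow> norm x \<le> R" by (auto simp: bounded_iff)
      have i: "integrable lborel (indicator (cball 0 (R + \<bar>c\<bar>)) :: real \<Rightarrow> real)"
        using emeasure_bounded_finite[OF bounded_cball] by (intro integrable_real_indicator) auto
      show ?thesis
      proof (rule Bochner_Integration.integrable_bound)
        show "integrable lborel (\<lambda>t::real. C * Bk * indicator (cball 0 (R + \<bar>c\<bar>)) t :: real)"
          using i by simp
        show "AE t in lborel. norm (\<phi> (t + c) * k t) \<le> norm (C * Bk * indicator (cball 0 (R + \<bar>c\<bar>)) t :: real)"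
        proof (rule AE_I2)
          fix t :: real
          show "norm (\<phi> (t + c) * k t) \<le> norm (C * Bk * indicator (cball 0 (R + \<bar>c\<bar>)) t :: real)"
          proof (cases "t + c \<in> Kc")
            case True
            then have "\<bar>t + c\<bar> \<le> R" using R[of "t + c"] by simp
            then have "t \<in> cball 0 (R + \<bar>c\<bar>)" by simp
            moreover have "\<bar>\<phi> (t + c)\<bar> * \<bar>k t\<bar> \<le> \<bar>C * Bk\<bar>"
              unfolding abs_mult using \<phi>p(9)[of "t + c"] Bk[of t] by (intro mult_mono) auto
            ultimately show ?thesis by (simp add: abs_mult)
          qed (simp add: \<phi>p(3))
        qed
      qed measurable
    qed
    \<comment> \<open>Discrete integration by parts: a translation by \<eta> turns the backward
      difference of \<open>k\<close> into minus the forward difference of \<phi>.\<close>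
    have quot: "(LINT t|?M. \<phi> t * B (D n t) v) =
        - (LINT t|lborel. (\<phi> (t + inverse (real (Suc (n + n0))) *\<^sub>R 1) - \<phi> t) * real (Suc (n + n0)) * k t)" for n
    proof -
      have inv: "inverse (\<eta> n) = real (Suc (n + n0))" by (simp add: \<eta>_def)
      have "(LINT t|?M. \<phi> t * B (D n t) v) = (LINT t|lborel. \<phi> t * (inverse (\<eta> n) * (k t - k (t - \<eta> n))))"
      proof (rule conv)
        fix t assume t: "t \<in> {0<..<T}"
        have "max 0 (min T (t - \<eta> n)) = max 0 (t - \<eta> n)" "max 0 (min T t) = t"
          using t \<eta>(1)[of n] by auto
        then show "\<phi> t * B (D n t) v = \<phi> t * (inverse (\<eta> n) * (k t - k (t - \<eta> n)))"
          using h_mem[OF t, of n] v by (simp add: D_def k_def scale_left diff_left)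
      next
        fix t assume "t \<notin> {0<..<T}"
        then have "t \<notin> Kc" using \<phi>p(2) by blast
        then show "\<phi> t * (inverse (\<eta> n) * (k t - k (t - \<eta> n))) = 0" by (simp add: \<phi>p(3))
      qed measurable
      also have "\<dots> = (LINT t|lborel. inverse (\<eta> n) * (\<phi> t * k t) - inverse (\<eta> n) * (\<phi> t * k (t - \<eta> n)))"
        by (intro Bochner_Integration.integral_cong refl) (simp add: algebra_simps)
      also have "\<dots> = inverse (\<eta> n) * (LINT t|lborel. \<phi> t * k t) - inverse (\<eta> n) * (LINT t|lborel. \<phi> t * k (t - \<eta> n))"
      proof -
        have "integrable lborel (\<lambda>t. \<phi> t * k (t - \<eta> n))"
          using lborel_integrable_real_affine[OF int\<phi>k[of "\<eta> n"], of 1 "- \<eta> n"] by simp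
        then show ?thesis using int\<phi>k[of 0] by simp
      qed
      also have "(LINT t|lborel. \<phi> t * k (t - \<eta> n)) = (LINT t|lborel. \<phi> (t + \<eta> n) * k t)"
        by (subst lborel_integral_real_affine[where c = 1 and t = "\<eta> n"]) (simp_all add: add.commute)
      also have "inverse (\<eta> n) * (LINT t|lborel. \<phi> t * k t) - inverse (\<eta> n) * (LINT t|lborel. \<phi> (t + \<eta> n) * k t) =
          - (LINT t|lborel. (\<phi> (t + \<eta> n) - \<phi> t) * inverse (\<eta> n) * k t)"
      proof -
        have "(LINT t|lborel. (\<phi> (t + \<eta> n) - \<phi> t) * inverse (\<eta> n) * k t) =
            (LINT t|lborel. inverse (\<eta> n) * (\<phi> (t + \<eta> n) * k t) - inverse (\<eta> n) * (\<phi> t * k t))"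
          by (intro Bochner_Integration.integral_cong refl) (simp add: algebra_simps)
        then show ?thesis using int\<phi>k[of 0] int\<phi>k[of "\<eta> n"] by simp
      qed
      finally show ?thesis unfolding inv by (simp add: \<eta>_def)
    qed
    have "bounded Kc" using \<phi>p(1) by (rule compact_imp_bounded)
    then obtain R where R: "\<And>x. x \<in> Kc \<Longrightarrow> norm x \<le> R" by (auto simp: bounded_iff)
    have "(\<lambda>n. LINT t|lborel. (\<phi> (t + inverse (real (Suc n)) *\<^sub>R 1) - \<phi> t) * real (Suc n) * k t)
        \<longlonglongrightarrow> (LINT t|lborel. dir_deriv 1 \<phi> t * k t)"
    proof (rule difference_quotient_tendsto[OF \<phi>p(7) _ _ _ k_meas Bk])
      show "continuous_on UNIV (dir_deriv 1 \<phi>)" using \<phi>p(6,8) by simp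
      show "\<phi> x = 0" if "x \<notin> cball 0 R" for x
        using that R[of x] by (intro \<phi>p(3)) auto
    qed simp
    then have "(\<lambda>n. - (LINT t|lborel. (\<phi> (t + inverse (real (Suc (n + n0))) *\<^sub>R 1) - \<phi> t) * real (Suc (n + n0)) * k t))
        \<longlonglongrightarrow> - (LINT t|lborel. dir_deriv 1 \<phi> t * k t)"
      by (intro tendsto_minus LIMSEQ_ignore_initial_segment)
    moreover have "(LINT t|lborel. dir_deriv 1 \<phi> t * k t) = (LINT t|?M. deriv \<phi> t * B (h t) v)"
    proof (rule conv[symmetric])
      fix t assume t: "t \<in> {0<..<T}"
      then have "max 0 (min T t) = t" by auto
      then show "deriv \<phi> t * B (h t) v = dir_deriv 1 \<phi> t * k t" by (simp add: k_def \<phi>p(8))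
    next
      fix t assume "t \<notin> {0<..<T}"
      then have "t \<notin> Kc" using \<phi>p(2) by blast
      then show "dir_deriv 1 \<phi> t * k t = 0" by (simp add: \<phi>p(4,8))
    qed (simp add: \<phi>p(8))
    ultimately have "(\<lambda>n. LINT t|?M. \<phi> t * B (D n t) v) \<longlonglongrightarrow> - (LINT t|?M. deriv \<phi> t * B (h t) v)"
      unfolding quot by simp
    then show ?thesis by (intro g(3)[OF \<phi>p(11) _ v]) (use \<phi>p(9) in auto)
  qed
  then show ?thesis using g(1,2) by (auto simp: time_L2_eq)
qed

end

section \<open>Regularity of the weak solution\<close>

text \<open>\<open>hU\<close> and \<open>hH\<close> are the representatives of \<open>u\<close> and \<open>\<^bold>H\<close> that are continuous on \<open>[0,T]\<close>.\<close>
locale weak_evolution = bounded_domain G for G :: "(real^'d) set" +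
  fixes T \<kappa> :: real and u hU :: "real \<Rightarrow> real^'d \<Rightarrow> real^'k" and u0 :: "real^'d \<Rightarrow> real^'k"
    and w :: "real \<Rightarrow> (real^'d \<Rightarrow> real^'k) \<Rightarrow> real" and H hH K :: "real \<Rightarrow> real^'d \<Rightarrow> ('k, 'd) tensor"
  assumes T: "0 < T" and \<kappa>: "0 < \<kappa>"
    and pos: "AE t in lebesgue_on {0<..<T}. AE x in lebesgue_on G. H t x \<in> sym_tensors_ge \<kappa>"
    and u: "u \<in> time_L2 T (Vspace G)"
    and gu: "strongly_measurable_in (lebesgue_on {0<..<T}) (Vdual G) (\<lambda>t. gelfand G (u t))"
    and w: "w \<in> time_L2 T (Vdual G)" and uw: "has_time_deriv T (Vdual G) (\<lambda>t. gelfand G (u t)) w"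
    and eq: "AE t in lebesgue_on {0<..<T}. \<forall>v\<in>carr (Vspace G). w t v + op_A G (H t) (u t) v = 0"
    and H: "strongly_measurable_in (lebesgue_on {0<..<T}) (Linf_sym G) H"
    and K: "K \<in> time_Linf T (Linf_sym G)" and HK: "has_time_deriv T (Linf_sym G) H K"
    and hU: "continuous_in T (Hspace G) hU" and hUu: "AE t in lebesgue_on {0<..<T}. snorm (Hspace G) (hU t - u t) = 0"
    and hU0: "snorm (Hspace G) (hU 0 - u0) = 0" and u0: "u0 \<in> carr (Vspace G)"
    and hH: "continuous_in T (Linf_sym G) hH" and hHH: "AE t in lebesgue_on {0<..<T}. snorm (Linf_sym G) (hH t - H t) = 0"
begin

abbreviation "MT \<equiv> lebesgue_on {0<..<T}"
abbreviation "VV \<equiv> Vspace G :: (real^'d \<Rightarrow> real^'k) space_rec"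
abbreviation "HH \<equiv> Hspace G :: (real^'d \<Rightarrow> real^'k) space_rec"
abbreviation "DD \<equiv> Vdual G :: ((real^'d \<Rightarrow> real^'k) \<Rightarrow> real) space_rec"
abbreviation "LL \<equiv> Linf_sym G :: (real^'d \<Rightarrow> ('k, 'd) tensor) space_rec"
abbreviation "gform x y \<equiv> tform (weak_jacobian G x) (weak_jacobian G y)"

sublocale MT: finite_complete_measure MT by (rule finite_complete_measure_interval)
sublocale V: inner_carrier VV ipV by (rule inner_carrier_Vspace)
sublocale V: complete_seminormed VV by (rule complete_Vspace)
sublocale V: complete_bochner_space MT VV ..
sublocale H: inner_carrier HH ip by (rule inner_carrier_Hspace)
sublocale H: complete_seminormed HH by (rule complete_Hspace)
sublocale H: complete_bochner_space MT HH ..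
sublocale D: seminormed DD by (rule seminormed_Vdual)
sublocale D: bochner_space MT DD ..
sublocale L: seminormed LL by (rule seminormed_Linf)
sublocale L: bochner_space MT LL ..

lemma u_carr: "AE t in MT. u t \<in> carr VV"
  using u V.L2set_carr by (simp add: time_L2_eq)

lemma w_carr: "AE t in MT. w t \<in> carr DD"
  using w D.strongly_measurable_carr by (auto simp: time_L2_def)

lemma hU_carr: "t \<in> {0..T} \<Longrightarrow> hU t \<in> carr HH"
  by (rule continuous_in_carr[OF hU])

lemma hH_carr: "t \<in> {0..T} \<Longrightarrow> hH t \<in> carr LL"
  by (rule continuous_in_carr[OF hH])

lemma AE_time: "AE t in MT. t \<in> {0<..<T}"
  by (rule AE_I2) simp

lemma ip_hU_AE: "AE t in MT. \<forall>v\<in>carr HH. ip (hU t) v = ip (u t) v"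
  using u_carr hUu AE_time
proof eventually_elim
  case (elim t)
  then have m: "u t \<in> carr HH" "hU t \<in> carr HH" using Vspace_Hspace hU_carr[of t] by auto
  show ?case
  proof
    fix v assume v: "v \<in> carr HH"
    have "\<bar>ip (hU t - u t) v\<bar> \<le> snorm HH (hU t - u t) * snorm HH v"
      by (rule H.Cauchy_Schwarz_snorm) (use m v in auto)
    then have "ip (hU t - u t) v = 0" using elim(2) by simp
    then show "ip (hU t) v = ip (u t) v" using m v by (simp add: H.diff_left)
  qed
qed

text \<open>Evaluation at \<open>v\<close> is a bounded functional on the dual space, and on
  embedded functions it is the product of L^2(G).\<close>

lemma w_weak:
  assumes \<phi>: "\<phi> \<in> test_functions {0<..<T}" and v: "v \<in> carr VV"
  shows "(LINT t|MT. deriv \<phi> t * ip (u t) v) = - (LINT t|MT. \<phi> t * w t v)"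
proof -
  have "(LINT t|MT. deriv \<phi> t * gelfand G (u t) v) = - (LINT t|MT. \<phi> t * w t v)"
  proof (rule D.time_deriv_functional[OF uw gu _ _ _ _ \<phi>, where \<Lambda> = "\<lambda>\<psi>. \<psi> v" and C = "snorm VV v"])
    show "strongly_measurable_in MT DD w" using w by (simp add: time_L2_def)
    show "\<bar>x v\<bar> \<le> snorm VV v * snorm DD x" if "x \<in> carr DD" for x
      using Vdual_apply_le[OF that v] by (simp add: mult.commute)
  qed (auto simp: scaleR_fun_def)
  then show ?thesis by (simp add: gelfand_def ip_def)
qed

lemma w_integrable:
  assumes v: "v \<in> carr VV" shows "integrable MT (\<lambda>t. w t v)"
proof -
  have w2: "w \<in> L2set MT DD" using w by (simp add: time_L2_eq)
  have b: "\<bar>x v\<bar> \<le> snorm VV v * snorm DD x" if "x \<in> carr DD" for x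
    using Vdual_apply_le[OF that v] by (simp add: mult.commute)
  show ?thesis
  proof (rule Bochner_Integration.integrable_bound)
    show "integrable MT (\<lambda>t. snorm VV v * snorm DD (w t))"
      using D.L2set_snorm_integrable[OF w2] by simp
    show "(\<lambda>t. w t v) \<in> borel_measurable MT"
      by (rule D.strongly_measurable_functional[where C = "snorm VV v" and \<Lambda> = "\<lambda>\<psi>. \<psi> v"])
         (use w2 b in \<open>auto simp: L2set_def scaleR_fun_def\<close>)
    show "AE t in MT. norm (w t v) \<le> norm (snorm VV v * snorm DD (w t))"
      using w_carr
    proof eventually_elim
      case (elim t)
      show ?case using b[OF elim] by auto
    qed
  qed
qed

lemma hU_functional_continuous:
  assumes v: "v \<in> carr HH" shows "continuous_on {0..T} (\<lambda>t. ip (hU t) v)"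
proof (rule H.continuous_in_functional[OF hU, where C = "snorm HH v"])
  fix x y assume "x \<in> carr HH" "y \<in> carr HH"
  then show "\<bar>ip x v - ip y v\<bar> \<le> snorm HH v * snorm HH (x - y)"
    using H.B_functional_bound[of "x - y" v] v by (simp add: H.diff_left)
qed

lemma integral_deriv_hU_eq:
  assumes \<phi>: "\<phi> \<in> test_functions {0<..<T}" and v: "v \<in> carr HH"
  shows "(LINT t|MT. deriv \<phi> t * ip (hU t) v) = (LINT t|MT. deriv \<phi> t * ip (u t) v)"
proof (rule integral_cong_AE)
  show m: "(\<lambda>t. deriv \<phi> t * ip (hU t) v) \<in> borel_measurable MT"
    by (rule borel_measurable_times[OF test_function_real_measurable(2)[OF \<phi>]
          continuous_imp_measurable_on_sets_lebesgue])
       (auto intro: continuous_on_subset[OF hU_functional_continuous[OF v]])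
  show ae: "AE t in MT. deriv \<phi> t * ip (hU t) v = deriv \<phi> t * ip (u t) v"
    using ip_hU_AE by eventually_elim (use v in auto)
  show "(\<lambda>t. deriv \<phi> t * ip (u t) v) \<in> borel_measurable MT"
    by (rule MT.measurable_AE_eq[OF m ae])
qed

text \<open>For fixed \<open>v\<close> the product with \<open>hU\<close> is a continuous scalar
  function with weak derivative \<open>w r v\<close>. This is the integrated equation in the form in
  which the energy estimate consumes it.\<close>

lemma hU_increment:
  assumes v: "v \<in> carr VV" and st: "0 \<le> s" "s \<le> t" "t \<le> T"
  shows "ip (hU t - hU s) v = (LINT r|MT. indicator {s<..<t} r * w r v)"
proof -
  have vH: "v \<in> carr HH" using v by (rule Vspace_Hspace)
  have "ip (hU t) v - ip (hU s) v = (LINT r|MT. indicator {s<..<t} r * w r v)"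
  proof (rule weak_derivative_imp_FTC[OF hU_functional_continuous[OF vH] w_integrable[OF v] _ st])
    fix \<phi> :: "real \<Rightarrow> real" assume \<phi>: "\<phi> \<in> test_functions {0<..<T}"
    note integral_deriv_hU_eq[OF \<phi> vH]
    also note w_weak[OF \<phi> v]
    finally show "(LINT t|MT. deriv \<phi> t * ip (hU t) v) = - (LINT t|MT. \<phi> t * w t v)" .
  qed
  then show ?thesis using hU_carr[of s] hU_carr[of t] st vH by (simp add: H.diff_left)
qed

section \<open>The elliptic form along the solution\<close>

lemma gform_linear:
  assumes "x \<in> carr VV" "y \<in> carr VV" "A \<in> carr LL"
  shows "B \<in> carr LL \<Longrightarrow> gform x y (A + B) = gform x y A + gform x y B" "gform x y (r *\<^sub>R A) = r * gform x y A"
  using tform_linear[OF Vspace_jacobian(2)[OF assms(1)] Vspace_jacobian(2)[OF assms(2)] assms(3)] by auto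

lemma gform_continuous:
  assumes x: "x \<in> carr VV" and y: "y \<in> carr VV"
  shows "continuous_on {0..T} (\<lambda>t. gform x y (hH t))"
proof -
  obtain c where c: "0 \<le> c" "\<And>K x y. K \<in> carr LL \<Longrightarrow> x \<in> carr VV \<Longrightarrow> y \<in> carr VV \<Longrightarrow>
    \<bar>gform x y K\<bar> \<le> c * snorm LL K * (snorm VV x * snorm VV y)"
    using tform_Vspace_bound by metis
  show ?thesis
  proof (rule L.continuous_in_functional[OF hH, where C = "c * (snorm VV x * snorm VV y)"])
    fix A B assume A: "A \<in> carr LL" and B: "B \<in> carr LL"
    have "A = B + (A - B)" by simp
    then have "gform x y A = gform x y B + gform x y (A - B)"
      using gform_linear(1)[OF x y B L.mem(3)[OF A B]] by metis
    then show "\<bar>gform x y A - gform x y B\<bar> \<le> c * (snorm VV x * snorm VV y) * snorm LL (A - B)"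
      using c(2)[OF L.mem(3)[OF A B] x y] by (simp add: mult_ac)
  qed
qed

lemma H_hH_AE: "AE t in MT. AE x in lebesgue_on G. hH t x = H t x"
  using hHH AE_time L.strongly_measurable_carr[OF H]
proof eventually_elim
  case (elim t)
  then have "hH t \<in> carr LL" by (intro hH_carr) auto
  then show ?case using elim by (intro Linf_diff_0_AE_eq) auto
qed

lemma gform_hH_AE: "AE t in MT. \<forall>x\<in>carr VV. \<forall>y\<in>carr VV. gform x y (hH t) = gform x y (H t)"
  using H_hH_AE AE_time L.strongly_measurable_carr[OF H]
proof eventually_elim
  case (elim t)
  then have "hH t \<in> carr LL" by (intro hH_carr) auto
  then show ?case using elim by (intro ballI tform_cong_AE Vspace_jacobian) auto
qed

text \<open>The lower bound on the tensors holds for a.e. time only. Continuity of the form along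
  \<open>hH\<close> extends nonnegativity to all times, in particular to 0 and T, where the
  triangles are frozen.\<close>

lemma gform_nonneg:
  assumes t: "t \<in> {0..T}" and x: "x \<in> carr VV"
  shows "0 \<le> gform x x (hH t)"
proof (rule nonneg_everywhere_if_AE[OF T gform_continuous[OF x x] _ t])
  show "AE t in MT. 0 \<le> gform x x (hH t)"
    using gform_hH_AE pos
  proof eventually_elim
    case (elim t)
    have "0 \<le> gform x x (H t)"
      unfolding tform_def
    proof (rule integral_nonneg_AE)
      show "AE z in lebesgue_on G. 0 \<le> tensor_apply (H t z) (weak_jacobian G x z) \<bullet> weak_jacobian G x z"
        using elim(2)
      proof eventually_elim
        case (elim z)
        then have "\<kappa> * (weak_jacobian G x z \<bullet> weak_jacobian G x z) \<le>
            tensor_apply (H t z) (weak_jacobian G x z) \<bullet> weak_jacobian G x z"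
          by (auto simp: sym_tensors_ge_def)
        moreover have "0 \<le> \<kappa> * (weak_jacobian G x z \<bullet> weak_jacobian G x z)" using \<kappa> by simp
        ultimately show ?case by linarith
      qed
    qed
    then show ?case using elim(1) x by auto
  qed
qed

lemma gform_semi_inner: "t \<in> {0..T} \<Longrightarrow> semi_inner (carr VV) (\<lambda>x y. gform x y (hH t))"
  by (intro semi_inner_tform hH_carr gform_nonneg)

lemma gform_bound:
  "\<exists>C\<ge>0. \<forall>t\<in>{0..T}. \<forall>x\<in>carr VV. \<forall>y\<in>carr VV. \<bar>gform x y (hH t)\<bar> \<le> C * (snorm VV x * snorm VV y)"
proof -
  obtain c where c: "0 \<le> c" "\<And>K x y. K \<in> carr LL \<Longrightarrow> x \<in> carr VV \<Longrightarrow> y \<in> carr VV \<Longrightarrow>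
    \<bar>gform x y K\<bar> \<le> c * snorm LL K * (snorm VV x * snorm VV y)"
    using tform_Vspace_bound by metis
  have "bounded ((\<lambda>t. snorm LL (hH t)) ` {0..T})"
    by (intro compact_imp_bounded compact_continuous_image L.continuous_in_snorm[OF hH] compact_Icc)
  then obtain b where "\<forall>t\<in>{0..T}. \<bar>snorm LL (hH t)\<bar> \<le> b" by (auto simp: bounded_iff)
  then have b: "\<bar>snorm LL (hH t)\<bar> \<le> b" if "t \<in> {0..T}" for t using that by blast
  have "0 \<le> b" using b[of 0] T by auto
  have "\<bar>gform x y (hH t)\<bar> \<le> c * b * (snorm VV x * snorm VV y)"
    if t: "t \<in> {0..T}" and x: "x \<in> carr VV" and y: "y \<in> carr VV" for t x y
  proof -
    have "snorm LL (hH t) \<le> b" using b[OF t] by simp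
    have "\<bar>gform x y (hH t)\<bar> \<le> c * snorm LL (hH t) * (snorm VV x * snorm VV y)"
      by (rule c(2)[OF hH_carr[OF t] x y])
    also have "\<dots> \<le> c * b * (snorm VV x * snorm VV y)"
      using c(1) \<open>snorm LL (hH t) \<le> b\<close> V.snorm_nonneg[OF x] V.snorm_nonneg[OF y]
      by (intro mult_right_mono mult_left_mono) auto
    finally show ?thesis .
  qed
  then show ?thesis using c(1) \<open>0 \<le> b\<close> by (intro exI[of _ "c * b"]) auto
qed

text \<open>For fixed arguments the form along \<open>hH\<close> has the weak derivative
  \<open>gform x y (K t)\<close>, which is bounded because \<open>K\<close> is essentially bounded
  in time. The fundamental theorem turns this bound into the Lipschitz constant
  \<open>c * b\<close>.\<close>

lemma gform_lipschitz:
  "\<exists>L\<ge>0. \<forall>t\<in>{0..T}. \<forall>s\<in>{0..T}. \<forall>x\<in>carr VV. \<forall>y\<in>carr VV.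
    \<bar>gform x y (hH t) - gform x y (hH s)\<bar> \<le> L * \<bar>t - s\<bar> * (snorm VV x * snorm VV y)"
proof -
  obtain c where c: "0 \<le> c" "\<And>K x y. K \<in> carr LL \<Longrightarrow> x \<in> carr VV \<Longrightarrow> y \<in> carr VV \<Longrightarrow>
    \<bar>gform x y K\<bar> \<le> c * snorm LL K * (snorm VV x * snorm VV y)"
    using tform_Vspace_bound by metis
  obtain b0 where b0: "AE t in MT. snorm LL (K t) \<le> b0" using K by (auto simp: time_Linf_def)
  define b where "b = max 0 b0"
  have b: "0 \<le> b" "AE t in MT. snorm LL (K t) \<le> b"
    using b0 by (auto simp: b_def elim: eventually_mono)
  have K2: "strongly_measurable_in MT LL K" using K by (simp add: time_Linf_def)
  have le: "\<bar>gform x y (hH t) - gform x y (hH s)\<bar> \<le> c * b * \<bar>t - s\<bar> * (snorm VV x * snorm VV y)"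
    if st: "0 \<le> s" "s \<le> t" "t \<le> T" and x: "x \<in> carr VV" and y: "y \<in> carr VV" for t s x y
  proof -
    let ?D = "c * b * (snorm VV x * snorm VV y)"
    have D: "0 \<le> ?D" using c(1) b(1) V.snorm_nonneg[OF x] V.snorm_nonneg[OF y] by simp
    have bound: "\<bar>gform x y A\<bar> \<le> c * (snorm VV x * snorm VV y) * snorm LL A" if "A \<in> carr LL" for A
      using c(2)[OF that x y] by (simp add: mult_ac)
    have Kb: "AE t in MT. norm (gform x y (K t)) \<le> ?D"
      using b(2) L.strongly_measurable_carr[OF K2]
    proof eventually_elim
      case (elim t)
      have "\<bar>gform x y (K t)\<bar> \<le> c * (snorm VV x * snorm VV y) * snorm LL (K t)" by (rule bound[OF elim(2)])
      also have "\<dots> \<le> c * (snorm VV x * snorm VV y) * b"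
        using elim(1) c(1) V.snorm_nonneg[OF x] V.snorm_nonneg[OF y] by (intro mult_left_mono) auto
      finally show ?case by (simp add: mult_ac)
    qed
    have Km: "(\<lambda>t. gform x y (K t)) \<in> borel_measurable MT"
      by (rule L.strongly_measurable_functional[OF K2 gform_linear(1)[OF x y] gform_linear(2)[OF x y] bound])
    have Ki: "integrable MT (\<lambda>t. gform x y (K t))"
      by (rule MT.integrable_const_bound[OF Kb Km])
    have ftc: "gform x y (hH t) - gform x y (hH s) = (LINT r|MT. indicator {s<..<t} r * gform x y (K r))"
    proof (rule weak_derivative_imp_FTC[OF gform_continuous[OF x y] Ki _ st])
      fix \<phi> :: "real \<Rightarrow> real" assume \<phi>: "\<phi> \<in> test_functions {0<..<T}"
      have "(LINT t|MT. deriv \<phi> t * gform x y (hH t)) = (LINT t|MT. deriv \<phi> t * gform x y (H t))"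
      proof (rule integral_cong_AE)
        show m: "(\<lambda>t. deriv \<phi> t * gform x y (hH t)) \<in> borel_measurable MT"
          by (rule borel_measurable_times[OF test_function_real_measurable(2)[OF \<phi>]
                continuous_imp_measurable_on_sets_lebesgue])
             (auto intro: continuous_on_subset[OF gform_continuous[OF x y]])
        show ae: "AE t in MT. deriv \<phi> t * gform x y (hH t) = deriv \<phi> t * gform x y (H t)"
          using gform_hH_AE by eventually_elim (use x y in auto)
        show "(\<lambda>t. deriv \<phi> t * gform x y (H t)) \<in> borel_measurable MT"
          by (rule MT.measurable_AE_eq[OF m ae])
      qed
      also have "\<dots> = - (LINT t|MT. \<phi> t * gform x y (K t))"
        by (rule L.time_deriv_functional[OF HK H K2 gform_linear(1)[OF x y] gform_linear(2)[OF x y] bound \<phi>])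
      finally show "(LINT t|MT. deriv \<phi> t * gform x y (hH t)) = - (LINT t|MT. \<phi> t * gform x y (K t))" .
    qed
    have ind: "integrable MT (\<lambda>r. indicator {s<..<t} r :: real)" "(LINT r|MT. indicator {s<..<t} r) = t - s"
    proof -
      have st': "{s<..<t} \<subseteq> {0<..<T}" using st by auto
      have sM: "{s<..<t} \<in> sets MT" using st' by (simp add: sets_restrict_space_iff)
      show "integrable MT (\<lambda>r. indicator {s<..<t} r :: real)"
        using sM by (intro MT.integrable_const_bound[where B = 1] borel_measurable_indicator) (auto simp: indicator_def)
      have "(LINT r|MT. indicator {s<..<t} r) = measure MT {s<..<t}"
        using st by (simp add: min_absorb1 max_absorb2)
      also have "\<dots> = measure lebesgue {s<..<t}" by (rule measure_restrict_space) (use st' in auto)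
      finally show "(LINT r|MT. indicator {s<..<t} r) = t - s" using st by simp
    qed
    have "\<bar>gform x y (hH t) - gform x y (hH s)\<bar> \<le> (LINT r|MT. \<bar>indicator {s<..<t} r * gform x y (K r)\<bar>)"
      unfolding ftc by (rule integral_abs_bound)
    also have "\<dots> \<le> (LINT r|MT. ?D * indicator {s<..<t} r)"
    proof (rule integral_mono_AE)
      have sM: "{s<..<t} \<in> sets MT" using st by (auto simp: sets_restrict_space_iff)
      show "integrable MT (\<lambda>r. \<bar>indicator {s<..<t} r * gform x y (K r)\<bar>)"
        using integrable_real_mult_indicator[OF sM Ki] by (simp add: mult.commute)
      show "integrable MT (\<lambda>r. ?D * indicator {s<..<t} r)" using ind(1) by simp
      show "AE r in MT. \<bar>indicator {s<..<t} r * gform x y (K r)\<bar> \<le> ?D * indicator {s<..<t} r"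
        using Kb by eventually_elim (auto simp: indicator_def)
    qed
    also have "\<dots> = ?D * (t - s)" using ind(2) by simp
    finally show ?thesis using st by (simp add: mult_ac)
  qed
  have "\<bar>gform x y (hH t) - gform x y (hH s)\<bar> \<le> c * b * \<bar>t - s\<bar> * (snorm VV x * snorm VV y)"
    if st: "s \<in> {0..T}" "t \<in> {0..T}" and x: "x \<in> carr VV" and y: "y \<in> carr VV" for t s x y
  proof (cases "s \<le> t")
    case True
    then show ?thesis using st by (intro le x y) auto
  next
    case False
    then have "\<bar>gform x y (hH s) - gform x y (hH t)\<bar> \<le> c * b * \<bar>s - t\<bar> * (snorm VV x * snorm VV y)"
      using st by (intro le x y) auto
    then show ?thesis by (simp add: abs_minus_commute)
  qed
  then show ?thesis using c(1) b(1) by (intro exI[of _ "c * b"]) auto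
qed

section \<open>Time differences of the weak solution\<close>

lemma snorm_Hspace_square_eq_0:
  assumes "x \<in> carr HH" "snorm HH x = 0" shows "ip x x = 0"
  using H.snorm_square[OF assms(1)] assms(2) by simp

lemma hU_difference_integrable:
  assumes \<eta>: "0 < \<eta>"
  shows "integrable MT (\<lambda>t. ip (hU t - hU (max 0 (t - \<eta>))) (hU t - hU (max 0 (t - \<eta>))))"
proof -
  have "(\<lambda>t. 1 *\<^sub>R (hU t - hU (max 0 (t - \<eta>)))) \<in> L2set MT HH"
    by (rule H.continuous_in_imp_L2set[OF H.continuous_in_diff_shift[OF hU T \<eta>] T])
  then have "integrable MT (\<lambda>t. (snorm HH (hU t - hU (max 0 (t - \<eta>))))\<^sup>2)"
    by (simp add: L2set_def)
  moreover have "(snorm HH (hU t - hU (max 0 (t - \<eta>))))\<^sup>2 = ip (hU t - hU (max 0 (t - \<eta>))) (hU t - hU (max 0 (t - \<eta>)))"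
    if "t \<in> space MT" for t
    using that \<eta> by (intro H.snorm_square H.mem hU_carr) auto
  ultimately show ?thesis by (rule Bochner_Integration.integrable_cong[OF refl, THEN iffD1, rotated])
qed

text \<open>Instantiates the abstract estimate with the continuous representatives \<open>hU\<close>
  and \<open>hH\<close>, for which values at single times are meaningful. The test vectors come from
  a version \<open>f\<close> of \<open>u\<close> that lies in the Sobolev space at every time and is
  an everywhere limit of simple functions.\<close>

lemma time_difference_estimate:
  "\<exists>B. \<forall>\<eta>. 0 < \<eta> \<longrightarrow> \<eta> < T \<longrightarrow>
    (LINT t|MT. ip (hU t - hU (max 0 (t - \<eta>))) (hU t - hU (max 0 (t - \<eta>)))) \<le> B * \<eta>\<^sup>2"
proof -
  obtain C where C: "0 \<le> C" "\<And>t x y. t \<in> {0..T} \<Longrightarrow> x \<in> carr VV \<Longrightarrow> y \<in> carr VV \<Longrightarrow>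
      \<bar>gform x y (hH t)\<bar> \<le> C * (snorm VV x * snorm VV y)"
    using gform_bound by metis
  obtain L where L: "0 \<le> L" "\<And>t s x y. t \<in> {0..T} \<Longrightarrow> s \<in> {0..T} \<Longrightarrow> x \<in> carr VV \<Longrightarrow> y \<in> carr VV \<Longrightarrow>
      \<bar>gform x y (hH t) - gform x y (hH s)\<bar> \<le> L * \<bar>t - s\<bar> * (snorm VV x * snorm VV y)"
    using gform_lipschitz by metis
  have um: "strongly_measurable_in MT VV u" using u by (simp add: time_L2_def)
  obtain f s where f: "\<And>t. f t \<in> carr VV" "AE t in MT. f t = u t" "\<And>n. simple_function MT (s n)"
      "\<And>n t. s n t \<in> carr VV" "\<And>t. t \<in> space MT \<Longrightarrow> (\<lambda>n. snorm VV (s n t - f t)) \<longlonglongrightarrow> 0"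
      "\<And>n t. t \<in> space MT \<Longrightarrow> snorm VV (s n t) \<le> 2 * snorm VV (f t)"
      "(\<lambda>t. snorm VV (f t)) \<in> borel_measurable MT"
    by (rule V.strongly_measurable_approx[OF um]) (rule that)
  interpret E: energy_setting VV ipV "carr HH" ip T C L "\<lambda>t x y. gform x y (hH t)" f hU s u0
  proof (rule energy_setting.intro[OF inner_carrier_Vspace H.semi_inner_axioms], rule energy_setting_axioms.intro)
    show "complete_seminormed VV" by (rule complete_Vspace)
    show "carr VV \<subseteq> carr HH" using Vspace_Hspace by blast
    show "0 < T" by (rule T)
    show "0 \<le> C" by (rule C(1))
    show "0 \<le> L" by (rule L(1))
    show "semi_inner (carr VV) (\<lambda>x y. gform x y (hH t))" if "t \<in> {0..T}" for t
      by (rule gform_semi_inner[OF that])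
    show "\<bar>gform x y (hH t)\<bar> \<le> C * (snorm VV x * snorm VV y)"
      if "t \<in> {0..T}" "x \<in> carr VV" "y \<in> carr VV" for t x y by (rule C(2)[OF that])
    show "\<bar>gform x y (hH t) - gform x y (hH t')\<bar> \<le> L * \<bar>t - t'\<bar> * (snorm VV x * snorm VV y)"
      if "t \<in> {0..T}" "t' \<in> {0..T}" "x \<in> carr VV" "y \<in> carr VV" for t t' x y by (rule L(2)[OF that])
    have "u \<in> L2set MT VV" using u by (simp add: time_L2_eq)
    moreover have "AE t in MT. u t = f t" using f(2) by eventually_elim simp
    ultimately show "f \<in> L2set MT VV" by (rule V.L2set_AE_eq)
    show "f t \<in> carr VV" for t by (rule f(1))
    show "simple_function MT (s n)" for n by (rule f(3))
    show "s n t \<in> carr VV" for n t by (rule f(4))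
    show "(\<lambda>n. snorm VV (s n t - f t)) \<longlonglongrightarrow> 0" if "t \<in> {0<..<T}" for t by (rule f(5)) (use that in simp)
    show "hU t \<in> carr HH" if "t \<in> {0..T}" for t by (rule hU_carr[OF that])
    show "AE t in MT. ip (hU t - f t) (hU t - f t) = 0"
      using hUu f(2) AE_time
    proof eventually_elim
      case (elim t)
      have "hU t - f t \<in> carr HH"
        using elim(3) by (intro H.mem hU_carr Vspace_Hspace f(1)) auto
      then show ?case using elim(1,2) by (intro snorm_Hspace_square_eq_0) auto
    qed
    show "u0 \<in> carr VV" by (rule u0)
    show "ip (hU 0 - u0) (hU 0 - u0) = 0"
      using T by (intro snorm_Hspace_square_eq_0 hU0 H.mem hU_carr Vspace_Hspace u0) auto
    \<comment> \<open>Under the time integral \<open>w\<close>, \<open>H\<close> and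
      \<open>u\<close> may be exchanged for the form with \<open>hH\<close> and \<open>f\<close>,
      since each agreement fails only on a null set of times.\<close>
    show "ip (hU t - hU t') v = - (LINT r|MT. indicator {t'<..<t} r * gform (f r) v (hH r))"
      if v: "v \<in> carr VV" and tt: "0 \<le> t'" "t' \<le> t" "t \<le> T" for v t' t
    proof -
      have "(LINT r|MT. indicator {t'<..<t} r * w r v) = (LINT r|MT. - (indicator {t'<..<t} r * gform (f r) v (hH r)))"
      proof (rule integral_cong_AE)
        have sM: "{t'<..<t} \<in> sets MT" using tt by (auto simp: sets_restrict_space_iff)
        show m: "(\<lambda>r. indicator {t'<..<t} r * w r v) \<in> borel_measurable MT"
          using integrable_real_mult_indicator[OF sM w_integrable[OF v]] by (auto simp: mult.commute)
        show ae: "AE r in MT. indicator {t'<..<t} r * w r v = - (indicator {t'<..<t} r * gform (f r) v (hH r))"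
          using gform_hH_AE eq f(2)
        proof eventually_elim
          case (elim r)
          have "gform (f r) v (hH r) = gform (f r) v (H r)" using elim(1) f(1) v by blast
          moreover have "w r v + gform (u r) v (H r) = 0" using elim(2) v by (simp add: op_A_eq)
          ultimately have "w r v = - gform (f r) v (hH r)" using elim(3) by simp
          then show ?case by simp
        qed
        show "(\<lambda>r. - (indicator {t'<..<t} r * gform (f r) v (hH r))) \<in> borel_measurable MT"
          by (rule MT.measurable_AE_eq[OF m ae])
      qed
      then show ?thesis using hU_increment[OF v tt] by simp
    qed
  qed
  show ?thesis
    using E.energy_estimate[unfolded E.e_def, OF hU_difference_integrable] .
qed

lemma time_derivative_exists:
  "\<exists>g\<in>time_L2 T HH. (\<forall>t. g t \<in> carr HH) \<and> (\<forall>\<phi> v. \<phi> \<in> test_functions {0<..<T} \<longrightarrow> v \<in> carr HH \<longrightarrow>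
    (LINT t|MT. \<phi> t * ip (g t) v) = - (LINT t|MT. deriv \<phi> t * ip (u t) v))"
proof -
  obtain B where B: "\<And>\<eta>. 0 < \<eta> \<Longrightarrow> \<eta> < T \<Longrightarrow>
      (LINT t|MT. ip (hU t - hU (max 0 (t - \<eta>))) (hU t - hU (max 0 (t - \<eta>)))) \<le> B * \<eta>\<^sup>2"
    using time_difference_estimate by blast
  obtain g where g: "g \<in> time_L2 T HH" "\<forall>t. g t \<in> carr HH"
    "\<And>\<phi> v. \<phi> \<in> test_functions {0<..<T} \<Longrightarrow> v \<in> carr HH \<Longrightarrow>
      (LINT t|MT. \<phi> t * ip (g t) v) = - (LINT t|MT. deriv \<phi> t * ip (hU t) v)"
    using H.weak_time_derivative_exists[OF complete_Hspace T hU B] by blast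
  show ?thesis using g integral_deriv_hU_eq by auto
qed

section \<open>Identification of the time derivative and of the divergence\<close>

lemma u_L2_Hspace: "u \<in> time_L2 T HH"
proof -
  have u2: "strongly_measurable_in MT VV u" "integrable MT (\<lambda>t. (snorm VV (u t))\<^sup>2)"
    using u by (auto simp: time_L2_def)
  then obtain s where s: "\<And>n. simple_function MT (s n)" "\<And>n. s n ` space MT \<subseteq> carr VV"
      "AE t in MT. (\<lambda>n. snorm VV (s n t - u t)) \<longlonglongrightarrow> 0"
    unfolding strongly_measurable_in_def by blast
  have m: "strongly_measurable_in MT HH u"
    unfolding strongly_measurable_in_def
  proof (intro conjI exI allI)
    show "AE t in MT. u t \<in> carr HH" using u_carr by eventually_elim (rule Vspace_Hspace)
    show "simple_function MT (s n)" for n by (rule s(1))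
    show "s n ` space MT \<subseteq> carr HH" for n using s(2)[of n] Vspace_Hspace by blast
    show "AE t in MT. (\<lambda>n. snorm HH (s n t - u t)) \<longlonglongrightarrow> 0"
      using s(3) u_carr AE_time
    proof eventually_elim
      case (elim t)
      have m: "s n t - u t \<in> carr VV" for n using s(2)[of n] elim(2,3) by (intro V.mem) auto
      show ?case
        by (rule null_squeeze[OF Vspace_snorm_bounds(3)[OF m] H.snorm_nonneg[OF Vspace_Hspace[OF m]] elim(1)])
    qed
  qed
  moreover have "integrable MT (\<lambda>t. (snorm HH (u t))\<^sup>2)"
  proof (rule Bochner_Integration.integrable_bound[OF u2(2)])
    show "(\<lambda>t. (snorm HH (u t))\<^sup>2) \<in> borel_measurable MT"
      by (intro borel_measurable_power H.strongly_measurable_snorm m)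
    show "AE t in MT. norm ((snorm HH (u t))\<^sup>2) \<le> norm ((snorm VV (u t))\<^sup>2)"
      using u_carr
    proof eventually_elim
      case (elim t)
      have "(snorm HH (u t))\<^sup>2 \<le> (snorm VV (u t))\<^sup>2"
        by (intro power_mono Vspace_snorm_bounds(3)[OF elim] H.snorm_nonneg Vspace_Hspace elim)
      then show ?case by simp
    qed
  qed
  ultimately show ?thesis by (simp add: time_L2_def)
qed

text \<open>The simple approximations of \<open>r\<close> take only countably many values, so countably many
  exceptional null sets suffice although \<open>\<V>\<close> is not known to be separable.\<close>
lemma Vdual_AE_eq_0:
  assumes r: "strongly_measurable_in MT DD r" and r0: "\<And>v. v \<in> carr VV \<Longrightarrow> AE t in MT. r t v = 0"
  shows "AE t in MT. \<forall>v\<in>carr VV. r t v = 0"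
proof -
  obtain f s where f: "\<And>t. f t \<in> carr DD" "AE t in MT. f t = r t" "\<And>n. simple_function MT (s n)"
      "\<And>n t. s n t \<in> carr DD" "\<And>t. t \<in> space MT \<Longrightarrow> (\<lambda>n. snorm DD (s n t - f t)) \<longlonglongrightarrow> 0"
      "\<And>n t. t \<in> space MT \<Longrightarrow> snorm DD (s n t) \<le> 2 * snorm DD (f t)"
      "(\<lambda>t. snorm DD (f t)) \<in> borel_measurable MT"
    by (rule D.strongly_measurable_approx[OF r]) (rule that)
  define A where "A = (\<Union>n. s n ` space MT)"
  have "countable (s n ` space MT)" for n
    by (rule countable_finite[OF simple_functionD(1)[OF f(3)]])
  then have cA: "countable A" unfolding A_def by (rule countable_UN[OF countableI_type])
  have AD: "A \<subseteq> carr DD" using f(4) by (auto simp: A_def)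
  have "\<forall>\<psi>\<in>A. \<exists>v. v \<in> V1 \<and> snorm DD \<psi> \<le> 2 * \<bar>\<psi> v\<bar>"
  proof
    fix \<psi> assume "\<psi> \<in> A"
    then have "\<psi> \<in> carr DD" using AD by (rule rev_subsetD)
    from Vdual_norming[OF this] show "\<exists>v. v \<in> V1 \<and> snorm DD \<psi> \<le> 2 * \<bar>\<psi> v\<bar>"
      by (simp only: Bex_def)
  qed
  then obtain N where N0: "\<forall>\<psi>\<in>A. N \<psi> \<in> V1 \<and> snorm DD \<psi> \<le> 2 * \<bar>\<psi> (N \<psi>)\<bar>"
    by (rule bchoice[THEN exE])
  have N: "N \<psi> \<in> V1" "snorm DD \<psi> \<le> 2 * \<bar>\<psi> (N \<psi>)\<bar>" if "\<psi> \<in> A" for \<psi>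
    using N0[rule_format, OF that] by (rule conjunct1, rule conjunct2)
  have "AE t in MT. r t (N \<psi>) = 0" if "\<psi> \<in> A" for \<psi>
    using N(1)[OF that] by (intro r0) simp
  then have "AE t in MT. \<forall>\<psi>\<in>A. r t (N \<psi>) = 0"
    by (intro AE_ball_countable[OF cA, THEN iffD2] ballI)
  then show ?thesis
    using f(2) AE_time
  proof eventually_elim
    case (elim t)
    have tM: "t \<in> space MT" using elim(3) by simp
    have mem: "s n t - f t \<in> carr DD" for n by (intro D.mem f(1,4))
    \<comment> \<open>\<open>f t\<close> vanishes at the vector that almost norms
      \<open>s n t\<close>. Hence the seminorm of \<open>s n t\<close> is at most twice the
      approximation error, and that of \<open>f t\<close> at most three times this error, which
      tends to 0.\<close>
    have "snorm DD (f t) \<le> 3 * snorm DD (s n t - f t)" for n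
    proof -
      have sA: "s n t \<in> A" unfolding A_def using tM by blast
      let ?v = "N (s n t)"
      have "f t ?v = 0" using elim(1,2) sA by simp
      then have "\<bar>s n t ?v\<bar> = \<bar>(s n t - f t) ?v\<bar>" by simp
      also have "\<dots> \<le> snorm DD (s n t - f t)" by (rule Vdual_upper[OF mem N(1)[OF sA]])
      finally have "snorm DD (s n t) \<le> 2 * snorm DD (s n t - f t)" using N(2)[OF sA] by linarith
      moreover have "\<bar>snorm DD (s n t) - snorm DD (f t)\<bar> \<le> snorm DD (s n t - f t)"
        by (rule D.snorm_reverse_triangle[OF f(4) f(1)])
      ultimately show ?thesis by (simp add: abs_le_iff)
    qed
    moreover have "(\<lambda>n. 3 * snorm DD (s n t - f t)) \<longlonglongrightarrow> 3 * 0"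
      by (intro tendsto_mult tendsto_const f(5) tM)
    ultimately have "snorm DD (f t) \<le> 3 * 0"
      by (intro LIMSEQ_le_const[of "\<lambda>n. 3 * snorm DD (s n t - f t)"]) auto
    then have "snorm DD (f t) = 0" using D.snorm_nonneg[OF f(1)[of t]] by simp
    then show ?case
      using Vdual_apply_le[OF f(1)[of t]] elim(2) by auto
  qed
qed

lemma gelfand_carr:
  assumes "x \<in> carr HH"
  shows "gelfand G x \<in> carr DD" "snorm DD (gelfand G x) \<le> snorm HH x"
proof -
  have eq: "gelfand G x v = ip x v" for v by (simp add: gelfand_def ip_def)
  have le: "\<bar>gelfand G x v\<bar> \<le> snorm HH x * snorm VV v" if v: "v \<in> carr VV" for v
  proof -
    have "\<bar>gelfand G x v\<bar> \<le> snorm HH x * snorm HH v"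
      unfolding eq by (rule H.Cauchy_Schwarz_snorm[OF assms Vspace_Hspace[OF v]])
    also have "\<dots> \<le> snorm HH x * snorm VV v"
      by (intro mult_left_mono Vspace_snorm_bounds(3)[OF v] H.snorm_nonneg assms)
    finally show ?thesis .
  qed
  show "gelfand G x \<in> carr DD"
    unfolding Vdual_carr
    using le assms by (auto simp: eq H.add_right H.scale_right Vspace_Hspace)
  show "snorm DD (gelfand G x) \<le> snorm HH x"
    by (intro Vdual_snorm_le le H.snorm_nonneg assms)
qed

text \<open>The embedding does not increase the seminorm, so it maps simple approximations to simple
  approximations.\<close>

lemma gelfand_strongly_measurable:
  assumes g: "strongly_measurable_in MT HH g"
  shows "strongly_measurable_in MT DD (\<lambda>t. gelfand G (g t))"
proof -
  obtain s where s: "\<And>n. simple_function MT (s n)" "\<And>n. s n ` space MT \<subseteq> carr HH"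
      "AE t in MT. (\<lambda>n. snorm HH (s n t - g t)) \<longlonglongrightarrow> 0"
    using g unfolding strongly_measurable_in_def by blast
  have gc: "AE t in MT. g t \<in> carr HH" by (rule H.strongly_measurable_carr[OF g])
  show ?thesis
    unfolding strongly_measurable_in_def
  proof (intro conjI exI allI)
    show "AE t in MT. gelfand G (g t) \<in> carr DD" using gc by eventually_elim (rule gelfand_carr)
    show "simple_function MT (\<lambda>t. gelfand G (s n t))" for n by (rule simple_function_compose1[OF s(1)])
    show "(\<lambda>t. gelfand G (s n t)) ` space MT \<subseteq> carr DD" for n
      using s(2)[of n] gelfand_carr(1) by blast
    show "AE t in MT. (\<lambda>n. snorm DD (gelfand G (s n t) - gelfand G (g t))) \<longlonglongrightarrow> 0"
      using s(3) gc AE_time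
    proof eventually_elim
      case (elim t)
      have sn: "s n t \<in> carr HH" for n using s(2)[of n] elim(3) by auto
      have "snorm DD (gelfand G (s n t) - gelfand G (g t)) \<le> snorm HH (s n t - g t)" for n
      proof (rule Vdual_snorm_le)
        fix v :: "real^'d \<Rightarrow> real^'k" assume v: "v \<in> carr VV"
        have "(gelfand G (s n t) - gelfand G (g t)) v = ip (s n t - g t) v"
          using sn elim(2) Vspace_Hspace[OF v] by (simp add: gelfand_def H.diff_left flip: ip_def)
        also have "\<bar>\<dots>\<bar> \<le> snorm HH (s n t - g t) * snorm HH v"
          by (intro H.Cauchy_Schwarz_snorm H.mem sn elim(2) Vspace_Hspace v)
        also have "\<dots> \<le> snorm HH (s n t - g t) * snorm VV v"
          by (intro mult_left_mono Vspace_snorm_bounds(3)[OF v] H.snorm_nonneg H.mem sn elim(2))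
        finally show "\<bar>(gelfand G (s n t) - gelfand G (g t)) v\<bar> \<le> snorm HH (s n t - g t) * snorm VV v" .
      qed (intro H.snorm_nonneg H.mem sn elim(2))
      moreover have "0 \<le> snorm DD (gelfand G (s n t) - gelfand G (g t))" for n
        by (intro D.snorm_nonneg D.mem gelfand_carr sn elim(2))
      ultimately show ?case by (rule null_squeeze[OF _ _ elim(1)])
    qed
  qed
qed

text \<open>For each fixed \<open>v\<close> both sides act in the same way on test functions of
  time, so they agree a.e. by the fundamental lemma. The null set depends on \<open>v\<close>;
  \<open>Vdual_AE_eq_0\<close> replaces it by one that serves all \<open>v\<close>.\<close>

lemma w_eq_time_derivative:
  assumes g: "g \<in> time_L2 T HH"
    and weak: "\<And>\<phi> v. \<phi> \<in> test_functions {0<..<T} \<Longrightarrow> v \<in> carr HH \<Longrightarrow>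
      (LINT t|MT. \<phi> t * ip (g t) v) = - (LINT t|MT. deriv \<phi> t * ip (u t) v)"
  shows "AE t in MT. \<forall>v\<in>carr VV. w t v = ip (g t) v"
proof -
  have g2: "g \<in> L2set MT HH" using g by (simp add: time_L2_eq)
  have "AE t in MT. \<forall>v\<in>carr VV. (w t - gelfand G (g t)) v = 0"
  proof (rule Vdual_AE_eq_0)
    show "strongly_measurable_in MT DD (\<lambda>t. w t - gelfand G (g t))"
      using w g by (intro D.strongly_measurable_diff gelfand_strongly_measurable) (auto simp: time_L2_def)
    fix v assume v: "v \<in> carr VV"
    have vH: "v \<in> carr HH" by (rule Vspace_Hspace[OF v])
    have i: "integrable MT (\<lambda>t. w t v)" "integrable MT (\<lambda>t. ip (g t) v)"
      using w_integrable[OF v] H.integrable_L2set[OF MT.finite_complete_measure_axioms g2 H.L2set_const[OF vH]]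
      by auto
    have loc: "locally_integrable {0<..<T} f" if "integrable MT f" for f :: "real \<Rightarrow> real"
      unfolding locally_integrable_def
    proof (intro allI impI)
      fix C :: "real set" assume C: "compact C \<and> C \<subseteq> {0<..<T}"
      have "set_integrable lebesgue {0<..<T} f"
        using that by (simp add: integrable_restrict_space set_integrable_def)
      then show "f absolutely_integrable_on C"
        by (rule set_integrable_subset) (use C fmeasurableD[OF lmeasurable_compact] in blast)+
    qed
    have "AE t in MT. w t v - ip (g t) v = 0"
    proof (rule test_functions_AE_eq_0)
      show "locally_integrable {0<..<T} (\<lambda>t. w t v - ip (g t) v)"
        by (intro loc Bochner_Integration.integrable_diff i)
      fix \<phi> :: "real \<Rightarrow> real" assume \<phi>: "\<phi> \<in> test_functions {0<..<T}"
      obtain K where K: "compact K" "K \<subseteq> {0<..<T}" "\<And>x. x \<notin> K \<Longrightarrow> \<phi> x = 0" "continuous_on UNIV \<phi>"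
        using test_functionD[OF \<phi>] by metis
      have i\<phi>: "integrable MT (\<lambda>t. \<phi> t * f t)" if "integrable MT f" for f :: "real \<Rightarrow> real"
        using continuous_compact_mult_integrable[OF _ loc[OF that] K(4,1,2,3)] by simp
      have "(LINT t|MT. \<phi> t *\<^sub>R (w t v - ip (g t) v)) = (LINT t|MT. \<phi> t * w t v) - (LINT t|MT. \<phi> t * ip (g t) v)"
        using i\<phi>[OF i(1)] i\<phi>[OF i(2)] by (simp add: right_diff_distrib)
      also have "\<dots> = 0" using weak[OF \<phi> vH] w_weak[OF \<phi> v] by simp
      finally show "(LINT t|MT. \<phi> t *\<^sub>R (w t v - ip (g t) v)) = 0" .
    qed simp
    then show "AE t in MT. (w t - gelfand G (g t)) v = 0" by (simp add: gelfand_def ip_def)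
  qed
  then show ?thesis by (simp add: gelfand_def ip_def)
qed

text \<open>Once \<open>w\<close> is represented by \<open>g\<close>, the equation at almost every
  time is a weak formulation in space with right-hand side in L^2(G), valid for all \<open>v\<close>
  simultaneously, which is the premise of \<open>has_weak_divergence_if_weak_form\<close>.\<close>

lemma strong_regularity:
  "u \<in> time_H1 T HH \<and> (\<exists>g\<in>time_L2 T HH. AE t in MT.
    has_weak_divergence G (\<lambda>x. tensor_apply (H t x) (weak_jacobian G (u t) x)) (g t))"
proof -
  obtain g where g: "g \<in> time_L2 T HH" "\<forall>t. g t \<in> carr HH"
    "\<And>\<phi> v. \<phi> \<in> test_functions {0<..<T} \<Longrightarrow> v \<in> carr HH \<Longrightarrow>
      (LINT t|MT. \<phi> t * ip (g t) v) = - (LINT t|MT. deriv \<phi> t * ip (u t) v)"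
    using time_derivative_exists by blast
  have w_g: "AE t in MT. \<forall>v\<in>carr VV. w t v = ip (g t) v"
    by (rule w_eq_time_derivative[OF g(1)]) (rule g(3))
  have "has_time_deriv T HH u g"
    by (rule H.has_time_derivI[OF complete_Hspace u_L2_Hspace g(1,3)])
  then have "u \<in> time_H1 T HH" using u_L2_Hspace g(1) by (auto simp: time_H1_def)
  moreover have "AE t in MT. has_weak_divergence G (\<lambda>x. tensor_apply (H t x) (weak_jacobian G (u t) x)) (g t)"
    using w_g eq u_carr L.strongly_measurable_carr[OF H]
  proof eventually_elim
    case (elim t)
    show ?case
    proof (rule has_weak_divergence_if_weak_form)
      show "square_integrable_on G (\<lambda>x. tensor_apply (H t x) (weak_jacobian G (u t) x))"
        by (intro tensor_apply_square_integrable elim(4) Vspace_jacobian elim(3))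
      show "g t \<in> carr HH" using g(2) by blast
      fix v :: "real^'d \<Rightarrow> real^'k" assume v: "v \<in> carr VV"
      show "ip (g t) v + ip (\<lambda>x. tensor_apply (H t x) (weak_jacobian G (u t) x)) (weak_jacobian G v) = 0"
        using elim(1,2) v by (simp add: op_A_eq tform_eq_ip)
    qed
  qed
  ultimately show ?thesis using g(1) by blast
qed

end

theorem corollary9:
  fixes G :: "(real^'d) set"
    and F :: "real^'d^'k \<Rightarrow> ('k, 'd) tensor"
    and \<rho> :: "real^'d \<Rightarrow> real"
    and u0 :: "real^'d \<Rightarrow> real^'k"
    and H0 :: "real^'d \<Rightarrow> ('k, 'd) tensor"
    and u :: "real \<Rightarrow> real^'d \<Rightarrow> real^'k"
    and H :: "real \<Rightarrow> real^'d \<Rightarrow> ('k, 'd) tensor"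
    and \<tau> \<sigma> c \<alpha> T :: real
  assumes "open G" "connected G" "G \<noteq> {}" "bounded G"
    and "\<tau> > 0" "\<sigma> > 0" "c > 0"
    and "\<And>D. F D \<in> sym_tensors_ge 0"
    and "\<exists>L. L-lipschitz_on UNIV F"
    and "weakly_differentiable_bounded c F"
    and "mollifier \<rho>"
    and "weakly_differentiable_bounded c \<rho>"
    and "\<alpha> > 0" "H0 \<in> Linf_sym_ge G \<alpha>"
    and "u0 \<in> carr (Vspace G)"
    and "T > 0"
    and "weak_solution G \<tau> \<rho> \<sigma> F u0 H0 T u H"
    and "AE t in lebesgue_on {0..T}. H t \<in> Linf_sym_ge G (\<alpha> * exp (- T / \<tau>))"
  shows "strong_solution G \<tau> \<rho> \<sigma> F u0 H0 T u H"
proof -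
  note ws = assms(17)[unfolded weak_solution_def has_initial_value_def]
  obtain \<kappa> where \<kappa>: "0 < \<kappa>"
    "AE t in lebesgue_on {0<..<T}. AE x in lebesgue_on G. H t x \<in> sym_tensors_ge \<kappa>"
    using ws by blast
  obtain w where w: "w \<in> time_L2 T (Vdual G)" "has_time_deriv T (Vdual G) (\<lambda>t. gelfand G (u t)) w"
    "AE t in lebesgue_on {0<..<T}. \<forall>v\<in>carr (Vspace G). w t v + op_A G (H t) (u t) v = 0"
    using ws by blast
  obtain K where K: "K \<in> time_Linf T (Linf_sym G)" "has_time_deriv T (Linf_sym G) H K"
    using ws by blast
  \<comment> \<open>The initial conditions are stated through representatives that are continuous up
    to time 0; these witnesses are what the energy argument evaluates at single times.\<close>
  obtain hU where hU: "continuous_in T (Hspace G) hU"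
    "AE t in lebesgue_on {0<..<T}. snorm (Hspace G) (hU t - u t) = 0" "snorm (Hspace G) (hU 0 - u0) = 0"
    using ws unfolding continuous_in_def by blast
  obtain hH where hH: "continuous_in T (Linf_sym G) hH"
    "AE t in lebesgue_on {0<..<T}. snorm (Linf_sym G) (hH t - H t) = 0"
    using ws unfolding continuous_in_def by blast
  interpret weak_evolution G T \<kappa> u hU u0 w H hH K
  proof unfold_locales
    show "strongly_measurable_in (lebesgue_on {0<..<T}) (Vdual G) (\<lambda>t. gelfand G (u t))"
      using ws by (auto simp: time_H1_def time_L2_def)
    show "strongly_measurable_in (lebesgue_on {0<..<T}) (Linf_sym G) H"
      using ws by (auto simp: time_W1inf_def time_Linf_def)
    show "u \<in> time_L2 T (Vspace G)" using ws by blast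
  qed (fact assms \<kappa> w K hU hH)+
  show ?thesis
    unfolding strong_solution_def using assms(17) strong_regularity by simp
qed

end
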